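(* Let $k\ge3$ and $g=2k$. Let $S\subset\mathbb{P}^g=\mathbb{P}(V)$ be a $K3$ surface over $\mathbb{C}$ whose Picard group is generated by the hyperplane class $\mathcal{O}_S(C)$, where $C$ is a smooth curve of genus $g$. Let $s$ be a $(k-2)$-nd linear syzygy of $S$ of rank $k+1$ (a Grassmannian syzygy), and let $$\pi:\mathbb{P}^g\dashrightarrow\mathbb{P}^n\subset\mathbb{P}^N,\qquad N=\binom{k+2}{2}-1,$$ be the linear projection induced by $s$, which satisfies $\pi(S)\subset\mathbb{G}=\mathrm{Gr}(k+2,2)\subset\mathbb{P}^N$. Then $\pi$ is an embedding, i.e. $\mathbb{P}^g\cong\mathbb{P}^n$ via $\pi$.
   Context: Conventions: the base field is $\mathbb{C}$; $\mathbb{P}(V)$ denotes the projective space with $H^0(\mathcal{O}(1))=V$, and $R=\mathrm{Sym}(V)$. For non-degenerate $X\subset\mathbb{P}(V)$ with ideal $I_X$ generated by quadrics, let $I_X\leftarrow V_0\otimes R(-2)\leftarrow V_1\otimes R(-3)\leftarrow\cdots$ be the linear strand of the minimal free resolution. Elements $s\in V_p$ are $p$-th syzygies. The induced map $V_p\to V_{p-1}\otimes V\cong\mathrm{Hom}(V_{p-1}^*,V)$, $s\mapsto\tilde\varphi(s)$, defines $L_s=\mathrm{Im}\,\tilde\varphi(s)\subset V$ and $\mathrm{rank}\,s=\dim L_s$. By Koszul cohomology $V_p\cong\ker(\Lambda^pV\otimes(I_X)_2\to\Lambda^{p-1}V\otimes(I_X)_3)$. A $p$-th syzygy of rank $p+3$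 is called Grassmannian. Induced projection (here $p=k-2$): let $s$ have rank $p+3$ and $L=L_s$. Lifting $\tilde\varphi(s)$ to a map from the dual of the linear strand to the Koszul complex of $L$ gives a linear map $\alpha:\Lambda^2L\to V$ such that $\pi^*=\iota\oplus\alpha: L\oplus\Lambda^2L\to V$ ($\iota:L\hookrightarrow V$ the inclusion) maps the generic syzygy to $s$. Here the generic syzygy is the image $s_{gen}$ of a generator of $\Lambda^{p+3}L$ under $\Lambda^{p+3}L\hookrightarrow\Lambda^pL\otimes(L\otimes\Lambda^2L)\subset\Lambda^pL\otimes S_2(L\oplus\Lambda^2L)$. Put $U=\mathbb{C}u_0\oplus L$ (dimension $p+4=k+2$), and identify $L\oplus\Lambda^2L$ with $\Lambda^2U$ via $l\mapsto u_0\wedge l$. The map $\pi^*$ defines $\pi:\mathbb{P}(V)\dashrightarrow\mathbb{P}^n:=\mathbb{P}(\mathrm{Im}\,\pi^* )\subset\mathbb{P}^N=\mathbb{P}(\Lambda^2U)$, and $\mathbb{G}=\mathrm{Gr}(U,2)$ is the Grassmannian of 2-dimensional quotients of $U$ in its Plücker embedding. So the claim says that $\pi^*:\Lambda^2U\to V$ is surjective. *)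

theory Defs
  imports "HOL-Analysis.Analysis" "HOL-Library.Function_Algebras"
begin

text \<open>
  Conventions.  Fix a finite index type \<open>'n\<close> with \<open>g + 1\<close> elements.  The space of linear forms
  \<open>V\<close> is \<open>complex ^ 'n\<close> (coefficient vectors), and a point of the projective space \<open>P(V)\<close>
  (with \<open>H^0(O(1)) = V\<close>) is a nonzero vector of \<open>complex ^ 'n\<close> up to scalars, on which a linear
  form \<open>l\<close> is evaluated by \<open>ev l x\<close>.  A projective algebraic set is represented by the set
  of all its nonzero representatives (its punctured affine cone).  As the field is infinite,
  \<open>R = Sym(V)\<close> is identified with the ring of polynomial functions on \<open>complex ^ 'n\<close>.
\<close>

definition ev :: "complex ^ 'n \<Rightarrow> complex ^ 'n \<Rightarrow> complex" where
  "ev l x = (\<Sum>i\<in>UNIV. l $ i * x $ i)"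

text \<open>\<open>hform d f\<close>: \<open>f\<close> is a homogeneous polynomial of degree \<open>d\<close>
  (zero is homogeneous of every degree).\<close>

inductive hform :: "nat \<Rightarrow> (complex ^ 'n \<Rightarrow> complex) \<Rightarrow> bool" where
  const: "hform 0 (\<lambda>x. c)"
| coord: "hform d f \<Longrightarrow> hform (Suc d) (\<lambda>x. x $ i * f x)"
| add: "hform d f \<Longrightarrow> hform d f' \<Longrightarrow> hform d (\<lambda>x. f x + f' x)"

text \<open>\<open>lin_on sA sB A f\<close>: \<open>f\<close> is linear on the subspace \<open>A\<close>, for the scalar
  multiplications \<open>sA\<close> and \<open>sB\<close>.\<close>

definition lin_on ::
  "(complex \<Rightarrow> 'a \<Rightarrow> 'a) \<Rightarrow> (complex \<Rightarrow> 'b \<Rightarrow> 'b) \<Rightarrow> 'a set \<Rightarrow>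
   ('a::ab_group_add \<Rightarrow> 'b::ab_group_add) \<Rightarrow> bool" where
  "lin_on sA sB A f \<longleftrightarrow>
     (\<forall>x\<in>A. \<forall>y\<in>A. f (x + y) = f x + f y) \<and> (\<forall>c. \<forall>x\<in>A. f (sA c x) = sB c (f x))"


section \<open>Projective varieties\<close>

definition pclosed :: "(complex ^ 'n) set \<Rightarrow> bool" where
  "pclosed Z \<longleftrightarrow> (\<exists>F. (\<forall>f\<in>F. \<exists>d. hform d f) \<and> Z = {x. x \<noteq> 0 \<and> (\<forall>f\<in>F. f x = 0)})"

definition popen_in :: "(complex ^ 'n) set \<Rightarrow> (complex ^ 'n) set \<Rightarrow> bool" where
  "popen_in X W \<longleftrightarrow> (\<exists>Z. pclosed Z \<and> W = X - Z)"

definition pvariety :: "(complex ^ 'n) set \<Rightarrow> bool" where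
  "pvariety X \<longleftrightarrow> pclosed X \<and> X \<noteq> {} \<and>
     (\<forall>Y Z. pclosed Y \<and> pclosed Z \<and> X \<subseteq> Y \<union> Z \<longrightarrow> X \<subseteq> Y \<or> X \<subseteq> Z)"

definition ideal_deg :: "(complex ^ 'n) set \<Rightarrow> nat \<Rightarrow> (complex ^ 'n \<Rightarrow> complex) set" where
  "ideal_deg X d = {f. hform d f \<and> (\<forall>x\<in>X. f x = 0)}"

definition nondegenerate :: "(complex ^ 'n) set \<Rightarrow> bool" where
  "nondegenerate X \<longleftrightarrow> (\<forall>l. (\<forall>x\<in>X. ev l x = 0) \<longrightarrow> l = 0)"

text \<open>Krull dimension of the Zariski topology.\<close>

definition has_chain :: "(complex ^ 'n) set \<Rightarrow> nat \<Rightarrow> bool" where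
  "has_chain X m \<longleftrightarrow>
     (\<exists>Y :: nat \<Rightarrow> (complex ^ 'n) set.
        (\<forall>i\<le>m. pvariety (Y i) \<and> Y i \<subseteq> X) \<and> (\<forall>i<m. Y i \<subset> Y (Suc i)))"

definition has_pdim :: "(complex ^ 'n) set \<Rightarrow> nat \<Rightarrow> bool" where
  "has_pdim X m \<longleftrightarrow> has_chain X m \<and> (\<forall>r. has_chain X r \<longrightarrow> r \<le> m)"

text \<open>Zariski tangent space of the affine cone at \<open>x\<close>; it contains the line through \<open>x\<close>,
  and the quotient by this line is the tangent space of the projective variety (twisted).\<close>

definition tangent :: "(complex ^ 'n) set \<Rightarrow> complex ^ 'n \<Rightarrow> (complex ^ 'n) set" where
  "tangent X x = {v. \<forall>d. \<forall>f\<in>ideal_deg X d. deriv (\<lambda>t. f (x + t *s v)) 0 = 0}"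

definition smooth_variety :: "(complex ^ 'n) set \<Rightarrow> nat \<Rightarrow> bool" where
  "smooth_variety X m \<longleftrightarrow>
     pvariety X \<and> has_pdim X m \<and> (\<forall>x\<in>X. vec.dim (tangent X x) = m + 1)"


section \<open>Structure sheaf, line bundles, differential forms\<close>

text \<open>Sections of \<open>O_X\<close> over the open set \<open>W\<close>.  Only the values on \<open>W\<close> matter.\<close>

definition regular :: "(complex ^ 'n) set \<Rightarrow> (complex ^ 'n) set \<Rightarrow> (complex ^ 'n \<Rightarrow> complex) set"
  where
  "regular X W =
     {f. \<forall>x\<in>W. \<exists>W' d P Q. popen_in X W' \<and> x \<in> W' \<and> W' \<subseteq> W \<and> hform d P \<and> hform d Q \<and>
           (\<forall>y\<in>W'. Q y \<noteq> 0 \<and> f y = P y / Q y)}"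

definition open_cover :: "(complex ^ 'n) set \<Rightarrow> 'i set \<Rightarrow> ('i \<Rightarrow> (complex ^ 'n) set) \<Rightarrow> bool"
  where
  "open_cover X I W \<longleftrightarrow> (\<forall>a\<in>I. popen_in X (W a)) \<and> (\<Union>a\<in>I. W a) = X"

text \<open>Vanishing of \<open>H^1(X, O_X)\<close>.  Degree-one sheaf cohomology is the direct limit over open
  covers of Cech cohomology, and the group of each cover injects into the limit; hence the
  limit vanishes iff every 1-cocycle on every open cover is a coboundary.  As \<open>X\<close> is
  quasi-compact, covers indexed by natural numbers suffice.\<close>

definition H1_structure_sheaf_zero :: "(complex ^ 'n) set \<Rightarrow> bool" where
  "H1_structure_sheaf_zero X \<longleftrightarrow>
     (\<forall>(I :: nat set) W f. open_cover X I W \<and>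
        (\<forall>a\<in>I. \<forall>b\<in>I. f a b \<in> regular X (W a \<inter> W b)) \<and>
        (\<forall>a\<in>I. \<forall>b\<in>I. \<forall>c\<in>I. \<forall>x\<in>W a \<inter> W b \<inter> W c. f a b x + f b c x = f a c x) \<longrightarrow>
        (\<exists>h. (\<forall>a\<in>I. h a \<in> regular X (W a)) \<and>
             (\<forall>a\<in>I. \<forall>b\<in>I. \<forall>x\<in>W a \<inter> W b. f a b x = h a x - h b x)))"

text \<open>A line bundle is given by an open cover and transition functions \<open>g\<close>; its sections are
  the families with \<open>t a = g a b * t b\<close>.\<close>

definition line_bundle ::
  "(complex ^ 'n) set \<Rightarrow> 'i set \<Rightarrow> ('i \<Rightarrow> (complex ^ 'n) set) \<Rightarrow>
   ('i \<Rightarrow> 'i \<Rightarrow> complex ^ 'n \<Rightarrow> complex) \<Rightarrow> bool" where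
  "line_bundle X I W g \<longleftrightarrow> open_cover X I W \<and>
     (\<forall>a\<in>I. \<forall>b\<in>I. g a b \<in> regular X (W a \<inter> W b) \<and> (\<forall>x\<in>W a \<inter> W b. g a b x \<noteq> 0)) \<and>
     (\<forall>a\<in>I. \<forall>b\<in>I. \<forall>c\<in>I. \<forall>x\<in>W a \<inter> W b \<inter> W c. g a b x * g b c x = g a c x)"

definition line_bundle_iso ::
  "(complex ^ 'n) set \<Rightarrow>
   'i set \<Rightarrow> ('i \<Rightarrow> (complex ^ 'n) set) \<Rightarrow> ('i \<Rightarrow> 'i \<Rightarrow> complex ^ 'n \<Rightarrow> complex) \<Rightarrow>
   'j set \<Rightarrow> ('j \<Rightarrow> (complex ^ 'n) set) \<Rightarrow> ('j \<Rightarrow> 'j \<Rightarrow> complex ^ 'n \<Rightarrow> complex) \<Rightarrow> bool" where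
  "line_bundle_iso X I W g J W' g' \<longleftrightarrow>
     (\<exists>\<theta>. (\<forall>a\<in>I. \<forall>i\<in>J. \<theta> i a \<in> regular X (W a \<inter> W' i) \<and>
                        (\<forall>x\<in>W a \<inter> W' i. \<theta> i a x \<noteq> 0)) \<and>
          (\<forall>a\<in>I. \<forall>b\<in>I. \<forall>i\<in>J. \<forall>j\<in>J. \<forall>x\<in>W a \<inter> W b \<inter> W' i \<inter> W' j.
             \<theta> i a x * g a b x = g' i j x * \<theta> j b x))"

text \<open>The hyperplane bundle \<open>O_X(1)\<close>: a linear form \<open>l\<close> is the section with component
  \<open>l / x_i\<close> on \<open>{x_i \<noteq> 0}\<close>.\<close>

definition std_open :: "(complex ^ 'n) set \<Rightarrow> 'n \<Rightarrow> (complex ^ 'n) set" where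
  "std_open X i = {x\<in>X. x $ i \<noteq> 0}"

definition hyperplane_cocycle :: "'n \<Rightarrow> 'n \<Rightarrow> complex ^ 'n \<Rightarrow> complex" where
  "hyperplane_cocycle i j x = x $ j / x $ i"

text \<open>\<open>Pic X\<close> is generated by the class of \<open>O_X(1)\<close>: every line bundle is isomorphic to a tensor
  power, of positive or negative exponent, of \<open>O_X(1)\<close>.\<close>

definition Pic_generated_by_hyperplane_class :: "(complex ^ 'n) set \<Rightarrow> bool" where
  "Pic_generated_by_hyperplane_class X \<longleftrightarrow>
     (\<forall>(I :: nat set) W g. line_bundle X I W g \<longrightarrow>
        (\<exists>m :: int. line_bundle_iso X I W g
                      UNIV (std_open X) (\<lambda>i j x. hyperplane_cocycle i j x powi m)))"

text \<open>Global sections of the \<open>q\<close>-forms on a smooth \<open>X\<close>: they are alternating forms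
  \<open>\<omega> x\<close> on the tangent spaces, locally of the form \<open>\<Sum> f dh_1 \<and> \<dots> \<and> dh_q\<close> with \<open>f\<close> and
  \<open>h_c = P_c / Q_c\<close> regular.  Since the \<open>h_c\<close> have degree 0, these forms descend from the
  cone to projective space.  \<open>\<omega>\<close> is set to 0 outside its domain to make it a unique function.\<close>

definition frac_diff ::
  "(complex ^ 'n \<Rightarrow> complex) \<Rightarrow> (complex ^ 'n \<Rightarrow> complex) \<Rightarrow> complex ^ 'n \<Rightarrow> complex ^ 'n \<Rightarrow> complex"
  where
  "frac_diff P Q x v = deriv (\<lambda>t. P (x + t *s v) / Q (x + t *s v)) 0"

definition tangent_lists ::
  "(complex ^ 'n) set \<Rightarrow> nat \<Rightarrow> complex ^ 'n \<Rightarrow> (complex ^ 'n) list set" where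
  "tangent_lists X q x = {vs. length vs = q \<and> set vs \<subseteq> tangent X x}"

definition regular_forms ::
  "(complex ^ 'n) set \<Rightarrow> nat \<Rightarrow> (complex ^ 'n \<Rightarrow> (complex ^ 'n) list \<Rightarrow> complex) set" where
  "regular_forms X q =
     {\<omega>. (\<forall>x vs. \<not> (x \<in> X \<and> vs \<in> tangent_lists X q x) \<longrightarrow> \<omega> x vs = 0) \<and>
         (\<forall>x\<in>X. \<exists>W (N::nat) f d P Q.
            popen_in X W \<and> x \<in> W \<and>
            (\<forall>r<N. f r \<in> regular X W) \<and>
            (\<forall>r<N. \<forall>c<q. hform (d r c) (P r c) \<and> hform (d r c) (Q r c) \<and>
                          (\<forall>y\<in>W. Q r c y \<noteq> 0)) \<and>
            (\<forall>y\<in>W. \<forall>vs\<in>tangent_lists X q y.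
               \<omega> y vs =
                 (\<Sum>r<N. f r y *
                    (\<Sum>\<sigma> | \<sigma> permutes {..<q}. of_int (sign \<sigma>) *
                       (\<Prod>c<q. frac_diff (P r c) (Q r c) y (vs ! \<sigma> c))))))}"

text \<open>An isomorphism from \<open>O_X\<close> to the sheaf of top-degree forms is the same as a nowhere vanishing
  global form (the image of 1).\<close>

definition trivial_canonical_bundle :: "(complex ^ 'n) set \<Rightarrow> nat \<Rightarrow> bool" where
  "trivial_canonical_bundle X m \<longleftrightarrow>
     (\<exists>\<omega>\<in>regular_forms X m. \<forall>x\<in>X. \<exists>vs\<in>tangent_lists X m x. \<omega> x vs \<noteq> 0)"

definition K3_surface :: "(complex ^ 'n) set \<Rightarrow> bool" where
  "K3_surface X \<longleftrightarrow>
     smooth_variety X 2 \<and> trivial_canonical_bundle X 2 \<and> H1_structure_sheaf_zero X"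

definition smooth_curve_of_genus :: "(complex ^ 'n) set \<Rightarrow> nat \<Rightarrow> bool" where
  "smooth_curve_of_genus C \<gamma> \<longleftrightarrow> smooth_variety C 1 \<and>
     (\<exists>B. finite B \<and> card B = \<gamma> \<and>
          \<not> module.dependent (\<lambda>c \<omega> x vs. c * \<omega> x vs) B \<and>
          module.span (\<lambda>c \<omega> x vs. c * \<omega> x vs) B = regular_forms C 1)"

text \<open>\<open>C\<close> is the scheme-theoretic hyperplane section of \<open>X\<close> by a hyperplane which is nowhere tangent
  to \<open>X\<close>; so \<open>C\<close> as a divisor on \<open>X\<close> has multiplicity one and \<open>O_X(C) = O_X(1)\<close>.\<close>

definition smooth_hyperplane_section :: "(complex ^ 'n) set \<Rightarrow> (complex ^ 'n) set \<Rightarrow> bool" where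
  "smooth_hyperplane_section X C \<longleftrightarrow>
     (\<exists>l. l \<noteq> 0 \<and> C = {x\<in>X. ev l x = 0} \<and> (\<forall>x\<in>C. \<exists>v\<in>tangent X x. ev l v \<noteq> 0))"


section \<open>Linear syzygies\<close>

text \<open>\<open>syzygies X p\<close> is \<open>V_p\<close>, the kernel of the Koszul map from
  \<open>\<Lambda>^p V \<otimes> (I_X)_2\<close> to \<open>\<Lambda>^(p-1) V \<otimes> (I_X)_3\<close>.  An element of the source is written as
  an alternating family \<open>s\<close> of quadrics indexed by the words \<open>js\<close> of length \<open>p\<close> in the
  coordinates (a decomposable \<open>v_1 \<and> \<dots> \<and> v_p \<otimes> f\<close> being \<open>js \<mapsto> det (v_a $ js ! b) f\<close>).\<close>

definition syzygies ::
  "(complex ^ 'n) set \<Rightarrow> nat \<Rightarrow> ('n list \<Rightarrow> complex ^ 'n \<Rightarrow> complex) set" where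
  "syzygies X p =
     {s. (\<forall>js. length js = p \<longrightarrow> s js \<in> ideal_deg X 2) \<and>
         (\<forall>js. length js \<noteq> p \<longrightarrow> s js = (\<lambda>x. 0)) \<and>
         (\<forall>us i j ws x. s (us @ i # j # ws) x = - s (us @ j # i # ws) x) \<and>
         (\<forall>js x. Suc (length js) = p \<longrightarrow> (\<Sum>i\<in>UNIV. x $ i * s (i # js) x) = 0)}"

text \<open>These spaces are the linear strand of the minimal free resolution:
  \<open>V_0 = (I_X)_2\<close>, \<open>V_1 = ker (V_0 \<otimes> V \<rightarrow> (I_X)_3)\<close> and
  \<open>V_(p+2) = ker (V_(p+1) \<otimes> V \<rightarrow> V_p \<otimes> S_2 V)\<close>, where \<open>\<Sum>_i s (i # _) \<otimes> x_i\<close> is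
  the element of \<open>V_(p+1) \<otimes> V\<close> corresponding to \<open>s\<close>.\<close>

lemma syzygies_iff:
  "s \<in> syzygies X p \<longleftrightarrow>
     (\<forall>js. length js = p \<longrightarrow> s js \<in> ideal_deg X 2) \<and>
     (\<forall>js. length js \<noteq> p \<longrightarrow> s js = (\<lambda>x. 0)) \<and>
     (\<forall>us i j ws x. s (us @ i # j # ws) x = - s (us @ j # i # ws) x) \<and>
     (\<forall>js x. Suc (length js) = p \<longrightarrow> (\<Sum>i\<in>UNIV. x $ i * s (i # js) x) = 0)"
  unfolding syzygies_def by (rule mem_Collect_eq)

lemma syzygiesD:
  assumes "s \<in> syzygies X p"
  shows "length js = p \<Longrightarrow> s js \<in> ideal_deg X 2"
    and "length js \<noteq> p \<Longrightarrow> s js = (\<lambda>x. 0)"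
    and "s (us @ i # j # ws) x = - s (us @ j # i # ws) x"
    and "Suc (length js) = p \<Longrightarrow> (\<Sum>i\<in>UNIV. x $ i * s (i # js) x) = 0"
  using assms[unfolded syzygies_iff] by (simp, simp, metis, simp)

lemma syzygiesI:
  assumes "\<And>js. length js = p \<Longrightarrow> s js \<in> ideal_deg X 2"
    and "\<And>js. length js \<noteq> p \<Longrightarrow> s js = (\<lambda>x. 0)"
    and "\<And>us i j ws x. s (us @ i # j # ws) x = - s (us @ j # i # ws) x"
    and "\<And>js x. Suc (length js) = p \<Longrightarrow> (\<Sum>i\<in>UNIV. x $ i * s (i # js) x) = 0"
  shows "s \<in> syzygies X p"
  unfolding syzygies_iff by (intro conjI allI impI assms)

lemma syzygies_0:
  "s \<in> syzygies X 0 \<longleftrightarrow> s [] \<in> ideal_deg X 2 \<and> (\<forall>js. js \<noteq> [] \<longrightarrow> s js = (\<lambda>x. 0))"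
  unfolding syzygies_iff by auto

lemma syzygies_1:
  "s \<in> syzygies X 1 \<longleftrightarrow>
     s [] = (\<lambda>x. 0) \<and> (\<forall>i. (\<lambda>js. s (i # js)) \<in> syzygies X 0) \<and>
     (\<forall>x. (\<Sum>i\<in>UNIV. x $ i * s [i] x) = 0)" (is "?L \<longleftrightarrow> ?R")
proof
  assume ?L
  note s = syzygiesD[OF this]
  show ?R
    unfolding syzygies_0 using s(1)[of "[_]"] s(2) s(4)[of "[]"] by simp
next
  assume R: ?R
  have a: "s [i] \<in> ideal_deg X 2" and b: "js \<noteq> [] \<Longrightarrow> s (i # js) = (\<lambda>x. 0)" for i js
    using R unfolding syzygies_0 by auto
  have c: "s js = (\<lambda>x. 0)" if "length js \<noteq> 1" for js
    using that R b by (cases js) auto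
  show ?L
  proof (rule syzygiesI)
    show "s js \<in> ideal_deg X 2" if "length js = 1" for js
      using that a by (auto simp: length_Suc_conv)
    show "s (us @ i # j # ws) x = - s (us @ j # i # ws) x" for us i j ws x
      by (simp add: c)
    show "(\<Sum>i\<in>UNIV. x $ i * s (i # js) x) = 0" if "Suc (length js) = 1" for js x
      using that R by simp
  qed (rule c)
qed

lemma syzygies_Suc_Suc:
  "s \<in> syzygies X (Suc (Suc p)) \<longleftrightarrow>
     s [] = (\<lambda>x. 0) \<and> (\<forall>i. (\<lambda>js. s (i # js)) \<in> syzygies X (Suc p)) \<and>
     (\<forall>i j js x. s (i # j # js) x + s (j # i # js) x = 0)" (is "?L \<longleftrightarrow> ?R")
proof
  assume ?L
  note s = syzygiesD[OF this]
  have alt0: "s (i # j # ws) x = - s (j # i # ws) x" for i j ws x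
    using s(3)[of "[]" i j ws x] by (simp only: append_Nil)
  have "(\<lambda>js. s (a # js)) \<in> syzygies X (Suc p)" for a
  proof (rule syzygiesI)
    show "s (a # js) \<in> ideal_deg X 2" if "length js = Suc p" for js
      using s(1)[of "a # js"] that by simp
    show "s (a # js) = (\<lambda>x. 0)" if "length js \<noteq> Suc p" for js
      using s(2)[of "a # js"] that by simp
    show "s (a # us @ i # j # ws) x = - s (a # us @ j # i # ws) x" for us i j ws x
      using s(3)[of "a # us" i j ws x] by (simp only: append_Cons)
    show "(\<Sum>j\<in>UNIV. x $ j * s (a # j # js) x) = 0" if "Suc (length js) = Suc p" for js x
    proof -
      have "(\<Sum>j\<in>UNIV. x $ j * s (a # j # js) x) = (\<Sum>j\<in>UNIV. - (x $ j * s (j # a # js) x))"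
        by (rule sum.cong[OF refl]) (metis alt0 mult_minus_right)
      also have "\<dots> = 0"
        using s(4)[of "a # js" x] that by (simp only: sum_negf length_Cons neg_equal_0_iff_equal)
      finally show ?thesis .
    qed
  qed
  moreover have "s [] = (\<lambda>x. 0)"
    by (rule s(2)) simp
  moreover have "s (i # j # js) x + s (j # i # js) x = 0" for i j js x
    by (metis alt0 add.left_inverse)
  ultimately show ?R by blast
next
  assume R: ?R
  have alt0: "s (i # j # ws) x = - s (j # i # ws) x" for i j ws x
    using R eq_neg_iff_add_eq_0 by blast
  have "(\<lambda>js. s (a # js)) \<in> syzygies X (Suc p)" for a
    using R by blast
  note sh = syzygiesD[OF this]
  show ?L
  proof (rule syzygiesI)
    show "s js \<in> ideal_deg X 2" if "length js = Suc (Suc p)" for js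
      using that sh(1) by (cases js) auto
    show "s js = (\<lambda>x. 0)" if "length js \<noteq> Suc (Suc p)" for js
      using that sh(2) R by (cases js) auto
    show "s (us @ i # j # ws) x = - s (us @ j # i # ws) x" for us i j ws x
    proof (cases us)
      case Nil
      then show ?thesis using alt0[of i j ws x] by (simp only: append_Nil)
    next
      case (Cons a us')
      then show ?thesis using sh(3)[of a us' i j ws x] by (simp only: append_Cons)
    qed
    show "(\<Sum>i\<in>UNIV. x $ i * s (i # js) x) = 0" if len: "Suc (length js) = Suc (Suc p)" for js x
    proof -
      obtain a ks where js: "js = a # ks" "Suc (length ks) = Suc p"
        using len by (cases js) auto
      have "(\<Sum>i\<in>UNIV. x $ i * s (i # js) x) = (\<Sum>i\<in>UNIV. - (x $ i * s (a # i # ks) x))"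
        unfolding js(1) by (rule sum.cong[OF refl]) (metis alt0 mult_minus_right)
      also have "\<dots> = 0"
        using sh(4)[OF js(2), of x a] by (simp only: sum_negf neg_equal_0_iff_equal)
      finally show ?thesis .
    qed
  qed
qed

text \<open>\<open>L_s\<close>: the image of the map from the dual of \<open>V_(p-1)\<close> to \<open>V\<close> induced by \<open>s\<close> in \<open>V_p\<close>
  (for \<open>p \<ge> 1\<close>).\<close>

definition syz_L ::
  "(complex ^ 'n) set \<Rightarrow> nat \<Rightarrow> ('n list \<Rightarrow> complex ^ 'n \<Rightarrow> complex) \<Rightarrow> (complex ^ 'n) set" where
  "syz_L X p s =
     {(\<chi> i. \<phi> (\<lambda>js. s (i # js))) | \<phi>.
        lin_on (\<lambda>c t js x. c * t js x) (*) (syzygies X (p - 1)) \<phi>}"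

definition syz_rank ::
  "(complex ^ 'n) set \<Rightarrow> nat \<Rightarrow> ('n list \<Rightarrow> complex ^ 'n \<Rightarrow> complex) \<Rightarrow> nat" where
  "syz_rank X p s = vec.dim (syz_L X p s)"


section \<open>The projection induced by a Grassmannian syzygy\<close>

text \<open>\<open>U = \<complex> u_0 \<oplus> L\<close>.  Linear maps on \<open>\<Lambda>^2 U\<close> are represented by alternating bilinear maps
  on \<open>U\<close>; in particular the cone over \<open>P^N = P(\<Lambda>^2 U)\<close> is the space of alternating bilinear
  forms on \<open>U\<close> (only their values on \<open>U\<close> matter).\<close>

type_synonym 'n U = "complex \<times> (complex ^ 'n)"

definition U_of :: "(complex ^ 'n) set \<Rightarrow> 'n U set" where
  "U_of L = UNIV \<times> L"

definition U_scale :: "complex \<Rightarrow> 'n::finite U \<Rightarrow> 'n U" where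
  "U_scale c u = (c * fst u, c *s snd u)"

definition u0 :: "'n::finite U" where
  "u0 = (1, 0)"

definition in_U :: "complex ^ 'n \<Rightarrow> 'n U" where
  "in_U l = (0, l)"

definition alternating_bilinear_on ::
  "(complex ^ 'n) set \<Rightarrow> (complex ^ 'n \<Rightarrow> complex ^ 'n \<Rightarrow> complex ^ 'n) \<Rightarrow> bool" where
  "alternating_bilinear_on L \<alpha> \<longleftrightarrow>
     (\<forall>l\<in>L. lin_on (*s) (*s) L (\<alpha> l) \<and> lin_on (*s) (*s) L (\<lambda>m. \<alpha> m l) \<and> \<alpha> l l = 0)"

text \<open>\<open>pi_star \<alpha>\<close> is \<open>\<iota> \<oplus> \<alpha>\<close> with \<open>L \<oplus> \<Lambda>^2 L\<close> identified with \<open>\<Lambda>^2 U\<close>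
  via \<open>l \<mapsto> u_0 \<and> l\<close>; \<open>proj \<alpha> x\<close> is the image in the cone over \<open>P^N\<close> of the point \<open>x\<close>
  of the cone over \<open>P(V)\<close>.\<close>

definition pi_star ::
  "(complex ^ 'n \<Rightarrow> complex ^ 'n \<Rightarrow> complex ^ 'n) \<Rightarrow> 'n U \<Rightarrow> 'n U \<Rightarrow> complex ^ 'n" where
  "pi_star \<alpha> u w = fst u *s snd w - fst w *s snd u + \<alpha> (snd u) (snd w)"

definition pi_star_image ::
  "(complex ^ 'n) set \<Rightarrow> (complex ^ 'n \<Rightarrow> complex ^ 'n \<Rightarrow> complex ^ 'n) \<Rightarrow> (complex ^ 'n) set" where
  "pi_star_image L \<alpha> = vec.span {pi_star \<alpha> u w | u w. u \<in> U_of L \<and> w \<in> U_of L}"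

definition proj ::
  "(complex ^ 'n \<Rightarrow> complex ^ 'n \<Rightarrow> complex ^ 'n) \<Rightarrow> complex ^ 'n \<Rightarrow> 'n U \<Rightarrow> 'n U \<Rightarrow> complex" where
  "proj \<alpha> x u w = ev (pi_star \<alpha> u w) x"

text \<open>The generic syzygy for the generator \<open>e_0 \<and> \<dots> \<and> e_(p+2)\<close> of \<open>\<Lambda>^(p+3) L\<close>.  Its
  image under comultiplication is
  \<open>1/(p! 2!) \<Sum>_\<sigma> sign \<sigma> (e_\<sigma>(0) \<and> \<dots> \<and> e_\<sigma>(p-1)) \<otimes> (e_\<sigma>(p) \<otimes> (e_\<sigma>(p+1) \<and> e_\<sigma>(p+2)))\<close>.
  Here \<open>\<Lambda>^p L\<close> is written as alternating families indexed by words as in \<open>syzygies\<close>; expanding the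
  determinant cancels \<open>1/p!\<close>.  The quadric \<open>l \<cdot> (m \<and> n)\<close> is the function
  \<open>\<omega> \<mapsto> \<omega> u_0 l * \<omega> m n\<close> on the cone over \<open>P^N\<close>.\<close>

definition generic_syzygy ::
  "nat \<Rightarrow> (nat \<Rightarrow> complex ^ 'n) \<Rightarrow> 'n list \<Rightarrow> ('n U \<Rightarrow> 'n U \<Rightarrow> complex) \<Rightarrow> complex" where
  "generic_syzygy p e js \<omega> =
     (1/2) * (\<Sum>\<sigma> | \<sigma> permutes {..<p+3}. of_int (sign \<sigma>) * (\<Prod>a<p. e (\<sigma> a) $ (js ! a)) *
                (\<omega> u0 (in_U (e (\<sigma> p))) *
                 \<omega> (in_U (e (\<sigma> (p+1)))) (in_U (e (\<sigma> (p+2))))))"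

text \<open>\<open>\<alpha>\<close> defines a projection induced by the \<open>p\<close>-th syzygy \<open>s\<close> of rank \<open>p + 3\<close>: pulling back by
  \<open>proj \<alpha>\<close>, i.e. applying \<open>pi_star \<alpha>\<close>, maps a generic syzygy to \<open>s\<close>.\<close>

definition induces_projection ::
  "(complex ^ 'n) set \<Rightarrow> nat \<Rightarrow> ('n list \<Rightarrow> complex ^ 'n \<Rightarrow> complex) \<Rightarrow>
   (complex ^ 'n \<Rightarrow> complex ^ 'n \<Rightarrow> complex ^ 'n) \<Rightarrow> bool" where
  "induces_projection X p s \<alpha> \<longleftrightarrow>
     alternating_bilinear_on (syz_L X p s) \<alpha> \<and>
     (\<exists>e. inj_on e {..<p+3} \<and> vec.independent (e ` {..<p+3}) \<and>
          vec.span (e ` {..<p+3}) = syz_L X p s \<and>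
          (\<forall>js x. length js = p \<longrightarrow> s js x = generic_syzygy p e js (proj \<alpha> x)))"

text \<open>Cone over the Pluecker-embedded Grassmannian of 2-dimensional quotients \<open>q : U \<rightarrow> \<complex>^2\<close>.\<close>

definition Gr2 :: "(complex ^ 'n) set \<Rightarrow> ('n U \<Rightarrow> 'n U \<Rightarrow> complex) set" where
  "Gr2 L =
     {\<omega>. \<exists>q :: 'n U \<Rightarrow> complex ^ 2. lin_on U_scale (*s) (U_of L) q \<and> q ` U_of L = UNIV \<and>
          (\<forall>u\<in>U_of L. \<forall>w\<in>U_of L. \<omega> u w = q u $ 1 * q w $ 2 - q u $ 2 * q w $ 1)}"

definition base_point ::
  "(complex ^ 'n) set \<Rightarrow> (complex ^ 'n \<Rightarrow> complex ^ 'n \<Rightarrow> complex ^ 'n) \<Rightarrow> complex ^ 'n \<Rightarrow> bool" where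
  "base_point L \<alpha> x \<longleftrightarrow> (\<forall>u\<in>U_of L. \<forall>w\<in>U_of L. proj \<alpha> x u w = 0)"

text \<open>The rational map defined by \<open>proj \<alpha>\<close> is an isomorphism from \<open>P(V)\<close> to \<open>P^n = P(Im (pi_star \<alpha>))\<close>,
  the linear subspace of \<open>P^N\<close> whose points satisfy all linear relations among the values of
  \<open>pi_star \<alpha>\<close>: it is a morphism (no base points), injective and onto.  For a map given by linear
  forms this is an isomorphism of varieties.\<close>

definition cone_Pn ::
  "(complex ^ 'n) set \<Rightarrow> (complex ^ 'n \<Rightarrow> complex ^ 'n \<Rightarrow> complex ^ 'n) \<Rightarrow>
   ('n U \<Rightarrow> 'n U \<Rightarrow> complex) set" where
  "cone_Pn L \<alpha> =
     {\<omega>. \<exists>\<phi>. lin_on (*s) (*) (pi_star_image L \<alpha>) \<phi> \<and>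
          (\<forall>u\<in>U_of L. \<forall>w\<in>U_of L. \<omega> u w = \<phi> (pi_star \<alpha> u w))}"

definition proj_is_iso ::
  "(complex ^ 'n) set \<Rightarrow> (complex ^ 'n \<Rightarrow> complex ^ 'n \<Rightarrow> complex ^ 'n) \<Rightarrow> bool" where
  "proj_is_iso L \<alpha> \<longleftrightarrow>
     (\<forall>x. x \<noteq> 0 \<longrightarrow> \<not> base_point L \<alpha> x) \<and>
     (\<forall>x y c. x \<noteq> 0 \<and> y \<noteq> 0 \<and>
        (\<forall>u\<in>U_of L. \<forall>w\<in>U_of L. proj \<alpha> x u w = c * proj \<alpha> y u w) \<longrightarrow> (\<exists>c'. x = c' *s y)) \<and>
     (\<forall>\<omega>\<in>cone_Pn L \<alpha>. \<exists>x. \<forall>u\<in>U_of L. \<forall>w\<in>U_of L. \<omega> u w = proj \<alpha> x u w)"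

end

theory Submission
  imports Defs "HOL-Computational_Algebra.Field_as_Ring" "HOL-Computational_Algebra.Polynomial_Factorial"
    "HOL-Computational_Algebra.Fundamental_Theorem_Algebra"
begin

text \<open>
  The coefficients of the generic syzygy are contractions of the Pfaffians
  \<open>Pf(a, b, c) = a \<alpha>(b, c) - b \<alpha>(a, c) + c \<alpha>(a, b)\<close> with \<open>a, b, c \<in> L\<close>; so the Pfaffians vanish on
  \<open>S\<close>, and they do not all vanish identically, as \<open>s \<noteq> 0\<close>. Where a form of \<open>L\<close> does not vanish, the
  Pfaffians imply all Pluecker relations, hence these hold on the irreducible \<open>S\<close>.

  Suppose that the image of \<open>\<pi>\<^sup>*\<close> is a proper subspace of \<open>V\<close>. It has dimension at most \<open>2 k\<close>, the
  dimension of the Grassmannian of planes in \<open>U\<close>, so a nonzero decomposable bivector is killed by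
  \<open>\<pi>\<^sup>*\<close>. This means \<open>\<alpha>(l, l') = c l\<close> for some linearly independent \<open>l, l' \<in> L\<close>. Now \<open>Pf(l, l', m)\<close> has
  rank at most 4 and reads \<open>l (\<alpha>(l', m) + c m) = l' \<alpha>(l, m)\<close> on \<open>S\<close>. The ideal
  sheaf \<open>(l : l')\<close> is invertible, because the local rings of the smooth surface \<open>S\<close> are factorial; as
  the Picard group is generated by the hyperplane class, it is \<open>O\<close> or \<open>O(-1)\<close>. In the first case
  \<open>l' / l\<close> would be constant, the second one gives \<open>\<alpha>(l, m) = \<lambda>(m) l\<close>. Then \<open>Pf(l, m, m')\<close> gives
  \<open>\<alpha>(m, m') = \<lambda>(m') m - \<lambda>(m) m'\<close>, for which all Pfaffians vanish identically, a contradiction.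
\<close>

section \<open>Noetherian subrings\<close>

text \<open>The value g = 2 k enters through dim V = 2 k + 1: a hyperplane containing the image
  leaves only 2 k linear conditions on decomposable bivectors. A killed plane of U meets L in some
  l, and \<alpha>(l, l') = c l is what lets the last term c l m of Pf(l, l', m) merge with l
  \<alpha>(l', m), so that only two products remain.

  The obstacle is that the Picard hypothesis speaks about cocycles on open covers: the ideal (l :
  l') has to be turned into transition functions, hence needs a generator near every point p of S.
  Only this one ideal is shown to be principal. Two linear forms serve both as local parameters at p
  and as a finite map from a chart of S to the plane. Modulo the first of them the local ring is a
  discrete valuation ring, and a generator is found by minimizing the valuation and correcting by
  powers of that form.

  Fractions are avoided by using polynomial functions on the chart and multipliers that do not
  vanish at p. Finiteness comes each time from the projective Nullstellensatz: forms without common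
  zero generate all forms of large degree.\<close>

definition subring :: "'r::comm_ring_1 set \<Rightarrow> bool" where
  "subring A \<longleftrightarrow> 1 \<in> A \<and> (\<forall>a\<in>A. \<forall>b\<in>A. a - b \<in> A \<and> a * b \<in> A)"

lemma subringD:
  assumes "subring A"
  shows "1 \<in> A" "0 \<in> A" "a \<in> A \<Longrightarrow> - a \<in> A"
    "a \<in> A \<Longrightarrow> b \<in> A \<Longrightarrow> a + b \<in> A" "a \<in> A \<Longrightarrow> b \<in> A \<Longrightarrow> a - b \<in> A"
    "a \<in> A \<Longrightarrow> b \<in> A \<Longrightarrow> a * b \<in> A"
proof -
  show 1: "1 \<in> A" and d: "a \<in> A \<Longrightarrow> b \<in> A \<Longrightarrow> a - b \<in> A"
    and "a \<in> A \<Longrightarrow> b \<in> A \<Longrightarrow> a * b \<in> A" for a b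
    using assms by (auto simp: subring_def)
  have "1 - 1 \<in> A" using 1 d by blast
  then show 0: "0 \<in> A" by simp
  show n: "- a \<in> A" if "a \<in> A" for a using d[OF 0 that] by simp
  show "a + b \<in> A" if "a \<in> A" "b \<in> A" using d[OF that(1) n[OF that(2)]] by simp
qed

lemma subring_sum:
  assumes "subring A" "\<And>i. i \<in> I \<Longrightarrow> f i \<in> A"
  shows "sum f I \<in> A"
  using assms(2) by (induction I rule: infinite_finite_induct) (auto simp: subringD[OF assms(1)])

lemma subring_power: "subring A \<Longrightarrow> a \<in> A \<Longrightarrow> a ^ n \<in> A"
  by (induction n) (auto simp: subringD)

text \<open>The A-submodule of the ambient ring generated by F. An induction step peels off a single
  product of a coefficient and a generator.\<close>

inductive_set idl :: "'r::comm_ring_1 set \<Rightarrow> 'r set \<Rightarrow> 'r set" for A F where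
  idl_0: "0 \<in> idl A F"
| idl_step: "a \<in> A \<Longrightarrow> f \<in> F \<Longrightarrow> g \<in> idl A F \<Longrightarrow> a * f + g \<in> idl A F"

lemma idl_add: "x \<in> idl A F \<Longrightarrow> y \<in> idl A F \<Longrightarrow> x + y \<in> idl A F"
  by (induction rule: idl.induct) (auto simp: add.assoc intro: idl.intros)

lemma idl_mult:
  assumes "subring A" "c \<in> A" shows "x \<in> idl A F \<Longrightarrow> c * x \<in> idl A F"
proof (induction rule: idl.induct)
  case (idl_step a f g)
  then have "(c * a) * f + c * g \<in> idl A F"
    by (intro idl.idl_step) (auto simp: subringD[OF assms(1)] assms)
  then show ?case by (simp add: algebra_simps)
qed (auto intro: idl.intros)

lemma idl_gen: "subring A \<Longrightarrow> f \<in> F \<Longrightarrow> f \<in> idl A F"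
  using idl_step[of 1 A f F 0] by (auto simp: subringD intro: idl.intros)

lemma idl_uminus: "subring A \<Longrightarrow> x \<in> idl A F \<Longrightarrow> - x \<in> idl A F"
  using idl_mult[of A "- 1" x F] by (simp add: subringD)

lemma idl_diff: "subring A \<Longrightarrow> x \<in> idl A F \<Longrightarrow> y \<in> idl A F \<Longrightarrow> x - y \<in> idl A F"
  using idl_add[of x A F "- y"] by (simp add: idl_uminus)

lemma idl_mono: "F \<subseteq> G \<Longrightarrow> idl A F \<subseteq> idl A G"
  by (rule subsetI, erule idl.induct) (auto intro: idl.intros)

lemma idl_idl: "subring A \<Longrightarrow> F \<subseteq> idl A G \<Longrightarrow> idl A F \<subseteq> idl A G"
  by (rule subsetI, erule idl.induct) (auto intro: idl.intros idl_add idl_mult)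

lemma idl_sum: "(\<And>i. i \<in> I \<Longrightarrow> f i \<in> idl A F) \<Longrightarrow> sum f I \<in> idl A F"
  by (induction I rule: infinite_finite_induct) (auto intro: idl_add idl_0)

lemma idl_finite_support: "x \<in> idl A F \<Longrightarrow> \<exists>G. finite G \<and> G \<subseteq> F \<and> x \<in> idl A G"
proof (induction rule: idl.induct)
  case (idl_step a f g)
  then obtain G where "finite G" "G \<subseteq> F" "g \<in> idl A G" by blast
  then show ?case using idl_step idl_mono[of G "insert f G" A]
    by (intro exI[of _ "insert f G"]) (auto intro: idl.intros)
qed (auto intro: idl.intros)

lemma idl_image_lessThan:
  assumes A: "subring A" and x: "x \<in> idl A (b ` {..<n::nat})"
  obtains u where "\<And>i. u i \<in> A" "x = (\<Sum>i<n. u i * b i)"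
proof -
  from x have "\<exists>u. (\<forall>i. u i \<in> A) \<and> x = (\<Sum>i<n. u i * b i)"
  proof (induction rule: idl.induct)
    case idl_0
    show ?case by (rule exI[of _ "\<lambda>_. 0"]) (simp add: subringD[OF A])
  next
    case (idl_step a f g)
    then obtain u i where u: "\<forall>i. u i \<in> A" "g = (\<Sum>i<n. u i * b i)" and i: "i < n" "f = b i" by blast
    have "a * f + g = (\<Sum>j<n. (u j + (if j = i then a else 0)) * b j)"
      using i by (simp add: u(2) distrib_right sum.distrib if_distrib[of "\<lambda>c. c * _"] cong: if_cong)
    then show ?case using u(1) idl_step(1)
      by (intro exI[of _ "\<lambda>j. u j + (if j = i then a else 0)"]) (auto simp: subringD[OF A])
  qed
  then show ?thesis using that by blast
qed

text \<open>Dependent choice in which each element is selected against the finite set of all its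
  predecessors; a recursion over lists carries this history along.\<close>

lemma finite_history_choice:
  assumes "\<And>G. finite G \<Longrightarrow> G \<subseteq> X \<Longrightarrow> \<exists>x\<in>X. R G x"
  obtains b :: "nat \<Rightarrow> 'a" where "\<And>n. b n \<in> X" "\<And>n. R (b ` {..<n}) (b n)"
proof -
  define h where "h G = (SOME x. x \<in> X \<and> R G x)" for G
  define xs where "xs = rec_nat [] (\<lambda>_ l. l @ [h (set l)])"
  define b where "b n = h (set (xs n))" for n
  have xs: "xs 0 = []" "xs (Suc n) = xs n @ [b n]" for n by (simp_all add: xs_def b_def)
  have set: "set (xs n) = b ` {..<n}" for n by (induction n) (auto simp: xs lessThan_Suc)
  have "h G \<in> X \<and> R G (h G)" if "finite G" "G \<subseteq> X" for G
    unfolding h_def using someI_ex[of "\<lambda>x. x \<in> X \<and> R G x"] assms[OF that] by blast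
  then have h: "b n \<in> X \<and> R (b ` {..<n}) (b n)" if "b ` {..<n} \<subseteq> X" for n
    using that unfolding b_def[of n] set by simp
  have sub: "b ` {..<n} \<subseteq> X" for n
    by (induction n) (use h in \<open>auto simp: lessThan_Suc\<close>)
  show ?thesis using that[of b] h[OF sub] by blast
qed

definition noetherian :: "'r::comm_ring_1 set \<Rightarrow> bool" where
  "noetherian A \<longleftrightarrow> (\<forall>F\<subseteq>A. \<exists>G. finite G \<and> G \<subseteq> F \<and> F \<subseteq> idl A G)"

text \<open>The ascending chain condition as it is used below: n lies beyond the indices of a finite
  generating subfamily of the sequence.\<close>

lemma noetherian_seq:
  assumes "noetherian A" "subring A" "\<And>n. b n \<in> A"
  obtains n where "b n \<in> idl A (b ` {..<n::nat})"
proof -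
  obtain G where G: "finite G" "G \<subseteq> range b" "range b \<subseteq> idl A G"
    using assms(1)[unfolded noetherian_def, rule_format, of "range b"] assms(3) by blast
  obtain J where J: "finite J" "G = b ` J" using G by (meson finite_subset_image)
  obtain n where "J \<subseteq> {..<n}" using J(1) finite_nat_bounded by blast
  then have "G \<subseteq> b ` {..<n}" using J by blast
  then have "b n \<in> idl A (b ` {..<n})" using G(3) idl_mono by blast
  then show ?thesis using that by blast
qed

lemma poly_subring: "subring A \<Longrightarrow> (\<And>i. coeff P i \<in> A) \<Longrightarrow> t \<in> A \<Longrightarrow> poly P t \<in> A"
  unfolding poly_altdef by (intro subring_sum subringD subring_power)

text \<open>The image of the polynomial ring over A under evaluation at t. As t may satisfy
  relations, the basis theorem below is about quotients of the polynomial ring.\<close>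

definition adjoin :: "'r::comm_ring_1 set \<Rightarrow> 'r \<Rightarrow> 'r set" where
  "adjoin A t = {poly P t | P. \<forall>i. coeff P i \<in> A}"

lemma coeff_mult_subring:
  "subring A \<Longrightarrow> (\<And>i. coeff P i \<in> A) \<Longrightarrow> (\<And>i. coeff Q i \<in> A) \<Longrightarrow> coeff (P * Q) i \<in> A"
  unfolding coeff_mult by (intro subring_sum subringD(6)) auto

lemma subring_adjoin:
  assumes A: "subring A" shows "subring (adjoin A t)"
  unfolding subring_def
proof safe
  show "1 \<in> adjoin A t" unfolding adjoin_def
    by (rule CollectI, rule exI[of _ 1]) (auto simp: coeff_1 subringD[OF A])
  fix x y assume "x \<in> adjoin A t" "y \<in> adjoin A t"
  then obtain P Q where *: "x = poly P t" "y = poly Q t" "\<And>i. coeff P i \<in> A" "\<And>i. coeff Q i \<in> A"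
    unfolding adjoin_def by blast
  show "x - y \<in> adjoin A t" unfolding adjoin_def
    by (rule CollectI, rule exI[of _ "P - Q"]) (simp add: * subringD[OF A])
  show "x * y \<in> adjoin A t" unfolding adjoin_def
    by (rule CollectI, rule exI[of _ "P * Q"]) (simp add: * coeff_mult_subring[OF A])
qed

lemma adjoin_superset: "subring A \<Longrightarrow> A \<subseteq> adjoin A t"
  unfolding adjoin_def
  by (auto intro!: exI[of _ "[:_:]"] simp: coeff_pCons subringD split: nat.splits)

lemma adjoin_gen: "subring A \<Longrightarrow> t \<in> adjoin A t"
  unfolding adjoin_def
  by (auto intro!: exI[of _ "[:0, 1:]"] simp: coeff_pCons subringD split: nat.splits)

text \<open>Hilbert's basis theorem: polynomials of minimal degree outside the ideals generated so far
  have leading coefficients that violate the ascending chain condition in \<open>A\<close>.\<close>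

lemma noetherian_adjoin:
  assumes A: "subring A" and N: "noetherian A"
  shows "noetherian (adjoin A t)"
  unfolding noetherian_def
proof (intro allI impI, rule ccontr)
  let ?B = "adjoin A t"
  note B = subring_adjoin[OF A, of t]
  fix F assume F: "F \<subseteq> ?B" and bad: "\<nexists>G. finite G \<and> G \<subseteq> F \<and> F \<subseteq> idl ?B G"
  define ev where "ev P = poly P t" for P
  define X where "X = {P. (\<forall>i. coeff P i \<in> A) \<and> ev P \<in> idl ?B F}"
  define R where "R G P \<longleftrightarrow> ev P \<notin> idl ?B (ev ` G) \<and>
      (\<forall>Q\<in>X. ev Q \<notin> idl ?B (ev ` G) \<longrightarrow> degree P \<le> degree Q)" for G P
  have "\<exists>x\<in>X. R G x" if G: "finite G" "G \<subseteq> X" for G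
  proof -
    have "\<forall>P\<in>G. \<exists>H. finite H \<and> H \<subseteq> F \<and> ev P \<in> idl ?B H"
    proof
      fix P assume "P \<in> G"
      then have "ev P \<in> idl ?B F" using G(2) by (auto simp: X_def)
      then show "\<exists>H. finite H \<and> H \<subseteq> F \<and> ev P \<in> idl ?B H" by (rule idl_finite_support)
    qed
    then obtain H where H: "\<And>P. P \<in> G \<Longrightarrow> finite (H P) \<and> H P \<subseteq> F \<and> ev P \<in> idl ?B (H P)" by metis
    define K where "K = (\<Union>P\<in>G. H P)"
    have "finite K" "K \<subseteq> F" using H G(1) by (auto simp: K_def)
    then obtain f where f: "f \<in> F" "f \<notin> idl ?B K" using bad by blast
    have "ev ` G \<subseteq> idl ?B K"
    proof safe
      fix P assume P: "P \<in> G"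
      then have "H P \<subseteq> K" by (auto simp: K_def)
      then show "ev P \<in> idl ?B K" using H[OF P] idl_mono by blast
    qed
    then have "f \<notin> idl ?B (ev ` G)" using f(2) idl_idl[OF B] by blast
    moreover obtain P where "\<forall>i. coeff P i \<in> A" "f = ev P"
      using f(1) F unfolding adjoin_def ev_def by blast
    ultimately have "\<exists>P. P \<in> X \<and> ev P \<notin> idl ?B (ev ` G)"
      using f(1) idl_gen[OF B] unfolding X_def by blast
    then obtain P where "P \<in> X \<and> ev P \<notin> idl ?B (ev ` G)"
      "\<And>Q. Q \<in> X \<and> ev Q \<notin> idl ?B (ev ` G) \<Longrightarrow> degree P \<le> degree Q"
      using ex_has_least_nat[of "\<lambda>P. P \<in> X \<and> ev P \<notin> idl ?B (ev ` G)" _ degree] by blast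
    then show ?thesis unfolding R_def by blast
  qed
  then obtain p where p: "\<And>n. p n \<in> X" "\<And>n::nat. R (p ` {..<n}) (p n)"
    using finite_history_choice[of X R] by blast
  have pA: "coeff (p n) i \<in> A" for n i using p(1) by (auto simp: X_def)
  obtain n where "lead_coeff (p n) \<in> idl A ((\<lambda>i. lead_coeff (p i)) ` {..<n})"
    using noetherian_seq[OF N A, of "\<lambda>i. lead_coeff (p i)"] pA by blast
  then obtain u where u: "\<And>i. u i \<in> A" "lead_coeff (p n) = (\<Sum>i<n. u i * lead_coeff (p i))"
    using idl_image_lessThan[OF A, of _ "\<lambda>i. lead_coeff (p i)"] by blast
  \<comment> \<open>Enlarging the ideal leaves fewer competitors: p n was already one when p i was
    chosen with least degree.\<close>
  have deg: "degree (p i) \<le> degree (p n)" if "i < n" for i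
  proof -
    have "idl ?B (ev ` p ` {..<i}) \<subseteq> idl ?B (ev ` p ` {..<n})" using that by (intro idl_mono) auto
    then show ?thesis using p unfolding R_def by blast
  qed
  \<comment> \<open>The relation between the leading coefficients cancels the top term, while Q
    stays outside the same ideal. Minimality of deg p n leaves only Q = 0, whose value lies in every
    ideal.\<close>
  define Q where "Q = p n - (\<Sum>i<n. monom (u i) (degree (p n) - degree (p i)) * p i)"
  have evQ: "ev Q = ev (p n) - (\<Sum>i<n. u i * t ^ (degree (p n) - degree (p i)) * ev (p i))"
    by (simp add: Q_def ev_def poly_sum poly_monom)
  have in_sum: "(\<Sum>i<n. u i * t ^ (degree (p n) - degree (p i)) * ev (p i)) \<in> idl ?B (ev ` p ` {..<n})"
    using u(1) adjoin_superset[OF A, of t] adjoin_gen[OF A, of t]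
    by (intro idl_sum idl_mult[OF B] idl_gen[OF B] subringD[OF B] subring_power[OF B]) auto
  have Qnot: "ev Q \<notin> idl ?B (ev ` p ` {..<n})"
  proof
    assume "ev Q \<in> idl ?B (ev ` p ` {..<n})"
    then have "ev (p n) \<in> idl ?B (ev ` p ` {..<n})" using idl_add[OF _ in_sum] evQ by fastforce
    then show False using p(2) unfolding R_def by blast
  qed
  have "ev Q \<in> idl ?B F"
  proof -
    have "ev ` p ` {..<n} \<subseteq> idl ?B F" using p(1) unfolding X_def by blast
    then have "(\<Sum>i<n. u i * t ^ (degree (p n) - degree (p i)) * ev (p i)) \<in> idl ?B F"
      using in_sum idl_idl[OF B] by blast
    then show ?thesis unfolding evQ using p(1) by (intro idl_diff[OF B]) (auto simp: X_def)
  qed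
  moreover have "coeff Q i \<in> A" for i
    unfolding Q_def coeff_diff coeff_sum coeff_mult
    by (intro subringD[OF A] subring_sum[OF A]) (auto simp: pA u subringD[OF A])
  ultimately have "Q \<in> X" by (simp add: X_def)
  then have "degree (p n) \<le> degree Q" using p(2) Qnot unfolding R_def by blast
  moreover have cQ: "coeff Q m = 0" if "m \<ge> degree (p n)" for m
  proof -
    have *: "coeff (monom (u i) (degree (p n) - degree (p i)) * p i) m
        = (if m = degree (p n) then u i * lead_coeff (p i) else 0)" if "i < n" for i
      using deg[OF that] \<open>m \<ge> degree (p n)\<close> by (auto simp: coeff_monom_mult coeff_eq_0)
    have "coeff Q m = coeff (p n) m - (\<Sum>i<n. if m = degree (p n) then u i * lead_coeff (p i) else 0)"
      by (simp add: Q_def coeff_sum *)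
    then show ?thesis using that u(2) by (cases "m = degree (p n)") (auto simp: coeff_eq_0)
  qed
  ultimately have "coeff Q (degree Q) = 0" by blast
  then have "ev Q = 0" by (simp add: ev_def)
  then show False using Qnot idl_0 by metis
qed

section \<open>Elimination\<close>

text \<open>A common generalisation of Nakayama's lemma (pivots are the units of a local ring, the other
  entries lie in the maximal ideal) and of the Cayley-Hamilton argument for integrality (pivots are
  monic of degree \<open>e\<close>, the other entries have smaller degree).\<close>

lemma elimination:
  fixes \<phi> :: "'q::comm_ring_1 \<Rightarrow> 'r::comm_ring_1" and U N :: "nat \<Rightarrow> 'q set" and Z :: "'r set" and r :: nat
  assumes hom: "\<And>P Q. \<phi> (P * Q) = \<phi> P * \<phi> Q" "\<And>P Q. \<phi> (P - Q) = \<phi> P - \<phi> Q"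
    and U: "\<And>e p q n n'. p \<in> U e \<Longrightarrow> q \<in> U e \<Longrightarrow> n \<in> N e \<Longrightarrow> n' \<in> N e \<Longrightarrow> p * q - n * n' \<in> U (2 * e)"
    and N: "\<And>e p m n n'. p \<in> U e \<Longrightarrow> m \<in> N e \<Longrightarrow> n \<in> N e \<Longrightarrow> n' \<in> N e \<Longrightarrow> p * m - n * n' \<in> N (2 * e)"
    and UU: "\<And>e e' p q. p \<in> U e \<Longrightarrow> q \<in> U e' \<Longrightarrow> p * q \<in> U (e + e')"
    and one: "1 \<in> U 0"
    and Z: "0 \<in> Z" "\<And>x y. x \<in> Z \<Longrightarrow> y \<in> Z \<Longrightarrow> x - y \<in> Z" "\<And>x c e. x \<in> Z \<Longrightarrow> c \<in> U e \<union> N e \<Longrightarrow> \<phi> c * x \<in> Z"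
    and sys: "\<And>i. i < r \<Longrightarrow> (\<Sum>j<r. \<phi> (P i j) * b j) \<in> Z"
    and piv: "\<And>i. i < r \<Longrightarrow> P i i \<in> U e"
    and off: "\<And>i j. i < r \<Longrightarrow> j < r \<Longrightarrow> i \<noteq> j \<Longrightarrow> P i j \<in> N e"
  shows "\<exists>e'. \<exists>u\<in>U e'. \<forall>i<r. \<phi> u * b i \<in> Z"
  using sys piv off
proof (induction r arbitrary: P e)
  case 0
  show ?case using one by (intro exI[of _ 0] bexI[of _ 1]) auto
next
  case (Suc r)
  \<comment> \<open>Cross multiplication with row r removes the unknown r without division. Pivots
    remain pivots and other entries remain small, with the degree e doubled.\<close>
  define P' where "P' i j = P r r * P i j - P i r * P r j" for i j
  have "\<exists>e'. \<exists>u\<in>U e'. \<forall>i<r. \<phi> u * b i \<in> Z"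
  proof (rule Suc.IH)
    fix i assume i: "i < r"
    have "(\<Sum>j<r. \<phi> (P' i j) * b j) =
        \<phi> (P r r) * (\<Sum>j<Suc r. \<phi> (P i j) * b j) - \<phi> (P i r) * (\<Sum>j<Suc r. \<phi> (P r j) * b j)"
      by (simp add: P'_def hom algebra_simps sum_subtractf sum_distrib_left)
    also have "\<dots> \<in> Z" using i Suc.prems(2)[of r] Suc.prems(3)[of i r]
      by (intro Z(2) Z(3)[where e = e] Suc.prems(1)) auto
    finally show "(\<Sum>j<r. \<phi> (P' i j) * b j) \<in> Z" .
    show "P' i i \<in> U (2 * e)" unfolding P'_def using i by (intro U Suc.prems) auto
    show "P' i j \<in> N (2 * e)" if "j < r" "i \<noteq> j" for j
      unfolding P'_def using i that by (intro N Suc.prems) auto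
  qed
  then obtain e' u where u: "u \<in> U e'" "\<And>i. i < r \<Longrightarrow> \<phi> u * b i \<in> Z" by blast
  have Zadd: "x + y \<in> Z" if "x \<in> Z" "y \<in> Z" for x y
    using Z(2)[OF that(1) Z(2)[OF Z(1) that(2)]] by simp
  have Zsum: "sum f I \<in> Z" if "\<And>i. i \<in> I \<Longrightarrow> f i \<in> Z" for f and I :: "nat set"
    using that by (induction I rule: infinite_finite_induct) (auto intro: Z(1) Zadd)
  have "\<phi> (P r r * u) * b r = \<phi> u * (\<Sum>j<Suc r. \<phi> (P r j) * b j) - (\<Sum>j<r. \<phi> (P r j) * (\<phi> u * b j))"
    by (simp add: hom algebra_simps sum_distrib_left)
  also have "\<dots> \<in> Z" using Suc.prems(3)[of r] u(1)
    by (intro Z(2) Z(3)[where e = e'] Zsum Z(3)[where e = e and c = "P r _"] Suc.prems(1) u(2)) auto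
  finally have "\<phi> (P r r * u) * b r \<in> Z" .
  moreover have "\<phi> (P r r * u) * b i \<in> Z" if "i < r" for i
    using Z(3)[OF u(2)[OF that], of "P r r" e] Suc.prems(2)[of r] by (simp add: hom algebra_simps)
  ultimately have "\<forall>i<Suc r. \<phi> (P r r * u) * b i \<in> Z" by (auto simp: less_Suc_eq)
  moreover have "P r r * u \<in> U (e + e')" using UU Suc.prems(2) u(1) by blast
  ultimately show ?case by blast
qed

section \<open>Polynomial functions and forms\<close>

interpretation fv: vector_space "\<lambda>(c::complex) (f :: 'a \<Rightarrow> complex) x. c * f x"
  by unfold_locales (auto simp: fun_eq_iff algebra_simps)

lemma sum_apply_fun: "sum f I x = (\<Sum>i\<in>I. f i x :: 'b::comm_monoid_add)"
  by (induction I rule: infinite_finite_induct) auto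

lemma hform_0: "hform d (\<lambda>x. 0)"
proof (induction d)
  case (Suc d)
  then show ?case using hform.coord[OF Suc, of undefined] by simp
qed (rule hform.const)

lemma hform_cmult: "hform d f \<Longrightarrow> hform d (\<lambda>x. c * f x)"
proof (induction rule: hform.induct)
  case (coord d f i)
  then show ?case using hform.coord[of d "\<lambda>x. c * f x" i] by (simp add: algebra_simps)
qed (auto simp: distrib_left intro: hform.intros)

lemma hform_mult: "hform d f \<Longrightarrow> hform e g \<Longrightarrow> hform (d + e) (\<lambda>x. f x * g x)"
proof (induction rule: hform.induct)
  case (coord d f i)
  then show ?case using hform.coord[of "d + e" "\<lambda>x. f x * g x" i] by (simp add: algebra_simps)
qed (auto simp: distrib_right intro: hform.intros hform_cmult)

lemma hform_uminus: "hform d f \<Longrightarrow> hform d (\<lambda>x. - f x)"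
  using hform_cmult[of d f "-1"] by simp

lemma hform_diff: "hform d f \<Longrightarrow> hform d g \<Longrightarrow> hform d (\<lambda>x. f x - g x)"
  using hform.add[OF _ hform_uminus, of d f g] by simp

lemma hform_sum: "(\<And>i. i \<in> I \<Longrightarrow> hform d (f i)) \<Longrightarrow> hform d (\<lambda>x. \<Sum>i\<in>I. f i x)"
  by (induction I rule: infinite_finite_induct) (auto intro: hform_0 hform.add)

lemma hform_power: "hform d f \<Longrightarrow> hform (n * d) (\<lambda>x. f x ^ n)"
proof (induction n)
  case (Suc n)
  then show ?case using hform_mult[of d f "n * d" "\<lambda>x. f x ^ n"] by simp
qed (use hform.const[of 1] in simp)

lemma hform_prod: "(\<And>i. i \<in> I \<Longrightarrow> hform (d i) (f i)) \<Longrightarrow> hform (\<Sum>i\<in>I. d i) (\<lambda>x. \<Prod>i\<in>I. f i x)"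
  by (induction I rule: infinite_finite_induct) (auto intro: hform.const hform_mult)

lemma hform_nth: "hform 1 (\<lambda>x. x $ i)"
  using hform.coord[OF hform.const[of 1], of i] by simp

lemma hform_nth_power: "hform n (\<lambda>x. x $ i ^ n)"
  using hform_power[OF hform_nth, of n i] by simp

lemma hform_ev: "hform 1 (ev l)"
  unfolding ev_def[abs_def] by (intro hform_sum hform_cmult hform_nth)

lemma hform_ev_power: "hform n (\<lambda>x. ev l x ^ n)"
  using hform_power[OF hform_ev, of n l] by simp

lemma hform_scale: "hform d f \<Longrightarrow> f (c *s x) = c ^ d * f x"
  by (induction arbitrary: x rule: hform.induct) (auto simp: algebra_simps)

lemma ev_scale: "ev l (c *s x) = c * ev l x"
  using hform_scale[OF hform_ev, of l c x] by simp

lemma ev_add: "ev l (x + y) = ev l x + ev l y"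
  by (simp add: ev_def algebra_simps sum.distrib)

lemma ev_diff: "ev l (x - y) = ev l x - ev l y"
  by (simp add: ev_def algebra_simps sum_subtractf)

lemma ev_0 [simp]: "ev l 0 = 0" "ev 0 x = 0"
  by (simp_all add: ev_def)

lemma ev_commute: "ev l x = ev x l"
  by (simp add: ev_def mult.commute)

lemma ev_add_left: "ev (l + m) x = ev l x + ev m x"
  using ev_add[of x l m] by (simp add: ev_commute)

lemma ev_diff_left: "ev (l - m) x = ev l x - ev m x"
  using ev_diff[of x l m] by (simp add: ev_commute)

lemma ev_scale_left: "ev (c *s l) x = c * ev l x"
  using ev_scale[of x c l] by (simp add: ev_commute)

lemma ev_sum: "ev l (sum f I) = (\<Sum>i\<in>I. ev l (f i))"
  by (induction I rule: infinite_finite_induct) (auto simp: ev_add)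

lemma ev_axis [simp]: "ev (axis i 1) x = x $ i"
  by (simp add: ev_def axis_def if_distrib[of "\<lambda>c. c * _"] cong: if_cong)

inductive_set pol :: "(complex ^ 'n \<Rightarrow> complex) set" where
  const: "(\<lambda>x. c) \<in> pol"
| coord: "f \<in> pol \<Longrightarrow> (\<lambda>x. x $ i * f x) \<in> pol"
| add: "f \<in> pol \<Longrightarrow> g \<in> pol \<Longrightarrow> (\<lambda>x. f x + g x) \<in> pol"

lemma hform_pol: "hform d f \<Longrightarrow> f \<in> pol"
  by (induction rule: hform.induct) (auto intro: pol.intros)

lemma pol_cmult: "f \<in> pol \<Longrightarrow> (\<lambda>x. c * f x) \<in> pol"
proof (induction rule: pol.induct)
  case (coord f i)
  then show ?case using pol.coord[of "\<lambda>x. c * f x" i] by (simp add: algebra_simps)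
qed (auto simp: distrib_left intro: pol.intros)

lemma pol_mult: "f \<in> pol \<Longrightarrow> g \<in> pol \<Longrightarrow> (\<lambda>x. f x * g x) \<in> pol"
proof (induction rule: pol.induct)
  case (coord f i)
  then show ?case using pol.coord[of "\<lambda>x. f x * g x" i] by (simp add: algebra_simps)
qed (auto simp: distrib_right intro: pol.intros pol_cmult)

lemma pol_diff: "f \<in> pol \<Longrightarrow> g \<in> pol \<Longrightarrow> (\<lambda>x. f x - g x) \<in> pol"
  using pol.add[of f "\<lambda>x. - 1 * g x"] pol_cmult[of g "-1"] by simp

lemma pol_sum: "(\<And>i. i \<in> I \<Longrightarrow> f i \<in> pol) \<Longrightarrow> (\<lambda>x. \<Sum>i\<in>I. f i x) \<in> pol"
  by (induction I rule: infinite_finite_induct) (auto intro: pol.intros)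

lemma pol_prod: "(\<And>i. i \<in> I \<Longrightarrow> f i \<in> pol) \<Longrightarrow> (\<lambda>x. \<Prod>i\<in>I. f i x) \<in> pol"
  by (induction I rule: infinite_finite_induct) (auto intro: pol.intros pol_mult)

lemma pol_power: "f \<in> pol \<Longrightarrow> (\<lambda>x. f x ^ n) \<in> pol"
  by (induction n) (auto intro: pol.intros pol_mult)

lemma pol_nth: "(\<lambda>x. x $ i) \<in> pol" and pol_ev: "ev l \<in> pol"
  using hform_pol[OF hform_nth] hform_pol[OF hform_ev] by auto

lemma subring_pol: "subring pol"
proof -
  have "1 = (\<lambda>x::complex ^ 'a. 1::complex)" by (simp add: fun_eq_iff)
  then have "1 \<in> (pol :: (complex ^ 'a \<Rightarrow> complex) set)" by (metis pol.const)
  moreover have "f - g = (\<lambda>x. f x - g x)" "f * g = (\<lambda>x. f x * g x)" for f g :: "complex ^ 'a \<Rightarrow> complex"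
    by (simp_all add: fun_eq_iff)
  ultimately show ?thesis unfolding subring_def by (auto intro: pol_diff pol_mult)
qed

lemma pol_line: "f \<in> pol \<Longrightarrow> \<exists>p. \<forall>t. f (a + t *s b) = poly p t"
proof (induction rule: pol.induct)
  case (const c)
  show ?case by (rule exI[of _ "[:c:]"]) simp
next
  case (coord f i)
  then obtain p where "\<forall>t. f (a + t *s b) = poly p t" by blast
  then show ?case by (intro exI[of _ "[:a $ i, b $ i:] * p"]) (simp add: algebra_simps)
next
  case (add f g)
  then obtain p q where "\<forall>t. f (a + t *s b) = poly p t" "\<forall>t. g (a + t *s b) = poly q t" by blast
  then show ?case by (intro exI[of _ "p + q"]) simp
qed

lemma poly_zero_infinite:
  fixes p :: "complex poly"
  assumes "infinite T" "\<And>t. t \<in> T \<Longrightarrow> poly p t = 0" shows "p = 0"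
proof (rule ccontr)
  assume "p \<noteq> 0"
  then have "finite {t. poly p t = 0}" by (rule poly_roots_finite)
  moreover have "T \<subseteq> {t. poly p t = 0}" using assms(2) by auto
  ultimately show False using assms(1) finite_subset by metis
qed

lemma pol_decomp:
  assumes "f \<in> pol"
  obtains M g where "\<And>d. hform d (g d)" "\<And>x. f x = (\<Sum>d<M. g d x)"
proof -
  \<comment> \<open>Vanishing from M on is part of the claim so that decompositions of different
    lengths can be padded and added.\<close>
  from assms have "\<exists>M g. (\<forall>d. hform d (g d)) \<and> (\<forall>d\<ge>M. g d = (\<lambda>x. 0)) \<and> (\<forall>x. f x = (\<Sum>d<M. g d x))"
  proof (induction rule: pol.induct)
    case (const c)
    define g where "g d = (\<lambda>x::complex ^ 'a. if d = 0 then c else 0)" for d :: nat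
    have "hform d (g d)" for d by (cases "d = 0") (simp_all add: g_def hform_0 hform.const)
    then show ?case by (intro exI[of _ 1] exI[of _ g]) (simp add: g_def)
  next
    case (coord f i)
    then obtain M g where g: "\<And>d. hform d (g d)" "\<And>d. d \<ge> M \<Longrightarrow> g d = (\<lambda>x. 0)" "\<And>x. f x = (\<Sum>d<M. g d x)"
      by blast
    define h where "h d = (case d of 0 \<Rightarrow> \<lambda>x. 0 | Suc d \<Rightarrow> \<lambda>x. x $ i * g d x)" for d
    have "hform d (h d)" for d
      by (cases d) (auto simp: h_def intro: hform_0 hform.coord g)
    moreover have "h d = (\<lambda>x. 0)" if "d \<ge> Suc M" for d
      using that g(2) by (cases d) (auto simp: h_def)
    moreover have "x $ i * f x = (\<Sum>d<Suc M. h d x)" for x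
      unfolding sum.lessThan_Suc_shift by (simp add: h_def g(3) sum_distrib_left)
    ultimately show ?case by (intro exI[of _ "Suc M"] exI[of _ h] conjI allI impI)
  next
    case (add f f')
    from add.IH(1) obtain M g where
      g: "\<And>d. hform d (g d)" "\<And>d. d \<ge> M \<Longrightarrow> g d = (\<lambda>x. 0)" "\<And>x. f x = (\<Sum>d<M. g d x)"
      by blast
    from add.IH(2) obtain M' g' where
      g': "\<And>d. hform d (g' d)" "\<And>d. d \<ge> M' \<Longrightarrow> g' d = (\<lambda>x. 0)" "\<And>x. f' x = (\<Sum>d<M'. g' d x)"
      by blast
    have *: "f x = (\<Sum>d<M + M'. g d x)" "f' x = (\<Sum>d<M + M'. g' d x)" for x
      unfolding g(3) g'(3) by (rule sum.mono_neutral_left; auto simp: g(2) g'(2))+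
    show ?case
      by (intro exI[of _ "M + M'"] exI[of _ "\<lambda>d x. g d x + g' d x"] conjI allI impI)
        (simp_all add: * sum.distrib g(2) g'(2) hform.add g(1) g'(1))
  qed
  then show ?thesis using that by blast
qed

text \<open>Starting from the constants, the basis theorem is applied once per coordinate function.
  All rings of this tower are subsets of one type of functions.\<close>

lemma noetherian_pol: "noetherian (pol :: (complex ^ 'n \<Rightarrow> complex) set)"
proof -
  define K where "K = range (\<lambda>c. (\<lambda>x::complex ^ 'n. c::complex))"
  have "subring K"
    unfolding subring_def
  proof safe
    show "1 \<in> K" unfolding K_def by (rule range_eqI[of _ _ 1]) (simp add: fun_eq_iff)
    fix f g assume "f \<in> K" "g \<in> K"
    then obtain a b where "f = (\<lambda>x. a)" "g = (\<lambda>x. b)" by (auto simp: K_def)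
    then have "f - g = (\<lambda>x. a - b)" "f * g = (\<lambda>x. a * b)" by (simp_all add: fun_eq_iff)
    then show "f - g \<in> K" "f * g \<in> K" by (auto simp: K_def)
  qed
  moreover have "noetherian K"
    unfolding noetherian_def
  proof (intro allI impI)
    fix F assume F: "F \<subseteq> K"
    show "\<exists>G. finite G \<and> G \<subseteq> F \<and> F \<subseteq> idl K G"
    proof (cases "F \<subseteq> {0}")
      case True
      then show ?thesis using idl_0 by (intro exI[of _ "{}"]) auto
    next
      case False
      then obtain f where f: "f \<in> F" "f \<noteq> 0" by blast
      then obtain c where c: "f = (\<lambda>x. c)" "c \<noteq> 0" using F by (auto simp: K_def fun_eq_iff)
      have "F \<subseteq> idl K {f}"
      proof
        fix g assume "g \<in> F"
        then obtain d where "g = (\<lambda>x. d)" using F by (auto simp: K_def)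
        then have "g = (\<lambda>x. d / c) * f + 0" using c by (simp add: fun_eq_iff)
        also have "\<dots> \<in> idl K {f}" by (rule idl_step[OF _ _ idl_0]) (simp_all add: K_def)
        finally show "g \<in> idl K {f}" .
      qed
      then show ?thesis using f by (intro exI[of _ "{f}"]) auto
    qed
  qed
  ultimately have base: "\<exists>A. subring A \<and> noetherian A \<and> K \<subseteq> A \<and> A \<subseteq> pol \<and> (\<forall>i\<in>{}. (\<lambda>x::complex ^ 'n. x $ i) \<in> A)"
    by (intro exI[of _ K]) (auto simp: K_def pol.const)
  have "\<exists>A. subring A \<and> noetherian A \<and> K \<subseteq> A \<and> A \<subseteq> pol \<and> (\<forall>i\<in>I. (\<lambda>x::complex ^ 'n. x $ i) \<in> A)"
    if "finite I" for I
    using that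
  proof (induction I)
    case empty
    show ?case by (rule base)
  next
    case (insert i I)
    then obtain A where A: "subring A" "noetherian A" "K \<subseteq> A" "A \<subseteq> pol"
      "\<forall>j\<in>I. (\<lambda>x::complex ^ 'n. x $ j) \<in> A" by blast
    let ?t = "\<lambda>x::complex ^ 'n. x $ i"
    have "adjoin A ?t \<subseteq> pol"
      using A(4) unfolding adjoin_def by (auto intro!: poly_subring[OF subring_pol] pol_nth)
    moreover have "subring (adjoin A ?t)" "noetherian (adjoin A ?t)" "A \<subseteq> adjoin A ?t" "?t \<in> adjoin A ?t"
      using A(1,2) by (auto simp: subring_adjoin noetherian_adjoin adjoin_superset adjoin_gen
          intro: subsetD[OF adjoin_superset])
    ultimately show ?case using A(3,5) by (intro exI[of _ "adjoin A ?t"]) auto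
  qed
  from this[of UNIV] obtain A where A: "subring A" "noetherian A" "K \<subseteq> A" "A \<subseteq> pol"
    "\<And>i. (\<lambda>x::complex ^ 'n. x $ i) \<in> A" by auto
  have "f \<in> A" if "f \<in> pol" for f
    using that
  proof (induction rule: pol.induct)
    case (coord f i)
    have "(\<lambda>x. x $ i * f x) = (\<lambda>x. x $ i) * f" by (simp add: fun_eq_iff)
    then show ?case using subringD(6)[OF A(1) A(5)] coord by metis
  next
    case (add f g)
    have "(\<lambda>x. f x + g x) = f + g" by (simp add: fun_eq_iff)
    then show ?case using subringD(4)[OF A(1)] add by metis
  qed (use A(3) in \<open>auto simp: K_def\<close>)
  then have "A = pol" using A(4) by blast
  then show ?thesis using A(2) by simp
qed

lemma idl_pol_zero: "f \<in> idl pol F \<Longrightarrow> (\<And>g. g \<in> F \<Longrightarrow> g x = 0) \<Longrightarrow> f x = 0"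
proof (induction rule: idl.induct)
  case (idl_step a f g)
  have "f x = 0" using idl_step by blast
  then show ?case using idl_step by simp
qed simp

section \<open>Monomials and linear relations between polynomial functions\<close>

definition monomial :: "('n \<Rightarrow> nat) \<Rightarrow> complex ^ 'n \<Rightarrow> complex" where
  "monomial m x = (\<Prod>i\<in>UNIV. x $ i ^ m i)"

definition monomials :: "nat \<Rightarrow> (complex ^ 'n \<Rightarrow> complex) set" where
  "monomials d = monomial ` {m. sum m UNIV = d}"

lemma finite_monomials: "finite (monomials d :: (complex ^ 'n \<Rightarrow> complex) set)"
proof -
  have "m i \<le> sum m UNIV" for m :: "'n \<Rightarrow> nat" and i by (rule member_le_sum) auto
  then have "{m::'n \<Rightarrow> nat. sum m UNIV = d} \<subseteq> Pi\<^sub>E UNIV (\<lambda>_. {..d})" by auto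
  then show ?thesis unfolding monomials_def
    by (intro finite_imageI finite_subset[OF _ finite_PiE]) auto
qed

lemma hform_monomial: "hform (sum m UNIV) (monomial m)"
  unfolding monomial_def[abs_def] by (intro hform_prod hform_nth_power)

lemma hform_monomials: "f \<in> monomials d \<Longrightarrow> hform d f"
  unfolding monomials_def using hform_monomial by auto

lemma hform_span_monomials: "hform d f \<Longrightarrow> f \<in> fv.span (monomials d)"
proof (induction rule: hform.induct)
  case (const c)
  have "(\<lambda>x. 1) \<in> monomials 0" unfolding monomials_def
    by (rule image_eqI[of _ _ "\<lambda>_. 0"]) (auto simp: monomial_def)
  then show ?case using fv.span_scale[OF fv.span_base, of "\<lambda>x. 1" "monomials 0" c] by simp
next
  case (coord d f i)
  from coord.IH show ?case
  proof (induction rule: fv.span_induct_alt)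
    case base
    then show ?case using fv.span_zero by (simp add: zero_fun_def)
  next
    case (step c g h)
    then obtain m where m: "g = monomial m" "sum m UNIV = d" by (auto simp: monomials_def)
    have g: "(\<lambda>x. x $ i * g x) = monomial (m(i := Suc (m i)))"
    proof
      fix x
      have "monomial (m(i := Suc (m i))) x = x $ i ^ Suc (m i) * (\<Prod>j\<in>UNIV - {i}. x $ j ^ m j)"
        unfolding monomial_def by (subst prod.remove[of _ i]) auto
      also have "\<dots> = x $ i * monomial m x"
        unfolding monomial_def by (subst (2) prod.remove[of _ i]) auto
      finally show "x $ i * g x = monomial (m(i := Suc (m i))) x" by (simp add: m)
    qed
    have "sum (m(i := Suc (m i))) UNIV = Suc (sum m UNIV)"
      by (subst (1 2) sum.remove[of _ i]) auto
    then have "(\<lambda>x. x $ i * g x) \<in> monomials (Suc d)" using g m by (auto simp: monomials_def)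
    then have "(\<lambda>x. c * (x $ i * g x)) + (\<lambda>x. x $ i * h x) \<in> fv.span (monomials (Suc d))"
      using step by (intro fv.span_add fv.span_scale[of "\<lambda>x. x $ i * g x"]) (auto intro: fv.span_base)
    moreover have "(\<lambda>x. c * (x $ i * g x)) + (\<lambda>x. x $ i * h x) = (\<lambda>x. x $ i * ((\<lambda>x. c * g x) + h) x)"
      by (auto simp: fun_eq_iff algebra_simps)
    ultimately show ?case by simp
  qed
next
  case (add d f f')
  then show ?case using fv.span_add[of f _ f'] by (simp add: plus_fun_def)
qed

lemma pol_span_monomials:
  assumes "f \<in> pol" obtains d where "f \<in> fv.span (\<Union>e<d. monomials e)"
proof -
  obtain M g where g: "\<And>d. hform d (g d)" "\<And>x. f x = (\<Sum>d<M. g d x)"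
    by (rule pol_decomp[OF assms]) (rule that)
  have "f = (\<Sum>d<M. g d)" using g(2) by (simp add: fun_eq_iff sum_apply_fun)
  also have "\<dots> \<in> fv.span (\<Union>e<M. monomials e)"
  proof (rule fv.span_sum)
    fix e assume "e \<in> {..<M}"
    then have "monomials e \<subseteq> (\<Union>e<M. monomials e)" by blast
    from subsetD[OF fv.span_mono[OF this] hform_span_monomials[OF g(1)]]
    show "g e \<in> fv.span (\<Union>e<M. monomials e)" .
  qed
  finally show ?thesis by (rule that)
qed

text \<open>More vectors than a spanning set has elements. The family is indexed, so two equal
  members have to be treated separately; they give the relation with coefficients 1 and -1.\<close>

lemma dependent_family:
  fixes g :: "'c \<Rightarrow> 'a \<Rightarrow> complex"
  assumes "finite B" "finite C" "card B < card C" "\<And>c. c \<in> C \<Longrightarrow> g c \<in> fv.span B"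
  obtains a c where "c \<in> C" "a c \<noteq> 0" "\<And>x. (\<Sum>c\<in>C. a c * g c x) = 0"
proof (cases "inj_on g C")
  case True
  then have "card (g ` C) = card C" by (rule card_image)
  then have "fv.dependent (g ` C)"
    using fv.independent_span_bound[of B "g ` C"] assms by force
  then obtain u f where u: "f \<in> g ` C" "u f \<noteq> 0" "(\<Sum>f\<in>g ` C. (\<lambda>x. u f * f x)) = 0"
    using fv.dependent_finite[of "g ` C"] assms(2) by auto
  then obtain c where c: "c \<in> C" "f = g c" by blast
  have "(\<Sum>c\<in>C. u (g c) * g c x) = 0" for x
  proof -
    have "(\<Sum>c\<in>C. u (g c) * g c x) = (\<Sum>f\<in>g ` C. u f * f x)" by (simp add: sum.reindex[OF True])
    also have "\<dots> = 0" using fun_cong[OF u(3), of x] by (simp add: sum_apply_fun)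
    finally show ?thesis .
  qed
  then show ?thesis using that[of c "\<lambda>c. u (g c)"] c u by auto
next
  case False
  then obtain c c' where c: "c \<in> C" "c' \<in> C" "c \<noteq> c'" "g c = g c'" unfolding inj_on_def by blast
  define a where "a d = (if d = c then 1 else if d = c' then -1 else 0::complex)" for d
  have "(\<Sum>d\<in>C. a d * g d x) = (\<Sum>d\<in>{c, c'}. a d * g d x)" for x
    using c assms(2) by (intro sum.mono_neutral_right) (auto simp: a_def)
  then have "(\<Sum>d\<in>C. a d * g d x) = 0" for x using c by (simp add: a_def)
  then show ?thesis using that[of c a] c by (auto simp: a_def)
qed

section \<open>The Nullstellensatz\<close>

lemma idl_insert:
  assumes A: "subring A" shows "x \<in> idl A (insert f F) \<Longrightarrow> \<exists>r\<in>A. \<exists>a\<in>idl A F. x = r * f + a"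
proof (induction rule: idl.induct)
  case idl_0
  show ?case by (rule bexI[of _ 0], rule bexI[of _ 0]) (auto simp: subringD[OF A] idl.idl_0)
next
  case (idl_step c h g)
  then obtain r a where ra: "r \<in> A" "a \<in> idl A F" "g = r * f + a" by blast
  show ?case
  proof (cases "h = f")
    case True
    then have "c * h + g = (c + r) * f + a" by (simp add: ra algebra_simps)
    then show ?thesis using ra idl_step(1) subringD(4)[OF A] by blast
  next
    case False
    then have "h \<in> F" using idl_step(2) by blast
    then have "c * h + a \<in> idl A F" by (intro idl.idl_step idl_step(1) ra(2))
    moreover have "c * h + g = r * f + (c * h + a)" by (simp add: ra algebra_simps)
    ultimately show ?thesis using ra(1) by blast
  qed
qed

lemma uncountable_complex: "uncountable (UNIV :: complex set)"
proof
  assume "countable (UNIV :: complex set)"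
  then have "countable (range Re)" by (rule countable_image)
  moreover have "range Re = UNIV" by (rule surjI[of _ complex_of_real]) simp
  ultimately show False using uncountable_UNIV_real by simp
qed

text \<open>Polynomial functions are a countable union of finite-dimensional spaces, so infinitely
  many members of an uncountable family lie in one of them.\<close>

lemma uncountable_family_dependent:
  fixes g :: "complex \<Rightarrow> complex ^ 'n \<Rightarrow> complex"
  assumes g: "\<And>c. g c \<in> pol"
  obtains C a c where "finite C" "c \<in> C" "a c \<noteq> 0" "\<And>x. (\<Sum>c\<in>C. a c * g c x) = 0"
proof -
  let ?B = "\<lambda>d. \<Union>e<d. monomials e :: (complex ^ 'n \<Rightarrow> complex) set"
  have "\<exists>d. g c \<in> fv.span (?B d)" for c
    by (rule pol_span_monomials[OF g[of c]]) blast
  then obtain D where D: "\<And>c. g c \<in> fv.span (?B (D c))" by metis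
  have "\<exists>d. infinite {c. D c = d}"
  proof (rule ccontr)
    assume "\<nexists>d. infinite {c. D c = d}"
    then have "countable (\<Union>d. {c. D c = d})"
      by (intro countable_UN) (auto intro: countable_finite)
    moreover have "(\<Union>d. {c. D c = d}) = UNIV" by auto
    ultimately show False using uncountable_complex by simp
  qed
  then obtain d where d: "infinite {c. D c = d}" by blast
  obtain C where C: "C \<subseteq> {c. D c = d}" "card C = Suc (card (?B d))" "finite C"
    using infinite_arbitrarily_large[OF d, of "Suc (card (?B d))"] by blast
  have fin: "finite (?B d)" by (intro finite_UN_I finite_monomials) auto
  show ?thesis
  proof (rule dependent_family[of "?B d" C g])
    show "g c \<in> fv.span (?B d)" if "c \<in> C" for c using D[of c] C(1) that by auto
    fix a c assume "c \<in> C" "a c \<noteq> 0" "\<And>x. (\<Sum>c\<in>C. a c * g c x) = 0"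
    then show thesis by (intro that[of C c a] C(3))
  qed (use C fin in auto)
qed

lemma pol_poly: "t \<in> pol \<Longrightarrow> (\<lambda>x. poly p (t x)) \<in> pol"
  by (induction p) (auto intro: pol.intros pol_mult)

text \<open>If every \<open>x_i - c\<close> were invertible modulo the ideal, then the uncountably many inverses would be
  linearly dependent over \<open>\<complex>\<close>, and clearing denominators would give a polynomial in \<open>x_i\<close> in the ideal.\<close>

lemma idl_proper_coordinate:
  fixes F :: "(complex ^ 'n \<Rightarrow> complex) set"
  assumes proper: "1 \<notin> idl pol F"
  obtains c where "1 \<notin> idl pol (insert (\<lambda>x. x $ i - c) F)"
proof (rule ccontr)
  assume "\<not> thesis"
  then have "1 \<in> idl pol (insert (\<lambda>x. x $ i - c) F)" for c using that by blast
  then have "\<exists>r\<in>pol. \<exists>a\<in>idl pol F. 1 = r * (\<lambda>x. x $ i - c) + a" for c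
    using idl_insert[OF subring_pol] by blast
  then obtain r a where r: "\<And>c. r c \<in> pol" and a: "\<And>c. a c \<in> idl pol F"
    and ra: "\<And>c. 1 = r c * (\<lambda>x. x $ i - c) + a c" by metis
  have one: "r c x * (x $ i - c) = 1 - a c x" for c x
    using fun_cong[OF ra[of c], of x] by (simp add: algebra_simps)
  \<comment> \<open>Each linear factor of q is invertible modulo the ideal, so the factors can be
    cancelled one by one until a nonzero constant is left.\<close>
  have descent: "1 \<in> idl pol F" if "q \<noteq> 0" "(\<lambda>x. poly q (x $ i)) \<in> idl pol F" for q
    using that
  proof (induction "degree q" arbitrary: q)
    case 0
    then obtain b where q: "q = [:b:]" "b \<noteq> 0" by (metis degree_eq_zeroE pCons_0_0)
    have "(\<lambda>x. inverse b) * (\<lambda>x. poly q (x $ i)) \<in> idl pol F"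
      by (intro idl_mult[OF subring_pol] pol.const 0)
    moreover have "(\<lambda>x::complex ^ 'n. inverse b) * (\<lambda>x. poly q (x $ i)) = 1" using q by (simp add: fun_eq_iff)
    ultimately show ?case by metis
  next
    case (Suc n)
    then obtain c where "poly q c = 0"
      using fundamental_theorem_of_algebra[of q] by (auto simp: constant_degree)
    then obtain q' where q': "q = [:- c, 1:] * q'" by (auto simp: poly_eq_0_iff_dvd)
    have "(\<lambda>x. poly q' (x $ i)) = (\<lambda>x. poly q' (x $ i)) * a c + r c * (\<lambda>x. poly q (x $ i))"
    proof
      fix x
      have "r c x * poly q (x $ i) = (r c x * (x $ i - c)) * poly q' (x $ i)"
        by (simp add: q' algebra_simps)
      then show "poly q' (x $ i) = ((\<lambda>x. poly q' (x $ i)) * a c + r c * (\<lambda>x. poly q (x $ i))) x"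
        unfolding one by (simp add: algebra_simps)
    qed
    also have "\<dots> \<in> idl pol F"
      by (intro idl_add idl_mult[OF subring_pol] pol_poly pol_nth a r Suc.prems)
    finally have q'F: "(\<lambda>x. poly q' (x $ i)) \<in> idl pol F" .
    have "q' \<noteq> 0" using q' Suc.prems by auto
    moreover from this have "degree q = Suc (degree q')" unfolding q' by (subst degree_mult_eq) auto
    then have "n = degree q'" using Suc.hyps(2) by simp
    ultimately show ?case using Suc.hyps(1) q'F by blast
  qed
  obtain C u c0 where C: "finite C" "c0 \<in> C" "u c0 \<noteq> 0" "\<And>x. (\<Sum>c\<in>C. u c * r c x) = 0"
    by (rule uncountable_family_dependent[OF r]) (rule that)
  \<comment> \<open>The linear relation between the inverses, multiplied by all x_i - d with d in C.
    At c0 every summand but one vanishes, so q is not the zero polynomial.\<close>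
  define q where "q = (\<Sum>c\<in>C. smult (u c) (\<Prod>d\<in>C - {c}. [:- d, 1:]))"
  have "poly q c0 = (\<Sum>c\<in>C. u c * (\<Prod>d\<in>C - {c}. c0 - d))"
    by (simp add: q_def poly_sum poly_prod)
  also have "\<dots> = (\<Sum>c\<in>{c0}. u c * (\<Prod>d\<in>C - {c}. c0 - d))"
    using C by (intro sum.mono_neutral_right) (auto intro!: prod_zero)
  also have "\<dots> \<noteq> 0" using C by simp
  finally have "q \<noteq> 0" by auto
  moreover have "(\<lambda>x. poly q (x $ i)) = (\<Sum>c\<in>C. (\<lambda>x. u c * (\<Prod>d\<in>C - {c}. x $ i - d)) * a c)"
  proof
    fix x
    have "poly q (x $ i) = (\<Sum>c\<in>C. u c * (\<Prod>d\<in>C - {c}. x $ i - d))"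
      by (simp add: q_def poly_sum poly_prod)
    also have "\<dots> = (\<Sum>c\<in>C. u c * (\<Prod>d\<in>C - {c}. x $ i - d) * (r c x * (x $ i - c) + a c x))"
      by (simp add: one)
    also have "\<dots> = (\<Sum>c\<in>C. u c * (\<Prod>d\<in>C - {c}. x $ i - d) * a c x)
        + (\<Sum>c\<in>C. u c * r c x * ((x $ i - c) * (\<Prod>d\<in>C - {c}. x $ i - d)))"
      unfolding sum.distrib[symmetric] by (intro sum.cong refl) (simp add: algebra_simps)
    also have "(\<Sum>c\<in>C. u c * r c x * ((x $ i - c) * (\<Prod>d\<in>C - {c}. x $ i - d)))
        = (\<Sum>c\<in>C. u c * r c x * (\<Prod>d\<in>C. x $ i - d))"
      using C(1) by (intro sum.cong refl) (simp add: prod.remove)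
    also have "\<dots> = 0" by (simp add: sum_distrib_right[symmetric] C(4))
    finally show "poly q (x $ i) = (\<Sum>c\<in>C. (\<lambda>x. u c * (\<Prod>d\<in>C - {c}. x $ i - d)) * a c) x"
      by (simp add: sum_apply_fun)
  qed
  moreover have "\<dots> \<in> idl pol F"
    by (intro idl_sum idl_mult[OF subring_pol] a pol_cmult pol_prod pol_diff pol_nth pol.const)
  ultimately show False using descent[of q] proper by auto
qed

text \<open>The coordinates are specialized one at a time while the ideal stays proper. Then every
  polynomial is congruent to its value at the resulting point, so a member of F with nonzero value
  there would put 1 into the ideal.\<close>

theorem nullstellensatz:
  fixes F :: "(complex ^ 'n \<Rightarrow> complex) set"
  assumes F: "F \<subseteq> pol" and proper: "1 \<notin> idl pol F"
  obtains c where "\<And>f. f \<in> F \<Longrightarrow> f c = 0"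
proof -
  have ex: "\<exists>c :: 'n \<Rightarrow> complex. 1 \<notin> idl pol (F \<union> (\<lambda>i x. x $ i - c i) ` I)" if "finite I" for I
    using that
  proof (induction I)
    case empty
    show ?case unfolding image_empty Un_empty_right using proper by blast
  next
    case (insert i I)
    then obtain c where c: "1 \<notin> idl pol (F \<union> (\<lambda>i x. x $ i - c i) ` I)" by blast
    obtain b where b: "1 \<notin> idl pol (insert (\<lambda>x. x $ i - b) (F \<union> (\<lambda>i x. x $ i - c i) ` I))"
      using idl_proper_coordinate[OF c] by blast
    have "insert (\<lambda>x. x $ i - b) (F \<union> (\<lambda>i x. x $ i - c i) ` I)
        = F \<union> (\<lambda>j x. x $ j - (c(i := b)) j) ` insert i I"
      using insert.hyps by (auto simp: image_iff)
    then show ?case using b by metis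
  qed
  obtain c where c: "1 \<notin> idl pol (F \<union> range (\<lambda>i x. x $ i - c i))"
    using ex[of UNIV] by auto
  let ?I = "idl pol (F \<union> range (\<lambda>i x. x $ i - c i))"
  define v where "v = (\<chi> i. c i)"
  have taylor: "(\<lambda>x. f x - f v) \<in> ?I" if "f \<in> pol" for f
    using that
  proof (induction rule: pol.induct)
    case (const b)
    then show ?case using idl_0[of pol] by (simp add: zero_fun_def)
  next
    case (coord f i)
    have "(\<lambda>x. x $ i * f x - v $ i * f v) = f * (\<lambda>x. x $ i - c i) + (\<lambda>x. c i) * (\<lambda>x. f x - f v)"
      by (simp add: fun_eq_iff v_def algebra_simps)
    also have "\<dots> \<in> ?I"
      by (intro idl_add idl_mult[OF subring_pol] idl_gen[OF subring_pol] coord pol.const) blast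
    finally show ?case .
  next
    case (add f g)
    have "(\<lambda>x. f x + g x - (f v + g v)) = (\<lambda>x. f x - f v) + (\<lambda>x. g x - g v)"
      by (simp add: fun_eq_iff)
    also have "\<dots> \<in> ?I" by (intro idl_add add.IH)
    finally show ?case .
  qed
  have "f v = 0" if f: "f \<in> F" for f
  proof (rule ccontr)
    assume nz: "f v \<noteq> 0"
    have fI: "f \<in> ?I" using f by (intro idl_gen[OF subring_pol]) blast
    have "(\<lambda>x. inverse (f v)) * (f - (\<lambda>x. f x - f v)) \<in> ?I"
      using f F by (intro idl_mult[OF subring_pol] idl_diff[OF subring_pol] taylor fI pol.const) blast
    moreover have "(\<lambda>x. inverse (f v)) * (f - (\<lambda>x. f x - f v)) = 1"
      using nz by (simp add: fun_eq_iff)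
    ultimately show False using c by metis
  qed
  then show ?thesis by (rule that)
qed

text \<open>The graded counterpart of \<open>idl\<close>: the degree of each cofactor is recorded,
  which is what inductions on the degree need.\<close>

inductive hid :: "(complex ^ 'n \<Rightarrow> complex) set \<Rightarrow> nat \<Rightarrow> (complex ^ 'n \<Rightarrow> complex) \<Rightarrow> bool" for F where
  hid_0: "hid F d (\<lambda>x. 0)"
| hid_step: "hform e a \<Longrightarrow> f \<in> F \<Longrightarrow> hform e' f \<Longrightarrow> hid F (e + e') g \<Longrightarrow> hid F (e + e') (\<lambda>x. a x * f x + g x)"

lemma hid_gen: "hform e a \<Longrightarrow> f \<in> F \<Longrightarrow> hform e' f \<Longrightarrow> hid F (e + e') (\<lambda>x. a x * f x)"
  using hid_step[OF _ _ _ hid_0, of e a f F e'] by simp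

lemma hid_add: "hid F d f \<Longrightarrow> hid F d g \<Longrightarrow> hid F d (\<lambda>x. f x + g x)"
  by (induction rule: hid.induct) (auto simp: add.assoc intro: hid_step)

lemma hid_mult: "hid F d f \<Longrightarrow> hform e a \<Longrightarrow> hid F (e + d) (\<lambda>x. a x * f x)"
proof (induction rule: hid.induct)
  case (hid_step e1 b f e' g)
  have "hid F ((e + e1) + e') (\<lambda>x. (a x * b x) * f x + a x * g x)"
    using hid_step by (intro hid.hid_step hform_mult) (auto simp: add.assoc)
  then show ?case by (simp add: algebra_simps)
qed (auto intro: hid_0)

lemma hid_sum: "(\<And>i. i \<in> I \<Longrightarrow> hid F d (f i)) \<Longrightarrow> hid F d (\<lambda>x. \<Sum>i\<in>I. f i x)"
  by (induction I rule: infinite_finite_induct) (auto intro: hid_0 hid_add)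

text \<open>Rabinowitsch's trick: the ideal contains a power of \<open>x_i\<close>, since it has no zero with \<open>x_i = 1\<close>.\<close>

lemma hid_nth_power:
  fixes F :: "(complex ^ 'n \<Rightarrow> complex) set"
  assumes F: "\<And>f. f \<in> F \<Longrightarrow> \<exists>d. hform d f"
    and nz: "\<And>x. (\<And>f. f \<in> F \<Longrightarrow> f x = 0) \<Longrightarrow> x = 0"
  obtains N where "hid F N (\<lambda>x. x $ i ^ N)"
proof -
  let ?F = "insert (\<lambda>x. x $ i - 1) F"
  have "?F \<subseteq> pol" using F hform_pol by (auto intro!: pol_diff pol_nth pol.const)
  have "1 \<in> idl pol ?F"
  proof (rule ccontr)
    assume "1 \<notin> idl pol ?F"
    with \<open>?F \<subseteq> pol\<close> obtain c where c: "\<And>f. f \<in> ?F \<Longrightarrow> f c = 0" by (rule nullstellensatz) (rule that)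
    have "c = 0" by (rule nz) (simp add: c)
    then show False using c[of "\<lambda>x. x $ i - 1"] by simp
  qed
  then obtain r a where r: "r \<in> pol" and a: "a \<in> idl pol F" and ra: "1 = r * (\<lambda>x. x $ i - 1) + a"
    using idl_insert[OF subring_pol] by blast
  \<comment> \<open>Homogenization: substitute x / x_i and clear denominators. The claim is made for
    all large M so that the summands can be brought to the same degree.\<close>
  from a have "\<exists>N. \<forall>M\<ge>N. \<exists>h. hid F M h \<and> (\<forall>x. x $ i \<noteq> 0 \<longrightarrow> x $ i ^ M * a ((1 / x $ i) *s x) = h x)"
  proof (induction rule: idl.induct)
    case idl_0
    then show ?case by (intro exI[of _ 0] allI impI exI[of _ "\<lambda>x. 0"]) (auto intro: hid_0)
  next
    case (idl_step a f g)
    then obtain N where N: "\<And>M. M \<ge> N \<Longrightarrow>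
        \<exists>h. hid F M h \<and> (\<forall>x. x $ i \<noteq> 0 \<longrightarrow> x $ i ^ M * g ((1 / x $ i) *s x) = h x)" by blast
    obtain e where e: "hform e f" using F idl_step by blast
    obtain K b where b: "\<And>d. hform d (b d)" "\<And>x. a x = (\<Sum>d<K. b d x)"
      by (rule pol_decomp[OF idl_step(1)]) (rule that)
    have "\<exists>h. hid F M h \<and> (\<forall>x. x $ i \<noteq> 0 \<longrightarrow> x $ i ^ M * (a * f + g) ((1 / x $ i) *s x) = h x)"
      if M: "M \<ge> max N (K + e)" for M
    proof -
      obtain h where h: "hid F M h" "\<And>x. x $ i \<noteq> 0 \<Longrightarrow> x $ i ^ M * g ((1 / x $ i) *s x) = h x"
        using N[of M] M by auto
      have "hid F M (\<lambda>x. \<Sum>d<K. (x $ i ^ (M - (d + e)) * b d x) * f x)"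
      proof (rule hid_sum)
        fix d assume "d \<in> {..<K}"
        then have "M = (M - (d + e) + d) + e" using M by auto
        moreover have "hid F ((M - (d + e) + d) + e) (\<lambda>x. (x $ i ^ (M - (d + e)) * b d x) * f x)"
          by (intro hid_gen hform_mult hform_nth_power b e idl_step)
        ultimately show "hid F M (\<lambda>x. (x $ i ^ (M - (d + e)) * b d x) * f x)" by simp
      qed
      then have "hid F M (\<lambda>x. (\<Sum>d<K. (x $ i ^ (M - (d + e)) * b d x) * f x) + h x)"
        by (rule hid_add) (rule h)
      moreover have "x $ i ^ M * (a * f + g) ((1 / x $ i) *s x)
          = (\<Sum>d<K. (x $ i ^ (M - (d + e)) * b d x) * f x) + h x" if x: "x $ i \<noteq> 0" for x
      proof -
        have "x $ i ^ M * (b d ((1 / x $ i) *s x) * f ((1 / x $ i) *s x)) = x $ i ^ (M - (d + e)) * b d x * f x"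
          if "d < K" for d
        proof -
          have "x $ i ^ M = x $ i ^ (M - (d + e)) * (x $ i ^ d * x $ i ^ e)"
            using M that by (simp add: power_add[symmetric])
          then show ?thesis using x by (simp add: hform_scale[OF b(1)] hform_scale[OF e] power_divide)
        qed
        then show ?thesis
          by (simp add: distrib_left h(2)[OF x] b(2) sum_distrib_right sum_distrib_left)
      qed
      ultimately show ?thesis by blast
    qed
    then show ?case by blast
  qed
  then obtain N h where h: "hid F N h" "\<And>x. x $ i \<noteq> 0 \<Longrightarrow> x $ i ^ N * a ((1 / x $ i) *s x) = h x"
    by blast
  \<comment> \<open>One more factor x_i makes the identity valid also where x_i = 0, a locus on
    which \<open>h\<close> is unknown.\<close>
  have "hid F (1 + N) (\<lambda>x. x $ i * h x)" by (intro hid_mult h hform_nth)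
  moreover have "x $ i * h x = x $ i ^ Suc N" for x
  proof (cases "x $ i = 0")
    case False
    have "a ((1 / x $ i) *s x) = 1"
      using fun_cong[OF ra, of "(1 / x $ i) *s x"] False by simp
    then show ?thesis using h(2)[OF False] by simp
  qed simp
  ultimately show ?thesis using that[of "Suc N"] by simp
qed

text \<open>Pigeonhole: a monomial whose degree exceeds the sum of all N i is divisible by some x_i
  ^ N i, and these powers lie in the ideal.\<close>

theorem projective_nullstellensatz:
  fixes F :: "(complex ^ 'n \<Rightarrow> complex) set"
  assumes F: "\<And>f. f \<in> F \<Longrightarrow> \<exists>d. hform d f"
    and nz: "\<And>x. (\<And>f. f \<in> F \<Longrightarrow> f x = 0) \<Longrightarrow> x = 0"
  obtains D where "\<And>d f. d \<ge> D \<Longrightarrow> hform d f \<Longrightarrow> hid F d f"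
proof -
  have "\<exists>N. hid F N (\<lambda>x. x $ i ^ N)" for i by (rule hid_nth_power[OF F nz]) auto
  then obtain N where N: "\<And>i. hid F (N i) (\<lambda>x. x $ i ^ N i)" by metis
  define D where "D = Suc (\<Sum>i\<in>UNIV. N i)"
  have "hid F d f" if d: "d \<ge> D" and f: "hform d f" for d f
    using hform_span_monomials[OF f]
  proof (induction rule: fv.span_induct_alt)
    case base
    show ?case using hid_0 by (simp add: zero_fun_def)
  next
    case (step c g h)
    then obtain m where m: "g = monomial m" "sum m UNIV = d" by (auto simp: monomials_def)
    have "\<exists>i. m i \<ge> N i"
    proof (rule ccontr)
      assume "\<nexists>i. m i \<ge> N i"
      then have "sum m UNIV \<le> sum N UNIV" by (intro sum_mono) (simp add: not_le less_imp_le)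
      then show False using d m by (simp add: D_def)
    qed
    then obtain i where i: "m i \<ge> N i" by blast
    define m' where "m' = m(i := m i - N i)"
    have deg: "sum m UNIV = sum m' UNIV + N i"
      using i by (subst (1 2) sum.remove[of _ i]) (auto simp: m'_def)
    have mono: "monomial m x = monomial m' x * x $ i ^ N i" for x
    proof -
      have "monomial m x = x $ i ^ m i * (\<Prod>j\<in>UNIV - {i}. x $ j ^ m j)"
        unfolding monomial_def by (subst prod.remove[of _ i]) auto
      also have "x $ i ^ m i = x $ i ^ (m i - N i) * x $ i ^ N i" using i by (simp flip: power_add)
      also have "x $ i ^ (m i - N i) * x $ i ^ N i * (\<Prod>j\<in>UNIV - {i}. x $ j ^ m j)
          = (x $ i ^ m' i * (\<Prod>j\<in>UNIV - {i}. x $ j ^ m' j)) * x $ i ^ N i"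
        by (simp add: m'_def)
      also have "x $ i ^ m' i * (\<Prod>j\<in>UNIV - {i}. x $ j ^ m' j) = monomial m' x"
        unfolding monomial_def by (subst (2) prod.remove[of _ i]) auto
      finally show ?thesis .
    qed
    have "hid F (sum m' UNIV + N i) (\<lambda>x. (c * monomial m' x) * x $ i ^ N i)"
      by (intro hid_mult N hform_cmult hform_monomial)
    then have "hid F d (\<lambda>x. (c * monomial m' x) * x $ i ^ N i)" using deg m by simp
    then have "hid F d (\<lambda>x. (c * monomial m' x) * x $ i ^ N i + h x)"
      by (rule hid_add) (rule step.IH)
    moreover have "(\<lambda>x. c * g x) + h = (\<lambda>x. (c * monomial m' x) * x $ i ^ N i + h x)"
      by (simp add: fun_eq_iff m mono)
    ultimately show ?case by simp
  qed
  then show ?thesis by (rule that)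
qed

section \<open>Closed sets and regular functions\<close>

lemma pclosed_form: "hform d f \<Longrightarrow> pclosed {x. x \<noteq> 0 \<and> f x = 0}"
  unfolding pclosed_def by (intro exI[of _ "{f}"]) auto

lemma pclosed_nonzero: "pclosed Z \<Longrightarrow> x \<in> Z \<Longrightarrow> x \<noteq> 0"
  unfolding pclosed_def by auto

lemma pclosed_scale:
  assumes "pclosed Z" "x \<in> Z" "c \<noteq> 0" shows "c *s x \<in> Z"
proof -
  obtain F where F: "\<forall>f\<in>F. \<exists>d. hform d f" "Z = {x. x \<noteq> 0 \<and> (\<forall>f\<in>F. f x = 0)}"
    using assms(1) unfolding pclosed_def by blast
  from assms(2) have "x \<noteq> 0 \<and> (\<forall>f\<in>F. f x = 0)" unfolding F(2) mem_Collect_eq .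
  then have x: "x \<noteq> 0" "\<forall>f\<in>F. f x = 0" by (rule conjunct1, rule conjunct2)
  have "\<forall>f\<in>F. f (c *s x) = 0"
  proof
    fix f assume f: "f \<in> F"
    obtain d where "hform d f" using bspec[OF F(1) f] by (rule exE)
    from hform_scale[OF this, of c x] show "f (c *s x) = 0" using bspec[OF x(2) f] by simp
  qed
  moreover have "c *s x \<noteq> 0" using x(1) assms(3) by (simp add: vec_eq_iff)
  ultimately show ?thesis unfolding F(2) by (intro CollectI conjI)
qed

lemma pclosed_Int:
  assumes "pclosed Y" "pclosed Z" shows "pclosed (Y \<inter> Z)"
proof -
  obtain F where F: "\<forall>f\<in>F. \<exists>d. hform d f" "Y = {x. x \<noteq> 0 \<and> (\<forall>f\<in>F. f x = 0)}"
    using assms(1) unfolding pclosed_def by (elim exE conjE)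
  obtain G where G: "\<forall>f\<in>G. \<exists>d. hform d f" "Z = {x. x \<noteq> 0 \<and> (\<forall>f\<in>G. f x = 0)}"
    using assms(2) unfolding pclosed_def by (elim exE conjE)
  show ?thesis unfolding pclosed_def
  proof (intro exI[of _ "F \<union> G"] conjI)
    show "\<forall>f\<in>F \<union> G. \<exists>d. hform d f" using F(1) G(1) unfolding ball_Un ..
    show "Y \<inter> Z = {x. x \<noteq> 0 \<and> (\<forall>f\<in>F \<union> G. f x = 0)}"
      unfolding F(2) G(2) ball_Un by (rule set_eqI) (unfold Int_iff mem_Collect_eq, argo)
  qed
qed

lemma pclosed_Un:
  assumes "pclosed Y" "pclosed Z" shows "pclosed (Y \<union> Z)"
proof -
  obtain F where F: "\<forall>f\<in>F. \<exists>d. hform d f" "Y = {x. x \<noteq> 0 \<and> (\<forall>f\<in>F. f x = 0)}"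
    using assms(1) unfolding pclosed_def by (elim exE conjE)
  obtain G where G: "\<forall>f\<in>G. \<exists>d. hform d f" "Z = {x. x \<noteq> 0 \<and> (\<forall>f\<in>G. f x = 0)}"
    using assms(2) unfolding pclosed_def by (elim exE conjE)
  define H where "H = (\<lambda>(f, g). \<lambda>x. f x * g x) ` (F \<times> G)"
  show ?thesis unfolding pclosed_def
  proof (intro exI[of _ H] conjI ballI)
    fix h assume "h \<in> H"
    then obtain f g where fg: "h = (\<lambda>x. f x * g x)" "f \<in> F" "g \<in> G" unfolding H_def by auto
    obtain d where "hform d f" using bspec[OF F(1) fg(2)] ..
    moreover obtain e where "hform e g" using bspec[OF G(1) fg(3)] ..
    ultimately show "\<exists>d. hform d h" unfolding fg(1) by (metis hform_mult)
  next
    have *: "(\<forall>h\<in>H. h x = 0) \<longleftrightarrow> (\<forall>f\<in>F. f x = 0) \<or> (\<forall>g\<in>G. g x = 0)" for x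
    proof -
      have "(\<forall>h\<in>H. h x = 0) \<longleftrightarrow> (\<forall>f\<in>F. \<forall>g\<in>G. f x * g x = 0)"
        unfolding H_def by simp
      also have "\<dots> \<longleftrightarrow> (\<forall>f\<in>F. f x = 0) \<or> (\<forall>g\<in>G. g x = 0)"
        unfolding mult_eq_0_iff by meson
      finally show ?thesis .
    qed
    show "Y \<union> Z = {x. x \<noteq> 0 \<and> (\<forall>h\<in>H. h x = 0)}"
      unfolding F(2) G(2) * by (rule set_eqI) (unfold Un_iff mem_Collect_eq, argo)
  qed
qed

lemma pclosed_empty: "pclosed {}"
  using pclosed_form[OF hform.const[of 1]] by simp

lemma pclosedD:
  assumes "pclosed Z" "x \<noteq> 0" "x \<notin> Z"
  obtains d f where "hform d f" "\<And>z. z \<in> Z \<Longrightarrow> f z = 0" "f x \<noteq> 0"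
proof -
  obtain F where F: "\<forall>f\<in>F. \<exists>d. hform d f" "Z = {x. x \<noteq> 0 \<and> (\<forall>f\<in>F. f x = 0)}"
    using assms(1) unfolding pclosed_def by (elim exE conjE)
  have "\<not> (\<forall>f\<in>F. f x = 0)" using assms(2,3) unfolding F(2) mem_Collect_eq by argo
  then have "\<exists>f\<in>F. f x \<noteq> 0" by (simp only: ball_simps bex_simps not_not)
  then obtain f where f: "f \<in> F" "f x \<noteq> 0" by (rule bexE)
  obtain d where "hform d f" using bspec[OF F(1) f(1)] ..
  moreover have "f z = 0" if "z \<in> Z" for z
  proof -
    from that have "z \<noteq> 0 \<and> (\<forall>f\<in>F. f z = 0)" unfolding F(2) mem_Collect_eq .
    from bspec[OF conjunct2[OF this] f(1)] show ?thesis .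
  qed
  ultimately show ?thesis using f(2) by (rule that)
qed

lemma pvariety_closed: "pvariety X \<Longrightarrow> pclosed X" and pvariety_nonempty: "pvariety X \<Longrightarrow> X \<noteq> {}"
  and pvariety_Un: "pvariety X \<Longrightarrow> pclosed Y \<Longrightarrow> pclosed Z \<Longrightarrow> X \<subseteq> Y \<union> Z \<Longrightarrow> X \<subseteq> Y \<or> X \<subseteq> Z"
  unfolding pvariety_def by blast+

text \<open>Irreducibility in algebraic form: the homogeneous coordinate ring has no zero divisors.
  The point a witnesses that f is not zero on X.\<close>

lemma pvariety_domain:
  assumes X: "pvariety X" and f: "hform d f" and g: "hform e g"
    and fg: "\<And>x. x \<in> X \<Longrightarrow> f x * g x = 0" and a: "a \<in> X" "f a \<noteq> 0" and b: "b \<in> X"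
  shows "g b = 0"
proof -
  have "X \<subseteq> {x. x \<noteq> 0 \<and> f x = 0} \<union> {x. x \<noteq> 0 \<and> g x = 0}"
    using fg pclosed_nonzero[OF pvariety_closed[OF X]] by fastforce
  then have "X \<subseteq> {x. x \<noteq> 0 \<and> f x = 0} \<or> X \<subseteq> {x. x \<noteq> 0 \<and> g x = 0}"
    by (intro pvariety_Un[OF X] pclosed_form[OF f] pclosed_form[OF g])
  then show ?thesis using a b by auto
qed

lemma popen_form: "hform d f \<Longrightarrow> pclosed X \<Longrightarrow> popen_in X {x\<in>X. f x \<noteq> 0}"
  unfolding popen_in_def
  by (rule exI[of _ "{x. x \<noteq> 0 \<and> f x = 0}"]) (auto intro: pclosed_form dest: pclosed_nonzero)

lemma popen_Int: "popen_in X U \<Longrightarrow> popen_in X W \<Longrightarrow> popen_in X (U \<inter> W)"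
proof -
  assume "popen_in X U" "popen_in X W"
  then obtain Y Z where "pclosed Y" "U = X - Y" "pclosed Z" "W = X - Z" unfolding popen_in_def by metis
  then show ?thesis unfolding popen_in_def by (intro exI[of _ "Y \<union> Z"]) (auto simp: pclosed_Un)
qed

lemma popen_subset: "popen_in X U \<Longrightarrow> U \<subseteq> X"
  unfolding popen_in_def by blast

lemma popen_self: "popen_in X X"
  unfolding popen_in_def by (intro exI[of _ "{}"]) (simp add: pclosed_empty)

lemma popen_dense:
  assumes X: "pvariety X" and W: "popen_in X W" "w \<in> W" and f: "hform d f"
    and 0: "\<And>y. y \<in> W \<Longrightarrow> f y = 0" and x: "x \<in> X"
  shows "f x = 0"
proof -
  obtain Z where Z: "pclosed Z" "W = X - Z" using W(1) unfolding popen_in_def by blast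
  have "X \<subseteq> Z \<union> {x. x \<noteq> 0 \<and> f x = 0}"
    using 0 Z(2) pclosed_nonzero[OF pvariety_closed[OF X]] by blast
  then have "X \<subseteq> Z \<or> X \<subseteq> {x. x \<noteq> 0 \<and> f x = 0}"
    by (intro pvariety_Un[OF X] Z pclosed_form[OF f])
  then show ?thesis using W Z x by auto
qed

lemma popen_meet:
  assumes X: "pvariety X" and "popen_in X U" "u \<in> U" "popen_in X W" "w \<in> W"
  shows "U \<inter> W \<noteq> {}"
proof
  assume e: "U \<inter> W = {}"
  obtain Y Z where YZ: "pclosed Y" "U = X - Y" "pclosed Z" "W = X - Z"
    using assms unfolding popen_in_def by metis
  then have "X \<subseteq> Y \<or> X \<subseteq> Z" using e by (intro pvariety_Un[OF X]) auto
  then show False using YZ assms by blast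
qed

text \<open>Germs at q of sections of O(n), as quotients of forms with degree difference n. All
  integers n are needed, since an ideal sheaf is going to be compared with a twist O(m).\<close>

definition reg_at :: "(complex ^ 'n) set \<Rightarrow> int \<Rightarrow> (complex ^ 'n \<Rightarrow> complex) \<Rightarrow> complex ^ 'n \<Rightarrow> bool" where
  "reg_at X n H q \<longleftrightarrow> (\<exists>W d e P Q. popen_in X W \<and> q \<in> W \<and> hform d P \<and> hform e Q \<and> int d = int e + n \<and>
     (\<forall>y\<in>W. Q y \<noteq> 0 \<and> H y = P y / Q y))"

lemma reg_atI:
  assumes "popen_in X W" "q \<in> W" "hform d P" "hform e Q" "int d = int e + n"
    "\<And>y. y \<in> W \<Longrightarrow> Q y \<noteq> 0" "\<And>y. y \<in> W \<Longrightarrow> H y = P y / Q y"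
  shows "reg_at X n H q"
  using assms unfolding reg_at_def by blast

lemma reg_atE:
  assumes "reg_at X n H q"
  obtains W d e P Q where "popen_in X W" "q \<in> W" "hform d P" "hform e Q" "int d = int e + n"
    "\<And>y. y \<in> W \<Longrightarrow> Q y \<noteq> 0" "\<And>y. y \<in> W \<Longrightarrow> H y = P y / Q y"
  using assms unfolding reg_at_def by blast

lemma reg_at_mult:
  assumes "reg_at X n H q" "reg_at X m K q" shows "reg_at X (n + m) (\<lambda>x. H x * K x) q"
proof -
  obtain W d e P Q where 1: "popen_in X W" "q \<in> W" "hform d P" "hform e Q" "int d = int e + n"
    "\<And>y. y \<in> W \<Longrightarrow> Q y \<noteq> 0" "\<And>y. y \<in> W \<Longrightarrow> H y = P y / Q y"
    by (rule reg_atE[OF assms(1)]) (rule that)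
  obtain W' d' e' P' Q' where 2: "popen_in X W'" "q \<in> W'" "hform d' P'" "hform e' Q'" "int d' = int e' + m"
    "\<And>y. y \<in> W' \<Longrightarrow> Q' y \<noteq> 0" "\<And>y. y \<in> W' \<Longrightarrow> K y = P' y / Q' y"
    by (rule reg_atE[OF assms(2)]) (rule that)
  show ?thesis
  proof (rule reg_atI[where W = "W \<inter> W'" and P = "\<lambda>x. P x * P' x" and Q = "\<lambda>x. Q x * Q' x"])
    show "popen_in X (W \<inter> W')" by (intro popen_Int 1 2)
    show "hform (d + d') (\<lambda>x. P x * P' x)" "hform (e + e') (\<lambda>x. Q x * Q' x)" by (intro hform_mult 1 2)+
  qed (use 1 2 in auto)
qed

lemma reg_at_cong:
  assumes "reg_at X n H q" "popen_in X U" "q \<in> U" "\<And>y. y \<in> U \<Longrightarrow> K y = H y"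
  shows "reg_at X n K q"
proof -
  obtain W d e P Q where 1: "popen_in X W" "q \<in> W" "hform d P" "hform e Q" "int d = int e + n"
    "\<And>y. y \<in> W \<Longrightarrow> Q y \<noteq> 0" "\<And>y. y \<in> W \<Longrightarrow> H y = P y / Q y"
    by (rule reg_atE[OF assms(1)]) (rule that)
  show ?thesis
    by (rule reg_atI[where W = "W \<inter> U", OF popen_Int[OF 1(1) assms(2)] _ 1(3,4,5)]) (use 1 assms in auto)
qed

lemma reg_at_form: "hform d f \<Longrightarrow> q \<in> X \<Longrightarrow> reg_at X (int d) f q"
  by (rule reg_atI[where W = X and Q = "\<lambda>x. 1", OF popen_self _ _ hform.const]) auto

lemma reg_at_inverse:
  assumes X: "pclosed X" and H: "reg_at X n H q" and nz: "H q \<noteq> 0"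
  shows "reg_at X (- n) (\<lambda>x. inverse (H x)) q"
proof -
  obtain W d e P Q where 1: "popen_in X W" "q \<in> W" "hform d P" "hform e Q" "int d = int e + n"
    "\<And>y. y \<in> W \<Longrightarrow> Q y \<noteq> 0" "\<And>y. y \<in> W \<Longrightarrow> H y = P y / Q y"
    by (rule reg_atE[OF H]) (rule that)
  show ?thesis
  proof (rule reg_atI[where W = "W \<inter> {x\<in>X. P x \<noteq> 0}" and P = Q and Q = P, OF _ _ 1(4) 1(3)])
    show "popen_in X (W \<inter> {x\<in>X. P x \<noteq> 0})" by (intro popen_Int popen_form[OF 1(3) X] 1(1))
    show "q \<in> W \<inter> {x\<in>X. P x \<noteq> 0}" using 1 nz popen_subset[OF 1(1)] by auto
  qed (use 1 in auto)
qed

lemma reg_at_nth_powi: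
  assumes X: "pclosed X" and q: "q \<in> X" "q $ i \<noteq> 0" shows "reg_at X m (\<lambda>x. x $ i powi m) q"
proof (cases "m \<ge> 0")
  case True
  then have "(\<lambda>x. x $ i powi m) = (\<lambda>x::complex ^ 'a. x $ i ^ nat m)" by (simp add: power_int_def)
  then show ?thesis using reg_at_form[OF hform_nth_power q(1), of "nat m" i] True by simp
next
  case False
  then have "(\<lambda>x. x $ i powi m) = (\<lambda>x::complex ^ 'a. inverse (x $ i ^ nat (- m)))"
    by (simp add: power_int_def power_inverse)
  then show ?thesis
    using reg_at_inverse[OF X reg_at_form[OF hform_nth_power q(1), of "nat (- m)" i]] False q by simp
qed

lemma regular_reg_at:
  assumes "f \<in> regular X W" "q \<in> W" shows "reg_at X 0 f q"
proof -
  obtain W' d P Q where "popen_in X W'" "q \<in> W'" "hform d P" "hform d Q" "\<forall>y\<in>W'. Q y \<noteq> 0 \<and> f y = P y / Q y"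
    using assms unfolding regular_def by blast
  then show ?thesis by (intro reg_atI[of X W' q d P d Q]) auto
qed

lemma reg_at_regular:
  assumes W: "popen_in X W" and f: "\<And>q. q \<in> W \<Longrightarrow> reg_at X 0 f q" shows "f \<in> regular X W"
  unfolding regular_def
proof (rule CollectI, rule ballI)
  fix q assume q: "q \<in> W"
  obtain U d e P Q where 1: "popen_in X U" "q \<in> U" "hform d P" "hform e Q" "int d = int e + 0"
    "\<And>y. y \<in> U \<Longrightarrow> Q y \<noteq> 0" "\<And>y. y \<in> U \<Longrightarrow> f y = P y / Q y"
    by (rule reg_atE[OF f[OF q]]) (rule that)
  have "popen_in X (U \<inter> W)" "q \<in> U \<inter> W" "U \<inter> W \<subseteq> W" "hform d Q" "\<forall>y\<in>U \<inter> W. Q y \<noteq> 0 \<and> f y = P y / Q y"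
    using 1 W q popen_Int by auto
  then show "\<exists>W' d P Q. popen_in X W' \<and> q \<in> W' \<and> W' \<subseteq> W \<and> hform d P \<and> hform d Q \<and>
      (\<forall>y\<in>W'. Q y \<noteq> 0 \<and> f y = P y / Q y)"
    using 1(3) by blast
qed

definition reg :: "(complex ^ 'n) set \<Rightarrow> int \<Rightarrow> (complex ^ 'n \<Rightarrow> complex) \<Rightarrow> bool" where
  "reg X n H \<longleftrightarrow> (\<forall>q\<in>X. reg_at X n H q)"

text \<open>Two local presentations agree after cross multiplication on the intersection of their
  domains, which is nonempty and dense. So H * Q = P spreads from a neighbourhood of q to all of
  X.\<close>

lemma reg_global:
  assumes X: "pvariety X" and H: "reg X n H" and q: "q \<in> X"
  obtains d e P Q where "hform d P" "hform e Q" "int d = int e + n" "Q q \<noteq> 0" "\<And>y. y \<in> X \<Longrightarrow> H y * Q y = P y"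
proof -
  have at: "reg_at X n H y" if "y \<in> X" for y using H that by (simp add: reg_def)
  obtain W d e P Q where 1: "popen_in X W" "q \<in> W" "hform d P" "hform e Q" "int d = int e + n"
    "\<And>y. y \<in> W \<Longrightarrow> Q y \<noteq> 0" "\<And>y. y \<in> W \<Longrightarrow> H y = P y / Q y"
    by (rule reg_atE[OF at[OF q]]) (rule that)
  have "H y * Q y = P y" if y: "y \<in> X" for y
  proof -
    obtain W' d' e' P' Q' where 2: "popen_in X W'" "y \<in> W'" "hform d' P'" "hform e' Q'" "int d' = int e' + n"
      "\<And>y. y \<in> W' \<Longrightarrow> Q' y \<noteq> 0" "\<And>y. y \<in> W' \<Longrightarrow> H y = P' y / Q' y"
      by (rule reg_atE[OF at[OF y]]) (rule that)
    obtain w where w: "w \<in> W \<inter> W'" using popen_meet[OF X 1(1,2) 2(1,2)] by blast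
    have deg: "d + e' = d' + e" using 1(5) 2(5) by linarith
    have "P y * Q' y - P' y * Q y = 0"
    proof (rule popen_dense[OF X popen_Int[OF 1(1) 2(1)] w, where f = "\<lambda>z. P z * Q' z - P' z * Q z"])
      show "hform (d + e') (\<lambda>z. P z * Q' z - P' z * Q z)"
        using hform_mult[OF 1(3) 2(4)] hform_mult[OF 2(3) 1(4)] deg by (simp add: hform_diff)
      show "P z * Q' z - P' z * Q z = 0" if "z \<in> W \<inter> W'" for z
      proof -
        have "P z = H z * Q z" using that 1(6)[of z] 1(7)[of z] by simp
        moreover have "P' z = H z * Q' z" using that 2(6)[of z] 2(7)[of z] by simp
        ultimately show ?thesis by simp
      qed
    qed (rule y)
    then have "P y * Q' y = P' y * Q y" by simp
    then have "P' y * Q y / Q' y = P y" using 2(6)[OF 2(2)] by (metis nonzero_mult_div_cancel_right)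
    then show ?thesis unfolding 2(7)[OF 2(2)] times_divide_eq_left .
  qed
  then show ?thesis using that 1(2,3,4,5,6) by blast
qed

section \<open>Global regular functions and sections of negative degree\<close>

lemma hform_degree_unique:
  assumes "hform d f" "hform e f" "f x \<noteq> 0" shows "d = e"
proof -
  have "2 ^ d * f x = 2 ^ e * f x" by (metis hform_scale assms(1,2))
  then have "(2::complex) ^ d = 2 ^ e" using assms(3) by simp
  then have "norm ((2::complex) ^ d) = norm ((2::complex) ^ e)" by simp
  then show ?thesis by (simp add: norm_power)
qed

text \<open>Multiplication by \<open>H\<close> acts on the finite-dimensional space of forms of large degree, by the
  Nullstellensatz; \<open>H\<close> equals its eigenvalue.\<close>

theorem regular_constant:
  assumes X: "pvariety X" and H: "reg X 0 H"
  obtains c where "\<And>x. x \<in> X \<Longrightarrow> H x = c"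
proof -
  have "\<exists>d P Q. hform d P \<and> hform d Q \<and> Q q \<noteq> 0 \<and> (\<forall>y\<in>X. H y * Q y = P y)" if "q \<in> X" for q
    by (rule reg_global[OF X H that]) auto
  then obtain d P Q where PQ: "\<And>q. q \<in> X \<Longrightarrow> hform (d q) (P q)" "\<And>q. q \<in> X \<Longrightarrow> hform (d q) (Q q)"
    "\<And>q. q \<in> X \<Longrightarrow> Q q q \<noteq> 0" "\<And>q y. q \<in> X \<Longrightarrow> y \<in> X \<Longrightarrow> H y * Q q y = P q y"
    by metis
  define F where "F = {f. \<exists>d. hform d f \<and> (\<forall>x\<in>X. f x = 0)} \<union> Q ` X"
  have F: "\<exists>d. hform d f" if "f \<in> F" for f using that PQ(2) unfolding F_def by blast
  have nz: "x = 0" if x: "\<And>f. f \<in> F \<Longrightarrow> f x = 0" for x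
  proof (rule ccontr)
    assume x0: "x \<noteq> 0"
    have "x \<in> X"
    proof (rule ccontr)
      assume "x \<notin> X"
      with x0 obtain d f where "hform d f" "\<And>z. z \<in> X \<Longrightarrow> f z = 0" "f x \<noteq> 0"
        by (rule pclosedD[OF pvariety_closed[OF X]]) (rule that)
      then show False using x[of f] unfolding F_def by blast
    qed
    then have "Q x \<in> F" unfolding F_def by blast
    then show False using x[of "Q x"] PQ(3)[OF \<open>x \<in> X\<close>] by simp
  qed
  obtain D where D: "\<And>d f. d \<ge> D \<Longrightarrow> hform d f \<Longrightarrow> hid F d f"
    by (rule projective_nullstellensatz[of F]) (use F nz in \<open>auto intro: that\<close>)
  \<comment> \<open>Modulo forms vanishing on X, every form of degree D is a combination of the
    denominators Q q, and H times such a denominator is the form P q of the same degree.\<close>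
  have stable: "\<exists>g'. hform D g' \<and> (\<forall>x\<in>X. H x * g x = g' x)" if g: "hform D g" for g
  proof -
    have "hid F e g \<Longrightarrow> \<exists>g'. hform e g' \<and> (\<forall>x\<in>X. H x * g x = g' x)" for e g
    proof (induction rule: hid.induct)
      case (hid_0 e)
      show ?case by (rule exI[of _ "\<lambda>x. 0"]) (simp add: hform_0)
    next
      case (hid_step e a f e' g)
      then obtain g' where g': "hform (e + e') g'" "\<And>x. x \<in> X \<Longrightarrow> H x * g x = g' x" by blast
      show ?case
      proof (cases "\<forall>x\<in>X. f x = 0")
        case True
        then show ?thesis using g' by (intro exI[of _ g']) (auto simp: distrib_left)
      next
        case False
        then obtain q where q: "q \<in> X" "f = Q q" using hid_step(2) unfolding F_def by blast
        then have "d q = e'" using hform_degree_unique[OF PQ(2) _ PQ(3), of q e'] hid_step(3) by blast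
        then have "hform (e + e') (\<lambda>x. a x * P q x + g' x)"
          using hid_step(1) PQ(1)[OF q(1)] g'(1) by (intro hform.add hform_mult) auto
        moreover have "H x * (a x * f x + g x) = a x * P q x + g' x" if "x \<in> X" for x
          using PQ(4)[OF q(1) that] g'(2)[OF that] q(2) by (simp add: algebra_simps)
        ultimately show ?thesis by blast
      qed
    qed
    then show ?thesis using D[OF order_refl g] by blast
  qed
  define mH where "mH g = (SOME g'. hform D g' \<and> (\<forall>x\<in>X. H x * g x = g' x))" for g
  have mH: "hform D (mH g)" "\<And>x. x \<in> X \<Longrightarrow> H x * g x = mH g x" if "hform D g" for g
    using someI_ex[OF stable[OF that]] unfolding mH_def by blast+
  obtain a where a: "a \<in> X" using pvariety_nonempty[OF X] by blast
  then have "a \<noteq> 0" by (rule pclosed_nonzero[OF pvariety_closed[OF X]])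
  then obtain i where i: "a $ i \<noteq> 0" by (auto simp: vec_eq_iff)
  define G where "G k = (mH ^^ k) (\<lambda>x. x $ i ^ D)" for k
  have G: "hform D (G k)" for k
    by (induction k) (auto simp: G_def hform_nth_power intro: mH)
  have GH: "G k x = H x ^ k * x $ i ^ D" if "x \<in> X" for k x
  proof (induction k)
    case (Suc k)
    have "G (Suc k) x = H x * G k x" using mH(2)[OF G that, of k] by (simp add: G_def)
    then show ?case by (simp add: Suc)
  qed (simp add: G_def)
  obtain u k0 where u: "k0 \<in> {..card (monomials D :: (complex ^ 'a \<Rightarrow> complex) set)}" "u k0 \<noteq> 0"
    "\<And>x. (\<Sum>k\<le>card (monomials D :: (complex ^ 'a \<Rightarrow> complex) set). u k * G k x) = 0"
    by (rule dependent_family[OF finite_monomials, of "{..card (monomials D)}" D G])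
      (auto intro: hform_span_monomials[OF G] that)
  define p where "p = (\<Sum>k\<le>card (monomials D :: (complex ^ 'a \<Rightarrow> complex) set). monom (u k) k)"
  have "coeff p k0 = u k0" using u(1) by (simp add: p_def coeff_sum)
  then have "p \<noteq> 0" using u(2) by auto
  moreover have "poly p (H x) * x $ i ^ D = 0" if "x \<in> X" for x
    using u(3)[of x] by (simp add: p_def poly_sum poly_monom GH[OF that] sum_distrib_right mult.assoc)
  \<comment> \<open>Linear factors of p are split off until one of them annihilates a form that is
    not zero on X; this form is an eigenvector of multiplication by H.\<close>
  ultimately have "\<exists>r g. hform D g \<and> (\<exists>x\<in>X. g x \<noteq> 0) \<and> (\<forall>x\<in>X. (H x - r) * g x = 0)"
  proof (induction "degree p" arbitrary: p)
    case 0
    then obtain b where "p = [:b:]" "b \<noteq> 0" by (metis degree_eq_zeroE pCons_0_0)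
    then have False using 0(3)[OF a] i by simp
    then show ?case ..
  next
    case (Suc n)
    then obtain r where "poly p r = 0"
      using fundamental_theorem_of_algebra[of p] by (auto simp: constant_degree)
    then obtain p' where p': "p = [:- r, 1:] * p'" by (auto simp: poly_eq_0_iff_dvd)
    have p'0: "p' \<noteq> 0" using p' Suc.prems(1) by auto
    moreover from this have "degree p = Suc (degree p')" unfolding p' by (subst degree_mult_eq) auto
    ultimately have IH: "(\<And>x. x \<in> X \<Longrightarrow> poly p' (H x) * x $ i ^ D = 0) \<Longrightarrow>
        \<exists>r g. hform D g \<and> (\<exists>x\<in>X. g x \<noteq> 0) \<and> (\<forall>x\<in>X. (H x - r) * g x = 0)"
      using Suc.hyps by simp
    define g where "g x = (\<Sum>k\<le>degree p'. coeff p' k * G k x)" for x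
    have g: "hform D g" unfolding g_def[abs_def] by (intro hform_sum hform_cmult G)
    have gx: "g x = poly p' (H x) * x $ i ^ D" if "x \<in> X" for x
      by (simp add: g_def GH[OF that] poly_altdef sum_distrib_right mult.assoc)
    show ?case
    proof (cases "\<exists>x\<in>X. g x \<noteq> 0")
      case True
      have "(H x - r) * g x = 0" if "x \<in> X" for x
        using Suc.prems(2)[OF that] by (simp add: gx[OF that] p' algebra_simps)
      then show ?thesis using g True by blast
    next
      case False
      then show ?thesis using gx by (intro IH) auto
    qed
  qed
  then obtain r g b where g: "hform D g" "b \<in> X" "g b \<noteq> 0" "\<And>x. x \<in> X \<Longrightarrow> (H x - r) * g x = 0" by blast
  have "H q = r" if q: "q \<in> X" for q
  proof -
    have "P q q - r * Q q q = 0"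
    proof (rule pvariety_domain[OF X g(1) _ _ g(2,3) q, where g = "\<lambda>x. P q x - r * Q q x"])
      show "hform (d q) (\<lambda>x. P q x - r * Q q x)" by (intro hform_diff hform_cmult PQ q)
      show "g x * (P q x - r * Q q x) = 0" if "x \<in> X" for x
        using g(4)[OF that] by (auto simp flip: PQ(4)[OF q that])
    qed
    then show ?thesis using PQ(3)[OF q] by (simp flip: PQ(4)[OF q q])
  qed
  then show ?thesis by (rule that)
qed

lemma reg_mult: "reg X n H \<Longrightarrow> reg X m K \<Longrightarrow> reg X (n + m) (\<lambda>x. H x * K x)"
  by (simp add: reg_def reg_at_mult)

lemma reg_form: "hform d f \<Longrightarrow> reg X (int d) f"
  by (simp add: reg_def reg_at_form)

text \<open>Multiplication by the power l ^ (- n) gives a regular function, hence a constant, and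
  the constant is 0 because of the zero a of l.\<close>

lemma reg_negative:
  assumes X: "pvariety X" and H: "reg X n H" and n: "n < 0"
    and l: "a \<in> X" "ev l a = 0" "b \<in> X" "ev l b \<noteq> 0" and x: "x \<in> X"
  shows "H x = 0"
proof -
  define m where "m = nat (- n)"
  have "reg X (n + int m) (\<lambda>x. H x * ev l x ^ m)" by (intro reg_mult H reg_form hform_ev_power)
  then have "reg X 0 (\<lambda>x. H x * ev l x ^ m)" using n by (simp add: m_def)
  then obtain c where c: "\<And>x. x \<in> X \<Longrightarrow> H x * ev l x ^ m = c"
    by (rule regular_constant[OF X]) (rule that)
  have "c = 0" using c[OF l(1)] l(2) n by (simp add: m_def power_0_left)
  obtain d e P Q where PQ: "hform d P" "hform e Q" "int d = int e + n" "Q x \<noteq> 0"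
      "\<And>y. y \<in> X \<Longrightarrow> H y * Q y = P y"
    by (rule reg_global[OF X H x]) (rule that)
  have "P x = 0"
  proof (rule pvariety_domain[OF X hform_ev_power PQ(1) _ l(3) _ x])
    fix y assume "y \<in> X"
    then show "ev l y ^ m * P y = 0"
      using c[of y] \<open>c = 0\<close> by (auto simp flip: PQ(5))
  qed (use l in simp)
  then show ?thesis using PQ(4) PQ(5)[OF x] by simp
qed

section \<open>Irreducible components and dimension\<close>

definition point :: "complex ^ 'n \<Rightarrow> (complex ^ 'n) set" where
  "point a = {c *s a | c. c \<noteq> 0}"

lemma point_self: "a \<in> point a"
  unfolding point_def by (auto intro!: exI[of _ 1])

lemma point_eq: "b \<in> point a \<Longrightarrow> point b = point a"
proof -
  assume "b \<in> point a"
  then obtain c where c: "b = c *s a" "c \<noteq> 0" unfolding point_def by blast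
  have "d *s b \<in> point a" if "d \<noteq> 0" for d
    unfolding point_def using c that by (auto intro!: exI[of _ "d * c"])
  moreover have "d *s a \<in> point b" if "d \<noteq> 0" for d
    unfolding point_def using c that by (auto intro!: exI[of _ "d / c"])
  ultimately show ?thesis unfolding point_def by blast
qed

lemma point_subset: "pclosed Z \<Longrightarrow> a \<in> Z \<Longrightarrow> point a \<subseteq> Z"
  unfolding point_def using pclosed_scale by blast

lemma pclosed_point:
  assumes "a \<noteq> 0" shows "pclosed (point a)"
proof -
  obtain j where j: "a $ j \<noteq> 0" using assms by (auto simp: vec_eq_iff)
  define f where "f i x = a $ j * x $ i - a $ i * x $ j" for i x
  have "point a = {x. x \<noteq> 0 \<and> (\<forall>i. f i x = 0)}"
  proof (intro set_eqI iffI CollectI conjI allI)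
    fix x assume "x \<in> point a"
    then obtain c where "x = c *s a" "c \<noteq> 0" unfolding point_def by blast
    then show "x \<noteq> 0" "f i x = 0" for i using assms by (auto simp: vec_eq_iff f_def)
  next
    fix x assume x: "x \<in> {x. x \<noteq> 0 \<and> (\<forall>i. f i x = 0)}"
    then have "a $ j * x $ i = x $ j * a $ i" for i by (auto simp: f_def algebra_simps)
    then have "x = (x $ j / a $ j) *s a" using j by (simp add: vec_eq_iff field_simps)
    moreover have "x $ j / a $ j \<noteq> 0" using calculation x by auto
    ultimately show "x \<in> point a" unfolding point_def by blast
  qed
  moreover have "hform 1 (f i)" for i unfolding f_def[abs_def] by (intro hform_diff hform_cmult hform_nth)
  ultimately show ?thesis unfolding pclosed_def by (intro exI[of _ "range f"]) auto
qed

lemma pvariety_point: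
  assumes "a \<noteq> 0" shows "pvariety (point a)"
  unfolding pvariety_def
proof (intro conjI allI impI)
  show "point a \<noteq> {}" using point_self by blast
  fix Y Z assume *: "pclosed Y \<and> pclosed Z \<and> point a \<subseteq> Y \<union> Z"
  then have "a \<in> Y \<or> a \<in> Z" using point_self by blast
  then show "point a \<subseteq> Y \<or> point a \<subseteq> Z" using point_subset * by blast
qed (rule pclosed_point[OF assms])

text \<open>In an infinite strictly descending chain pick forms f n that vanish on Z (n + 1) but not
  at a point x n of Z n. Some f n is a combination of its predecessors, all of which vanish on Z
  n.\<close>

lemma pclosed_minimal:
  fixes \<Z> :: "(complex ^ 'n) set set"
  assumes ne: "Z0 \<in> \<Z>" and closed: "\<And>Z. Z \<in> \<Z> \<Longrightarrow> pclosed Z"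
  obtains Z where "Z \<in> \<Z>" "\<And>Y. Y \<in> \<Z> \<Longrightarrow> \<not> Y \<subset> Z"
proof (rule ccontr)
  assume "\<not> thesis"
  then have "\<forall>Z\<in>\<Z>. \<exists>Y\<in>\<Z>. Y \<subset> Z" using that by blast
  then obtain h where h: "\<And>Z. Z \<in> \<Z> \<Longrightarrow> h Z \<in> \<Z> \<and> h Z \<subset> Z" by metis
  define Z where "Z n = (h ^^ n) Z0" for n
  have Z: "Z n \<in> \<Z>" for n by (induction n) (auto simp: Z_def ne h)
  have Suc: "Z (Suc n) \<subset> Z n" for n using h[OF Z[of n]] by (simp add: Z_def)
  then have anti: "Z n \<subseteq> Z m" if "m \<le> n" for m n using lift_Suc_antimono_le[of Z] that by blast
  have "\<exists>x f. x \<in> Z n \<and> f \<in> pol \<and> f x \<noteq> 0 \<and> (\<forall>z\<in>Z (Suc n). f z = 0)" for n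
  proof -
    obtain x where x: "x \<in> Z n" "x \<notin> Z (Suc n)" using Suc by blast
    have "x \<noteq> 0" using pclosed_nonzero[OF closed[OF Z]] x by blast
    then obtain d f where "hform d f" "\<And>z. z \<in> Z (Suc n) \<Longrightarrow> f z = 0" "f x \<noteq> 0"
      by (rule pclosedD[OF closed[OF Z] _ x(2)]) (rule that)
    then show ?thesis using x hform_pol by blast
  qed
  then obtain x f where xf: "\<And>n. x n \<in> Z n" "\<And>n. f n \<in> pol" "\<And>n. f n (x n) \<noteq> 0"
    "\<And>n z. z \<in> Z (Suc n) \<Longrightarrow> f n z = 0" by metis
  obtain n where n: "f n \<in> idl pol (f ` {..<n})"
    by (rule noetherian_seq[OF noetherian_pol subring_pol, of f]) (use xf in \<open>auto intro: that\<close>)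
  have "f n (x n) = 0"
  proof (rule idl_pol_zero[OF n])
    fix g assume "g \<in> f ` {..<n}"
    then obtain i where i: "i < n" "g = f i" by blast
    then have "x n \<in> Z (Suc i)" using anti[of "Suc i" n] xf(1)[of n] by auto
    then show "g (x n) = 0" using xf(4) i(2) by simp
  qed
  then show False using xf(3) by blast
qed

text \<open>Noetherian induction: a minimal closed set without such a decomposition would be
  reducible, with two smaller parts that do decompose.\<close>

lemma irreducible_components:
  assumes "pclosed Z"
  obtains \<C> where "finite \<C>" "\<And>C. C \<in> \<C> \<Longrightarrow> pvariety C" "Z = \<Union>\<C>"
proof (rule ccontr)
  assume no: "\<not> thesis"
  define dec where "dec Z \<longleftrightarrow> (\<exists>\<C>. finite \<C> \<and> (\<forall>C\<in>\<C>. pvariety C) \<and> Z = \<Union>\<C>)" for Z :: "(complex ^ 'a) set"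
  have "Z \<in> {Z. pclosed Z \<and> \<not> dec Z}" using no assms that unfolding dec_def by blast
  then obtain Y where Y: "pclosed Y" "\<not> dec Y" "\<And>X. X \<in> {Z. pclosed Z \<and> \<not> dec Z} \<Longrightarrow> \<not> X \<subset> Y"
    by (rule pclosed_minimal) auto
  have "dec {}" unfolding dec_def by (intro exI[of _ "{}"]) auto
  moreover have "dec Y" if "pvariety Y" unfolding dec_def using that by (intro exI[of _ "{Y}"]) auto
  ultimately have "\<not> pvariety Y" "Y \<noteq> {}" using Y(2) by auto
  then obtain A B where AB: "pclosed A" "pclosed B" "Y \<subseteq> A \<union> B" "\<not> Y \<subseteq> A" "\<not> Y \<subseteq> B"
    using Y(1) unfolding pvariety_def by blast
  have "Y \<inter> A \<subset> Y" "Y \<inter> B \<subset> Y" using AB(4,5) by auto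
  then have "dec (Y \<inter> A)" "dec (Y \<inter> B)" using Y(3) pclosed_Int[OF Y(1)] AB(1,2) by blast+
  then obtain \<C> \<D> where "finite \<C>" "\<forall>C\<in>\<C>. pvariety C" "Y \<inter> A = \<Union>\<C>"
    "finite \<D>" "\<forall>C\<in>\<D>. pvariety C" "Y \<inter> B = \<Union>\<D>" unfolding dec_def by metis
  moreover from this have "Y = \<Union>(\<C> \<union> \<D>)" using AB(3) unfolding Union_Un_distrib by blast
  ultimately have "finite (\<C> \<union> \<D>)" "\<forall>C\<in>\<C> \<union> \<D>. pvariety C" "Y = \<Union>(\<C> \<union> \<D>)" by auto
  then show False using Y(2) unfolding dec_def by blast
qed

lemma pvariety_subset_component:
  assumes "finite \<C>" "\<And>C. C \<in> \<C> \<Longrightarrow> pclosed C" "pvariety X" "X \<subseteq> \<Union>\<C>"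
  obtains C where "C \<in> \<C>" "X \<subseteq> C"
proof -
  have "(\<forall>C\<in>\<C>. pclosed C) \<Longrightarrow> pclosed (\<Union>\<C>) \<and> (X \<subseteq> \<Union>\<C> \<longrightarrow> (\<exists>C\<in>\<C>. X \<subseteq> C))"
    using assms(1)
  proof (induction \<C>)
    case empty
    then show ?case using pvariety_nonempty[OF assms(3)] pclosed_empty by auto
  next
    case (insert C \<C>)
    then have IH: "pclosed (\<Union>\<C>)" "X \<subseteq> \<Union>\<C> \<Longrightarrow> \<exists>C\<in>\<C>. X \<subseteq> C" and C: "pclosed C" by auto
    have "X \<subseteq> C \<or> X \<subseteq> \<Union>\<C>" if "X \<subseteq> \<Union>(insert C \<C>)"
      using that by (intro pvariety_Un[OF assms(3) C IH(1)]) auto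
    then show ?case using IH pclosed_Un[OF C IH(1)] by auto
  qed
  then show ?thesis using assms that by blast
qed

section \<open>Linear forms in general position\<close>

lemma linear_form_separates:
  assumes "\<And>c. q \<noteq> c *s p"
  obtains y where "ev y p = 0" "ev y q \<noteq> 0"
proof (cases "p = 0")
  case True
  have "q \<noteq> 0" using assms[of 0] by simp
  then obtain i where "q $ i \<noteq> 0" by (auto simp: vec_eq_iff)
  then show ?thesis using that[of "axis i 1"] True by simp
next
  case False
  then obtain j where j: "p $ j \<noteq> 0" by (auto simp: vec_eq_iff)
  obtain i where "q $ i \<noteq> (q $ j / p $ j) * p $ i"
    using assms[of "q $ j / p $ j"] by (auto simp: vec_eq_iff)
  then have "p $ j * q $ i - p $ i * q $ j \<noteq> 0" using j by (auto simp: field_simps)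
  then show ?thesis
    using that[of "p $ j *s axis i 1 - p $ i *s axis j 1"] by (simp add: ev_diff_left ev_scale_left)
qed

text \<open>In the pencil y + t y' each point of Q excludes at most one value of t.\<close>

lemma linear_form_avoids:
  assumes "finite Q" "\<And>q c. q \<in> Q \<Longrightarrow> q \<noteq> c *s p"
  obtains y where "ev y p = 0" "\<And>q. q \<in> Q \<Longrightarrow> ev y q \<noteq> 0"
proof -
  have "\<exists>y. ev y p = 0 \<and> (\<forall>q\<in>Q. ev y q \<noteq> 0)"
    using assms
  proof (induction Q)
    case empty
    show ?case by (rule exI[of _ 0]) simp
  next
    case (insert q Q)
    then obtain y where y: "ev y p = 0" "\<And>q. q \<in> Q \<Longrightarrow> ev y q \<noteq> 0" by blast
    obtain y' where y': "ev y' p = 0" "ev y' q \<noteq> 0"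
      by (rule linear_form_separates[of q p]) (use insert.prems in \<open>auto intro: that\<close>)
    have "finite (\<Union>r\<in>insert q Q. {t. ev y r + t * ev y' r = 0})"
    proof (intro finite_UN_I)
      fix r assume "r \<in> insert q Q"
      then have "ev y r \<noteq> 0 \<or> ev y' r \<noteq> 0" using y y' by blast
      then have "t = - ev y r / ev y' r" if "ev y r + t * ev y' r = 0" for t
      proof -
        have "ev y' r \<noteq> 0" using \<open>ev y r \<noteq> 0 \<or> ev y' r \<noteq> 0\<close> that by auto
        moreover have "t * ev y' r = - ev y r" using that by (simp add: eq_neg_iff_add_eq_0 add.commute)
        ultimately show ?thesis by (metis nonzero_mult_div_cancel_right)
      qed
      then have "{t. ev y r + t * ev y' r = 0} \<subseteq> {- ev y r / ev y' r}" by blast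
      then show "finite {t. ev y r + t * ev y' r = 0}" by (rule finite_subset) simp
    qed (use insert in auto)
    then obtain t where "t \<notin> (\<Union>r\<in>insert q Q. {t. ev y r + t * ev y' r = 0})"
      using infinite_UNIV_char_0 ex_new_if_finite by blast
    then show ?case using y y'
      by (intro exI[of _ "y + t *s y'"]) (auto simp: ev_add_left ev_scale_left)
  qed
  then show ?thesis using that by blast
qed

section \<open>Tangent spaces and local coordinates\<close>

text \<open>Expansion to first order at p with the remainder in the square of the maximal ideal. The
  polynomial coefficients h become matrix entries in the application of Nakayama's lemma.\<close>

lemma taylor:
  assumes "f \<in> pol"
  obtains c h where "\<And>i j. h i j \<in> pol"
    "\<And>x. f x = f p + ev c (x - p) + (\<Sum>i\<in>UNIV. \<Sum>j\<in>UNIV. (x - p) $ i * (x - p) $ j * h i j x)"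
proof -
  define T where "T f c h \<longleftrightarrow> (\<forall>i j. h i j \<in> pol) \<and>
    (\<forall>x. f x = f p + ev c (x - p) + (\<Sum>i\<in>UNIV. \<Sum>j\<in>UNIV. (x - p) $ i * (x - p) $ j * h i j x))"
    for f :: "complex ^ 'a \<Rightarrow> complex" and c h
  from assms have "\<exists>c h. T f c h"
  proof (induction rule: pol.induct)
    case (const b)
    have "T (\<lambda>x. b) 0 (\<lambda>i j x. 0)" unfolding T_def by (simp add: pol.const)
    then show ?case by blast
  next
    case (coord f k)
    then obtain c h where ch: "T f c h" by blast
    define c' where "c' = p $ k *s c + f p *s axis k 1"
    define h' where "h' i j x = x $ k * h i j x + (if i = k then c $ j else 0)" for i j x
    have "h' i j \<in> pol" for i j
      using ch unfolding h'_def[abs_def] T_def by (intro pol.add pol.coord pol.const) auto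
    moreover have "x $ k * f x = p $ k * f p + ev c' (x - p)
        + (\<Sum>i\<in>UNIV. \<Sum>j\<in>UNIV. (x - p) $ i * (x - p) $ j * h' i j x)" for x
    proof -
      let ?z = "x - p"
      let ?q = "\<Sum>i\<in>UNIV. \<Sum>j\<in>UNIV. ?z $ i * ?z $ j * h i j x"
      have *: "(\<Sum>i\<in>UNIV. \<Sum>j\<in>UNIV. ?z $ i * ?z $ j * (if i = k then c $ j else 0)) = ?z $ k * ev c ?z"
      proof -
        have "(\<Sum>j\<in>UNIV. ?z $ i * ?z $ j * (if i = k then c $ j else 0)) = (if i = k then ?z $ k * ev c ?z else 0)" for i
          by (simp add: ev_def sum_distrib_left mult_ac)
        then show ?thesis by simp
      qed
      have "(\<Sum>i\<in>UNIV. \<Sum>j\<in>UNIV. ?z $ i * ?z $ j * h' i j x) = x $ k * ?q + ?z $ k * ev c ?z"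
        unfolding *[symmetric] h'_def by (simp add: distrib_left sum.distrib sum_distrib_left mult_ac)
      moreover have "f x = f p + ev c ?z + ?q" using ch unfolding T_def by blast
      moreover have "ev c' ?z = p $ k * ev c ?z + f p * ?z $ k"
        by (simp add: c'_def ev_add_left ev_scale_left)
      ultimately show ?thesis by (simp add: algebra_simps)
    qed
    ultimately have "T (\<lambda>x. x $ k * f x) c' h'" unfolding T_def by blast
    then show ?case by blast
  next
    case (add f g)
    then obtain c h c' h' where ch: "T f c h" "T g c' h'" by blast
    have "T (\<lambda>x. f x + g x) (c + c') (\<lambda>i j x. h i j x + h' i j x)"
      unfolding T_def
    proof (intro conjI allI)
      fix x
      let ?z = "x - p"
      have "f x = f p + ev c ?z + (\<Sum>i\<in>UNIV. \<Sum>j\<in>UNIV. ?z $ i * ?z $ j * h i j x)"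
        "g x = g p + ev c' ?z + (\<Sum>i\<in>UNIV. \<Sum>j\<in>UNIV. ?z $ i * ?z $ j * h' i j x)"
        using ch unfolding T_def by blast+
      then show "f x + g x = f p + g p + ev (c + c') ?z
          + (\<Sum>i\<in>UNIV. \<Sum>j\<in>UNIV. ?z $ i * ?z $ j * (h i j x + h' i j x))"
        by (simp add: distrib_left sum.distrib ev_add_left)
    qed (use ch in \<open>auto simp: T_def intro: pol.add\<close>)
    then show ?case by blast
  qed
  then show ?thesis using that unfolding T_def by blast
qed

text \<open>The bridge from the analytic derivative in the definition of \<open>tangent\<close> to
  the algebraic linear part c.\<close>

lemma taylor_deriv:
  assumes h: "\<And>i j. h i j \<in> pol"
    and f: "\<And>x. f x = f p + ev c (x - p) + (\<Sum>i\<in>UNIV. \<Sum>j\<in>UNIV. (x - p) $ i * (x - p) $ j * h i j x)"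
  shows "deriv (\<lambda>t. f (p + t *s v)) 0 = ev c v"
proof -
  have "\<exists>q. \<forall>t. h i j (p + t *s v) = poly q t" for i j by (rule pol_line[OF h])
  then obtain q where q: "\<And>i j t. h i j (p + t *s v) = poly (q i j) t" by metis
  define r where "r = [:f p, ev c v:] + [:0, 0, 1:] * (\<Sum>i\<in>UNIV. \<Sum>j\<in>UNIV. smult (v $ i * v $ j) (q i j))"
  have "f (p + t *s v) = poly r t" for t
    unfolding f[of "p + t *s v"] r_def
    by (simp add: q poly_sum ev_scale sum_distrib_left algebra_simps)
  then have "(\<lambda>t. f (p + t *s v)) = poly r" by blast
  moreover have "poly (pderiv r) 0 = ev c v" by (simp add: r_def pderiv_mult pderiv_pCons pderiv_add)
  ultimately show ?thesis using DERIV_imp_deriv[OF poly_DERIV[of r 0]] by simp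
qed

text \<open>The linear parts at p of the polynomials vanishing on S, i.e. the conormal space of the
  affine cone. The second-order remainder is kept because it is needed to generate the maximal
  ideal.\<close>

definition gradients :: "(complex ^ 'n) set \<Rightarrow> complex ^ 'n \<Rightarrow> (complex ^ 'n) set" where
  "gradients S p = {c. \<exists>f\<in>pol. (\<forall>x\<in>S. f x = 0) \<and> (\<exists>h. (\<forall>i j. h i j \<in> pol) \<and>
     (\<forall>x. f x = f p + ev c (x - p) + (\<Sum>i\<in>UNIV. \<Sum>j\<in>UNIV. (x - p) $ i * (x - p) $ j * h i j x)))}"

text \<open>Double annihilator: a vector z outside G is separated from G by a functional that is 1
  at z and 0 on a basis of G.\<close>

lemma annihilator_span:
  fixes G :: "(complex ^ 'n) set"
  assumes G: "vec.subspace G" and z: "\<And>v. (\<And>c. c \<in> G \<Longrightarrow> ev c v = 0) \<Longrightarrow> ev z v = 0"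
  shows "z \<in> G"
proof (rule ccontr)
  assume zG: "z \<notin> G"
  obtain B where B: "B \<subseteq> G" "vec.independent B" "G \<subseteq> vec.span B"
    using vec.maximal_independent_subset[of G] by blast
  have "z \<notin> vec.span B" using zG B(1) vec.span_minimal[OF _ G] by blast
  then have "vec.independent (insert z B)" using B(2) by (rule vec.independent_insertI)
  then obtain g where g: "Vector_Spaces.linear (*s) (*s) g"
    "\<forall>b\<in>insert z B. g b = (if b = z then 1 else 0 :: complex ^ 'n)"
    using vec.linear_independent_extend[of "insert z B" "\<lambda>b. if b = z then 1 else 0"] by blast
  interpret g: Vector_Spaces.linear "(*s)" "(*s)" g by (rule g(1))
  \<comment> \<open>The extension lemma yields a vector-valued map; one arbitrary coordinate of its
    value serves as the scalar functional.\<close>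
  define \<phi> where "\<phi> x = g x $ undefined" for x
  define v where "v = (\<chi> i. \<phi> (axis i 1))"
  have ev\<phi>: "ev c v = \<phi> c" for c
  proof -
    have "\<phi> c = \<phi> (\<Sum>i\<in>UNIV. c $ i *s axis i 1)" by (simp add: basis_expansion)
    also have "\<dots> = (\<Sum>i\<in>UNIV. c $ i * \<phi> (axis i 1))" by (simp add: \<phi>_def g.sum g.scale)
    finally show ?thesis by (simp add: ev_def v_def)
  qed
  have \<phi>B: "\<phi> b = 0" if "b \<in> B" for b
    using g(2) that \<open>z \<notin> vec.span B\<close> vec.span_base by (auto simp: \<phi>_def)
  have "\<phi> c = 0" if "c \<in> vec.span B" for c using that
    by (induction rule: vec.span_induct_alt) (use \<phi>B in \<open>auto simp: \<phi>_def g.add g.scale g.zero\<close>)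
  then have "ev z v = 0" using B(3) ev\<phi> by (intro z) auto
  then show False using ev\<phi> g(2) by (simp add: \<phi>_def)
qed
lemma gradientsI:
  assumes "f \<in> pol" "\<And>x. x \<in> S \<Longrightarrow> f x = 0" "\<And>i j. h i j \<in> pol"
    "\<And>x. f x = f p + ev c (x - p) + (\<Sum>i\<in>UNIV. \<Sum>j\<in>UNIV. (x - p) $ i * (x - p) $ j * h i j x)"
  shows "c \<in> gradients S p"
  unfolding gradients_def
  by (rule CollectI, rule bexI[of _ f], rule conjI, rule ballI, rule assms(2), assumption,
      rule exI[of _ h], rule conjI, rule allI, rule allI, rule assms(3), rule allI, rule assms(4), rule assms(1))

lemma gradientsE:
  assumes "c \<in> gradients S p"
  obtains f h where "f \<in> pol" "\<And>x. x \<in> S \<Longrightarrow> f x = 0" "\<And>i j. h i j \<in> pol"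
    "\<And>x. f x = f p + ev c (x - p) + (\<Sum>i\<in>UNIV. \<Sum>j\<in>UNIV. (x - p) $ i * (x - p) $ j * h i j x)"
proof -
  from assms obtain f h where "f \<in> pol" "\<forall>x\<in>S. f x = 0" "\<forall>i j. h i j \<in> pol"
      "\<forall>x. f x = f p + ev c (x - p) + (\<Sum>i\<in>UNIV. \<Sum>j\<in>UNIV. (x - p) $ i * (x - p) $ j * h i j x)"
    unfolding gradients_def by (elim CollectE bexE exE conjE)
  note * = this
  show ?thesis by (rule that[OF *(1) bspec[OF *(2)] spec[OF spec[OF *(3)]] spec[OF *(4)]])
qed

lemma subspace_gradients: "vec.subspace (gradients S p)"
proof (rule vec.subspaceI)
  show "0 \<in> gradients S p"
    by (rule gradientsI[of "\<lambda>x. 0" _ "\<lambda>i j x. 0"]) (simp_all add: pol.const)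
next
  fix c c' assume c: "c \<in> gradients S p" and c': "c' \<in> gradients S p"
  obtain f h where f: "f \<in> pol" "\<And>x. x \<in> S \<Longrightarrow> f x = 0" "\<And>i j. h i j \<in> pol"
      "\<And>x. f x = f p + ev c (x - p) + (\<Sum>i\<in>UNIV. \<Sum>j\<in>UNIV. (x - p) $ i * (x - p) $ j * h i j x)"
    by (rule gradientsE[OF c]) (rule that)
  obtain f' h' where f': "f' \<in> pol" "\<And>x. x \<in> S \<Longrightarrow> f' x = 0" "\<And>i j. h' i j \<in> pol"
      "\<And>x. f' x = f' p + ev c' (x - p) + (\<Sum>i\<in>UNIV. \<Sum>j\<in>UNIV. (x - p) $ i * (x - p) $ j * h' i j x)"
    by (rule gradientsE[OF c']) (rule that)
  show "c + c' \<in> gradients S p"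
  proof (rule gradientsI[of "\<lambda>x. f x + f' x" _ "\<lambda>i j x. h i j x + h' i j x"])
    show "f x + f' x = f p + f' p + ev (c + c') (x - p)
        + (\<Sum>i\<in>UNIV. \<Sum>j\<in>UNIV. (x - p) $ i * (x - p) $ j * (h i j x + h' i j x))" for x
      by (subst f(4), subst f'(4)) (simp add: distrib_left sum.distrib ev_add_left)
    show "f x + f' x = 0" if "x \<in> S" for x using f(2)[OF that] f'(2)[OF that] by simp
  qed (intro pol.add f f')+
next
  fix a c assume c: "c \<in> gradients S p"
  obtain f h where f: "f \<in> pol" "\<And>x. x \<in> S \<Longrightarrow> f x = 0" "\<And>i j. h i j \<in> pol"
      "\<And>x. f x = f p + ev c (x - p) + (\<Sum>i\<in>UNIV. \<Sum>j\<in>UNIV. (x - p) $ i * (x - p) $ j * h i j x)"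
    by (rule gradientsE[OF c]) (rule that)
  show "a *s c \<in> gradients S p"
  proof (rule gradientsI[of "\<lambda>x. a * f x" _ "\<lambda>i j x. a * h i j x"])
    show "a * f x = a * f p + ev (a *s c) (x - p)
        + (\<Sum>i\<in>UNIV. \<Sum>j\<in>UNIV. (x - p) $ i * (x - p) $ j * (a * h i j x))" for x
      by (subst f(4)) (simp add: algebra_simps sum_distrib_left ev_scale_left)
    show "a * f x = 0" if "x \<in> S" for x using f(2)[OF that] by simp
  qed (intro pol_cmult f)+
qed

lemma form_gradient:
  assumes "f \<in> ideal_deg S d"
  obtains c where "c \<in> gradients S p" "\<And>v. deriv (\<lambda>t. f (p + t *s v)) 0 = ev c v"
proof -
  have f: "hform d f" "\<And>x. x \<in> S \<Longrightarrow> f x = 0" using assms unfolding ideal_deg_def by blast+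
  obtain c h where ch: "\<And>i j. h i j \<in> pol"
    "\<And>x. f x = f p + ev c (x - p) + (\<Sum>i\<in>UNIV. \<Sum>j\<in>UNIV. (x - p) $ i * (x - p) $ j * h i j x)"
    by (rule taylor[OF hform_pol[OF f(1)], of p]) (rule that)
  have "c \<in> gradients S p" by (rule gradientsI[OF hform_pol[OF f(1)] f(2) ch])
  then show ?thesis by (rule that) (rule taylor_deriv[OF ch])
qed

lemma annihilator_tangent:
  assumes "\<And>v. v \<in> tangent S p \<Longrightarrow> ev z v = 0" shows "z \<in> gradients S p"
proof (rule annihilator_span[OF subspace_gradients])
  fix v assume v: "\<And>c. c \<in> gradients S p \<Longrightarrow> ev c v = 0"
  have "v \<in> tangent S p" unfolding tangent_def
  proof (intro CollectI allI ballI)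
    fix d f assume "f \<in> ideal_deg S d"
    then obtain c where "c \<in> gradients S p" "\<And>v. deriv (\<lambda>t. f (p + t *s v)) 0 = ev c v"
      by (rule form_gradient) (rule that)
    then show "deriv (\<lambda>t. f (p + t *s v)) 0 = 0" using v by simp
  qed
  then show "ev z v = 0" by (rule assms)
qed

lemma subspace_tangent: "vec.subspace (tangent (S :: (complex ^ 'n) set) p)"
proof -
  define D where "D f v = deriv (\<lambda>t. f (p + t *s v)) 0" for f :: "complex ^ 'n \<Rightarrow> complex" and v
  have D: "\<exists>c. \<forall>v. D f v = ev c v" if "f \<in> ideal_deg S d" for f d
    by (rule form_gradient[OF that, of p]) (auto simp: D_def)
  have lin: "D f 0 = 0" "D f (a *s v) = a * D f v" "D f (v + w) = D f v + D f w"
    if "f \<in> ideal_deg S d" for f d a v w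
    using D[OF that] by (auto simp: ev_scale ev_add)
  have "vec.subspace {v. \<forall>d. \<forall>f\<in>ideal_deg S d. D f v = 0}"
    by (rule vec.subspaceI) (use lin in simp_all)
  then show ?thesis unfolding tangent_def D_def .
qed

lemma tangent_self:
  assumes "p \<in> S" shows "p \<in> tangent S p"
  unfolding tangent_def
proof (intro CollectI allI ballI)
  fix d f assume f: "f \<in> ideal_deg S d"
  have "f (p + t *s p) = 0" for t
  proof -
    have "p + t *s p = (1 + t) *s p" by (simp add: vec_eq_iff algebra_simps)
    then have "f (p + t *s p) = (1 + t) ^ d * f p"
      using f unfolding ideal_deg_def by (metis (mono_tags) hform_scale mem_Collect_eq)
    moreover have "f p = 0" using f assms unfolding ideal_deg_def by blast
    ultimately show ?thesis by simp
  qed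
  then show "deriv (\<lambda>t. f (p + t *s p)) 0 = 0" by simp
qed

lemma has_chain_3:
  assumes "pvariety A" "pvariety B" "pvariety C" "pvariety D" "A \<subset> B" "B \<subset> C" "C \<subset> D" "D \<subseteq> X"
  shows "has_chain X 3"
proof -
  define Y where "Y i = (if i = 0 then A else if i = 1 then B else if i = 2 then C else D)" for i :: nat
  have "pvariety (Y i) \<and> Y i \<subseteq> X" for i using assms by (auto simp: Y_def)
  moreover have "Y i \<subset> Y (Suc i)" if "i < 3" for i
    using that assms(5-7) by (auto simp: Y_def numeral_3_eq_3 less_Suc_eq)
  ultimately show ?thesis unfolding has_chain_def by blast
qed

text \<open>One triple of forms plays two roles. On the tangent space of the cone at p the three
  forms are independent, so they span all differentials; and they have no common zero on S, so the
  chart of y0 is finite over the plane. The second role is secured by a general choice of y2 and y0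
  relative to the components of the successive sections.\<close>

lemma local_coordinates:
  fixes S :: "(complex ^ 'n) set"
  assumes S: "smooth_variety S 2" and p: "p \<in> S"
  obtains y0 y1 y2 where "ev y0 p = 1" "ev y1 p = 0" "ev y2 p = 0"
    "\<And>x. x \<in> S \<Longrightarrow> ev y0 x \<noteq> 0 \<or> ev y1 x \<noteq> 0 \<or> ev y2 x \<noteq> 0"
    "\<And>z. \<exists>a0 a1 a2. z - a0 *s y0 - a1 *s y1 - a2 *s y2 \<in> gradients S p"
proof -
  let ?T = "tangent S p"
  have SV: "pvariety S" and dimT: "vec.dim ?T = 3" and chain: "\<not> has_chain S 3"
    using S p unfolding smooth_variety_def has_pdim_def by force+
  have p0: "p \<noteq> 0" using p pclosed_nonzero[OF pvariety_closed[OF SV]] by blast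
  obtain B where B: "{p} \<subseteq> B" "B \<subseteq> ?T" "vec.independent B" "?T \<subseteq> vec.span B"
    using vec.maximal_independent_subset_extend[of "{p}" ?T] tangent_self[OF p] p0
    by (auto simp: vec.dependent_single)
  have "card B = 3" using vec.basis_card_eq_dim[OF B(2,4,3)] dimT by simp
  then have "card (B - {p}) = 2" using B(1) by (simp add: card_Diff_singleton)
  then obtain v1 v2 where v: "B - {p} = {v1, v2}" "v1 \<noteq> v2" by (auto simp: card_2_iff)
  have Bv: "B = {p, v1, v2}" "p \<noteq> v1" "p \<noteq> v2" using v B(1) by auto
  have "B = insert v2 (insert v1 {p})" using Bv(1) by blast
  then have "vec.independent (insert v1 {p}) \<and> v2 \<notin> vec.span (insert v1 {p})"
    using B(3) v(2) Bv(3) by (metis vec.independent_insert insertE singletonD)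
  then have indep: "v1 \<notin> vec.span {p}" "v2 \<notin> vec.span {p, v1}"
    using Bv(2) vec.independent_insert[of v1 "{p}"] by (auto simp: insert_commute)
  have v1p: "v1 \<noteq> c *s p" for c using indep(1) vec.span_scale[OF vec.span_base, of p "{p}" c] by auto
  obtain y1 where y1: "ev y1 p = 0" "ev y1 v1 \<noteq> 0"
    by (rule linear_form_separates[OF v1p]) (rule that)
  \<comment> \<open>A tangent vector independent of p on which y1 vanishes; asking that y2 w is
    nonzero makes y1 and y2 independent modulo the line of p.\<close>
  define w where "w = v2 - (ev y1 v2 / ev y1 v1) *s v1"
  have w1: "ev y1 w = 0" using y1 by (simp add: w_def ev_diff ev_scale)
  have wp: "w \<noteq> c *s p" for c
  proof
    assume "w = c *s p"
    then have "v2 = c *s p + (ev y1 v2 / ev y1 v1) *s v1" by (simp add: w_def algebra_simps)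
    also have "\<dots> \<in> vec.span {p, v1}" by (intro vec.span_add vec.span_scale vec.span_base) auto
    finally show False using indep(2) by simp
  qed
  have vT: "v1 \<in> ?T" "w \<in> ?T" unfolding w_def
    using B(2) Bv by (auto intro!: vec.subspace_diff[OF subspace_tangent] vec.subspace_scale[OF subspace_tangent])
  obtain b where b: "b \<in> S" "ev y1 b \<noteq> 0"
  proof (rule ccontr)
    assume "\<not> thesis"
    then have "\<forall>x\<in>S. ev y1 x = 0" using that by blast
    then have "ev y1 \<in> ideal_deg S 1"
      unfolding ideal_deg_def by (rule_tac CollectI, rule_tac conjI[OF hform_ev])
    from vT(1)[unfolded tangent_def mem_Collect_eq, THEN spec, THEN bspec, OF this]
    have "deriv (\<lambda>t. ev y1 (p + t *s v1)) 0 = 0" .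
    moreover have "(\<lambda>t. ev y1 (p + t *s v1)) = (\<lambda>t. t * ev y1 v1)" by (simp add: ev_add ev_scale y1)
    ultimately show False using y1(2) by simp
  qed
  define Z where "Z = S \<inter> {x. x \<noteq> 0 \<and> ev y1 x = 0}"
  have Zc: "pclosed Z" unfolding Z_def
    by (intro pclosed_Int pvariety_closed[OF SV] pclosed_form[OF hform_ev])
  obtain \<C> where C: "finite \<C>" "\<And>C. C \<in> \<C> \<Longrightarrow> pvariety C" "Z = \<Union>\<C>"
    by (rule irreducible_components[OF Zc]) (rule that)
  define q where "q C = (SOME q. q \<in> C - point p)" for C
  have q: "q C \<in> C - point p" if "\<not> C \<subseteq> point p" for C
    unfolding q_def some_in_eq using that by simp
  \<comment> \<open>The points that y2 has to avoid: besides w, one point on each component of the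
    section by y1 that is not just p.\<close>
  define Q where "Q = insert w (q ` {C\<in>\<C>. \<not> C \<subseteq> point p})"
  have "r \<noteq> c *s p" if rQ: "r \<in> Q" for r c
  proof (cases "r = w")
    case False
    then obtain C where C': "C \<in> \<C>" "\<not> C \<subseteq> point p" "r = q C" using rQ unfolding Q_def by auto
    have "r \<in> C" "r \<notin> point p" using q[OF C'(2)] C'(3) by auto
    note C' = C'(1) this
    have "r \<noteq> 0" by (rule pclosed_nonzero[OF pvariety_closed[OF C(2)[OF C'(1)]] C'(2)])
    then show ?thesis using C'(3) unfolding point_def by (cases "c = 0") auto
  qed (simp add: wp)
  have "finite Q" using C(1) by (simp add: Q_def)
  note Qp = \<open>\<And>r c. r \<in> Q \<Longrightarrow> r \<noteq> c *s p\<close> this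
  obtain y2 where y2: "ev y2 p = 0" "\<And>r. r \<in> Q \<Longrightarrow> ev y2 r \<noteq> 0"
    by (rule linear_form_avoids[OF Qp(2) Qp(1)]) (assumption, rule that)
  define Z2 where "Z2 = Z \<inter> {x. x \<noteq> 0 \<and> ev y2 x = 0}"
  have Z2c: "pclosed Z2" unfolding Z2_def by (intro pclosed_Int Zc pclosed_form[OF hform_ev])
  obtain \<D> where D: "finite \<D>" "\<And>D. D \<in> \<D> \<Longrightarrow> pvariety D" "Z2 = \<Union>\<D>"
    by (rule irreducible_components[OF Z2c]) (rule that)
  \<comment> \<open>The common zeros of y1 and y2 on S are finitely many points: a larger component
    D would give the chain point a, D, C', S, although S has dimension 2.\<close>
  have pt: "D \<subseteq> point a" if DD: "D \<in> \<D>" and a: "a \<in> D" for D a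
  proof (rule ccontr)
    assume nD: "\<not> D \<subseteq> point a"
    have DV: "pvariety D" by (rule D(2)[OF DD])
    have aD: "point a \<subset> D" using point_subset[OF pvariety_closed[OF DV] a] nD by blast
    have DC: "D \<subseteq> \<Union>\<C>" using DD D(3) C(3) Z2_def by blast
    obtain C' where C': "C' \<in> \<C>" "D \<subseteq> C'"
      by (rule pvariety_subset_component[OF C(1) pvariety_closed[OF C(2)] DV DC]) (assumption, rule that)
    have "\<not> C' \<subseteq> point p"
    proof
      assume "C' \<subseteq> point p"
      then have "D \<subseteq> point p" using C'(2) by blast
      moreover from this have "point a = point p" using a by (intro point_eq) blast
      ultimately show False using nD by simp
    qed
    then have "q C' \<in> C'" "q C' \<in> Q" using q[of C'] C'(1) unfolding Q_def by auto
    have "q C' \<notin> D" using y2(2)[OF \<open>q C' \<in> Q\<close>] DD D(3) unfolding Z2_def by auto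
    then have DC: "D \<subset> C'" using C'(2) \<open>q C' \<in> C'\<close> by blast
    have "C' \<subset> S" using C' C(3) b unfolding Z_def by blast
    moreover have "a \<noteq> 0" using a pclosed_nonzero[OF pvariety_closed[OF DV]] by blast
    ultimately have "has_chain S 3"
      using has_chain_3[OF pvariety_point DV C(2)[OF C'(1)] SV aD DC] by blast
    then show False using chain by blast
  qed
  define e where "e D = (SOME a. a \<in> D)" for D :: "(complex ^ 'n) set"
  have e: "e D \<in> D" if "D \<in> \<D>" for D
    unfolding e_def using pvariety_nonempty[OF D(2)[OF that]] by (simp add: some_in_eq)
  define Q0 where "Q0 = insert p (e ` \<D>)"
  have "r \<noteq> c *s 0" if "r \<in> Q0" for r c
  proof -
    have "e D' \<noteq> 0" if "D' \<in> \<D>" for D'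
      by (rule pclosed_nonzero[OF pvariety_closed[OF D(2)[OF that]] e[OF that]])
    then show ?thesis using that p0 unfolding Q0_def by auto
  qed
  have "finite Q0" using D(1) by (simp add: Q0_def)
  note Q0p = \<open>\<And>r c. r \<in> Q0 \<Longrightarrow> r \<noteq> c *s 0\<close> this
  \<comment> \<open>Avoiding the multiples of the zero vector only means being nonzero at all points
    of Q0.\<close>
  obtain y where y: "\<And>r. r \<in> Q0 \<Longrightarrow> ev y r \<noteq> 0"
    by (rule linear_form_avoids[OF Q0p(2) Q0p(1)]) (assumption, rule that)
  have yp: "ev y p \<noteq> 0" using y by (simp add: Q0_def)
  define y0 where "y0 = (1 / ev y p) *s y"
  show ?thesis
  proof (rule that[of y0 y1 y2])
    show y0p: "ev y0 p = 1" using yp by (simp add: y0_def ev_scale_left)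
    show "ev y0 x \<noteq> 0 \<or> ev y1 x \<noteq> 0 \<or> ev y2 x \<noteq> 0" if x: "x \<in> S" for x
    proof (rule ccontr)
      assume n: "\<not> (ev y0 x \<noteq> 0 \<or> ev y1 x \<noteq> 0 \<or> ev y2 x \<noteq> 0)"
      have "x \<noteq> 0" using x pclosed_nonzero[OF pvariety_closed[OF SV]] by blast
      then have "x \<in> Z2" using n x unfolding Z2_def Z_def by blast
      then obtain D' where D': "D' \<in> \<D>" "x \<in> D'" using D(3) by blast
      then obtain c where c: "x = c *s e D'" "c \<noteq> 0" using pt[OF D'(1) e[OF D'(1)]] unfolding point_def by blast
      have "ev y (e D') \<noteq> 0" using y D'(1) unfolding Q0_def by blast
      then show False using n c yp by (simp add: y0_def ev_scale_left ev_scale)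
    qed
    show "\<exists>a0 a1 a2. z - a0 *s y0 - a1 *s y1 - a2 *s y2 \<in> gradients S p" for z
    proof -
      have y2w: "ev y2 w \<noteq> 0" using y2(2) by (simp add: Q_def)
      \<comment> \<open>The system for the coefficients is triangular with respect to p, w, v1: y1
        vanishes at p and w, and y2 vanishes at p.\<close>
      define a0 where "a0 = ev z p"
      define a2 where "a2 = (ev z w - a0 * ev y0 w) / ev y2 w"
      define a1 where "a1 = (ev z v1 - a0 * ev y0 v1 - a2 * ev y2 v1) / ev y1 v1"
      let ?z = "z - a0 *s y0 - a1 *s y1 - a2 *s y2"
      have zz: "ev ?z x = ev z x - a0 * ev y0 x - a1 * ev y1 x - a2 * ev y2 x" for x
        by (simp add: ev_diff_left ev_scale_left)
      have zp: "ev ?z p = 0" unfolding zz by (simp add: y0p y1 y2 a0_def)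
      have zw: "ev ?z w = 0" unfolding zz using y2w by (simp add: w1 a2_def)
      have z1: "ev ?z v1 = 0" unfolding zz using y1 by (simp add: a1_def)
      have "v2 = w + (ev y1 v2 / ev y1 v1) *s v1" by (simp add: w_def)
      then have z2: "ev ?z v2 = 0" by (metis ev_add ev_scale zw z1 add_0 mult_zero_right)
      have "ev ?z x = 0" if "x \<in> vec.span B" for x using that
        by (induction rule: vec.span_induct_alt) (auto simp: ev_add ev_scale Bv(1) zp z1 z2)
      then have "?z \<in> gradients S p" using B(4) by (intro annihilator_tangent) blast
      then show ?thesis by blast
    qed
  qed (use y1 y2 in auto)
qed

section \<open>Affine slices\<close>

text \<open>The affine chart of S where y is nonzero, realized inside the cone by the normalization
  y = 1. Its regular functions are restrictions of polynomials.\<close>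

definition slice :: "(complex ^ 'n) set \<Rightarrow> complex ^ 'n \<Rightarrow> (complex ^ 'n) set" where
  "slice S y = {x\<in>S. ev y x = 1}"

lemma slice_scale:
  assumes "pclosed S" "x \<in> S" "ev y x \<noteq> 0"
  shows "(1 / ev y x) *s x \<in> slice S y" "x = ev y x *s ((1 / ev y x) *s x)"
  using assms pclosed_scale[OF assms(1,2), of "1 / ev y x"]
  by (auto simp: slice_def ev_scale vec_eq_iff)

lemma slice_form_zero:
  assumes S: "pvariety S" and f: "hform d f" and p: "p \<in> S" "ev y p \<noteq> 0"
    and 0: "\<And>x. x \<in> slice S y \<Longrightarrow> f x = 0" and x: "x \<in> S"
  shows "f x = 0"
proof (rule pvariety_domain[OF S hform_ev f _ p x])
  fix z assume z: "z \<in> S"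
  show "ev y z * f z = 0"
  proof (cases "ev y z = 0")
    case False
    note s = slice_scale[OF pvariety_closed[OF S] z False]
    have "f z = ev y z ^ d * f ((1 / ev y z) *s z)" using hform_scale[OF f] s(2) by metis
    then show ?thesis using 0[OF s(1)] by simp
  qed simp
qed

text \<open>All degrees from D on are offered so that several polynomials can be homogenized to a
  common degree.\<close>

lemma homogenize:
  assumes "f \<in> pol"
  obtains D where "\<And>d. d \<ge> D \<Longrightarrow> \<exists>g. hform d g \<and> (\<forall>x. ev y x = 1 \<longrightarrow> g x = f x)"
proof -
  obtain M h where h: "\<And>d. hform d (h d)" "\<And>x. f x = (\<Sum>d<M. h d x)"
    by (rule pol_decomp[OF assms]) (rule that)
  have "\<exists>g. hform d g \<and> (\<forall>x. ev y x = 1 \<longrightarrow> g x = f x)" if "d \<ge> M" for d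
  proof (intro exI[of _ "\<lambda>x. \<Sum>e<M. ev y x ^ (d - e) * h e x"] conjI allI impI)
    show "hform d (\<lambda>x. \<Sum>e<M. ev y x ^ (d - e) * h e x)"
    proof (rule hform_sum)
      fix e assume "e \<in> {..<M}"
      then have "(d - e) + e = d" using that by simp
      moreover have "hform ((d - e) + e) (\<lambda>x. ev y x ^ (d - e) * h e x)"
        by (intro hform_mult hform_ev_power h)
      ultimately show "hform d (\<lambda>x. ev y x ^ (d - e) * h e x)" by simp
    qed
  qed (simp add: h(2))
  then show ?thesis by (rule that)
qed

lemma slice_domain:
  assumes S: "pvariety S" and p: "p \<in> S" "ev y p \<noteq> 0" and f: "f \<in> pol" and g: "g \<in> pol"
    and fg: "\<And>x. x \<in> slice S y \<Longrightarrow> f x * g x = 0" and a: "a \<in> slice S y" "f a \<noteq> 0"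
    and b: "b \<in> slice S y"
  shows "g b = 0"
proof -
  obtain D where "\<And>d. d \<ge> D \<Longrightarrow> \<exists>h. hform d h \<and> (\<forall>x. ev y x = 1 \<longrightarrow> h x = f x)"
    by (rule homogenize[OF f]) (rule that)
  then obtain F where F: "hform D F" "\<And>x. ev y x = 1 \<Longrightarrow> F x = f x" by blast
  obtain E where "\<And>d. d \<ge> E \<Longrightarrow> \<exists>h. hform d h \<and> (\<forall>x. ev y x = 1 \<longrightarrow> h x = g x)"
    by (rule homogenize[OF g]) (rule that)
  then obtain G where G: "hform E G" "\<And>x. ev y x = 1 \<Longrightarrow> G x = g x" by blast
  have 1: "ev y x = 1" if "x \<in> slice S y" for x using that by (simp add: slice_def)
  have FG: "F x * G x = 0" if "x \<in> S" for x
  proof (rule slice_form_zero[OF S hform_mult[OF F(1) G(1)] p _ that])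
    show "F x * G x = 0" if "x \<in> slice S y" for x using fg[OF that] 1[OF that] F(2) G(2) by simp
  qed
  have "G b = 0"
    using a b F(2)[OF 1[OF a(1)]]
    by (intro pvariety_domain[OF S F(1) G(1) FG, of a]) (auto simp: slice_def)
  then show ?thesis using G(2)[OF 1[OF b]] by simp
qed

section \<open>Noether normalization\<close>

text \<open>If the linear forms \<open>y, ys\<close> have no common zero on \<open>S\<close>, then every form of degree \<open>\<ge> D\<close> lies in
  the ideal they generate modulo \<open>I_S\<close>; so the monomials of degree \<open>< D\<close> generate the coordinate
  ring of the slice as a module over any ring of functions \<open>C\<close> containing \<open>ys\<close>.\<close>

lemma slice_finite_module:
  fixes S :: "(complex ^ 'n) set"
  assumes S: "pclosed S" and ys: "\<And>x. x \<in> S \<Longrightarrow> ev y x \<noteq> 0 \<or> (\<exists>z\<in>Y. ev z x \<noteq> 0)"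
    and C: "subring C" "\<And>c. (\<lambda>x. c) \<in> C" "\<And>z. z \<in> Y \<Longrightarrow> ev z \<in> C"
  obtains b r where "\<And>j. j < r \<Longrightarrow> b j \<in> pol"
    "\<And>f. f \<in> pol \<Longrightarrow> \<exists>c. (\<forall>j. c j \<in> C) \<and> (\<forall>x\<in>slice S y. f x = (\<Sum>j<r::nat. c j x * b j x))"
proof -
  define F where "F = {f. \<exists>d. hform d f \<and> (\<forall>x\<in>S. f x = 0)} \<union> ev ` insert y Y"
  have F: "\<exists>d. hform d f" if "f \<in> F" for f using that hform_ev unfolding F_def by blast
  have nz: "x = 0" if x: "\<And>f. f \<in> F \<Longrightarrow> f x = 0" for x
  proof (rule ccontr)
    assume x0: "x \<noteq> 0"
    have "x \<in> S"
    proof (rule ccontr)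
      assume "x \<notin> S"
      with x0 obtain d f where "hform d f" "\<And>z. z \<in> S \<Longrightarrow> f z = 0" "f x \<noteq> 0"
        by (rule pclosedD[OF S]) (rule that)
      then show False using x[of f] unfolding F_def by blast
    qed
    moreover have "ev z x = 0" if "z \<in> insert y Y" for z using x[of "ev z"] that unfolding F_def by blast
    ultimately show False using ys by blast
  qed
  obtain D where D: "\<And>d f. d \<ge> D \<Longrightarrow> hform d f \<Longrightarrow> hid F d f"
    by (rule projective_nullstellensatz[of F, OF F nz]) (assumption, blast, rule that)
  define B where "B = (\<Union>d<D. monomials d :: (complex ^ 'n \<Rightarrow> complex) set)"
  have "finite B" unfolding B_def by (intro finite_UN_I finite_monomials) auto
  then obtain b r where b: "B = b ` {..<r::nat}" "inj_on b {..<r}"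
    using finite_imp_nat_seg_image_inj_on[of B] by (auto simp: lessThan_def)
  define good where "good f \<longleftrightarrow> (\<exists>c. (\<forall>j. c j \<in> C) \<and> (\<forall>x\<in>slice S y. f x = (\<Sum>j<r. c j x * b j x)))" for f
  have good0: "good (\<lambda>x. 0)" unfolding good_def
    by (rule exI[of _ "\<lambda>j x. 0"]) (simp add: C)
  have good_add: "good (\<lambda>x. f x + g x)" if fg: "good f" "good g" for f g
  proof -
    obtain c where c: "\<forall>j. c j \<in> C" "\<forall>x\<in>slice S y. f x = (\<Sum>j<r. c j x * b j x)"
      using fg(1) unfolding good_def by (elim exE conjE)
    obtain c' where c': "\<forall>j. c' j \<in> C" "\<forall>x\<in>slice S y. g x = (\<Sum>j<r. c' j x * b j x)"
      using fg(2) unfolding good_def by (elim exE conjE)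
    have "\<forall>j. c j + c' j \<in> C" using c(1) c'(1) subringD(4)[OF C(1)] by simp
    moreover have "f x + g x = (\<Sum>j<r. (c j + c' j) x * b j x)" if "x \<in> slice S y" for x
      using bspec[OF c(2) that] bspec[OF c'(2) that] by (simp add: distrib_right sum.distrib)
    ultimately show ?thesis unfolding good_def by (intro exI[of _ "\<lambda>j. c j + c' j"]) simp
  qed
  have good_mult: "good (\<lambda>x. a x * f x)" if a: "a \<in> C" and f: "good f" for a f
  proof -
    obtain c where c: "\<forall>j. c j \<in> C" "\<forall>x\<in>slice S y. f x = (\<Sum>j<r. c j x * b j x)"
      using f unfolding good_def by (elim exE conjE)
    have "\<forall>j. a * c j \<in> C" using a c(1) subringD(6)[OF C(1)] by simp
    moreover have "a x * f x = (\<Sum>j<r. (a * c j) x * b j x)" if "x \<in> slice S y" for x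
      using bspec[OF c(2) that] by (simp add: sum_distrib_left mult.assoc)
    ultimately show ?thesis unfolding good_def by (intro exI[of _ "\<lambda>j. a * c j"]) simp
  qed
  have good_cong: "good g" if f: "good f" and fg: "\<And>x. x \<in> slice S y \<Longrightarrow> g x = f x" for f g
    using f unfolding good_def by (metis fg)
  have good_b: "good f" if f: "f \<in> B" for f
  proof -
    obtain i where i: "i < r" "f = b i" using f b by blast
    show ?thesis unfolding good_def
    proof (intro exI[of _ "\<lambda>j x. if j = i then 1 else 0"] conjI allI ballI)
      show "(\<lambda>x. if j = i then 1 else 0) \<in> C" for j using C(2) by (cases "j = i") simp_all
      show "f x = (\<Sum>j<r. (if j = i then 1 else 0) * b j x)" for x
        using i by (simp add: if_distrib[of "\<lambda>c. c * _"] cong: if_cong)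
    qed
  qed
  have goodform: "good f" if "hform d f" for d f using that
  proof (induction d arbitrary: f rule: less_induct)
    case (less d)
    show ?case
    proof (cases "d < D")
      case True
      from hform_span_monomials[OF less.prems] show ?thesis
      proof (induction rule: fv.span_induct_alt)
        case base
        show ?case using good0 by (simp add: zero_fun_def)
      next
        case (step c g h)
        have "g \<in> B" using step.hyps(1) True unfolding B_def by blast
        then have "good (\<lambda>x. (\<lambda>x. c) x * g x)" by (intro good_mult C(2) good_b)
        then have "good (\<lambda>x. c * g x + h x)" using good_add step.IH by simp
        then show ?case by (simp add: plus_fun_def)
      qed
    next
      case False
      \<comment> \<open>The form is a combination of y and Y modulo the ideal of S. On the slice y
        is 1, and the forms in Y belong to C, so the claim for the cofactors, which have smaller
        degree, is enough.\<close>
      then have "hid F d f" using D less.prems by simp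
      then show ?thesis using less.IH
      proof (induction rule: hid.induct)
        case (hid_step e a f e' g)
        have g: "good g" by (rule hid_step.IH) (rule hid_step.prems)
        consider "\<forall>x\<in>S. f x = 0" | z where "z \<in> insert y Y" "f = ev z"
          using hid_step.hyps(2) unfolding F_def by blast
        then show ?case
        proof cases
          case 1
          then show ?thesis by (intro good_cong[OF g]) (auto simp: slice_def)
        next
          case 2
          show ?thesis
          proof (cases "\<exists>x. f x \<noteq> 0")
            case True
            then have "e' = 1" using hform_degree_unique[OF hid_step.hyps(3) hform_ev[of z, folded 2(2)]] by blast
            then have a: "good a" using hid_step.prems[of e a] hid_step.hyps(1) by simp
            have "good (\<lambda>x. a x * f x)"
            proof (cases "z = y")
              case True
              then show ?thesis using 2(2) by (intro good_cong[OF a]) (simp add: slice_def)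
            next
              case False
              then have "f \<in> C" using 2 C(3) by simp
              from good_mult[OF this a] show ?thesis by (simp add: mult.commute)
            qed
            then show ?thesis by (intro good_add g)
          next
            case False
            then show ?thesis by (intro good_cong[OF g]) simp
          qed
        qed
      qed (rule good0)
    qed
  qed
  have "good f" if "f \<in> pol" for f
  proof -
    obtain M h where h: "\<And>d. hform d (h d)" "\<And>x. f x = (\<Sum>d<M. h d x)"
      by (rule pol_decomp[OF \<open>f \<in> pol\<close>]) (rule that)
    have "good (\<lambda>x. \<Sum>d<m. h d x)" for m
    proof (induction m)
      case (Suc m)
      show ?case using good_add[OF Suc goodform[OF h(1), of m]] by simp
    qed (simp add: good0)
    then show ?thesis by (rule good_cong) (rule h(2))
  qed
  then have goodpol: "\<exists>c. (\<forall>j. c j \<in> C) \<and> (\<forall>x\<in>slice S y. f x = (\<Sum>j<r. c j x * b j x))" if "f \<in> pol" for f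
    using that unfolding good_def by blast
  have "b j \<in> pol" if "j < r" for j
  proof -
    have "b j \<in> B" using b(1) that by blast
    then show ?thesis unfolding B_def using hform_monomials hform_pol by blast
  qed
  then show ?thesis by (rule that[of r b, OF _ goodpol])
qed

text \<open>Cayley-Hamilton for multiplication by \<open>t\<close> on the module generators.\<close>

lemma slice_integral:
  fixes S :: "(complex ^ 'n) set"
  assumes S: "pclosed S" and ys: "\<And>x. x \<in> S \<Longrightarrow> ev y x \<noteq> 0 \<or> (\<exists>z\<in>Y. ev z x \<noteq> 0)"
    and C: "subring C" "\<And>c. (\<lambda>x. c) \<in> C" "\<And>z. z \<in> Y \<Longrightarrow> ev z \<in> C"
    and t: "t \<in> pol"
  obtains P where "\<And>i. coeff P i \<in> C" "lead_coeff P = 1" "\<And>x. x \<in> slice S y \<Longrightarrow> poly P t x = 0"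
proof -
  obtain b r where b: "\<And>j. j < r \<Longrightarrow> b j \<in> pol"
    "\<And>f. f \<in> pol \<Longrightarrow> \<exists>c. (\<forall>j. c j \<in> C) \<and> (\<forall>x\<in>slice S y. f x = (\<Sum>j<r::nat. c j x * b j x))"
    by (rule slice_finite_module[OF S ys C]) (assumption, assumption, rule that)
  have "\<exists>c. (\<forall>j. c j \<in> C) \<and> (\<forall>x\<in>slice S y. t x * b i x = (\<Sum>j<r. c j x * b j x))" if "i < r" for i
    using b(2)[OF pol_mult[OF t b(1)[OF that]]] .
  then obtain c where c: "\<And>i j. i < r \<Longrightarrow> c i j \<in> C"
    "\<And>i x. i < r \<Longrightarrow> x \<in> slice S y \<Longrightarrow> t x * b i x = (\<Sum>j<r. c i j x * b j x)" by metis
  \<comment> \<open>N e holds the polynomials of degree below e and U e the monic ones of degree e,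
    with coefficients in C.\<close>
  define N where "N e = {P. (\<forall>i. coeff P i \<in> C) \<and> (\<forall>i\<ge>e. coeff P i = 0)}" for e :: nat
  define U where "U e = {P. \<exists>n\<in>N e. P = monom 1 e + n}" for e
  define Z where "Z = {f::complex ^ 'n \<Rightarrow> complex. \<forall>x\<in>slice S y. f x = 0}"
  note C' = subringD[OF C(1)]
  have NN: "n * n' \<in> N (e + e')" if n: "n \<in> N e" "n' \<in> N e'" for n n' e e'
  proof -
    have "coeff n i * coeff n' (m - i) = 0" if "m \<ge> e + e'" for m i
    proof (cases "i \<ge> e")
      case False
      then have "m - i \<ge> e'" using that by linarith
      then show ?thesis using n by (simp add: N_def)
    qed (use n in \<open>simp add: N_def\<close>)
    then have "coeff (n * n') m = 0" if "m \<ge> e + e'" for m unfolding coeff_mult using that by (simp add: sum.neutral)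
    moreover have "coeff (n * n') m \<in> C" for m using n by (intro coeff_mult_subring[OF C(1)]) (auto simp: N_def)
    ultimately show ?thesis by (simp add: N_def)
  qed
  have Nadd: "n + n' \<in> N e" "n - n' \<in> N e" if "n \<in> N e" "n' \<in> N e" for n n' e
    using that C' by (auto simp: N_def)
  have Nmon: "monom 1 d * n \<in> N (d + e)" if "n \<in> N e" for n e d
    using that C' by (auto simp: N_def coeff_monom_mult)
  have mon: "monom 1 d * monom 1 e = monom (1::complex ^ 'n \<Rightarrow> complex) (d + e)" for d e
    by (simp add: mult_monom)
  have UU: "p * q \<in> U (e + e')" if pq: "p \<in> U e" "q \<in> U e'" for p q e e'
  proof -
    obtain n n' where n: "n \<in> N e" "p = monom 1 e + n" "n' \<in> N e'" "q = monom 1 e' + n'"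
      using pq unfolding U_def by blast
    have "p * q = monom 1 (e + e') + (monom 1 e * n' + (monom 1 e' * n + n * n'))"
      by (simp add: n mon[symmetric] algebra_simps)
    moreover have "monom 1 e * n' + (monom 1 e' * n + n * n') \<in> N (e + e')"
      using Nmon[OF n(1), of e'] Nmon[OF n(3), of e] NN[OF n(1,3)] by (simp add: Nadd add.commute[of e'])
    ultimately show ?thesis unfolding U_def by blast
  qed
  have "\<exists>e'. \<exists>u\<in>U e'. \<forall>i<r. poly u t * b i \<in> Z"
  proof (rule elimination[where P = "\<lambda>i j. (if i = j then monom 1 1 else 0) - [:c i j:]" and N = N and e = 1])
    show "p * q - n * n' \<in> U (2 * e)" if q: "p \<in> U e" "q \<in> U e" "n \<in> N e" "n' \<in> N e" for e p q n n'
    proof -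
      obtain m where m: "m \<in> N (e + e)" "p * q = monom 1 (e + e) + m" using UU[OF q(1,2)] unfolding U_def by blast
      have "p * q - n * n' = monom 1 (e + e) + (m - n * n')" by (simp add: m)
      moreover have "m - n * n' \<in> N (e + e)" by (intro Nadd m NN q)
      ultimately show ?thesis unfolding U_def mult_2 by blast
    qed
    show "p * m - n * n' \<in> N (2 * e)" if q: "p \<in> U e" "m \<in> N e" "n \<in> N e" "n' \<in> N e" for e p m n n'
    proof -
      obtain k where k: "k \<in> N e" "p = monom 1 e + k" using q(1) unfolding U_def by blast
      have "p * m - n * n' = monom 1 e * m + (k * m - n * n')" by (simp add: k algebra_simps)
      also have "\<dots> \<in> N (e + e)" by (intro Nadd Nmon NN k q)
      finally show ?thesis by (simp add: mult_2)
    qed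
    show "1 \<in> U 0" unfolding U_def using C'
      by (intro CollectI bexI[of _ 0]) (auto simp: N_def monom_0)
    show "0 \<in> Z" by (simp add: Z_def)
    show "x - y \<in> Z" if "x \<in> Z" "y \<in> Z" for x y using that by (simp add: Z_def)
    show "poly c t * x \<in> Z" if "x \<in> Z" for x c using that by (simp add: Z_def)
    show "(\<Sum>j<r. poly ((if i = j then monom 1 1 else 0) - [:c i j:]) t * b j) \<in> Z" if i: "i < r" for i
    proof -
      have "(\<Sum>j<r. poly ((if i = j then monom 1 1 else 0) - [:c i j:]) t * b j) x = 0" if x: "x \<in> slice S y" for x
      proof -
        have "(\<Sum>j<r. poly ((if i = j then monom 1 1 else 0) - [:c i j:]) t * b j) x
            = (\<Sum>j<r. (if i = j then t x * b j x else 0) - c i j x * b j x)"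
          unfolding sum_apply_fun by (intro sum.cong) (auto simp: poly_monom algebra_simps)
        also have "\<dots> = 0" using c(2)[OF i x] i by (simp add: sum_subtractf)
        finally show ?thesis .
      qed
      then show ?thesis by (simp add: Z_def)
    qed
    show "(if i = i then monom 1 1 else 0) - [:c i i:] \<in> U 1" if "i < r" for i
      unfolding U_def using c(1)[OF that] C'
      by (intro CollectI bexI[of _ "- [:c i i:]"]) (auto simp: N_def coeff_pCons split: nat.splits)
    show "(if i = j then monom 1 1 else 0) - [:c i j:] \<in> N 1" if "i < r" "j < r" "i \<noteq> j" for i j
      using c(1)[OF that(1)] C' that by (auto simp: N_def coeff_pCons split: nat.splits)
  qed (use UU in auto)
  then obtain e u where u: "u \<in> U e" "\<And>i. i < r \<Longrightarrow> poly u t * b i \<in> Z" by blast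
  then obtain n where n: "n \<in> N e" "u = monom 1 e + n" unfolding U_def by blast
  \<comment> \<open>1 is itself a combination of the generators, so what annihilates all generators
    is 0 on the slice.\<close>
  obtain d where d: "\<forall>x\<in>slice S y. 1 = (\<Sum>j<r. d j x * b j x)"
    using b(2)[OF pol.const[of 1]] by blast
  have lead: "degree u = e"
  proof (rule antisym)
    show "degree u \<le> e" by (rule degree_le) (use n in \<open>auto simp: N_def\<close>)
    have "coeff u e \<noteq> 0" using n by (auto simp: N_def fun_eq_iff)
    then show "e \<le> degree u" by (rule le_degree)
  qed
  show ?thesis
  proof (rule that)
    show "coeff u i \<in> C" for i using n C' by (auto simp: N_def)
    show "lead_coeff u = 1" unfolding lead using n by (simp add: N_def)
    show "poly u t x = 0" if x: "x \<in> slice S y" for x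
    proof -
      have "poly u t x = poly u t x * (\<Sum>j<r. d j x * b j x)" using bspec[OF d x] by simp
      also have "\<dots> = (\<Sum>j<r. d j x * (poly u t * b j) x)" by (simp add: sum_distrib_left mult_ac)
      also have "\<dots> = 0" using u(2) x by (intro sum.neutral ballI) (auto simp: Z_def)
      finally show ?thesis .
    qed
  qed
qed

text \<open>A projective variety that misses a hyperplane m = 0 is a point: the quotients x_i / m
  are regular, hence constant.\<close>

lemma pol_ratio_constant:
  assumes Y: "pvariety Y" and m: "\<And>x. x \<in> Y \<Longrightarrow> ev m x \<noteq> 0" and a: "a \<in> Y"
  shows "Y \<subseteq> point a"
proof
  fix x assume x: "x \<in> Y"
  have "x $ i / ev m x = a $ i / ev m a" for i
  proof -
    have "reg_at Y 0 (\<lambda>x. x $ i / ev m x) q" if "q \<in> Y" for q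
      by (rule reg_atI[where W = Y, OF popen_self that hform_nth hform_ev]) (use m in auto)
    then have "reg Y 0 (\<lambda>x. x $ i / ev m x)" by (simp add: reg_def)
    then obtain c where "\<And>x. x \<in> Y \<Longrightarrow> x $ i / ev m x = c" by (rule regular_constant[OF Y]) (rule that)
    then show ?thesis using x a by simp
  qed
  then have "x $ i = (ev m x / ev m a) * a $ i" for i
    using m[OF x] m[OF a] by (simp add: frac_eq_eq field_simps)
  then have "x = (ev m x / ev m a) *s a" by (simp add: vec_eq_iff)
  then show "x \<in> point a" unfolding point_def using m[OF x] m[OF a] by auto
qed

text \<open>A form vanishing on \<open>Y1\<close> satisfies an integral equation over \<open>\<complex>[\<mu>]\<close> whose constant term vanishes
  at all values of \<open>\<mu>\<close>.\<close>

lemma no_chain_over_pencil: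
  fixes X :: "(complex ^ 'n) set"
  assumes X: "pvariety X" and lm: "\<And>x. x \<in> X \<Longrightarrow> ev l x \<noteq> 0 \<or> ev m x \<noteq> 0"
    and Y1: "pvariety Y1" "Y1 \<subset> X" and Y0: "pvariety Y0" "Y0 \<subset> Y1"
  shows False
proof -
  obtain a where a: "a \<in> Y0" using pvariety_nonempty[OF Y0(1)] by blast
  have zero: "\<exists>x\<in>Y1. ev y x = 0" for y
  proof (rule ccontr)
    assume "\<not> (\<exists>x\<in>Y1. ev y x = 0)"
    then have "Y1 \<subseteq> point a" using a Y0(2) by (intro pol_ratio_constant[OF Y1(1)]) auto
    also have "\<dots> \<subseteq> Y0" by (rule point_subset[OF pvariety_closed[OF Y0(1)] a])
    finally show False using Y0(2) by blast
  qed
  have val: "\<exists>x\<in>slice Y1 l. ev m x = c" for c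
  proof -
    obtain x where x: "x \<in> Y1" "ev (m - c *s l) x = 0" using zero by blast
    then have mx: "ev m x = c * ev l x" by (simp add: ev_diff_left ev_scale_left)
    then have "ev l x \<noteq> 0" using lm[of x] x(1) Y1(2) by auto
    then show ?thesis using slice_scale(1)[OF pvariety_closed[OF Y1(1)] x(1)] mx
      by (intro bexI[of _ "(1 / ev l x) *s x"]) (auto simp: ev_scale)
  qed
  obtain b0 where b0: "b0 \<in> X" "b0 \<notin> Y1" using Y1(2) by blast
  obtain d G where G: "hform d G" "\<And>z. z \<in> Y1 \<Longrightarrow> G z = 0" "G b0 \<noteq> 0"
    by (rule pclosedD[OF pvariety_closed[OF Y1(1)] pclosed_nonzero[OF pvariety_closed[OF X] b0(1)] b0(2)])
      (rule that)
  obtain w where w: "w \<in> slice Y1 l" using val by blast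
  then have wX: "w \<in> X" "ev l w \<noteq> 0" using Y1(2) by (auto simp: slice_def)
  have "\<exists>b\<in>X. ev l b * G b \<noteq> 0"
  proof (rule ccontr)
    assume "\<not> (\<exists>b\<in>X. ev l b * G b \<noteq> 0)"
    then have "G b0 = 0" by (intro pvariety_domain[OF X hform_ev G(1) _ wX b0(1)]) auto
    then show False using G(3) by simp
  qed
  then obtain b1 where b1: "b1 \<in> X" "ev l b1 \<noteq> 0" "G b1 \<noteq> 0" by auto
  define b where "b = (1 / ev l b1) *s b1"
  have b: "b \<in> slice X l" unfolding b_def by (rule slice_scale(1)[OF pvariety_closed[OF X] b1(1,2)])
  have Gb: "G b \<noteq> 0" using b1 hform_scale[OF G(1), of "1 / ev l b1" b1] by (simp add: b_def)
  define C where "C = {(\<lambda>x. poly q (ev m x)) | q. True}"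
  have C: "subring C" unfolding subring_def
  proof safe
    show "1 \<in> C" unfolding C_def by (intro CollectI exI[of _ 1]) (simp add: fun_eq_iff)
    fix f g assume "f \<in> C" "g \<in> C"
    then obtain q r where "f = (\<lambda>x. poly q (ev m x))" "g = (\<lambda>x. poly r (ev m x))" unfolding C_def by blast
    then have "f - g = (\<lambda>x. poly (q - r) (ev m x))" "f * g = (\<lambda>x. poly (q * r) (ev m x))"
      by (simp_all add: fun_eq_iff)
    then show "f - g \<in> C" "f * g \<in> C" unfolding C_def by blast+
  qed
  have Cconst: "(\<lambda>x. c) \<in> C" for c unfolding C_def by (intro CollectI exI[of _ "[:c:]"]) simp
  have Cm: "ev m \<in> C" unfolding C_def by (intro CollectI exI[of _ "[:0, 1:]"]) simp
  have Cpol: "C \<subseteq> pol" unfolding C_def using pol_poly[OF pol_ev] by blast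
  have Gpol: "G \<in> pol" by (rule hform_pol[OF G(1)])
  define good where "good P \<longleftrightarrow> (\<forall>i. coeff P i \<in> C) \<and> lead_coeff P = 1 \<and> (\<forall>x\<in>slice X l. poly P G x = 0)" for P
  have "\<exists>P. good P"
    by (rule slice_integral[OF pvariety_closed[OF X], of l "{m}" C G])
      (use lm C Cconst Cm Gpol in \<open>auto simp: good_def\<close>)
  then obtain P where P: "good P" "\<And>Q. good Q \<Longrightarrow> degree P \<le> degree Q"
    using ex_has_least_nat[of good _ degree] by metis
  obtain c0 P' where P': "P = pCons c0 P'" by (cases P)
  have Pv: "poly P G x = c0 x + G x * poly P' G x" for x by (simp add: P')
  have "P' \<noteq> 0"
  proof
    assume "P' = 0"
    then have "c0 = 1" using P(1) P' by (cases "c0 = 0") (auto simp: good_def)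
    then show False using P(1) b Pv[of b] \<open>P' = 0\<close> by (auto simp: good_def)
  qed
  have P'C: "coeff P' i \<in> C" for i using P(1)[unfolded good_def] P' coeff_pCons_Suc[of c0 P' i] by metis
  have c0C: "c0 \<in> C" using P(1)[unfolded good_def] P' coeff_pCons_0[of c0 P'] by metis
  obtain q where q: "c0 = (\<lambda>x. poly q (ev m x))" using c0C unfolding C_def by blast
  \<comment> \<open>On the slice of Y1, where m takes every value, G vanishes and the equation
    reduces to c0 = 0. So P is divisible by its variable, and cancelling G contradicts the minimal
    degree of P.\<close>
  have "poly q c = 0" for c
  proof -
    obtain x where x: "x \<in> slice Y1 l" "ev m x = c" using val by blast
    then have "x \<in> slice X l" "G x = 0" using Y1(2) G(2) by (auto simp: slice_def)
    then have "c0 x = 0" using P(1) Pv[of x] unfolding good_def by simp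
    then show ?thesis using x(2) q by simp
  qed
  then have "c0 x = 0" for x using q by simp
  then have GP: "G x * poly P' G x = 0" if "x \<in> slice X l" for x
    using P(1) Pv[of x] that unfolding good_def by simp
  have "poly P' G x = 0" if "x \<in> slice X l" for x
    by (rule slice_domain[OF X wX Gpol _ GP b Gb that])
      (use P'C Cpol in \<open>auto intro!: poly_subring[OF subring_pol] Gpol\<close>)
  then have "good P'" using P(1) P'C P' \<open>P' \<noteq> 0\<close> by (simp add: good_def)
  then show False using P(2)[of P'] P' \<open>P' \<noteq> 0\<close> by simp
qed

section \<open>Local factoriality of a smooth surface\<close>

text \<open>The data produced by \<open>local_coordinates\<close>: a chart with origin p, on which
  y1 and y2 are local parameters at p and define a finite map to the plane.\<close>

locale surface_point =
  fixes S :: "(complex ^ 'n) set" and p y0 y1 y2 :: "complex ^ 'n"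
  assumes S: "pvariety S" and chain: "has_chain S 2" and p: "p \<in> S"
    and y0p: "ev y0 p = 1" and y1p: "ev y1 p = 0" and y2p: "ev y2 p = 0"
    and ys: "\<And>x. x \<in> S \<Longrightarrow> ev y0 x \<noteq> 0 \<or> ev y1 x \<noteq> 0 \<or> ev y2 x \<noteq> 0"
    and grad: "\<And>z. \<exists>a0 a1 a2. z - a0 *s y0 - a1 *s y1 - a2 *s y2 \<in> gradients S p"
begin

abbreviation "S0 \<equiv> slice S y0"

lemma p_S0: "p \<in> S0"
  using p y0p by (simp add: slice_def)

lemma domain:
  assumes "f \<in> pol" "g \<in> pol" "\<And>x. x \<in> S0 \<Longrightarrow> f x * g x = 0" "a \<in> S0" "f a \<noteq> 0" "b \<in> S0"
  shows "g b = 0"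
  by (rule slice_domain[OF S p _ assms(1,2,3,4,5,6)]) (use y0p in auto)

text \<open>A nontrivial relation is nonzero at some (b, c), so y1 - b y0 and y2 - c y0 have no
  common zero on S. Then S would be finite over a line, which leaves no room for a chain of length
  2.\<close>

lemma algebraically_independent:
  assumes q: "\<And>x. x \<in> S0 \<Longrightarrow> poly (poly q [:ev y1 x:]) (ev y2 x) = 0"
  shows "q = 0"
proof (rule ccontr)
  assume q0: "q \<noteq> 0"
  have "\<exists>b. poly q [:b:] \<noteq> 0"
  proof (rule ccontr)
    assume "\<nexists>b. poly q [:b:] \<noteq> 0"
    then have "range (\<lambda>b. [:b:]) \<subseteq> {z. poly q z = 0}" by auto
    moreover have "infinite (range (\<lambda>b::complex. [:b:]))"
      using infinite_UNIV_char_0 by (subst finite_image_iff) (auto simp: inj_on_def)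
    ultimately show False using poly_roots_finite[OF q0] finite_subset by blast
  qed
  then obtain b where b: "poly q [:b:] \<noteq> 0" by blast
  then obtain c where c: "poly (poly q [:b:]) c \<noteq> 0" using poly_all_0_iff_0 by blast
  define l where "l = y1 - b *s y0"
  define m where "m = y2 - c *s y0"
  have lm: "ev l x \<noteq> 0 \<or> ev m x \<noteq> 0" if x: "x \<in> S" for x
  proof (rule ccontr)
    assume "\<not> (ev l x \<noteq> 0 \<or> ev m x \<noteq> 0)"
    then have e: "ev y1 x = b * ev y0 x" "ev y2 x = c * ev y0 x"
      by (simp_all add: l_def m_def ev_diff_left ev_scale_left)
    then have nz: "ev y0 x \<noteq> 0" using ys[OF x] by auto
    note s = slice_scale(1)[OF pvariety_closed[OF S] x nz]
    have "ev y1 ((1 / ev y0 x) *s x) = b" "ev y2 ((1 / ev y0 x) *s x) = c"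
      using e nz by (simp_all add: ev_scale)
    then show False using q[OF s] c by simp
  qed
  obtain Y where Y: "\<forall>i\<le>2. pvariety (Y i) \<and> Y i \<subseteq> S" "\<forall>i<2. Y i \<subset> Y (Suc i)"
    using chain unfolding has_chain_def by blast
  have "Y 0 \<subset> Y 1" "Y 1 \<subset> Y 2" using Y(2) by (auto simp: numeral_2_eq_2)
  moreover have "pvariety (Y 0)" "pvariety (Y 1)" "pvariety (Y 2)" "Y 2 \<subseteq> S" using Y(1) by auto
  ultimately show False using lm by (intro no_chain_over_pencil[of "Y 2" l m "Y 1" "Y 0"]) auto
qed

lemma y1_nonzero: "\<exists>x\<in>S0. ev y1 x \<noteq> 0"
proof (rule ccontr)
  assume "\<not> (\<exists>x\<in>S0. ev y1 x \<noteq> 0)"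
  then have "[:0, 1:] = (0 :: complex poly poly)" by (intro algebraically_independent) simp
  then show False by simp
qed

text \<open>Evaluation of a formal polynomial in three variables: the outer variable becomes s, the
  middle one y1 and the inner one y2. Formal polynomials are needed because divisibility takes place
  in a factorial ring.\<close>

definition E :: "complex poly poly poly \<Rightarrow> complex \<Rightarrow> complex ^ 'n \<Rightarrow> complex" where
  "E \<Theta> s x = poly (poly (poly \<Theta> [:[:s:]:]) [:ev y1 x:]) (ev y2 x)"

lemma E_simps [simp]: "E 0 s x = 0" "E 1 s x = 1" "E (a + b) s x = E a s x + E b s x"
  "E (a - b) s x = E a s x - E b s x" "E (a * b) s x = E a s x * E b s x"
  "E (pCons d \<Theta>) s x = poly (poly d [:ev y1 x:]) (ev y2 x) + s * E \<Theta> s x"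
  by (simp_all add: E_def)

lemma E_sum: "E (sum f I) s x = (\<Sum>i\<in>I. E (f i) s x)"
  by (induction I rule: infinite_finite_induct) auto

lemma E_monom: "E (monom d n) s x = poly (poly d [:ev y1 x:]) (ev y2 x) * s ^ n"
  by (simp add: E_def poly_monom poly_power flip: power_mult)

lemma pol_coefficient: "(\<lambda>x. poly (poly d [:ev y1 x:]) (ev y2 x)) \<in> pol"
proof (induction d)
  case 0
  show ?case by (simp add: pol.const)
next
  case (pCons a d)
  have "(\<lambda>x. poly a (ev y2 x) + ev y1 x * poly (poly d [:ev y1 x:]) (ev y2 x)) \<in> pol"
    by (intro pol.add pol_mult pol_poly pol_ev pCons.IH)
  then show ?case by simp
qed

lemma pol_E: "t \<in> pol \<Longrightarrow> (\<lambda>x. E \<Theta> (t x) x) \<in> pol"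
proof (induction \<Theta>)
  case 0
  show ?case by (simp add: pol.const)
next
  case (pCons d \<Theta>)
  then show ?case by (simp, intro pol.add pol_mult pol_coefficient)
qed

text \<open>Integrality of t over the polynomials in y1 and y2, with the coefficient functions
  lifted to formal polynomials.\<close>

lemma monic_relation:
  assumes t: "t \<in> pol"
  obtains \<Phi> where "lead_coeff \<Phi> = 1" "\<And>x. x \<in> S0 \<Longrightarrow> E \<Phi> (t x) x = 0"
proof -
  define C where "C = {(\<lambda>x. poly (poly q [:ev y1 x:]) (ev y2 x)) | q. True}"
  have C: "subring C" unfolding subring_def
  proof safe
    show "1 \<in> C" unfolding C_def by (intro CollectI exI[of _ 1]) (simp add: fun_eq_iff)
    fix f g assume "f \<in> C" "g \<in> C"
    then obtain q r where "f = (\<lambda>x. poly (poly q [:ev y1 x:]) (ev y2 x))"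
      "g = (\<lambda>x. poly (poly r [:ev y1 x:]) (ev y2 x))" unfolding C_def by blast
    then have "f - g = (\<lambda>x. poly (poly (q - r) [:ev y1 x:]) (ev y2 x))"
      "f * g = (\<lambda>x. poly (poly (q * r) [:ev y1 x:]) (ev y2 x))"
      by (simp_all add: fun_eq_iff)
    then show "f - g \<in> C" "f * g \<in> C" unfolding C_def by blast+
  qed
  have C2: "(\<lambda>x. c) \<in> C" for c unfolding C_def by (intro CollectI exI[of _ "[:[:c:]:]"]) simp
  have "ev y1 \<in> C" unfolding C_def by (intro CollectI exI[of _ "[:0, 1:]"]) simp
  moreover have "ev y2 \<in> C" unfolding C_def by (intro CollectI exI[of _ "[:[:0, 1:]:]"]) simp
  ultimately have C3: "ev z \<in> C" if "z \<in> {y1, y2}" for z using that by auto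
  have ys': "ev y0 x \<noteq> 0 \<or> (\<exists>z\<in>{y1, y2}. ev z x \<noteq> 0)" if "x \<in> S" for x using ys[OF that] by auto
  obtain P where P: "\<And>i. coeff P i \<in> C" "lead_coeff P = 1" "\<And>x. x \<in> S0 \<Longrightarrow> poly P t x = 0"
    by (rule slice_integral[OF pvariety_closed[OF S] ys' C C2 C3 t]) (assumption, assumption, rule that)
  have "\<forall>i. \<exists>q. coeff P i = (\<lambda>x. poly (poly q [:ev y1 x:]) (ev y2 x))" using P(1) unfolding C_def by blast
  then obtain q where q: "\<And>i. coeff P i = (\<lambda>x. poly (poly (q i) [:ev y1 x:]) (ev y2 x))" by metis
  define \<Phi> where "\<Phi> = monom 1 (degree P) + (\<Sum>i<degree P. monom (q i) i)"
  have cf: "coeff \<Phi> i = (if i = degree P then 1 else if i < degree P then q i else 0)" for i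
    by (auto simp: \<Phi>_def coeff_sum)
  have "degree \<Phi> = degree P" by (rule antisym[OF degree_le le_degree]) (auto simp: cf)
  then have "lead_coeff \<Phi> = 1" by (simp add: cf)
  moreover have "E \<Phi> (t x) x = 0" if x: "x \<in> S0" for x
  proof -
    have "poly P t x = (\<Sum>i\<le>degree P. coeff P i x * t x ^ i)"
    proof -
      have "(f ^ i) x = f x ^ i" for f :: "complex ^ 'n \<Rightarrow> complex" and i by (induction i) auto
      then show ?thesis by (simp add: poly_altdef sum_apply_fun)
    qed
    also have "\<dots> = (\<Sum>i<degree P. coeff P i x * t x ^ i) + t x ^ degree P"
      using P(2) by (simp add: lessThan_Suc_atMost[symmetric])
    also have "\<dots> = E \<Phi> (t x) x" by (simp add: \<Phi>_def E_sum E_monom q)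
    finally show ?thesis using P(3)[OF x] by simp
  qed
  ultimately show ?thesis by (rule that)
qed

text \<open>Gauss' lemma: the relations of \<open>t\<close> over \<open>\<complex>[y_1, y_2]\<close> form a principal prime ideal.\<close>

lemma minimal_polynomial:
  assumes t: "t \<in> pol"
  obtains \<Psi> where "\<forall>\<Theta>. (\<forall>x\<in>S0. E \<Theta> (t x) x = 0) \<longrightarrow> \<Psi> dvd \<Theta>"
    "\<And>x. x \<in> S0 \<Longrightarrow> E \<Psi> (t x) x = 0" "degree \<Psi> > 0"
proof -
  define K where "K = {\<Theta>. \<forall>x\<in>S0. E \<Theta> (t x) x = 0}"
  have K_prime: "a \<in> K \<or> b \<in> K" if "a * b \<in> K" for a b
  proof (rule disjCI)
    assume "b \<notin> K"
    then obtain z where z: "z \<in> S0" "E b (t z) z \<noteq> 0" unfolding K_def by blast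
    have "E a (t x) x = 0" if "x \<in> S0" for x
    proof (rule domain[OF pol_E[OF t] pol_E[OF t] _ z that])
      show "E b (t x) x * E a (t x) x = 0" if "x \<in> S0" for x
        using \<open>a * b \<in> K\<close> that unfolding K_def by (auto simp: mult.commute)
    qed
    then show "a \<in> K" unfolding K_def by blast
  qed
  have K_const: "d = 0" if "[:d:] \<in> K" for d
    using that by (intro algebraically_independent) (auto simp: K_def)
  obtain \<Phi> where \<Phi>: "lead_coeff \<Phi> = 1" "\<And>x. x \<in> S0 \<Longrightarrow> E \<Phi> (t x) x = 0"
    by (rule monic_relation[OF t]) (rule that)
  then have "\<Phi> \<in> K \<and> \<Phi> \<noteq> 0" unfolding K_def by auto
  then obtain \<Psi>0 where \<Psi>0: "\<Psi>0 \<in> K \<and> \<Psi>0 \<noteq> 0" "\<And>\<Theta>. \<Theta> \<in> K \<and> \<Theta> \<noteq> 0 \<Longrightarrow> degree \<Psi>0 \<le> degree \<Theta>"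
    using ex_has_least_nat[of "\<lambda>\<Theta>. \<Theta> \<in> K \<and> \<Theta> \<noteq> 0" \<Phi> degree] by blast
  have K_mult: "a * b \<in> K" if "b \<in> K" for a b using that by (auto simp: K_def)
  \<comment> \<open>Relations form a prime ideal, so some prime factor of a relation of least degree
    is again a relation.\<close>
  define A where "A = prime_factorization \<Psi>0"
  have "\<Psi>0 dvd prod_mset A" "prod_mset A dvd \<Psi>0"
    using \<Psi>0(1) prod_mset_prime_factorization_weak[of \<Psi>0] by (auto simp: A_def dest: associatedD1 associatedD2)
  then have "prod_mset A \<in> K" using K_mult \<Psi>0(1) by (metis dvdE mult.commute)
  then have "\<exists>\<Psi>. \<Psi> \<in># A \<and> \<Psi> \<in> K"
  proof (induction A)
    case empty
    then show ?case using p_S0 by (auto simp: K_def)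
  next
    case (add a A)
    then show ?case using K_prime[of a "prod_mset A"] by auto
  qed
  then obtain \<Psi> where \<Psi>: "\<Psi> \<in># A" "\<Psi> \<in> K" by blast
  have prime: "prime_elem \<Psi>" using \<Psi>(1) by (auto simp: A_def in_prime_factors_iff prime_def)
  have "\<Psi> dvd \<Psi>0" using \<Psi>(1) by (auto simp: A_def in_prime_factors_iff)
  then have deg: "degree \<Psi> \<le> degree \<Psi>0" using \<Psi>0(1) by (intro dvd_imp_degree_le) auto
  have \<Psi>nz: "\<Psi> \<noteq> 0" using prime by auto
  have degpos: "degree \<Psi> > 0"
  proof (rule ccontr)
    assume "\<not> degree \<Psi> > 0"
    then obtain d where "\<Psi> = [:d:]" by (metis degree_eq_zeroE neq0_conv)
    then show False using K_const \<Psi>(2) \<Psi>nz by auto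
  qed
  have "\<Psi> dvd \<Theta>" if \<Theta>: "\<Theta> \<in> K" for \<Theta>
  proof -
    \<comment> \<open>Pseudo-division needs no fractions. The remainder is a relation of smaller
      degree, hence 0; the multiplier a is constant in the outer variable, so the prime \<Psi> of
      positive degree does not divide it.\<close>
    obtain a q where aq: "a \<noteq> 0" "smult a \<Theta> = \<Psi> * q + pseudo_mod \<Theta> \<Psi>"
      using pseudo_mod(1)[OF \<Psi>nz, of \<Theta>] by blast
    have "pseudo_mod \<Theta> \<Psi> = [:a:] * \<Theta> - q * \<Psi>" using aq(2) by (simp add: mult.commute)
    moreover have "\<dots> \<in> K" unfolding K_def
    proof (intro CollectI ballI)
      fix x assume "x \<in> S0"
      then have "E \<Theta> (t x) x = 0" "E \<Psi> (t x) x = 0" using \<Theta> \<Psi>(2) by (auto simp: K_def)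
      then show "E ([:a:] * \<Theta> - q * \<Psi>) (t x) x = 0" by (simp del: mult_pCons_left)
    qed
    ultimately have "pseudo_mod \<Theta> \<Psi> \<in> K" by simp
    then have "pseudo_mod \<Theta> \<Psi> = 0"
      using pseudo_mod(2)[OF \<Psi>nz, of \<Theta>] \<Psi>0(2)[of "pseudo_mod \<Theta> \<Psi>"] deg
      by (cases "pseudo_mod \<Theta> \<Psi> = 0") auto
    then have "\<Psi> dvd [:a:] * \<Theta>" using aq(2) by simp
    then have "\<Psi> dvd [:a:] \<or> \<Psi> dvd \<Theta>" using prime by (simp only: prime_elem_dvd_mult_iff)
    moreover have "\<not> \<Psi> dvd [:a:]" using dvd_imp_degree_le[of \<Psi> "[:a:]"] aq(1) degpos by auto
    ultimately show ?thesis by blast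
  qed
  then show ?thesis using \<Psi>(2) degpos unfolding K_def by (intro that) auto
qed

text \<open>Degree and order at 0 are additive on products. They agree for a monomial, hence for
  each of its factors.\<close>

lemma monom_factor:
  fixes a b :: "'a::idom poly"
  assumes "a * b = monom c n" "c \<noteq> 0"
  shows "coeff a i = 0 \<or> i = degree a"
proof -
  have nz: "a \<noteq> 0" "b \<noteq> 0" using assms by auto
  have "order 0 (monom c n) = n"
  proof -
    have "monom c n = smult c ([:- 0, 1:] ^ n)" by (simp add: monom_altdef)
    moreover have "order 0 ([:0, 1::'a:] ^ n) = n" using order_power_n_n[of "0::'a" n] by simp
    ultimately show ?thesis using assms(2) by (simp add: order_smult)
  qed
  then have "order 0 a + order 0 b = n" using assms nz by (metis monom_eq_0_iff order_mult)
  moreover have "degree a + degree b = n"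
    using degree_mult_eq[OF nz] degree_monom_eq[OF assms(2), of n] assms(1) by simp
  moreover have "order 0 a \<le> degree a" "order 0 b \<le> degree b" by (intro order_degree nz)+
  ultimately have "order 0 a = degree a" by linarith
  then have "[:0, 1:] ^ degree a dvd a" using order_1[of 0 a] by simp
  then obtain r where r: "a = [:0, 1:] ^ degree a * r" by (rule dvdE)
  then have "coeff a i = coeff (monom 1 (degree a) * r) i" by (simp add: monom_altdef)
  then have "coeff a i = 0" if "i < degree a" using that by (simp add: coeff_monom_mult)
  then show ?thesis by (meson coeff_eq_0 linorder_neqE_nat)
qed

text \<open>In the ring of the slice, no multiple of \<open>y_1\<close> is a power of \<open>y_2\<close> up to a local unit: the
  minimal polynomial of \<open>t\<close> divides a polynomial that is a monomial modulo \<open>y_1\<close>, so it is itself a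
  power of the variable modulo \<open>y_1\<close>.\<close>

lemma dimension_two:
  assumes t: "t \<in> pol" and H: "H \<in> pol" and tH: "\<And>x. x \<in> S0 \<Longrightarrow> t x * ev y2 x ^ n = H x * ev y1 x"
  shows "t p = 0"
proof -
  obtain \<Phi> where \<Phi>: "lead_coeff \<Phi> = 1" "\<And>x. x \<in> S0 \<Longrightarrow> E \<Phi> (H x) x = 0"
    by (rule monic_relation[OF H]) (rule that)
  obtain \<Psi>' where \<Psi>': "lead_coeff \<Psi>' = 1" "\<And>x. x \<in> S0 \<Longrightarrow> E \<Psi>' (t x) x = 0"
    by (rule monic_relation[OF t]) (rule that)
  obtain \<Psi> where \<Psi>: "\<forall>\<Theta>. (\<forall>x\<in>S0. E \<Theta> (t x) x = 0) \<longrightarrow> \<Psi> dvd \<Theta>"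
    "\<And>x. x \<in> S0 \<Longrightarrow> E \<Psi> (t x) x = 0" "degree \<Psi> > 0"
    by (rule minimal_polynomial[OF t]) (rule that)
  define N where "N = degree \<Phi>"
  define X1 X2 where "X1 = [:0, 1::complex poly:]" and "X2 = [:[:0, 1::complex:]:]"
  \<comment> \<open>The integral equation of H multiplied by y1 ^ N, with each product H y1 replaced
    by t y2 ^ n; this is a relation for t.\<close>
  define \<Theta> where "\<Theta> = (\<Sum>i\<le>N. monom (coeff \<Phi> i * X2 ^ (n * i) * X1 ^ (N - i)) i)"
  have "\<Psi> dvd \<Theta>"
  proof (rule \<Psi>(1)[rule_format])
    fix x assume x: "x \<in> S0"
    have X: "poly (poly X1 [:ev y1 x:]) (ev y2 x) = ev y1 x" "poly (poly X2 [:ev y1 x:]) (ev y2 x) = ev y2 x"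
      by (simp_all add: X1_def X2_def)
    have "E \<Theta> (t x) x = (\<Sum>i\<le>N. poly (poly (coeff \<Phi> i) [:ev y1 x:]) (ev y2 x) * (t x * ev y2 x ^ n) ^ i * ev y1 x ^ (N - i))"
      unfolding \<Theta>_def E_sum E_monom
      by (intro sum.cong refl) (simp add: poly_power X power_mult_distrib mult_ac flip: power_mult)
    also have "\<dots> = ev y1 x ^ N * (\<Sum>i\<le>N. poly (poly (coeff \<Phi> i) [:ev y1 x:]) (ev y2 x) * H x ^ i)"
      unfolding tH[OF x] sum_distrib_left power_mult_distrib
    proof (intro sum.cong refl)
      fix i assume "i \<in> {..N}"
      then have "ev y1 x ^ N = ev y1 x ^ i * ev y1 x ^ (N - i)" by (simp flip: power_add)
      then show "poly (poly (coeff \<Phi> i) [:ev y1 x:]) (ev y2 x) * (H x ^ i * ev y1 x ^ i) * ev y1 x ^ (N - i)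
          = ev y1 x ^ N * (poly (poly (coeff \<Phi> i) [:ev y1 x:]) (ev y2 x) * H x ^ i)" by simp
    qed
    also have "(\<Sum>i\<le>N. poly (poly (coeff \<Phi> i) [:ev y1 x:]) (ev y2 x) * H x ^ i) = E \<Phi> (H x) x"
      by (subst (2) poly_as_sum_of_monoms[of \<Phi>, symmetric]) (simp add: E_sum E_monom N_def)
    finally show "E \<Theta> (t x) x = 0" using \<Phi>(2)[OF x] by simp
  qed
  then obtain Q where Q: "\<Theta> = \<Psi> * Q" by (rule dvdE)
  have "\<Psi> dvd \<Psi>'" by (rule \<Psi>(1)[rule_format]) (rule \<Psi>'(2))
  \<comment> \<open>A divisor of a monic polynomial has a unit as leading coefficient, so \<Psi>
    keeps its degree when reduced modulo y1.\<close>
  then have lead_unit: "lead_coeff \<Psi> dvd 1" using \<Psi>'(1) by (metis dvd_def lead_coeff_mult)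
  then obtain u where u: "lead_coeff \<Psi> = [:[:u:]:]" "u \<noteq> 0"
    by (metis is_unit_poly_iff dvd_refl is_unit_pCons_iff poly_0 not_is_unit_0 pCons_0_0)
  \<comment> \<open>Reduction modulo y1: coefficient 0 in the middle variable sets that variable to
    0.\<close>
  define red where "red = map_poly (\<lambda>d::complex poly poly. coeff d 0)"
  have red_coeff: "coeff (red \<Theta>) i = coeff (coeff \<Theta> i) 0" for \<Theta> i
    unfolding red_def by (subst coeff_map_poly) simp_all
  have red_mult: "red (a * b) = red a * red b" for a b
    by (rule poly_eqI) (simp add: red_coeff coeff_mult coeff_sum)
  have "red \<Theta> = monom ([:0, 1:] ^ (n * N)) N"
  proof (rule poly_eqI)
    fix i
    have "coeff \<Theta> i = (if i \<le> N then coeff \<Phi> i * X2 ^ (n * i) * X1 ^ (N - i) else 0)"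
      by (simp add: \<Theta>_def coeff_sum)
    moreover have c0: "coeff (a * b) 0 = coeff a 0 * coeff b 0" "coeff (a ^ m) 0 = coeff a 0 ^ m"
      for a b :: "complex poly poly" and m by (simp_all add: coeff_mult coeff_0_power)
    moreover have "coeff \<Phi> N = 1" using \<Phi>(1) by (simp add: N_def)
    ultimately show "coeff (red \<Theta>) i = coeff (monom ([:0, 1:] ^ (n * N)) N) i"
      by (auto simp: red_coeff X1_def X2_def power_0_left)
  qed
  then have "red \<Psi> * red Q = monom ([:0, 1:] ^ (n * N)) N" by (simp add: Q red_mult)
  moreover have "[:0, 1:] ^ (n * N) \<noteq> (0 :: complex poly)" by simp
  ultimately have mon: "coeff (red \<Psi>) i = 0 \<or> i = degree (red \<Psi>)" for i by (rule monom_factor)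
  have "coeff (red \<Psi>) (degree \<Psi>) = [:u:]" using u by (simp add: red_coeff)
  then have "degree (red \<Psi>) = degree \<Psi>" using mon[of "degree \<Psi>"] u(2) by auto
  then have low: "coeff (coeff \<Psi> i) 0 = 0" if "i \<noteq> degree \<Psi>" for i
    using mon[of i] that by (simp add: red_coeff)
  \<comment> \<open>All lower coefficients of \<Psi> are divisible by the middle variable, whose
    value y1 is 0 at p.\<close>
  have "E \<Psi> (t p) p = (\<Sum>i\<le>degree \<Psi>. poly (poly (coeff \<Psi> i) [:0:]) 0 * t p ^ i)"
    by (subst poly_as_sum_of_monoms[of \<Psi>, symmetric]) (simp only: E_sum E_monom y1p y2p)
  also have "\<dots> = (\<Sum>i\<in>{degree \<Psi>}. poly (poly (coeff \<Psi> i) [:0:]) 0 * t p ^ i)"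
    by (rule sum.mono_neutral_right) (auto simp: poly_0_coeff_0 low)
  also have "\<dots> = u * t p ^ degree \<Psi>" by (simp add: u)
  finally have "u * t p ^ degree \<Psi> = 0" using \<Psi>(2)[OF p_S0] by simp
  then show ?thesis using u(2) by simp
qed

end

section \<open>The local ring of S at p in terms of polynomials on the chart\<close>

context surface_point
begin

text \<open>Denominators of the local ring at p. Identities between fractions are stated after
  multiplication by such a t.\<close>

definition lunit :: "(complex ^ 'n \<Rightarrow> complex) \<Rightarrow> bool" where
  "lunit t \<longleftrightarrow> t \<in> pol \<and> t p \<noteq> 0"

lemma lunit_mult: "lunit s \<Longrightarrow> lunit t \<Longrightarrow> lunit (\<lambda>x. s x * t x)"
  by (simp add: lunit_def pol_mult)

lemma lunit_1: "lunit (\<lambda>x. 1)"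
  by (simp add: lunit_def pol.const)

lemma lunit_pol: "lunit t \<Longrightarrow> t \<in> pol"
  by (simp add: lunit_def)

text \<open>Membership in the ideals \<open>(g)\<close> and \<open>(g, h)\<close> of the local ring of \<open>S\<close> at \<open>p\<close>.\<close>

definition loc1 :: "(complex ^ 'n \<Rightarrow> complex) \<Rightarrow> (complex ^ 'n \<Rightarrow> complex) \<Rightarrow> bool" where
  "loc1 g f \<longleftrightarrow> (\<exists>t c. lunit t \<and> c \<in> pol \<and> (\<forall>x\<in>S0. t x * f x = c x * g x))"

definition loc2 :: "(complex ^ 'n \<Rightarrow> complex) \<Rightarrow> (complex ^ 'n \<Rightarrow> complex) \<Rightarrow> (complex ^ 'n \<Rightarrow> complex) \<Rightarrow> bool" where
  "loc2 g h f \<longleftrightarrow> (\<exists>t a b. lunit t \<and> a \<in> pol \<and> b \<in> pol \<and> (\<forall>x\<in>S0. t x * f x = a x * g x + b x * h x))"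

lemma loc1I: "lunit t \<Longrightarrow> c \<in> pol \<Longrightarrow> (\<And>x. x \<in> S0 \<Longrightarrow> t x * f x = c x * g x) \<Longrightarrow> loc1 g f"
  unfolding loc1_def by (rule exI[of _ t], rule exI[of _ c], rule conjI, assumption, rule conjI, assumption, rule ballI)

lemma loc1E:
  assumes "loc1 g f"
  obtains t c where "lunit t" "c \<in> pol" "\<And>x. x \<in> S0 \<Longrightarrow> t x * f x = c x * g x"
proof -
  from assms obtain t c where "lunit t" "c \<in> pol" "\<forall>x\<in>S0. t x * f x = c x * g x"
    unfolding loc1_def by (elim exE conjE)
  note * = this
  show ?thesis by (rule that[OF *(1,2) bspec[OF *(3)]])
qed

lemma loc2I: "lunit t \<Longrightarrow> a \<in> pol \<Longrightarrow> b \<in> pol \<Longrightarrow> (\<And>x. x \<in> S0 \<Longrightarrow> t x * f x = a x * g x + b x * h x) \<Longrightarrow> loc2 g h f"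
  unfolding loc2_def
  by (rule exI[of _ t], rule exI[of _ a], rule exI[of _ b], rule conjI, assumption, rule conjI, assumption,
      rule conjI, assumption, rule ballI)

lemma loc2E:
  assumes "loc2 g h f"
  obtains t a b where "lunit t" "a \<in> pol" "b \<in> pol" "\<And>x. x \<in> S0 \<Longrightarrow> t x * f x = a x * g x + b x * h x"
proof -
  from assms obtain t a b where "lunit t" "a \<in> pol" "b \<in> pol" "\<forall>x\<in>S0. t x * f x = a x * g x + b x * h x"
    unfolding loc2_def by (elim exE conjE)
  note * = this
  show ?thesis by (rule that[OF *(1-3) bspec[OF *(4)]])
qed

text \<open>The maximal ideal is generated by \<open>y_1, y_2\<close> (Nakayama's lemma).\<close>

lemma maximal_ideal:
  assumes f: "f \<in> pol" "f p = 0" shows "loc2 (ev y1) (ev y2) f"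
proof -
  have z: "(\<lambda>x. (x - p) $ i) \<in> pol" for i
  proof -
    have "(\<lambda>x. x $ i - p $ i) \<in> pol" by (intro pol_diff pol_nth pol.const)
    then show ?thesis by simp
  qed
  \<comment> \<open>A relation on the slice for each coordinate of x - p: up to terms of second
    order it is a combination of y1 and y2. It is read off from \<open>grad\<close>, since y0 is
    constant on the slice.\<close>
  define R where "R i w \<longleftrightarrow> (\<forall>j k. snd (snd w) j k \<in> pol) \<and> (\<forall>x\<in>S0. (x - p) $ i
      + (\<Sum>j\<in>UNIV. \<Sum>k\<in>UNIV. (x - p) $ j * (x - p) $ k * snd (snd w) j k x)
      = fst w * ev y1 x + fst (snd w) * ev y2 x)"
    for i and w :: "complex \<times> complex \<times> ('n \<Rightarrow> 'n \<Rightarrow> complex ^ 'n \<Rightarrow> complex)"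
  have "\<forall>i. \<exists>w. R i w"
  proof
    fix i
    obtain a0 a1 a2 where c: "axis i 1 - a0 *s y0 - a1 *s y1 - a2 *s y2 \<in> gradients S p"
      using grad[of "axis i 1"] by blast
    let ?c = "axis i 1 - a0 *s y0 - a1 *s y1 - a2 *s y2"
    obtain f h where fh: "f \<in> pol" "\<And>x. x \<in> S \<Longrightarrow> f x = 0" "\<And>i j. h i j \<in> pol"
      "\<And>x. f x = f p + ev ?c (x - p) + (\<Sum>j\<in>UNIV. \<Sum>k\<in>UNIV. (x - p) $ j * (x - p) $ k * h j k x)"
      by (rule gradientsE[OF c]) (rule that)
    have "(x - p) $ i + (\<Sum>j\<in>UNIV. \<Sum>k\<in>UNIV. (x - p) $ j * (x - p) $ k * h j k x) = a1 * ev y1 x + a2 * ev y2 x"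
      if x: "x \<in> S0" for x
    proof -
      have "x \<in> S" "ev y0 x = 1" using x by (simp_all add: slice_def)
      then have "ev ?c (x - p) = (x - p) $ i - a1 * ev y1 x - a2 * ev y2 x"
        by (simp add: ev_diff_left ev_scale_left ev_diff y0p y1p y2p)
      moreover have "0 = 0 + ev ?c (x - p) + (\<Sum>j\<in>UNIV. \<Sum>k\<in>UNIV. (x - p) $ j * (x - p) $ k * h j k x)"
        using fh(4)[of x] fh(2)[OF \<open>x \<in> S\<close>] fh(2)[OF p] by simp
      ultimately show ?thesis by algebra
    qed
    then have "\<forall>x\<in>S0. (x - p) $ i + (\<Sum>j\<in>UNIV. \<Sum>k\<in>UNIV. (x - p) $ j * (x - p) $ k * h j k x)
        = a1 * ev y1 x + a2 * ev y2 x" by (rule ballI)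
    moreover have "\<forall>j k. h j k \<in> pol" by (intro allI fh(3))
    ultimately show "\<exists>w. R i w" unfolding R_def by (intro exI[of _ "(a1, a2, h)"] conjI) (unfold fst_conv snd_conv, assumption+)
  qed
  then obtain w where w: "\<forall>i. R i (w i)" by (elim choice[THEN exE])
  define a1 a2 h where "a1 i = fst (w i)" and "a2 i = fst (snd (w i))" and "h i = snd (snd (w i))" for i
  have h: "h i j k \<in> pol" for i j k
    using spec[OF w, of i] unfolding R_def h_def by (elim conjE allE)
  have h2: "(x - p) $ i + (\<Sum>j\<in>UNIV. \<Sum>k\<in>UNIV. (x - p) $ j * (x - p) $ k * h i j k x)
      = a1 i * ev y1 x + a2 i * ev y2 x" if "x \<in> S0" for i x
    using bspec[OF conjunct2[OF spec[OF w, of i, unfolded R_def]] that] unfolding a1_def a2_def h_def .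
  obtain idx :: "nat \<Rightarrow> 'n" where idx: "bij_betw idx {..<CARD('n)} UNIV"
    using ex_bij_betw_nat_finite[of "UNIV :: 'n set"] by (auto simp: atLeast0LessThan)
  \<comment> \<open>Nakayama's case of \<open>elimination\<close>: pivots are nonzero at p and the
    other entries vanish at p, independently of the degree e.\<close>
  define U N where "U e = {u \<in> pol. u p \<noteq> 0}" and "N e = {u \<in> pol. u p = 0}" for e :: nat
  define Z where "Z = {f::complex ^ 'n \<Rightarrow> complex. \<exists>a\<in>pol. \<exists>b\<in>pol. \<forall>x\<in>S0. f x = a x * ev y1 x + b x * ev y2 x}"
  have ZI: "f \<in> Z" if "a \<in> pol" "b \<in> pol" "\<And>x. x \<in> S0 \<Longrightarrow> f x = a x * ev y1 x + b x * ev y2 x" for a b f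
    unfolding Z_def by (rule CollectI, rule bexI[of _ a], rule bexI[of _ b], rule ballI, rule that(3), assumption, (rule that)+)
  have pol_fun: "f - g \<in> pol" "f * g \<in> pol" if "f \<in> pol" "g \<in> pol" for f g :: "complex ^ 'n \<Rightarrow> complex"
    by (rule subringD(5)[OF subring_pol that], rule subringD(6)[OF subring_pol that])
  \<comment> \<open>The second-order terms regrouped as a matrix acting on the coordinates of x - p.
    At p this matrix is the identity.\<close>
  define P where "P i k = (\<lambda>x. (if i = k then 1 else 0) + (\<Sum>j\<in>UNIV. (x - p) $ j * h (idx i) j (idx k) x))" for i k
  have Ppol: "P i k \<in> pol" for i k
    unfolding P_def by (intro pol.add pol_sum pol_mult z h) (auto intro: pol.const)
  have "\<exists>e'. \<exists>u\<in>U e'. \<forall>i<CARD('n). id u * (\<lambda>x. (x - p) $ idx i) \<in> Z"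
  proof (rule elimination[where P = P and N = N and e = 0])
    show "q * q' - n * n' \<in> U (2 * e)" if "q \<in> U e" "q' \<in> U e" "n \<in> N e" "n' \<in> N e" for q q' n n' e
      using that pol_fun by (simp add: U_def N_def)
    show "q * m - n * n' \<in> N (2 * e)" if "q \<in> U e" "m \<in> N e" "n \<in> N e" "n' \<in> N e" for q m n n' e
      using that pol_fun by (simp add: U_def N_def)
    show "q * q' \<in> U (e + e')" if "q \<in> U e" "q' \<in> U e'" for q q' e e'
      using that pol_fun by (simp add: U_def)
    show "1 \<in> U 0" using subringD(1)[OF subring_pol] by (simp add: U_def del: one_fun_def)
    show "0 \<in> Z" by (rule ZI[of "\<lambda>x. 0" "\<lambda>x. 0"]) (auto intro: pol.const)
    show "f - g \<in> Z" if f: "f \<in> Z" and g: "g \<in> Z" for f g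
    proof -
      obtain a b where ab: "a \<in> pol" "b \<in> pol" "\<forall>x\<in>S0. f x = a x * ev y1 x + b x * ev y2 x"
        using f unfolding Z_def by (elim CollectE bexE)
      obtain a' b' where ab': "a' \<in> pol" "b' \<in> pol" "\<forall>x\<in>S0. g x = a' x * ev y1 x + b' x * ev y2 x"
        using g unfolding Z_def by (elim CollectE bexE)
      show ?thesis
      proof (rule ZI[of "a - a'" "b - b'"])
        show "(f - g) x = (a - a') x * ev y1 x + (b - b') x * ev y2 x" if "x \<in> S0" for x
          using bspec[OF ab(3) that] bspec[OF ab'(3) that] by (simp add: algebra_simps)
      qed (intro pol_fun ab ab')+
    qed
    show "id c * f \<in> Z" if f: "f \<in> Z" and c: "c \<in> U e \<union> N e" for f c e
    proof -
      obtain a b where ab: "a \<in> pol" "b \<in> pol" "\<forall>x\<in>S0. f x = a x * ev y1 x + b x * ev y2 x"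
        using f unfolding Z_def by (elim CollectE bexE)
      have cp: "c \<in> pol" using c by (auto simp: U_def N_def)
      show ?thesis
      proof (rule ZI[of "c * a" "c * b"])
        show "(id c * f) x = (c * a) x * ev y1 x + (c * b) x * ev y2 x" if "x \<in> S0" for x
          using bspec[OF ab(3) that] by (simp add: algebra_simps)
      qed (intro pol_fun ab cp)+
    qed
    show "(\<Sum>k<CARD('n). id (P i k) * (\<lambda>x. (x - p) $ idx k)) \<in> Z" if i: "i < CARD('n)" for i
    proof (rule ZI[of "\<lambda>x. a1 (idx i)" "\<lambda>x. a2 (idx i)"])
      fix x assume x: "x \<in> S0"
      have "(\<Sum>k<CARD('n). id (P i k) * (\<lambda>x. (x - p) $ idx k)) x
          = (\<Sum>k<CARD('n). (if i = k then (x - p) $ idx k else 0))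
            + (\<Sum>k<CARD('n). \<Sum>j\<in>UNIV. (x - p) $ j * (x - p) $ idx k * h (idx i) j (idx k) x)"
        unfolding sum_apply_fun sum.distrib[symmetric]
      proof (intro sum.cong refl)
        fix k
        show "(id (P i k) * (\<lambda>x. (x - p) $ idx k)) x = (if i = k then (x - p) $ idx k else 0)
            + (\<Sum>j\<in>UNIV. (x - p) $ j * (x - p) $ idx k * h (idx i) j (idx k) x)"
          by (cases "i = k") (simp_all add: P_def distrib_left sum_distrib_left mult_ac)
      qed
      also have "(\<Sum>k<CARD('n). \<Sum>j\<in>UNIV. (x - p) $ j * (x - p) $ idx k * h (idx i) j (idx k) x)
          = (\<Sum>k\<in>UNIV. \<Sum>j\<in>UNIV. (x - p) $ j * (x - p) $ k * h (idx i) j k x)"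
        by (rule sum.reindex_bij_betw[OF idx])
      also have "\<dots> = (\<Sum>j\<in>UNIV. \<Sum>k\<in>UNIV. (x - p) $ j * (x - p) $ k * h (idx i) j k x)"
        by (rule sum.swap)
      also have "(\<Sum>k<CARD('n). if i = k then (x - p) $ idx k else 0) = (x - p) $ idx i"
        using i by simp
      also have "(x - p) $ idx i + (\<Sum>j\<in>UNIV. \<Sum>k\<in>UNIV. (x - p) $ j * (x - p) $ k * h (idx i) j k x)
          = a1 (idx i) * ev y1 x + a2 (idx i) * ev y2 x" by (rule h2[OF x])
      finally show "(\<Sum>k<CARD('n). id (P i k) * (\<lambda>x. (x - p) $ idx k)) x
          = a1 (idx i) * ev y1 x + a2 (idx i) * ev y2 x" .
    qed (rule pol.const)+
    show "P i i \<in> U 0" for i using Ppol by (simp add: U_def) (simp add: P_def)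
    show "P i k \<in> N 0" if "i \<noteq> k" for i k using Ppol that by (simp add: N_def) (simp add: P_def)
  qed auto
  then obtain u where u: "lunit u" "\<And>i. i < CARD('n) \<Longrightarrow> u * (\<lambda>x. (x - p) $ idx i) \<in> Z"
    unfolding U_def lunit_def by auto
  have "u * (\<lambda>x. (x - p) $ i) \<in> Z" for i
  proof -
    obtain k where "k < CARD('n)" "i = idx k" using idx unfolding bij_betw_def by (metis imageE UNIV_I lessThan_iff)
    then show ?thesis using u(2) by simp
  qed
  then have "\<forall>i. \<exists>w. fst w \<in> pol \<and> snd w \<in> pol \<and>
      (\<forall>x\<in>S0. (u * (\<lambda>x. (x - p) $ i)) x = fst w x * ev y1 x + snd w x * ev y2 x)"
    unfolding Z_def by fastforce
  then obtain v where v: "\<forall>i. fst (v i) \<in> pol \<and> snd (v i) \<in> pol \<and>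
      (\<forall>x\<in>S0. (u * (\<lambda>x. (x - p) $ i)) x = fst (v i) x * ev y1 x + snd (v i) x * ev y2 x)"
    by (elim choice[THEN exE])
  define a b where "a i = fst (v i)" and "b i = snd (v i)" for i
  have ab: "a i \<in> pol" "b i \<in> pol" for i
    unfolding a_def b_def by (rule conjunct1[OF spec[OF v]], rule conjunct1[OF conjunct2[OF spec[OF v]]])
  have ab3: "u x * (x - p) $ i = a i x * ev y1 x + b i x * ev y2 x" if "x \<in> S0" for i x
    using bspec[OF conjunct2[OF conjunct2[OF spec[OF v, of i]]] that] unfolding a_def b_def times_fun_def .
  obtain c h where ch: "\<And>i j. h i j \<in> pol"
    "\<And>x. f x = f p + ev c (x - p) + (\<Sum>i\<in>UNIV. \<Sum>j\<in>UNIV. (x - p) $ i * (x - p) $ j * h i j x)"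
    by (rule taylor[OF f(1), of p]) (rule that)
  define g where "g i = (\<lambda>x. c $ i + (\<Sum>j\<in>UNIV. (x - p) $ j * h i j x))" for i
  have g: "g i \<in> pol" for i unfolding g_def by (intro pol.add pol_sum pol_mult z ch pol.const)
  have fg: "f x = (\<Sum>i\<in>UNIV. (x - p) $ i * g i x)" for x
    unfolding ch(2)[of x] g_def f(2) by (simp add: ev_def distrib_left sum.distrib sum_distrib_left mult_ac)
  show ?thesis
  proof (rule loc2I[OF u(1)])
    show "(\<lambda>x. \<Sum>i\<in>UNIV. g i x * a i x) \<in> pol" "(\<lambda>x. \<Sum>i\<in>UNIV. g i x * b i x) \<in> pol"
      by (intro pol_sum pol_mult g ab)+
    fix x assume x: "x \<in> S0"
    have "u x * f x = (\<Sum>i\<in>UNIV. g i x * (u x * (x - p) $ i))"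
      unfolding fg sum_distrib_left by (intro sum.cong refl) (simp add: mult_ac)
    also have "\<dots> = (\<Sum>i\<in>UNIV. g i x * a i x) * ev y1 x + (\<Sum>i\<in>UNIV. g i x * b i x) * ev y2 x"
      unfolding ab3[OF x] by (simp add: distrib_left sum.distrib sum_distrib_right mult.assoc)
    finally show "u x * f x = (\<Sum>i\<in>UNIV. g i x * a i x) * ev y1 x + (\<Sum>i\<in>UNIV. g i x * b i x) * ev y2 x" .
  qed
qed

text \<open>Krull's intersection theorem: if \<open>f = a_n g + b_n z^n\<close> for all \<open>n\<close>, apply the ascending chain
  condition to the \<open>b_n\<close>.\<close>

lemma krull_intersection:
  assumes z: "z \<in> pol" "z p = 0" and fn: "\<And>n. loc2 g (\<lambda>x. z x ^ n) f"
  shows "loc1 g f"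
proof -
  have "\<forall>n. \<exists>w. lunit (fst w) \<and> fst (snd w) \<in> pol \<and> snd (snd w) \<in> pol \<and>
      (\<forall>x\<in>S0. fst w x * f x = fst (snd w) x * g x + snd (snd w) x * z x ^ n)"
    using fn unfolding loc2_def by fastforce
  then obtain w where w: "\<forall>n. lunit (fst (w n)) \<and> fst (snd (w n)) \<in> pol \<and> snd (snd (w n)) \<in> pol \<and>
      (\<forall>x\<in>S0. fst (w n) x * f x = fst (snd (w n)) x * g x + snd (snd (w n)) x * z x ^ n)"
    by (elim choice[THEN exE])
  define t a b where "t n = fst (w n)" and "a n = fst (snd (w n))" and "b n = snd (snd (w n))" for n
  have tab: "lunit (t n)" "a n \<in> pol" "b n \<in> pol" for n
    unfolding t_def a_def b_def
    by (rule conjunct1[OF spec[OF w, of n]], rule conjunct1[OF conjunct2[OF spec[OF w, of n]]],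
        rule conjunct1[OF conjunct2[OF conjunct2[OF spec[OF w, of n]]]])
  have tab4: "t n x * f x = a n x * g x + b n x * z x ^ n" if "x \<in> S0" for n x
    using bspec[OF conjunct2[OF conjunct2[OF conjunct2[OF spec[OF w, of n]]]] that] unfolding t_def a_def b_def .
  obtain n where n: "b n \<in> idl pol (b ` {..<n})"
    by (rule noetherian_seq[OF noetherian_pol subring_pol, of b]) (rule tab, rule that)
  obtain u where u: "\<And>i. u i \<in> pol" "b n = (\<Sum>i<n. u i * b i)"
    by (rule idl_image_lessThan[OF subring_pol n]) (rule that)
  \<comment> \<open>Substituting the earlier equations for the b i into that for b n removes all b.
    At p the subtracted sum vanishes because z has a positive exponent there, so T is still a
    unit.\<close>
  define T where "T = (\<lambda>x. t n x - (\<Sum>i<n. u i x * z x ^ (n - i) * t i x))"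
  define c where "c = (\<lambda>x. a n x - (\<Sum>i<n. u i x * z x ^ (n - i) * a i x))"
  show ?thesis
  proof (rule loc1I[of T c])
    have "T \<in> pol" unfolding T_def by (intro pol_diff pol_sum pol_mult pol_power z u lunit_pol tab)
    moreover have "T p \<noteq> 0" using tab(1)[of n] z(2) by (simp add: T_def lunit_def power_0_left)
    ultimately show "lunit T" by (simp add: lunit_def)
    show "c \<in> pol" unfolding c_def by (intro pol_diff pol_sum pol_mult pol_power z u tab)
    fix x assume x: "x \<in> S0"
    have "b n x * z x ^ n = (\<Sum>i<n. u i x * z x ^ (n - i) * (b i x * z x ^ i))"
    proof -
      have "b n x * z x ^ n = (\<Sum>i<n. u i x * b i x * z x ^ n)"
        unfolding u(2) by (simp add: sum_apply_fun sum_distrib_right)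
      also have "\<dots> = (\<Sum>i<n. u i x * z x ^ (n - i) * (b i x * z x ^ i))"
      proof (intro sum.cong refl)
        fix i assume "i \<in> {..<n}"
        then have "z x ^ n = z x ^ (n - i) * z x ^ i" by (simp flip: power_add)
        then show "u i x * b i x * z x ^ n = u i x * z x ^ (n - i) * (b i x * z x ^ i)" by simp
      qed
      finally show ?thesis .
    qed
    also have "\<dots> = (\<Sum>i<n. u i x * z x ^ (n - i) * (t i x * f x - a i x * g x))"
      using tab4[OF x] by simp
    also have "\<dots> = (\<Sum>i<n. u i x * z x ^ (n - i) * t i x) * f x - (\<Sum>i<n. u i x * z x ^ (n - i) * a i x) * g x"
      by (simp add: right_diff_distrib sum_subtractf sum_distrib_right mult.assoc)
    finally show "T x * f x = c x * g x" using tab4[OF x, of n] by (simp add: T_def c_def algebra_simps)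
  qed
qed

lemma loc1_0_zero:
  assumes "loc1 (\<lambda>x. 0) f" "f \<in> pol" shows "\<forall>x\<in>S0. f x = 0"
proof
  fix x assume x: "x \<in> S0"
  obtain t c where t: "lunit t" "\<And>x. x \<in> S0 \<Longrightarrow> t x * f x = c x * 0"
    by (rule loc1E[OF assms(1)]) (rule that)
  then show "f x = 0"
    by (intro domain[of t f p x]) (auto simp: lunit_def p_S0 assms x)
qed

lemma cancel:
  assumes h: "h \<in> pol" "\<exists>x\<in>S0. h x \<noteq> 0" and fg: "f \<in> pol" "g \<in> pol" "\<And>x. x \<in> S0 \<Longrightarrow> h x * f x = h x * g x"
    and x: "x \<in> S0"
  shows "f x = g x"
proof -
  obtain a where "a \<in> S0" "h a \<noteq> 0" using h(2) by blast
  then have "f x - g x = 0"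
    by (intro domain[OF h(1) pol_diff[OF fg(1,2)] _ _ _ x, of a]) (use fg(3) in \<open>auto simp: right_diff_distrib\<close>)
  then show ?thesis by simp
qed

text \<open>The local ring modulo \<open>y_1\<close> is a discrete valuation ring with uniformizer \<open>y_2\<close>.\<close>

lemma valuation:
  assumes f: "f \<in> pol" "\<not> loc1 (ev y1) f"
  obtains n t u b where "lunit t" "lunit u" "b \<in> pol"
    "\<And>x. x \<in> S0 \<Longrightarrow> t x * f x = u x * ev y2 x ^ n + b x * ev y1 x"
proof -
  have "\<exists>n. \<not> loc2 (ev y1) (\<lambda>x. ev y2 x ^ n) f"
    using krull_intersection[OF pol_ev y2p, of "ev y1" f] f(2) by blast
  then obtain n where n: "\<not> loc2 (ev y1) (\<lambda>x. ev y2 x ^ n) f" "\<And>m. m < n \<Longrightarrow> loc2 (ev y1) (\<lambda>x. ev y2 x ^ m) f"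
    using ex_has_least_nat[of "\<lambda>n. \<not> loc2 (ev y1) (\<lambda>x. ev y2 x ^ n) f" _ id] by (metis id_apply not_less)
  have "loc2 (ev y1) (\<lambda>x. ev y2 x ^ 0) f"
    by (rule loc2I[OF lunit_1 pol.const[of 0] f(1)]) simp
  then obtain m where m: "n = Suc m" using n(1) by (cases n) auto
  obtain t a b where t: "lunit t" "a \<in> pol" "b \<in> pol" "\<And>x. x \<in> S0 \<Longrightarrow> t x * f x = a x * ev y1 x + b x * ev y2 x ^ m"
    by (rule loc2E[OF n(2)[of m]]) (simp add: m, rule that)
  \<comment> \<open>Otherwise b would lie in the ideal (y1, y2), and f would be in (y1, y2 ^ n),
    against the choice of n.\<close>
  have "b p \<noteq> 0"
  proof
    assume "b p = 0"
    obtain t' a' b' where t': "lunit t'" "a' \<in> pol" "b' \<in> pol" "\<And>x. x \<in> S0 \<Longrightarrow> t' x * b x = a' x * ev y1 x + b' x * ev y2 x"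
      by (rule loc2E[OF maximal_ideal[OF t(3) \<open>b p = 0\<close>]]) (rule that)
    have "loc2 (ev y1) (\<lambda>x. ev y2 x ^ Suc m) f"
    proof (rule loc2I[OF lunit_mult[OF t'(1) t(1)] _ t'(3)])
      show "(\<lambda>x. t' x * a x + a' x * ev y2 x ^ m) \<in> pol"
        by (intro pol.add pol_mult pol_power pol_ev lunit_pol t t')
      show "t' x * t x * f x = (t' x * a x + a' x * ev y2 x ^ m) * ev y1 x + b' x * ev y2 x ^ Suc m" if "x \<in> S0" for x
      proof -
        have "t' x * t x * f x = t' x * a x * ev y1 x + (t' x * b x) * ev y2 x ^ m"
          using t(4)[OF that] by (simp add: mult.assoc distrib_left)
        then show ?thesis unfolding t'(4)[OF that] by (simp add: algebra_simps)
      qed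
    qed
    then show False using n(1) m by simp
  qed
  then show ?thesis using t by (intro that[of t b a m]) (auto simp: lunit_def add.commute)
qed

text \<open>If neither factor is divisible by y1, the product is modulo y1 a unit times a power of
  y2, and \<open>dimension_two\<close> says that this is not a multiple of y1.\<close>

lemma y1_prime:
  assumes "f \<in> pol" "g \<in> pol" "loc1 (ev y1) (\<lambda>x. f x * g x)" "\<not> loc1 (ev y1) f"
  shows "loc1 (ev y1) g"
proof (rule ccontr)
  assume "\<not> loc1 (ev y1) g"
  obtain n t u b where f: "lunit t" "lunit u" "b \<in> pol"
    "\<And>x. x \<in> S0 \<Longrightarrow> t x * f x = u x * ev y2 x ^ n + b x * ev y1 x"
    by (rule valuation[OF assms(1,4)]) (rule that)
  obtain n' t' u' b' where g: "lunit t'" "lunit u'" "b' \<in> pol"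
    "\<And>x. x \<in> S0 \<Longrightarrow> t' x * g x = u' x * ev y2 x ^ n' + b' x * ev y1 x"
    by (rule valuation[OF assms(2) \<open>\<not> loc1 (ev y1) g\<close>]) (rule that)
  obtain s c where s: "lunit s" "c \<in> pol" "\<And>x. x \<in> S0 \<Longrightarrow> s x * (f x * g x) = c x * ev y1 x"
    by (rule loc1E[OF assms(3)]) (rule that)
  define H where "H = (\<lambda>x. t x * t' x * c x - s x * (b x * (t' x * g x) + u x * ev y2 x ^ n * b' x))"
  have "H \<in> pol" unfolding H_def
    by (intro pol_diff pol.add pol_mult pol_power pol_ev lunit_pol f g s assms(2))
  have "(s x * u x * u' x) * ev y2 x ^ (n + n') = H x * ev y1 x" if x: "x \<in> S0" for x
  proof -
    define P Q where "P = ev y2 x ^ n" and "Q = ev y2 x ^ n'"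
    show ?thesis
      using f(4)[OF x, folded P_def] g(4)[OF x, folded Q_def] s(3)[OF x]
      unfolding H_def power_add P_def[symmetric] Q_def[symmetric] by algebra
  qed
  then have "s p * u p * u' p = 0"
    by (intro dimension_two[of "\<lambda>x. s x * u x * u' x" H] pol_mult lunit_pol f g s \<open>H \<in> pol\<close>)
  then show False using f(2) g(2) s(1) by (simp add: lunit_def)
qed

text \<open>\<open>quot l l'\<close> is the ideal \<open>(l : l')\<close> of the local ring.\<close>

definition quot :: "(complex ^ 'n \<Rightarrow> complex) \<Rightarrow> (complex ^ 'n \<Rightarrow> complex) \<Rightarrow> (complex ^ 'n \<Rightarrow> complex) \<Rightarrow> bool" where
  "quot l l' a \<longleftrightarrow> a \<in> pol \<and> loc1 l (\<lambda>x. a x * l' x)"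

lemma quotI:
  "a \<in> pol \<Longrightarrow> lunit t \<Longrightarrow> b \<in> pol \<Longrightarrow> (\<And>x. x \<in> S0 \<Longrightarrow> t x * (a x * l' x) = b x * l x) \<Longrightarrow> quot l l' a"
  unfolding quot_def using loc1I[of t b "\<lambda>x. a x * l' x" l] by blast

lemma quot_diff:
  assumes "quot l l' a" "quot l l' a'" "c \<in> pol" "c' \<in> pol"
  shows "quot l l' (\<lambda>x. c x * a x - c' x * a' x)"
proof -
  obtain t b where t: "lunit t" "b \<in> pol" "\<And>x. x \<in> S0 \<Longrightarrow> t x * (a x * l' x) = b x * l x"
    by (rule loc1E[of l "\<lambda>x. a x * l' x"]) (use assms(1) in \<open>simp add: quot_def\<close>, rule that)
  obtain t' b' where t': "lunit t'" "b' \<in> pol" "\<And>x. x \<in> S0 \<Longrightarrow> t' x * (a' x * l' x) = b' x * l x"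
    by (rule loc1E[of l "\<lambda>x. a' x * l' x"]) (use assms(2) in \<open>simp add: quot_def\<close>, rule that)
  have a: "a \<in> pol" "a' \<in> pol" using assms by (auto simp: quot_def)
  show ?thesis
  proof (rule quotI[OF _ lunit_mult[OF t(1) t'(1)]])
    show "(\<lambda>x. t' x * c x * b x - t x * c' x * b' x) \<in> pol" "(\<lambda>x. c x * a x - c' x * a' x) \<in> pol"
      by (intro pol_diff pol_mult lunit_pol t t' assms a)+
    show "t x * t' x * ((c x * a x - c' x * a' x) * l' x) = (t' x * c x * b x - t x * c' x * b' x) * l x"
      if x: "x \<in> S0" for x using t(3)[OF x] t'(3)[OF x] by algebra
  qed
qed

text \<open>Take g in (l : l') of least valuation modulo y1. Any other element is a multiple of g up
  to a unit and a multiple of y1, and its quotient by y1 stays in (l : l') because the prime y1 does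
  not divide l. Iterating shows membership in (g, y1 ^ k) for all k.\<close>

lemma quot_principal_prime:
  assumes l: "l \<in> pol" "l' \<in> pol" and nl: "\<not> loc1 (ev y1) l"
  obtains g where "quot l l' g" "\<And>a. quot l l' a \<Longrightarrow> loc1 g a"
proof -
  have div: "\<exists>s a1. lunit s \<and> quot l l' a1 \<and> (\<forall>x\<in>S0. s x * a x = a1 x * ev y1 x)"
    if a: "quot l l' a" "loc1 (ev y1) a" for a
  proof -
    obtain t b where t: "lunit t" "b \<in> pol" "\<And>x. x \<in> S0 \<Longrightarrow> t x * (a x * l' x) = b x * l x"
      by (rule loc1E[of l "\<lambda>x. a x * l' x"]) (use a(1) in \<open>simp add: quot_def\<close>, rule that)
    obtain s c where s: "lunit s" "c \<in> pol" "\<And>x. x \<in> S0 \<Longrightarrow> s x * a x = c x * ev y1 x"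
      by (rule loc1E[OF a(2)]) (rule that)
    have "loc1 (ev y1) (\<lambda>x. l x * b x)"
    proof (rule loc1I[OF s(1)])
      show "(\<lambda>x. t x * c x * l' x) \<in> pol" by (intro pol_mult lunit_pol t s l)
      show "s x * (l x * b x) = t x * c x * l' x * ev y1 x" if x: "x \<in> S0" for x
        using t(3)[OF x] s(3)[OF x] by algebra
    qed
    from y1_prime[OF l(1) t(2) this nl] obtain s' c' where s': "lunit s'" "c' \<in> pol"
      "\<And>x. x \<in> S0 \<Longrightarrow> s' x * b x = c' x * ev y1 x" by (rule loc1E) (rule that)
    have "quot l l' c"
    proof (rule quotI[OF s(2) lunit_mult[OF s'(1) t(1)]])
      show "(\<lambda>x. s x * c' x) \<in> pol" by (intro pol_mult lunit_pol s s')
      show "s' x * t x * (c x * l' x) = s x * c' x * l x" if x: "x \<in> S0" for x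
      proof (rule cancel[OF pol_ev[of y1] y1_nonzero _ _ _ x])
        show "(\<lambda>x. s' x * t x * (c x * l' x)) \<in> pol" "(\<lambda>x. s x * c' x * l x) \<in> pol"
          by (intro pol_mult lunit_pol s s' t l)+
        show "ev y1 x * (s' x * t x * (c x * l' x)) = ev y1 x * (s x * c' x * l x)" if x: "x \<in> S0" for x
          using t(3)[OF x] s(3)[OF x] s'(3)[OF x] by algebra
      qed
    qed
    then show ?thesis using s by blast
  qed
  define val where "val a n \<longleftrightarrow> (\<exists>t u b. lunit t \<and> lunit u \<and> b \<in> pol \<and>
      (\<forall>x\<in>S0. t x * a x = u x * ev y2 x ^ n + b x * ev y1 x))" for a n
  have valex: "\<exists>n. val a n" if "a \<in> pol" "\<not> loc1 (ev y1) a" for a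
    by (rule valuation[OF that]) (unfold val_def, blast)
  have ql: "quot l l' l" by (rule quotI[OF l(1) lunit_1 l(2)]) (simp add: mult.commute)
  then have "\<exists>n a. quot l l' a \<and> val a n" using valex[OF l(1) nl] by blast
  note ex = this
  define n where "n = (LEAST n. \<exists>a. quot l l' a \<and> val a n)"
  have n: "\<exists>a. quot l l' a \<and> val a n" "\<And>m. \<exists>a. quot l l' a \<and> val a m \<Longrightarrow> n \<le> m"
    unfolding n_def by (rule LeastI_ex[OF ex], rule Least_le)
  then obtain g where g: "quot l l' g" "val g n" by blast
  have gp: "g \<in> pol" using g(1) by (simp add: quot_def)
  obtain t0 u0 b0 where g0: "lunit t0" "lunit u0" "b0 \<in> pol"
    "\<And>x. x \<in> S0 \<Longrightarrow> t0 x * g x = u0 x * ev y2 x ^ n + b0 x * ev y1 x"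
    using g(2) unfolding val_def by blast
  have step: "\<exists>s c a1. lunit s \<and> c \<in> pol \<and> quot l l' a1 \<and> (\<forall>x\<in>S0. s x * a x = c x * g x + a1 x * ev y1 x)"
    if a: "quot l l' a" for a
  proof (cases "loc1 (ev y1) a")
    case True
    then obtain s a1 where s: "lunit s" "quot l l' a1" "\<forall>x\<in>S0. s x * a x = a1 x * ev y1 x" using div a by blast
    then have "\<forall>x\<in>S0. s x * a x = (\<lambda>x. 0) x * g x + a1 x * ev y1 x" by simp
    then show ?thesis using s pol.const[of 0] by blast
  next
    case False
    have ap: "a \<in> pol" using a by (simp add: quot_def)
    obtain m where m: "val a m" using valex[OF ap False] by blast
    then have nm: "n \<le> m" using n(2) a by blast
    obtain t u b where t: "lunit t" "lunit u" "b \<in> pol"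
      "\<And>x. x \<in> S0 \<Longrightarrow> t x * a x = u x * ev y2 x ^ m + b x * ev y1 x"
      using m unfolding val_def by blast
    define a2 where "a2 = (\<lambda>x. (u0 x * t x) * a x - (u x * ev y2 x ^ (m - n) * t0 x) * g x)"
    have k: "(\<lambda>x. u x * ev y2 x ^ (m - n) * t0 x) \<in> pol" by (intro pol_mult pol_power pol_ev lunit_pol t g0)
    have "quot l l' a2" unfolding a2_def
      by (intro quot_diff a g(1) k pol_mult lunit_pol g0 t)
    moreover have "loc1 (ev y1) a2"
    proof (rule loc1I[OF lunit_1])
      show "(\<lambda>x. u0 x * b x - u x * ev y2 x ^ (m - n) * b0 x) \<in> pol"
        by (intro pol_diff pol_mult pol_power pol_ev lunit_pol t g0)
      show "1 * a2 x = (u0 x * b x - u x * ev y2 x ^ (m - n) * b0 x) * ev y1 x" if x: "x \<in> S0" for x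
      proof -
        define P Q R where "P = ev y2 x ^ m" and "Q = ev y2 x ^ (m - n)" and "R = ev y2 x ^ n"
        have "P = Q * R" unfolding P_def Q_def R_def using nm by (simp flip: power_add)
        then show ?thesis using t(4)[OF x, folded P_def] g0(4)[OF x, folded R_def]
          unfolding a2_def Q_def[symmetric] by algebra
      qed
    qed
    ultimately obtain s a1 where s: "lunit s" "quot l l' a1" "\<forall>x\<in>S0. s x * a2 x = a1 x * ev y1 x" using div by blast
    have "\<forall>x\<in>S0. (s x * (u0 x * t x)) * a x = (s x * (u x * ev y2 x ^ (m - n) * t0 x)) * g x + a1 x * ev y1 x"
      using s(3) unfolding a2_def by (simp add: algebra_simps)
    moreover have "lunit (\<lambda>x. s x * (u0 x * t x))" by (intro lunit_mult s g0 t)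
    moreover have "(\<lambda>x. s x * (u x * ev y2 x ^ (m - n) * t0 x)) \<in> pol" by (intro pol_mult k lunit_pol s)
    ultimately show ?thesis using s(2)
      by (intro exI[of _ "\<lambda>x. s x * (u0 x * t x)"] exI[of _ "\<lambda>x. s x * (u x * ev y2 x ^ (m - n) * t0 x)"] exI[of _ a1]) simp
  qed
  have "loc1 g a" if a: "quot l l' a" for a
  proof (rule krull_intersection[OF pol_ev y1p])
    have "\<exists>s c a1. lunit s \<and> c \<in> pol \<and> quot l l' a1 \<and> (\<forall>x\<in>S0. s x * a x = c x * g x + a1 x * ev y1 x ^ k)" for k
    proof (induction k)
      case 0
      have "\<forall>x\<in>S0. (\<lambda>x. 1) x * a x = (\<lambda>x. 0) x * g x + a x * ev y1 x ^ 0" by simp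
      then show ?case using a lunit_1 pol.const[of 0] by blast
    next
      case (Suc k)
      then obtain s c a1 where s: "lunit s" "c \<in> pol" "quot l l' a1"
        "\<forall>x\<in>S0. s x * a x = c x * g x + a1 x * ev y1 x ^ k" by blast
      obtain s' c' a2 where s': "lunit s'" "c' \<in> pol" "quot l l' a2"
        "\<forall>x\<in>S0. s' x * a1 x = c' x * g x + a2 x * ev y1 x" using step[OF s(3)] by blast
      have "\<forall>x\<in>S0. (s' x * s x) * a x = (s' x * c x + c' x * ev y1 x ^ k) * g x + a2 x * ev y1 x ^ Suc k"
      proof
        fix x assume x: "x \<in> S0"
        show "(s' x * s x) * a x = (s' x * c x + c' x * ev y1 x ^ k) * g x + a2 x * ev y1 x ^ Suc k"
        proof -
          define P where "P = ev y1 x ^ k"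
          show ?thesis using bspec[OF s(4) x, folded P_def] bspec[OF s'(4) x]
            unfolding power_Suc P_def[symmetric] by algebra
        qed
      qed
      moreover have "lunit (\<lambda>x. s' x * s x)" by (intro lunit_mult s s')
      moreover have "(\<lambda>x. s' x * c x + c' x * ev y1 x ^ k) \<in> pol"
        by (intro pol.add pol_mult pol_power pol_ev lunit_pol s s')
      ultimately show ?case using s'(3)
        by (intro exI[of _ "\<lambda>x. s' x * s x"] exI[of _ "\<lambda>x. s' x * c x + c' x * ev y1 x ^ k"] exI[of _ a2]) simp
    qed
    then show "loc2 g (\<lambda>x. ev y1 x ^ k) a" for k unfolding loc2_def quot_def by blast
  qed
  then show ?thesis using g(1) by (intro that)
qed

text \<open>The common power of y1 is removed from l and l' first, so that y1 fails to divide one of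
  the cofactors c and c'. If only c' qualifies, the two forms exchange their roles.\<close>

theorem quot_principal:
  assumes l: "l \<in> pol" "\<exists>x\<in>S0. l x \<noteq> 0" and l': "l' \<in> pol" "\<exists>x\<in>S0. l' x \<noteq> 0"
  obtains g b where "g \<in> pol" "b \<in> pol" "\<And>x. x \<in> S0 \<Longrightarrow> g x * l' x = b x * l x"
    "\<And>a a'. a \<in> pol \<Longrightarrow> a' \<in> pol \<Longrightarrow> (\<And>x. x \<in> S0 \<Longrightarrow> a x * l' x = a' x * l x) \<Longrightarrow> loc1 g a"
proof -
  define D where "D n \<longleftrightarrow> loc1 (\<lambda>x. ev y1 x ^ n) l \<and> loc1 (\<lambda>x. ev y1 x ^ n) l'" for n
  have "D 0" unfolding D_def by (intro conjI loc1I[OF lunit_1 l(1)] loc1I[OF lunit_1 l'(1)]) auto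
  have "\<exists>n. \<not> D n"
  proof (rule ccontr)
    assume "\<nexists>n. \<not> D n"
    then have L: "loc1 (\<lambda>x. ev y1 x ^ n) l" for n unfolding D_def by blast
    have "loc1 (\<lambda>x. 0) l"
    proof (rule krull_intersection[OF pol_ev y1p])
      fix n
      obtain t c where "lunit t" "c \<in> pol" "\<And>x. x \<in> S0 \<Longrightarrow> t x * l x = c x * ev y1 x ^ n"
        by (rule loc1E[OF L[of n]]) (rule that)
      then show "loc2 (\<lambda>x. 0) (\<lambda>x. ev y1 x ^ n) l" by (intro loc2I[of t "\<lambda>x. 0" c]) (auto intro: pol.const)
    qed
    then show False using loc1_0_zero l by blast
  qed
  then obtain n where n: "\<not> D n" "\<And>m. m < n \<Longrightarrow> D m"
    using ex_has_least_nat[of "\<lambda>n. \<not> D n" _ id] by (metis id_apply not_less)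
  obtain m where m: "n = Suc m" using n(1) \<open>D 0\<close> by (cases n) auto
  have Dm: "loc1 (\<lambda>x. ev y1 x ^ m) l" "loc1 (\<lambda>x. ev y1 x ^ m) l'" using n(2)[of m] m unfolding D_def by auto
  obtain t c where t: "lunit t" "c \<in> pol" "\<And>x. x \<in> S0 \<Longrightarrow> t x * l x = c x * ev y1 x ^ m"
    by (rule loc1E[OF Dm(1)]) (rule that)
  obtain t' c' where t': "lunit t'" "c' \<in> pol" "\<And>x. x \<in> S0 \<Longrightarrow> t' x * l' x = c' x * ev y1 x ^ m"
    by (rule loc1E[OF Dm(2)]) (rule that)
  have up: "loc1 (\<lambda>x. ev y1 x ^ n) f" if f: "lunit u" "\<And>x. x \<in> S0 \<Longrightarrow> u x * f x = d x * ev y1 x ^ m" "loc1 (ev y1) d"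
    for u f d
  proof -
    obtain s e where s: "lunit s" "e \<in> pol" "\<And>x. x \<in> S0 \<Longrightarrow> s x * d x = e x * ev y1 x"
      by (rule loc1E[OF f(3)]) (rule that)
    show ?thesis
    proof (rule loc1I[OF lunit_mult[OF s(1) f(1)] s(2)])
      show "s x * u x * f x = e x * ev y1 x ^ n" if x: "x \<in> S0" for x
      proof -
        define P where "P = ev y1 x ^ m"
        show ?thesis using f(2)[OF x, folded P_def] s(3)[OF x] unfolding m power_Suc P_def[symmetric] by algebra
      qed
    qed
  qed
  have either: "\<not> loc1 (ev y1) c \<or> \<not> loc1 (ev y1) c'"
    using n(1) up[OF t(1) t(3)] up[OF t'(1) t'(3)] unfolding D_def by blast
  have c'nz: "\<exists>x\<in>S0. c' x \<noteq> 0"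
  proof (rule ccontr)
    assume "\<not> (\<exists>x\<in>S0. c' x \<noteq> 0)"
    then have "t' x * l' x = 0" if "x \<in> S0" for x using t'(3)[OF that] that by simp
    then have "l' x = 0" if "x \<in> S0" for x
      using that t'(1) by (intro domain[of t' l' p x]) (auto simp: lunit_def p_S0 l')
    then show False using l'(2) by blast
  qed
  have y1m: "(\<lambda>x. ev y1 x ^ m) \<in> pol" "\<exists>x\<in>S0. ev y1 x ^ m \<noteq> 0" using y1_nonzero by (auto intro: pol_power pol_ev)
  have "\<exists>g. quot c c' g \<and> (\<forall>a. quot c c' a \<longrightarrow> loc1 g a)"
  proof (cases "loc1 (ev y1) c")
    case False
    show ?thesis by (rule quot_principal_prime[OF t(2) t'(2) False]) blast
  next
    case True
    then have "\<not> loc1 (ev y1) c'" using either by blast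
    then obtain g' where g': "quot c' c g'" "\<And>a. quot c' c a \<Longrightarrow> loc1 g' a"
      by (rule quot_principal_prime[OF t'(2) t(2)]) (rule that)
    obtain s b where s: "lunit s" "b \<in> pol" "\<And>x. x \<in> S0 \<Longrightarrow> s x * (g' x * c x) = b x * c' x"
      by (rule loc1E[of c' "\<lambda>x. g' x * c x"]) (use g'(1) in \<open>simp add: quot_def\<close>, rule that)
    have g'p: "g' \<in> pol" using g'(1) by (simp add: quot_def)
    \<comment> \<open>The ideals (c : c') and (c' : c) are isomorphic through multiplication by c /
      c', which takes the generator g' to b up to a unit.\<close>
    have "quot c c' b"
    proof (rule quotI[OF s(2) lunit_1])
      show "(\<lambda>x. s x * g' x) \<in> pol" by (intro pol_mult lunit_pol s g'p)
      show "1 * (b x * c' x) = s x * g' x * c x" if x: "x \<in> S0" for x using s(3)[OF x] by (simp add: mult.assoc)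
    qed
    moreover have "loc1 b a" if a: "quot c c' a" for a
    proof -
      have ap: "a \<in> pol" using a by (simp add: quot_def)
      obtain u a' where u: "lunit u" "a' \<in> pol" "\<And>x. x \<in> S0 \<Longrightarrow> u x * (a x * c' x) = a' x * c x"
        by (rule loc1E[of c "\<lambda>x. a x * c' x"]) (use a in \<open>simp add: quot_def\<close>, rule that)
      have "quot c' c a'"
      proof (rule quotI[OF u(2) lunit_1])
        show "(\<lambda>x. u x * a x) \<in> pol" by (intro pol_mult lunit_pol u ap)
        show "1 * (a' x * c x) = u x * a x * c' x" if x: "x \<in> S0" for x using u(3)[OF x] by (simp add: mult.assoc)
      qed
      from g'(2)[OF this] obtain v d where v: "lunit v" "d \<in> pol" "\<And>x. x \<in> S0 \<Longrightarrow> v x * a' x = d x * g' x"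
        by (rule loc1E) (rule that)
      show ?thesis
      proof (rule loc1I[OF lunit_mult[OF s(1) lunit_mult[OF v(1) u(1)]] v(2)])
        show "s x * (v x * u x) * a x = d x * b x" if x: "x \<in> S0" for x
        proof (rule cancel[OF t'(2) c'nz _ _ _ x])
          show "(\<lambda>x. s x * (v x * u x) * a x) \<in> pol" "(\<lambda>x. d x * b x) \<in> pol"
            by (intro pol_mult lunit_pol s v u ap)+
          show "c' x * (s x * (v x * u x) * a x) = c' x * (d x * b x)" if x: "x \<in> S0" for x
            using s(3)[OF x] u(3)[OF x] v(3)[OF x] by algebra
        qed
      qed
    qed
    ultimately show ?thesis by blast
  qed
  then obtain g where g: "quot c c' g" "\<And>a. quot c c' a \<Longrightarrow> loc1 g a" by blast
  have gp: "g \<in> pol" using g(1) by (simp add: quot_def)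
  obtain s b where s: "lunit s" "b \<in> pol" "\<And>x. x \<in> S0 \<Longrightarrow> s x * (g x * c' x) = b x * c x"
    by (rule loc1E[of c "\<lambda>x. g x * c' x"]) (use g(1) in \<open>simp add: quot_def\<close>, rule that)
  show ?thesis
  \<comment> \<open>Units are multiplied into the generator so that its equation holds on the whole
    slice without denominators.\<close>
  proof (rule that[of "\<lambda>x. (s x * t' x) * g x" "\<lambda>x. b x * t x"])
    show "(\<lambda>x. (s x * t' x) * g x) \<in> pol" "(\<lambda>x. b x * t x) \<in> pol" by (intro pol_mult lunit_pol s t t' gp)+
    show "s x * t' x * g x * l' x = b x * t x * l x" if x: "x \<in> S0" for x
    proof -
      define P where "P = ev y1 x ^ m"
      show ?thesis using s(3)[OF x] t(3)[OF x, folded P_def] t'(3)[OF x, folded P_def] by algebra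
    qed
    fix a a' assume a: "a \<in> pol" "a' \<in> pol" and aa: "\<And>x. x \<in> S0 \<Longrightarrow> a x * l' x = a' x * l x"
    have "quot c c' a"
    proof (rule quotI[OF a(1) t(1)])
      show "(\<lambda>x. a' x * t' x) \<in> pol" by (intro pol_mult lunit_pol a t')
      show "t x * (a x * c' x) = a' x * t' x * c x" if x: "x \<in> S0" for x
      proof (rule cancel[OF y1m _ _ _ x])
        show "(\<lambda>x. t x * (a x * c' x)) \<in> pol" "(\<lambda>x. a' x * t' x * c x) \<in> pol"
          by (intro pol_mult lunit_pol a t t')+
        show "ev y1 x ^ m * (t x * (a x * c' x)) = ev y1 x ^ m * (a' x * t' x * c x)" if x: "x \<in> S0" for x
        proof -
          define P where "P = ev y1 x ^ m"
          show ?thesis using t(3)[OF x, folded P_def] t'(3)[OF x, folded P_def] aa[OF x]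
            unfolding P_def[symmetric] by algebra
        qed
      qed
    qed
    from g(2)[OF this] obtain u d where u: "lunit u" "d \<in> pol" "\<And>x. x \<in> S0 \<Longrightarrow> u x * a x = d x * g x"
      by (rule loc1E) (rule that)
    show "loc1 (\<lambda>x. (s x * t' x) * g x) a"
    proof (rule loc1I[OF lunit_mult[OF lunit_mult[OF s(1) t'(1)] u(1)] u(2)])
      show "s x * t' x * u x * a x = d x * (s x * t' x * g x)" if x: "x \<in> S0" for x using u(3)[OF x] by algebra
    qed
  qed
qed

end

section \<open>Reducible quadrics in a linear system\<close>

text \<open>Comparing coefficients along the line t x shows that the component of c of degree e - d
  already does the job.\<close>

lemma homogeneous_quotient:
  assumes S: "pclosed S" and F: "hform e F" and g: "hform d g" and c: "c \<in> pol" and de: "d \<le> e"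
    and Fc: "\<And>x. x \<in> S \<Longrightarrow> F x = c x * g x"
  obtains c' where "hform (e - d) c'" "\<And>x. x \<in> S \<Longrightarrow> F x = c' x * g x"
proof -
  obtain M h where h: "\<And>k. hform k (h k)" "\<And>x. c x = (\<Sum>k<M. h k x)"
    by (rule pol_decomp[OF c]) (rule that)
  define c' where "c' = (if e - d < M then h (e - d) else (\<lambda>x. 0))"
  have "hform (e - d) c'" by (simp add: c'_def h(1) hform_0)
  moreover have "F x = c' x * g x" if x: "x \<in> S" for x
  proof -
    define P where "P = monom (F x) e - (\<Sum>k<M. monom (h k x * g x) (k + d))"
    have "poly P t = 0" if "t \<noteq> 0" for t
    proof -
      have "F (t *s x) = c (t *s x) * g (t *s x)" by (rule Fc[OF pclosed_scale[OF S x that]])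
      then have "t ^ e * F x = (\<Sum>k<M. t ^ k * h k x) * (t ^ d * g x)"
        unfolding h(2) hform_scale[OF F] hform_scale[OF g] hform_scale[OF h(1)] .
      then show ?thesis
        by (simp add: P_def poly_monom poly_sum sum_distrib_left sum_distrib_right power_add mult_ac)
    qed
    then have "P = 0" by (intro poly_zero_infinite[of "UNIV - {0}"]) (auto simp: infinite_UNIV_char_0)
    then have "coeff P e = 0" by simp
    moreover have "coeff P e = F x - (\<Sum>k<M. if k = e - d then h k x * g x else 0)"
      unfolding P_def coeff_diff coeff_sum coeff_monom using de
      by (intro arg_cong2[where f = "(-)"] sum.cong) auto
    ultimately show ?thesis by (simp add: c'_def)
  qed
  ultimately show ?thesis by (rule that)
qed

text \<open>The part of degree e of the ideal (l : l') in the homogeneous coordinate ring of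
  S.\<close>

definition quotient_forms ::
  "(complex ^ 'n) set \<Rightarrow> complex ^ 'n \<Rightarrow> complex ^ 'n \<Rightarrow> nat \<Rightarrow> (complex ^ 'n \<Rightarrow> complex) set" where
  "quotient_forms S l l' e = {a. hform e a \<and> (\<exists>a'. hform e a' \<and> (\<forall>x\<in>S. a x * ev l' x = a' x * ev l x))}"

text \<open>The homogenized local generator. The single multiplier T works for the whole ideal, so g
  generates it on the entire open set where T is nonzero, not just at p.\<close>

lemma local_generator:
  fixes S :: "(complex ^ 'n) set"
  assumes S: "smooth_variety S 2" and nd: "nondegenerate S" and l: "l \<noteq> 0" "l' \<noteq> 0" and p: "p \<in> S"
  obtains j d g b m T where "hform d g" "g \<in> quotient_forms S l l' d" "\<exists>x\<in>S. g x \<noteq> 0"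
    "hform d b" "\<And>x. x \<in> S \<Longrightarrow> g x * ev l' x = b x * ev l x"
    "hform m T" "T p \<noteq> 0" "d \<le> m" "\<And>x. T x \<noteq> 0 \<Longrightarrow> x $ j \<noteq> 0"
    "\<forall>e. \<forall>a\<in>quotient_forms S l l' e. \<exists>c. hform (m + e - d) c \<and> (\<forall>x\<in>S. T x * a x = c x * g x)"
proof -
  have SV: "pvariety S" and ch: "has_chain S 2" using S by (simp_all add: smooth_variety_def has_pdim_def)
  note Sc = pvariety_closed[OF SV]
  obtain y0 y1 y2 where y: "ev y0 p = 1" "ev y1 p = 0" "ev y2 p = 0"
    "\<And>x. x \<in> S \<Longrightarrow> ev y0 x \<noteq> 0 \<or> ev y1 x \<noteq> 0 \<or> ev y2 x \<noteq> 0"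
    "\<And>z. \<exists>a0 a1 a2. z - a0 *s y0 - a1 *s y1 - a2 *s y2 \<in> gradients S p"
    by (rule local_coordinates[OF S p]) (rule that)
  interpret surface_point S p y0 y1 y2
    by (unfold_locales) (rule SV, rule ch, rule p, rule y(1), rule y(2), rule y(3), erule y(4), rule y(5))
  have nz: "\<exists>x\<in>S0. ev z x \<noteq> 0" if "z \<noteq> 0" for z
  proof (rule ccontr)
    assume "\<not> (\<exists>x\<in>S0. ev z x \<noteq> 0)"
    then have "ev z x = 0" if "x \<in> S" for x
      by (intro slice_form_zero[OF SV hform_ev p _ _ that, of y0]) (auto simp: y0p)
    then show False using nd that unfolding nondegenerate_def by blast
  qed
  obtain g0 b0 where g0: "g0 \<in> pol" "b0 \<in> pol" "\<And>x. x \<in> S0 \<Longrightarrow> g0 x * ev l' x = b0 x * ev l x"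
    and gen: "\<And>a a'. a \<in> pol \<Longrightarrow> a' \<in> pol \<Longrightarrow> (\<And>x. x \<in> S0 \<Longrightarrow> a x * ev l' x = a' x * ev l x) \<Longrightarrow> loc1 g0 a"
    by (rule quot_principal[OF pol_ev nz[OF l(1)] pol_ev nz[OF l(2)]]) blast
  obtain Dg where Dg: "\<And>d. d \<ge> Dg \<Longrightarrow> \<exists>h. hform d h \<and> (\<forall>x. ev y0 x = 1 \<longrightarrow> h x = g0 x)"
    by (rule homogenize[OF g0(1)]) (rule that)
  obtain Db where Db: "\<And>d. d \<ge> Db \<Longrightarrow> \<exists>h. hform d h \<and> (\<forall>x. ev y0 x = 1 \<longrightarrow> h x = b0 x)"
    by (rule homogenize[OF g0(2)]) (rule that)
  define d where "d = Dg + Db"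
  obtain g where g: "hform d g" "\<forall>x. ev y0 x = 1 \<longrightarrow> g x = g0 x" using Dg[of d] by (auto simp: d_def)
  obtain b where b: "hform d b" "\<forall>x. ev y0 x = 1 \<longrightarrow> b x = b0 x" using Db[of d] by (auto simp: d_def)
  have one: "ev y0 x = 1" if "x \<in> S0" for x using that by (simp add: slice_def)
  have gb: "g x * ev l' x = b x * ev l x" if x: "x \<in> S" for x
  proof -
    have "g x * ev l' x - b x * ev l x = 0"
    proof (rule slice_form_zero[OF SV _ p _ _ x, where f = "\<lambda>x. g x * ev l' x - b x * ev l x" and y = y0])
      show "hform (d + 1) (\<lambda>x. g x * ev l' x - b x * ev l x)" by (intro hform_diff hform_mult g b hform_ev)
      show "g x * ev l' x - b x * ev l x = 0" if "x \<in> S0" for x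
        using g0(3)[OF that] spec[OF g(2), of x] spec[OF b(2), of x] one[OF that] by simp
    qed (simp add: y0p)
    then show ?thesis by simp
  qed
  have gq: "g \<in> quotient_forms S l l' d" unfolding quotient_forms_def using g(1) b(1) gb by blast
  have gnz: "\<exists>x\<in>S. g x \<noteq> 0"
  proof (rule ccontr)
    assume z: "\<not> (\<exists>x\<in>S. g x \<noteq> 0)"
    have "loc1 g0 (ev l)" by (rule gen[of "ev l" "ev l'"]) (auto intro: pol_ev)
    then obtain t c where t: "lunit t" "\<And>x. x \<in> S0 \<Longrightarrow> t x * ev l x = c x * g0 x" by (rule loc1E) (rule that)
    have "g0 x = 0" if "x \<in> S0" for x
    proof -
      have "x \<in> S" using that by (simp add: slice_def)
      then show ?thesis using z spec[OF g(2), of x] one[OF that] by auto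
    qed
    then have "ev l x = 0" if "x \<in> S0" for x
      using that t by (intro domain[OF lunit_pol[OF t(1)] pol_ev _ p_S0 _ that]) (auto simp: lunit_def)
    then show False using nz[OF l(1)] by blast
  qed
  have loc: "\<exists>m T. hform m T \<and> T p \<noteq> 0 \<and> (\<exists>c\<in>pol. \<forall>x\<in>S. T x * a x = c x * g x)"
    if a: "a \<in> quotient_forms S l l' e" for a e
  proof -
    obtain a' where a': "hform e a" "hform e a'" "\<forall>x\<in>S. a x * ev l' x = a' x * ev l x"
      using a unfolding quotient_forms_def by blast
    have "loc1 g0 a" using a' by (intro gen[of a a'] hform_pol) (auto simp: slice_def)
    then obtain t c where t: "lunit t" "c \<in> pol" "\<And>x. x \<in> S0 \<Longrightarrow> t x * a x = c x * g0 x" by (rule loc1E) (rule that)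
    obtain Dt where Dt: "\<And>d. d \<ge> Dt \<Longrightarrow> \<exists>h. hform d h \<and> (\<forall>x. ev y0 x = 1 \<longrightarrow> h x = t x)"
      by (rule homogenize[OF lunit_pol[OF t(1)]]) (rule that)
    obtain Dc where Dc: "\<And>d. d \<ge> Dc \<Longrightarrow> \<exists>h. hform d h \<and> (\<forall>x. ev y0 x = 1 \<longrightarrow> h x = c x)"
      by (rule homogenize[OF t(2)]) (rule that)
    define m where "m = Dt + Dc + d"
    obtain T where T: "hform m T" "\<forall>x. ev y0 x = 1 \<longrightarrow> T x = t x" using Dt[of m] by (auto simp: m_def)
    obtain c1 where c1: "hform (m + e - d) c1" "\<forall>x. ev y0 x = 1 \<longrightarrow> c1 x = c x"
      using Dc[of "m + e - d"] by (auto simp: m_def)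
    have "T x * a x = c1 x * g x" if x: "x \<in> S" for x
    proof -
      have "T x * a x - c1 x * g x = 0"
      proof (rule slice_form_zero[OF SV _ p _ _ x, where f = "\<lambda>x. T x * a x - c1 x * g x" and y = y0])
        have "m + e - d + d = m + e" by (simp add: m_def)
        then show "hform (m + e) (\<lambda>x. T x * a x - c1 x * g x)"
          using hform_mult[OF T(1) a'(1)] hform_mult[OF c1(1) g(1)] by (simp add: hform_diff)
        show "T x * a x - c1 x * g x = 0" if "x \<in> S0" for x
          using t(3)[OF that] spec[OF T(2), of x] spec[OF c1(2), of x] spec[OF g(2), of x] one[OF that] by simp
      qed (simp add: y0p)
      then show ?thesis by simp
    qed
    moreover have "T p \<noteq> 0" using spec[OF T(2), of p] t(1) y0p by (simp add: lunit_def)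
    ultimately show ?thesis using T(1) hform_pol[OF c1(1)] by blast
  qed
  \<comment> \<open>Each a brings its own denominator; as the ideal is finitely generated, the
    product over the generators is a common one.\<close>
  define Q where "Q = (\<Union>e. quotient_forms S l l' e)"
  have Qpol: "Q \<subseteq> pol" unfolding Q_def quotient_forms_def using hform_pol by blast
  obtain G where G: "finite G" "G \<subseteq> Q" "Q \<subseteq> idl pol G"
    using noetherian_pol[unfolded noetherian_def, rule_format, OF Qpol] by blast
  have "\<forall>a\<in>G. \<exists>w. hform (fst w) (snd w) \<and> snd w p \<noteq> 0 \<and> (\<exists>c\<in>pol. \<forall>x\<in>S. snd w x * a x = c x * g x)"
    using loc G(2) unfolding Q_def by fastforce
  then obtain w where w: "\<forall>a\<in>G. hform (fst (w a)) (snd (w a)) \<and> snd (w a) p \<noteq> 0 \<and>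
      (\<exists>c\<in>pol. \<forall>x\<in>S. snd (w a) x * a x = c x * g x)" by (elim bchoice[THEN exE])
  have p0: "p \<noteq> 0" by (rule pclosed_nonzero[OF Sc p])
  then obtain j where j: "p $ j \<noteq> 0" by (auto simp: vec_eq_iff)
  \<comment> \<open>The power of x_j ensures that x_j trivializes the hyperplane bundle where T is
    nonzero, and that d is at most m.\<close>
  define T where "T = (\<lambda>x. x $ j ^ Suc d * (\<Prod>a\<in>G. snd (w a) x))"
  define m where "m = Suc d + (\<Sum>a\<in>G. fst (w a))"
  have T: "hform m T" unfolding T_def m_def using w by (intro hform_mult hform_nth_power hform_prod) blast
  have Tp: "T p \<noteq> 0" using w j G(1) by (auto simp: T_def)
  have TG: "\<exists>c\<in>pol. \<forall>x\<in>S. T x * a x = c x * g x" if a: "a \<in> G" for a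
  proof -
    obtain c where c: "c \<in> pol" "\<forall>x\<in>S. snd (w a) x * a x = c x * g x" using w a by blast
    define r where "r = (\<lambda>x. x $ j ^ Suc d * (\<Prod>a\<in>G - {a}. snd (w a) x))"
    have "(\<lambda>x. \<Prod>a\<in>G - {a}. snd (w a) x) \<in> pol"
      using w by (intro pol_prod) (blast intro: hform_pol)
    then have "r \<in> pol" unfolding r_def by (intro pol_mult hform_pol[OF hform_nth_power])
    moreover have "T x * a x = (r x * c x) * g x" if x: "x \<in> S" for x
    proof -
      have "T x = r x * snd (w a) x" unfolding T_def r_def using G(1) a by (simp add: prod.remove[of G a])
      then have "T x * a x = r x * (snd (w a) x * a x)" by (simp add: mult.assoc)
      then show ?thesis using bspec[OF c(2) x] by (simp add: mult.assoc)
    qed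
    ultimately show ?thesis using c(1) by (intro bexI[of _ "\<lambda>x. r x * c x"] pol_mult) auto
  qed
  have TQ: "\<exists>c\<in>pol. \<forall>x\<in>S. T x * a x = c x * g x" if "a \<in> idl pol G" for a using that
  proof (induction rule: idl.induct)
    case idl_0
    show ?case by (intro bexI[of _ "\<lambda>x. 0"] pol.const) simp
  next
    case (idl_step r f h)
    obtain c where c: "c \<in> pol" "\<forall>x\<in>S. T x * f x = c x * g x" using TG[OF idl_step(2)] by blast
    obtain c' where c': "c' \<in> pol" "\<forall>x\<in>S. T x * h x = c' x * g x" using idl_step.IH by blast
    have "T x * (r * f + h) x = (r x * c x + c' x) * g x" if "x \<in> S" for x
    proof -
      have "T x * (r * f + h) x = r x * (T x * f x) + T x * h x" by (simp add: algebra_simps)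
      then show ?thesis using bspec[OF c(2) that] bspec[OF c'(2) that] by (simp add: algebra_simps)
    qed
    then show ?case using c(1) c'(1) idl_step(1)
      by (intro bexI[of _ "\<lambda>x. r x * c x + c' x"] pol.add pol_mult) auto
  qed
  have main: "\<exists>c. hform (m + e - d) c \<and> (\<forall>x\<in>S. T x * a x = c x * g x)" if a: "a \<in> quotient_forms S l l' e" for e a
  proof -
    have "a \<in> idl pol G" using a G(3) unfolding Q_def by blast
    then obtain c where c: "c \<in> pol" "\<forall>x\<in>S. T x * a x = c x * g x" using TQ by blast
    have ha: "hform e a" using a unfolding quotient_forms_def by blast
    have dm: "d \<le> m + e" by (simp add: m_def)
    obtain c' where "hform (m + e - d) c'" "\<And>x. x \<in> S \<Longrightarrow> T x * a x = c' x * g x"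
      by (rule homogeneous_quotient[OF Sc hform_mult[OF T ha] g(1) c(1) dm bspec[OF c(2)]]) (assumption, rule that)
    then show ?thesis by blast
  qed
  show ?thesis
    by (rule that[of d g b m T j]) (use g(1) gq gnz b(1) gb T Tp main in \<open>auto simp: m_def T_def\<close>)
qed

text \<open>If \<open>l A = l' B\<close> on \<open>S\<close>, the ideal sheaf \<open>(l : l')\<close> is a line bundle, hence isomorphic to some
  \<open>O(m)\<close>. It is contained in \<open>O\<close> and \<open>l\<close> is a section of its twist by \<open>O(1)\<close>, so \<open>m\<close> is \<open>0\<close> or \<open>-1\<close>.
  If \<open>m = 0\<close>, then \<open>l' / l\<close> is a regular function, i.e. constant; if \<open>m = -1\<close>, then \<open>l\<close> and \<open>B\<close> are
  sections of a trivial bundle.\<close>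

theorem proportional_factors:
  fixes S :: "(complex ^ 'n) set"
  assumes S: "smooth_variety S 2" and nd: "nondegenerate S" and Pic: "Pic_generated_by_hyperplane_class S"
    and l: "l \<noteq> 0" "\<And>c. l' \<noteq> c *s l"
    and lAB: "\<And>x. x \<in> S \<Longrightarrow> ev l x * ev A x = ev l' x * ev B x"
  obtains c where "B = c *s l"
proof -
  have SV: "pvariety S" using S by (simp add: smooth_variety_def)
  note Sc = pvariety_closed[OF SV]
  have l'0: "l' \<noteq> 0" using l(2)[of 0] by simp
  have sep: "\<exists>x\<in>S. ev z x \<noteq> 0" if "z \<noteq> 0" for z using nd that unfolding nondegenerate_def by blast
  define gen where "gen p w \<longleftrightarrow> (case w of (j, d, g, b, m, T) \<Rightarrow>
    hform d g \<and> g \<in> quotient_forms S l l' d \<and> (\<exists>x\<in>S. g x \<noteq> 0) \<and>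
    hform d b \<and> (\<forall>x\<in>S. g x * ev l' x = b x * ev l x) \<and>
    hform m T \<and> T p \<noteq> 0 \<and> d \<le> m \<and> (\<forall>x. T x \<noteq> 0 \<longrightarrow> x $ j \<noteq> 0) \<and>
    (\<forall>e. \<forall>a\<in>quotient_forms S l l' e. \<exists>c. hform (m + e - d) c \<and> (\<forall>x\<in>S. T x * a x = c x * g x)))"
    for p :: "complex ^ 'n" and w :: "'n \<times> nat \<times> (complex ^ 'n \<Rightarrow> complex) \<times> (complex ^ 'n \<Rightarrow> complex) \<times> nat \<times> (complex ^ 'n \<Rightarrow> complex)"
  have "\<forall>p\<in>S. \<exists>w. gen p w"
  proof
    fix p assume p: "p \<in> S"
    show "\<exists>w. gen p w"
      by (rule local_generator[OF S nd l(1) l'0 p]) (rule exI, unfold gen_def case_prod_conv, blast)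
  qed
  then obtain w where w: "\<forall>p\<in>S. gen p (w p)" by (elim bchoice[THEN exE])
  define TT where "TT p = (case w p of (j, d, g, b, m, T) \<Rightarrow> T)" for p
  have TT: "TT p \<in> pol \<and> TT p p \<noteq> 0" if p: "p \<in> S" for p
  proof -
    obtain j d g b m T where e: "w p = (j, d, g, b, m, T)" by (cases "w p")
    then have "hform m T \<and> T p \<noteq> 0" using bspec[OF w p] unfolding gen_def e case_prod_conv by blast
    then show ?thesis using hform_pol by (auto simp: TT_def e)
  qed
  \<comment> \<open>Quasi-compactness: finitely many of the multipliers generate the ideal of all of
    them, so they still have no common zero on S.\<close>
  have TTpol: "TT ` S \<subseteq> pol" using TT by blast
  obtain G where G: "finite G" "G \<subseteq> TT ` S" "TT ` S \<subseteq> idl pol G"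
    using noetherian_pol[unfolded noetherian_def, rule_format, OF TTpol] by blast
  obtain P where P: "P \<subseteq> S" "finite P" "G = TT ` P" using finite_subset_image[OF G(1,2)] by blast
  obtain q and r :: nat where q: "P = q ` {..<r}"
    using finite_imp_nat_seg_image_inj_on[OF P(2)] by (auto simp: lessThan_def)
  define I where "I = {..<r}"
  define jj dd gg bb mm T where "jj i = fst (w (q i))" and "dd i = fst (snd (w (q i)))"
    and "gg i = fst (snd (snd (w (q i))))" and "bb i = fst (snd (snd (snd (w (q i)))))"
    and "mm i = fst (snd (snd (snd (snd (w (q i))))))" and "T i = snd (snd (snd (snd (snd (w (q i))))))" for i
  have gw: "gen (q i) (jj i, dd i, gg i, bb i, mm i, T i)" if "i \<in> I" for i
  proof -
    have "q i \<in> S" using that P(1) q by (auto simp: I_def)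
    then show ?thesis using w by (simp add: jj_def dd_def gg_def bb_def mm_def T_def)
  qed
  have g: "hform (dd i) (gg i)" "gg i \<in> quotient_forms S l l' (dd i)" "\<exists>x\<in>S. gg i x \<noteq> 0"
    and b: "hform (dd i) (bb i)" "\<And>x. x \<in> S \<Longrightarrow> gg i x * ev l' x = bb i x * ev l x"
    and T: "hform (mm i) (T i)" "dd i \<le> mm i" "\<And>x. T i x \<noteq> 0 \<Longrightarrow> x $ jj i \<noteq> 0"
    and Tgen: "\<And>e a. a \<in> quotient_forms S l l' e \<Longrightarrow>
      \<exists>c. hform (mm i + e - dd i) c \<and> (\<forall>x\<in>S. T i x * a x = c x * gg i x)" if "i \<in> I" for i
    using gw[OF that] unfolding gen_def case_prod_conv by (elim conjE; blast)+
  have cover: "\<exists>i\<in>I. T i x \<noteq> 0" if x: "x \<in> S" for x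
  proof (rule ccontr)
    assume n: "\<not> (\<exists>i\<in>I. T i x \<noteq> 0)"
    have "g x = 0" if gG: "g \<in> G" for g
    proof -
      obtain i where i: "i \<in> I" "g = TT (q i)" using gG P(3) q by (auto simp: I_def)
      have "TT (q i) = T i" unfolding TT_def T_def by (simp add: case_prod_beta)
      then show ?thesis using n i by auto
    qed
    moreover have "TT x \<in> idl pol G" using G(3) x by blast
    ultimately have "TT x x = 0" by (intro idl_pol_zero[of "TT x" G x])
    then show False using TT[OF x] by blast
  qed
  define W where "W i = {x\<in>S. T i x \<noteq> 0}" for i
  have Wo: "popen_in S (W i)" if "i \<in> I" for i unfolding W_def by (rule popen_form[OF T(1)[OF that] Sc])
  have WS: "W i \<subseteq> S" for i unfolding W_def by blast
  define cf where "cf i e a = (SOME c. hform (mm i + e - dd i) c \<and> (\<forall>x\<in>S. T i x * a x = c x * gg i x))" for i e a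
  have cf: "hform (mm i + e - dd i) (cf i e a)" "\<And>x. x \<in> S \<Longrightarrow> T i x * a x = cf i e a x * gg i x"
    if "i \<in> I" "a \<in> quotient_forms S l l' e" for i e a
    using someI_ex[OF Tgen[OF that]] unfolding cf_def by blast+
  \<comment> \<open>On W a the generator gg b equals (c a b / T a) times gg a.\<close>
  define c where "c a b = cf a (dd b) (gg b)" for a b
  have c: "T a x * gg b x = c a b x * gg a x" if "a \<in> I" "b \<in> I" "x \<in> S" for a b x
    using cf(2)[OF that(1) g(2)[OF that(2)] that(3)] by (simp add: c_def)
  have ch: "hform (mm a + dd b - dd a) (c a b)" if "a \<in> I" "b \<in> I" for a b
    using cf(1)[OF that(1) g(2)[OF that(2)]] by (simp add: c_def)
  have canc: "f x = h x" if a: "a \<in> I" and fh: "hform k f" "hform k h" "\<And>x. x \<in> S \<Longrightarrow> gg a x * f x = gg a x * h x"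
    and x: "x \<in> S" for a k f h x
  proof -
    obtain z where z: "z \<in> S" "gg a z \<noteq> 0" using g(3)[OF a] by blast
    have "f x - h x = 0"
      by (rule pvariety_domain[OF SV g(1)[OF a] hform_diff[OF fh(1,2)] _ z x])
        (simp add: right_diff_distrib fh(3))
    then show ?thesis by simp
  qed
  have cA: "T b x * cf a e f x = cf b e f x * c a b x"
    if a: "a \<in> I" and b: "b \<in> I" and f: "f \<in> quotient_forms S l l' e" and x: "x \<in> S" for a b e f x
  proof (rule canc[OF a _ _ _ x])
    have e: "mm b + (mm a + e - dd a) = mm b + mm a + e - dd a" using T(2)[OF a] by simp
    have e': "(mm b + e - dd b) + (mm a + dd b - dd a) = mm b + mm a + e - dd a"
      using T(2)[OF a] T(2)[OF b] by simp
    show "hform (mm b + mm a + e - dd a) (\<lambda>x. T b x * cf a e f x)"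
      using hform_mult[OF T(1)[OF b] cf(1)[OF a f]] unfolding e .
    show "hform (mm b + mm a + e - dd a) (\<lambda>x. cf b e f x * c a b x)"
      using hform_mult[OF cf(1)[OF b f] ch[OF a b]] unfolding e' .
    show "gg a x * (T b x * cf a e f x) = gg a x * (cf b e f x * c a b x)" if x: "x \<in> S" for x
      using cf(2)[OF a f x] cf(2)[OF b f x] c[OF a b x] by algebra
  qed
  have cocycle: "T b x * c a d x = c a b x * c b d x" if "a \<in> I" "b \<in> I" "d \<in> I" "x \<in> S" for a b d x
    using cA[OF that(1,2) g(2)[OF that(3)] that(4)] by (simp add: c_def mult.commute)
  have caa: "c a a x = T a x" if a: "a \<in> I" and x: "x \<in> S" for a x
  proof (rule canc[OF a _ T(1)[OF a] _ x])
    show "hform (mm a) (c a a)" using ch[OF a a] by simp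
    show "gg a x * c a a x = gg a x * T a x" if "x \<in> S" for x using c[OF a a that] by (metis mult.commute)
  qed
  have cnz: "c a b x \<noteq> 0" if "a \<in> I" "b \<in> I" "x \<in> W a \<inter> W b" for a b x
  proof -
    have x: "x \<in> S" "T a x \<noteq> 0" "T b x \<noteq> 0" using that by (auto simp: W_def)
    have "T b x * T a x = c a b x * c b a x" using cocycle[OF that(1,2,1) x(1)] caa[OF that(1) x(1)] by simp
    then show ?thesis using x by auto
  qed
  \<comment> \<open>Division by X a makes the generator gg a a function of degree 0; gt a b is the
    ratio of the normalized generators of b and a.\<close>
  define X where "X a x = x $ jj a ^ dd a" for a and x :: "complex ^ 'n"
  have Xh: "hform (dd a) (X a)" for a unfolding X_def[abs_def] by (rule hform_nth_power)
  have Xnz: "X a x \<noteq> 0" if "a \<in> I" "x \<in> W a" for a x using T(3)[OF that(1)] that(2) by (simp add: X_def W_def)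
  define gt where "gt a b x = c a b x * X a x / (T a x * X b x)" for a b x
  have reg_gt: "gt a b \<in> regular S (W a \<inter> W b)" if ab: "a \<in> I" "b \<in> I" for a b
  proof (rule reg_at_regular[OF popen_Int[OF Wo[OF ab(1)] Wo[OF ab(2)]]])
    fix x assume x: "x \<in> W a \<inter> W b"
    show "reg_at S 0 (gt a b) x"
    proof (rule reg_atI[OF popen_Int[OF Wo[OF ab(1)] Wo[OF ab(2)]] x hform_mult[OF ch[OF ab] Xh[of a]]
          hform_mult[OF T(1)[OF ab(1)] Xh[of b]]])
      show "int (mm a + dd b - dd a + dd a) = int (mm a + dd b) + 0" using T(2)[OF ab(1)] by simp
      show "T a y * X b y \<noteq> 0" if "y \<in> W a \<inter> W b" for y
        using that Xnz[OF ab(2), of y] by (simp add: W_def)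
    qed (simp add: gt_def)
  qed
  have lb: "line_bundle S I W gt"
    unfolding line_bundle_def open_cover_def
  proof (intro conjI ballI)
    show "(\<Union>a\<in>I. W a) = S" using cover unfolding W_def by blast
    fix a assume a: "a \<in> I"
    show "popen_in S (W a)" by (rule Wo[OF a])
    fix b assume b: "b \<in> I"
    show "gt a b \<in> regular S (W a \<inter> W b)" by (rule reg_gt[OF a b])
    show "gt a b x \<noteq> 0" if "x \<in> W a \<inter> W b" for x
      using that cnz[OF a b that] Xnz[OF a, of x] Xnz[OF b, of x] by (simp add: gt_def W_def)
    fix d x assume d: "d \<in> I" and x: "x \<in> W a \<inter> W b \<inter> W d"
    have nz: "T a x \<noteq> 0" "T b x \<noteq> 0" "X b x \<noteq> 0" "X d x \<noteq> 0" "x \<in> S"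
      using x Xnz[OF b, of x] Xnz[OF d, of x] by (auto simp: W_def)
    show "gt a b x * gt b d x = gt a d x"
      using nz cocycle[OF a b d nz(5)] unfolding gt_def by (simp add: frac_eq_eq) algebra
  qed
  obtain m :: int where "line_bundle_iso S I W gt UNIV (std_open S) (\<lambda>i j x. hyperplane_cocycle i j x powi m)"
    using Pic lb unfolding Pic_generated_by_hyperplane_class_def by blast
  then obtain \<theta> where \<theta>: "\<forall>a\<in>I. \<forall>i\<in>UNIV. \<theta> i a \<in> regular S (W a \<inter> std_open S i) \<and>
        (\<forall>x\<in>W a \<inter> std_open S i. \<theta> i a x \<noteq> 0)"
    "\<forall>a\<in>I. \<forall>b\<in>I. \<forall>i\<in>UNIV. \<forall>j\<in>UNIV. \<forall>x\<in>W a \<inter> W b \<inter> std_open S i \<inter> std_open S j.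
       \<theta> i a x * gt a b x = hyperplane_cocycle i j x powi m * \<theta> j b x"
    unfolding line_bundle_iso_def by (elim exE conjE)
  have so: "popen_in S (std_open S i)" for i unfolding std_open_def by (rule popen_form[OF hform_nth Sc])
  define U where "U a i = W a \<inter> std_open S i" for a i
  have Uo: "popen_in S (U a i)" if "a \<in> I" for a i unfolding U_def by (intro popen_Int Wo that so)
  have \<theta>nz: "\<theta> i a x \<noteq> 0" if "a \<in> I" "x \<in> U a i" for a i x using \<theta>(1) that unfolding U_def by blast
  have \<theta>reg: "reg_at S 0 (\<theta> i a) x" if "a \<in> I" "x \<in> U a i" for a i x
    using regular_reg_at[of "\<theta> i a" S "U a i"] \<theta>(1) that unfolding U_def by blast
  \<comment> \<open>Rescaling \<theta> by x_i to the power m removes the dependence on i: E is a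
    nowhere vanishing local section of O(m) that is multiplied by gt a b in passing from a to
    b.\<close>
  define E where "E a i x = x $ i powi m * \<theta> i a x" for a i x
  have Enz: "E a i x \<noteq> 0" if "a \<in> I" "x \<in> U a i" for a i x
    using \<theta>nz[OF that] that(2) by (simp add: E_def U_def std_open_def)
  have Ereg: "reg_at S m (E a i) x" if "a \<in> I" "x \<in> U a i" for a i x
  proof -
    have "reg_at S m (\<lambda>x. x $ i powi m) x"
      using that(2) by (intro reg_at_nth_powi[OF Sc]) (auto simp: U_def std_open_def)
    from reg_at_mult[OF this \<theta>reg[OF that]] show ?thesis by (simp add: E_def[abs_def])
  qed
  have Egt: "E b j x = E a i x * gt a b x" if ab: "a \<in> I" "b \<in> I" and x: "x \<in> U a i" "x \<in> U b j" for a b i j x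
  proof -
    have "x \<in> W a \<inter> W b \<inter> std_open S i \<inter> std_open S j" using x by (auto simp: U_def)
    then have "\<theta> i a x * gt a b x = (x $ j / x $ i) powi m * \<theta> j b x"
      using \<theta>(2) ab unfolding hyperplane_cocycle_def by blast
    moreover have "x $ i \<noteq> 0" using x by (simp add: U_def std_open_def)
    ultimately show ?thesis by (simp add: E_def power_int_divide_distrib mult.assoc)
  qed
  have ex: "\<exists>w. fst w \<in> I \<and> x \<in> U (fst w) (snd w)" if x: "x \<in> S" for x
  proof -
    obtain a where "a \<in> I" "T a x \<noteq> 0" using cover[OF x] by blast
    moreover obtain i where "x $ i \<noteq> 0" using pclosed_nonzero[OF Sc x] by (auto simp: vec_eq_iff)
    ultimately show ?thesis using x by (intro exI[of _ "(a, i)"]) (simp add: U_def W_def std_open_def)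
  qed
  \<comment> \<open>One chart per point, so that compatible local data are glued by evaluating them
    in the chosen chart.\<close>
  define ch where "ch x = (SOME w. fst w \<in> I \<and> x \<in> U (fst w) (snd w))" for x
  have ch: "fst (ch x) \<in> I" "x \<in> U (fst (ch x)) (snd (ch x))" if "x \<in> S" for x
    using someI_ex[OF ex[OF that]] unfolding ch_def by blast+
  have glue: "reg S n (\<lambda>x. H (fst (ch x)) (snd (ch x)) x)"
    if compat: "\<And>a b i j x. a \<in> I \<Longrightarrow> b \<in> I \<Longrightarrow> x \<in> U a i \<Longrightarrow> x \<in> U b j \<Longrightarrow> H a i x = H b j x"
      and at: "\<And>a i x. a \<in> I \<Longrightarrow> x \<in> U a i \<Longrightarrow> reg_at S n (H a i) x" for n H
    unfolding reg_def
  proof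
    fix x assume x: "x \<in> S"
    show "reg_at S n (\<lambda>x. H (fst (ch x)) (snd (ch x)) x) x"
    proof (rule reg_at_cong[OF at[OF ch[OF x]] Uo[OF ch(1)[OF x]] ch(2)[OF x]])
      fix y assume y: "y \<in> U (fst (ch x)) (snd (ch x))"
      then have yS: "y \<in> S" using WS by (auto simp: U_def)
      show "H (fst (ch y)) (snd (ch y)) y = H (fst (ch x)) (snd (ch x)) y"
        by (rule compat[OF ch(1)[OF yS] ch(1)[OF x] ch(2)[OF yS] y])
    qed
  qed
  have UW: "x \<in> S" "T a x \<noteq> 0" "X a x \<noteq> 0" if "a \<in> I" "x \<in> U a i" for a i x
    using that Xnz[OF that(1), of x] by (auto simp: U_def W_def)
  \<comment> \<open>Identifying the ideal sheaf with O(m), K1 is its inclusion into O, a section of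
    O(- m). A member f of degree e corresponds to the section KA of O(m + e) below, and f is the
    product of both.\<close>
  define K1 where "K1 a i x = gg a x / X a x * inverse (E a i x)" for a i x
  have K1: "reg S (- m) (\<lambda>x. K1 (fst (ch x)) (snd (ch x)) x)"
  proof (rule glue)
    fix a b i j x assume ab: "a \<in> I" "b \<in> I" and x: "x \<in> U a i" "x \<in> U b j"
    note nz = UW[OF ab(1) x(1)] UW[OF ab(2) x(2)] Enz[OF ab(1) x(1)]
    have "c a b x \<noteq> 0" using cnz[OF ab, of x] x by (auto simp: U_def)
    moreover have "gg b x = c a b x * gg a x / T a x" using c[OF ab nz(1)] nz by (simp add: field_simps)
    ultimately show "K1 a i x = K1 b j x"
      unfolding K1_def Egt[OF ab x] gt_def using nz by (simp add: field_simps)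
  next
    fix a i x assume a: "a \<in> I" "x \<in> U a i"
    have "reg_at S 0 (\<lambda>x. gg a x / X a x) x"
      by (rule reg_atI[OF Uo[OF a(1)] a(2) g(1)[OF a(1)] Xh[of a]]) (use UW(3)[OF a(1)] in auto)
    from reg_at_mult[OF this reg_at_inverse[OF Sc Ereg[OF a] Enz[OF a]]]
    show "reg_at S (- m) (K1 a i) x" by (simp add: K1_def[abs_def])
  qed
  define KA where "KA e f a i x = E a i x * (cf a e f x * X a x / T a x)" for e f a i x
  have KA: "reg S (m + int e) (\<lambda>x. KA e f (fst (ch x)) (snd (ch x)) x)" if f: "f \<in> quotient_forms S l l' e" for e f
  proof (rule glue)
    fix a b i j x assume ab: "a \<in> I" "b \<in> I" and x: "x \<in> U a i" "x \<in> U b j"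
    note nz = UW[OF ab(1) x(1)] UW[OF ab(2) x(2)]
    have "cf a e f x = cf b e f x * c a b x / T b x" using cA[OF ab f nz(1)] nz by (simp add: field_simps)
    then show "KA e f a i x = KA e f b j x"
      unfolding KA_def Egt[OF ab x] gt_def using nz by (simp add: field_simps)
  next
    fix a i x assume a: "a \<in> I" "x \<in> U a i"
    have "reg_at S (int e) (\<lambda>x. cf a e f x * X a x / T a x) x"
      by (rule reg_atI[OF Uo[OF a(1)] a(2) hform_mult[OF cf(1)[OF a(1) f] Xh[of a]] T(1)[OF a(1)]])
        (use UW(2)[OF a(1)] T(2)[OF a(1)] in auto)
    from reg_at_mult[OF Ereg[OF a] this] show "reg_at S (m + int e) (KA e f a i) x" by (simp add: KA_def[abs_def])
  qed
  have prod: "K1 (fst (ch x)) (snd (ch x)) x * KA e f (fst (ch x)) (snd (ch x)) x = f x"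
    if f: "f \<in> quotient_forms S l l' e" and x: "x \<in> S" for e f x
  proof -
    note nz = UW[OF ch[OF x]] Enz[OF ch[OF x]]
    show ?thesis unfolding K1_def KA_def using nz cf(2)[OF ch(1)[OF x] f x] by (simp add: field_simps)
  qed
  obtain p where p: "p \<in> S" using pvariety_nonempty[OF SV] by blast
  \<comment> \<open>For \<open>reg_negative\<close> a linear form is needed that has a zero on S
    without vanishing identically there.\<close>
  have "\<exists>y. y \<noteq> 0 \<and> ev y p = 0"
  proof (cases "ev l p = 0")
    case False
    have "ev l p *s l' - ev l' p *s l \<noteq> 0"
    proof
      assume "ev l p *s l' - ev l' p *s l = 0"
      then have "ev l p * l' $ i = ev l' p * l $ i" for i by (simp add: vec_eq_iff)
      then have "l' = (ev l' p / ev l p) *s l" using False by (simp add: vec_eq_iff field_simps)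
      then show False using l(2) by blast
    qed
    moreover have "ev (ev l p *s l' - ev l' p *s l) p = 0" by (simp add: ev_diff_left ev_scale_left)
    ultimately show ?thesis by blast
  qed (use l in blast)
  then obtain y z where y: "ev y p = 0" "z \<in> S" "ev y z \<noteq> 0" using sep by blast
  note neg = reg_negative[OF SV _ _ p y]
  have lq: "ev l \<in> quotient_forms S l l' 1"
    unfolding quotient_forms_def using hform_ev by (intro CollectI conjI exI[of _ "ev l'"]) (auto simp: mult.commute)
  have Bq: "ev B \<in> quotient_forms S l l' 1"
    unfolding quotient_forms_def using hform_ev lAB by (intro CollectI conjI exI[of _ "ev A"]) (auto simp: mult.commute)
  obtain xl where xl: "xl \<in> S" "ev l xl \<noteq> 0" using sep[OF l(1)] by blast
  have "m \<le> 0"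
  proof (rule ccontr)
    assume "\<not> m \<le> 0"
    then have "K1 (fst (ch xl)) (snd (ch xl)) xl = 0" by (intro neg[OF K1 _ xl(1)]) simp
    then show False using prod[OF lq xl(1)] xl(2) by simp
  qed
  moreover have "m \<ge> - 1"
  proof (rule ccontr)
    assume "\<not> m \<ge> - 1"
    then have "KA 1 (ev l) (fst (ch xl)) (snd (ch xl)) xl = 0" by (intro neg[OF KA[OF lq] _ xl(1)]) simp
    then show False using prod[OF lq xl(1)] xl(2) by simp
  qed
  ultimately consider "m = 0" | "m = - 1" by linarith
  then show ?thesis
  proof cases
    case 1
    have "reg S 0 (\<lambda>x. K1 (fst (ch x)) (snd (ch x)) x)" using K1 1 by simp
    then obtain k where k: "\<And>x. x \<in> S \<Longrightarrow> K1 (fst (ch x)) (snd (ch x)) x = k"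
      by (rule regular_constant[OF SV]) (rule that)
    have "k \<noteq> 0" using k[OF xl(1)] prod[OF lq xl(1)] xl(2) by auto
    \<comment> \<open>As K1 is a nonzero constant, the generators vanish nowhere; so bb / gg is a
      regular function, and it represents l' / l.\<close>
    have gnz: "gg a x \<noteq> 0" if a: "a \<in> I" "x \<in> U a i" for a i x
    proof
      assume z: "gg a x = 0"
      note x = UW(1)[OF a]
      have "T a x * gg (fst (ch x)) x = 0" using c[OF a(1) ch(1)[OF x] x] z by simp
      then have "K1 (fst (ch x)) (snd (ch x)) x = 0" using UW(2)[OF a] by (simp add: K1_def)
      then show False using k[OF x] \<open>k \<noteq> 0\<close> by simp
    qed
    have "reg S 0 (\<lambda>x. bb (fst (ch x)) x / gg (fst (ch x)) x)"
    proof (rule glue[where H = "\<lambda>a i x. bb a x / gg a x"])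
      fix a b i j x assume ab: "a \<in> I" "b \<in> I" and x: "x \<in> U a i" "x \<in> U b j"
      note xS = UW(1)[OF ab(1) x(1)]
      have "gg a x * bb b x - gg b x * bb a x = 0"
      proof (rule pvariety_domain[OF SV hform_ev[of l] _ _ xl(1) xl(2) xS])
        have "hform (dd a + dd b) (\<lambda>x. gg a x * bb b x)" by (rule hform_mult[OF g(1)[OF ab(1)] b(1)[OF ab(2)]])
        moreover have "hform (dd a + dd b) (\<lambda>x. gg b x * bb a x)"
          using hform_mult[OF g(1)[OF ab(2)] b(1)[OF ab(1)]] by (simp add: add.commute)
        ultimately show "hform (dd a + dd b) (\<lambda>x. gg a x * bb b x - gg b x * bb a x)" by (rule hform_diff)
        show "ev l x * (gg a x * bb b x - gg b x * bb a x) = 0" if x: "x \<in> S" for x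
          using b(2)[OF ab(1) x] b(2)[OF ab(2) x] by algebra
      qed
      then show "bb a x / gg a x = bb b x / gg b x"
        using gnz[OF ab(1) x(1)] gnz[OF ab(2) x(2)] by (simp add: frac_eq_eq mult.commute)
    next
      fix a i x assume a: "a \<in> I" "x \<in> U a i"
      show "reg_at S 0 (\<lambda>x. bb a x / gg a x) x"
        by (rule reg_atI[OF Uo[OF a(1)] a(2) b(1)[OF a(1)] g(1)[OF a(1)]]) (use gnz[OF a(1)] in auto)
    qed
    then obtain f where f: "\<And>x. x \<in> S \<Longrightarrow> bb (fst (ch x)) x / gg (fst (ch x)) x = f"
      by (rule regular_constant[OF SV]) (rule that)
    have "ev (l' - f *s l) x = 0" if x: "x \<in> S" for x
    proof -
      have "bb (fst (ch x)) x = f * gg (fst (ch x)) x" using f[OF x] gnz[OF ch[OF x]] by (simp add: field_simps)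
      then show ?thesis using b(2)[OF ch(1)[OF x] x] gnz[OF ch[OF x]] by (simp add: ev_diff_left ev_scale_left)
    qed
    then have "l' - f *s l = 0" using sep by blast
    then have "l' = f *s l" by simp
    then show ?thesis using l(2) by blast
  next
    case 2
    have "reg S 0 (\<lambda>x. KA 1 (ev l) (fst (ch x)) (snd (ch x)) x)" using KA[OF lq] 2 by simp
    then obtain k where k: "\<And>x. x \<in> S \<Longrightarrow> KA 1 (ev l) (fst (ch x)) (snd (ch x)) x = k"
      by (rule regular_constant[OF SV]) (rule that)
    have "reg S 0 (\<lambda>x. KA 1 (ev B) (fst (ch x)) (snd (ch x)) x)" using KA[OF Bq] 2 by simp
    then obtain k' where k': "\<And>x. x \<in> S \<Longrightarrow> KA 1 (ev B) (fst (ch x)) (snd (ch x)) x = k'"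
      by (rule regular_constant[OF SV]) (rule that)
    have "k \<noteq> 0" using k[OF xl(1)] prod[OF lq xl(1)] xl(2) by auto
    have "ev (B - (k' / k) *s l) x = 0" if x: "x \<in> S" for x
    proof -
      have "ev l x = K1 (fst (ch x)) (snd (ch x)) x * k" using prod[OF lq x] unfolding k[OF x] by (rule sym)
      moreover have "ev B x = K1 (fst (ch x)) (snd (ch x)) x * k'" using prod[OF Bq x] unfolding k'[OF x] by (rule sym)
      ultimately show ?thesis using \<open>k \<noteq> 0\<close> by (simp add: ev_diff_left ev_scale_left)
    qed
    then have "B - (k' / k) *s l = 0" using sep by blast
    then show ?thesis by (intro that[of "k' / k"]) simp
  qed
qed

section \<open>Linear sections of Grassmannians of lines\<close>

lemma digits:
  fixes K :: nat assumes "K > 0" "n < K ^ N"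
  shows "n = (\<Sum>t<N. (n div K ^ t mod K) * K ^ t)"
  using assms(2)
proof (induction N arbitrary: n)
  case (Suc N)
  have "n div K < K ^ N" using Suc.prems assms(1) by (simp add: less_mult_imp_div_less mult.commute)
  then have "n div K = (\<Sum>t<N. (n div K div K ^ t mod K) * K ^ t)" by (rule Suc.IH)
  then have "K * (n div K) = K * (\<Sum>t<N. (n div K div K ^ t mod K) * K ^ t)" by (rule arg_cong)
  also have "\<dots> = (\<Sum>t<N. (n div K ^ Suc t mod K) * K ^ Suc t)"
    by (simp add: sum_distrib_left div_mult2_eq mult_ac)
  finally show ?case using mult_div_mod_eq[of K n] unfolding sum.lessThan_Suc_shift by simp
qed simp

text \<open>The prescribed sum determines the exponent at m0 from the others; this is what lowers
  the growth by one power.\<close>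

lemma card_exponents:
  fixes M :: "'m set"
  assumes M: "finite M" "m0 \<in> M"
  shows "card {\<mu> \<in> Pi\<^sub>E M (\<lambda>_. {..d::nat}). sum \<mu> M = s} \<le> (d + 1) ^ (card M - 1)"
proof -
  let ?A = "{\<mu> \<in> Pi\<^sub>E M (\<lambda>_. {..d::nat}). sum \<mu> M = s}"
  let ?B = "Pi\<^sub>E (M - {m0}) (\<lambda>_. {..d})"
  have "inj_on (\<lambda>\<mu>. restrict \<mu> (M - {m0})) ?A"
  proof (rule inj_onI)
    fix \<mu> \<nu> assume a: "\<mu> \<in> ?A" "\<nu> \<in> ?A" and r: "restrict \<mu> (M - {m0}) = restrict \<nu> (M - {m0})"
    have e: "\<mu> m = \<nu> m" if "m \<in> M - {m0}" for m using fun_cong[OF r, of m] that by simp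
    have "\<mu> m0 + sum \<mu> (M - {m0}) = \<nu> m0 + sum \<nu> (M - {m0})"
      using a M by (simp flip: sum.remove)
    moreover have "sum \<mu> (M - {m0}) = sum \<nu> (M - {m0})" by (intro sum.cong refl e)
    ultimately have "\<mu> m = \<nu> m" if "m \<in> M" for m using e[of m] that by (cases "m = m0") auto
    then show "\<mu> = \<nu>" using a by (intro PiE_ext[of \<mu> M "\<lambda>_. {..d}" \<nu>]) auto
  qed
  moreover have "(\<lambda>\<mu>. restrict \<mu> (M - {m0})) ` ?A \<subseteq> ?B"
  proof (intro image_subsetI PiE_I)
    fix \<mu> m assume "\<mu> \<in> ?A" "m \<in> M - {m0}"
    then have "\<mu> m \<in> {..d}" by (intro PiE_mem[of \<mu> M "\<lambda>_. {..d}" m]) auto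
    then show "restrict \<mu> (M - {m0}) m \<in> {..d}" using \<open>m \<in> M - {m0}\<close> by simp
  qed auto
  ultimately have "card ?A \<le> card ?B" by (rule card_inj_on_le) (intro finite_PiE, use M in auto)
  also have "\<dots> = (d + 1) ^ (card M - 1)" using M by (simp add: card_PiE)
  finally show ?thesis .
qed

text \<open>The bivector \<open>u \<and> w\<close> is in the kernel of \<open>\<beta>\<close>. If there were no nonzero decomposable bivector
  in the kernel, then, by the Nullstellensatz, the homogeneous coordinate ring of the Grassmannian
  would be a finite module over the polynomials in \<open>2 k\<close> linear forms, and its Hilbert
  function would have growth \<open>d ^ (2 k - 1)\<close>; but the \<open>2 k\<close> affine coordinates of a chart are independent,
  as is seen on the curves where they are \<open>T, T ^ K, T ^ (K ^ 2), \<dots>\<close>.\<close>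

lemma decomposable_in_kernel:
  fixes \<beta> :: "'n::finite \<Rightarrow> 'n \<Rightarrow> complex ^ 'n"
  assumes k: "k \<ge> 1" "CARD('n) = 2 * k + 1" and J: "card J = k + 2"
    and anti: "\<And>i j. i \<in> J \<Longrightarrow> j \<in> J \<Longrightarrow> \<beta> i j = - \<beta> j i"
    and \<psi>: "\<psi> \<noteq> 0" "\<And>i j. i \<in> J \<Longrightarrow> j \<in> J \<Longrightarrow> ev \<psi> (\<beta> i j) = 0"
  obtains u w i j where "i \<in> J" "j \<in> J" "u i * w j - u j * w i \<noteq> 0"
    "(\<Sum>i\<in>J. \<Sum>j\<in>J. (u i * w j) *s \<beta> i j) = 0"
proof (rule ccontr)
  assume nt: "\<not> thesis"
  note th = that
  have no: "(\<Sum>i\<in>J. \<Sum>j\<in>J. (u i * w j) *s \<beta> i j) \<noteq> 0"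
    if "i \<in> J" "j \<in> J" "u i * w j - u j * w i \<noteq> 0" for u w i j using th[OF that] nt by blast
  \<comment> \<open>\<psi> expresses coordinate i0 of every \<beta> i j by the other coordinates, so
    the 2 k coordinates in M suffice.\<close>
  obtain i0 where i0: "\<psi> $ i0 \<noteq> 0" using \<psi>(1) by (auto simp: vec_eq_iff)
  define M where "M = UNIV - {i0}"
  have cM: "card M = 2 * k" using k by (simp add: M_def card_Diff_singleton)
  define pl where "pl i j a b P = P $ (i, j) * P $ (a, b) - P $ (i, a) * P $ (j, b) + P $ (i, b) * P $ (j, a)"
    for i j a b and P :: "complex ^ ('n \<times> 'n)"
  define bt where "bt m P = (\<Sum>i\<in>J. \<Sum>j\<in>J. (\<beta> i j $ m) * P $ (i, j))" for m and P :: "complex ^ ('n \<times> 'n)"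
  define sk where "sk i j P = P $ (i, j) + P $ (j, i)" for i j and P :: "complex ^ ('n \<times> 'n)"
  define co where "co i j P = P $ (i, j)" for i j and P :: "complex ^ ('n \<times> 'n)"
  \<comment> \<open>A point P is a full matrix; its entries have to be skew, supported on J, subject
    to the Pluecker relations, and killed by the 2 k linear forms.\<close>
  define F where "F = {pl i j a b | i j a b. True} \<union> {sk i j | i j. True} \<union> {co i j | i j. i \<notin> J \<or> j \<notin> J} \<union> bt ` M"
  have plF: "pl i j a b \<in> F" and skF: "sk i j \<in> F" for i j a b unfolding F_def by blast+
  have coF: "co i j \<in> F" if "i \<notin> J \<or> j \<notin> J" for i j using that unfolding F_def by blast
  have btF: "bt m \<in> F" if "m \<in> M" for m using that unfolding F_def by blast
  have hbt: "hform 1 (bt m)" for m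
    unfolding bt_def[abs_def] by (intro hform_sum hform_cmult hform_nth)
  have hpl: "hform 2 (pl i j a b)" for i j a b
  proof -
    have "hform (1 + 1) (pl i j a b)"
      unfolding pl_def[abs_def] by (intro hform.add hform_diff hform_mult hform_nth)
    then show ?thesis by (simp add: numeral_2_eq_2)
  qed
  have hF: "\<exists>d. hform d f" if "f \<in> F" for f
  proof -
    have "hform 1 (sk i j)" "hform 1 (co i j)" for i j
      unfolding sk_def[abs_def] co_def[abs_def] by (intro hform.add hform_nth)+
    then show ?thesis using that hbt hpl unfolding F_def by blast
  qed
  have "P = 0" if P: "\<And>f. f \<in> F \<Longrightarrow> f P = 0" for P
  proof (rule ccontr)
    assume "P \<noteq> 0"
    then obtain ab where "P $ ab \<noteq> 0" by (auto simp: vec_eq_iff)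
    then obtain a b where ab: "P $ (a, b) \<noteq> 0" by (cases ab) auto
    have out: "P $ (i, j) = 0" if "i \<notin> J \<or> j \<notin> J" for i j
      using P[OF coF[OF that]] by (simp add: co_def)
    have skew: "P $ (i, j) = - P $ (j, i)" for i j
    proof -
      have "sk i j P = 0" by (rule P[OF skF])
      then show ?thesis by (simp add: sk_def eq_neg_iff_add_eq_0)
    qed
    have abJ: "a \<in> J" "b \<in> J" using out ab by auto
    \<comment> \<open>By the Pluecker relations the wedge of rows a and b is P(a, b) times the whole
      matrix, so a nonzero P gives a decomposable element of the kernel.\<close>
    define u w where "u i = P $ (a, i)" and "w i = P $ (b, i)" for i
    have dec: "u i * w j - u j * w i = P $ (a, b) * P $ (i, j)" for i j
    proof -
      have "pl a b i j P = 0" by (rule P[OF plF])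
      then show ?thesis unfolding pl_def u_def w_def by algebra
    qed
    have "bt m P = 0" if "m \<noteq> i0" for m by (rule P[OF btF]) (use that in \<open>simp add: M_def\<close>)
    moreover have "(\<Sum>m\<in>UNIV. \<psi> $ m * bt m P) = 0"
    proof -
      have "(\<Sum>m\<in>UNIV. \<psi> $ m * bt m P) = (\<Sum>m\<in>UNIV. \<Sum>i\<in>J. \<Sum>j\<in>J. \<psi> $ m * (\<beta> i j $ m * P $ (i, j)))"
        by (simp add: bt_def sum_distrib_left)
      also have "\<dots> = (\<Sum>i\<in>J. \<Sum>m\<in>UNIV. \<Sum>j\<in>J. \<psi> $ m * (\<beta> i j $ m * P $ (i, j)))" by (rule sum.swap)
      also have "\<dots> = (\<Sum>i\<in>J. \<Sum>j\<in>J. \<Sum>m\<in>UNIV. \<psi> $ m * (\<beta> i j $ m * P $ (i, j)))"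
        by (rule sum.cong[OF refl]) (rule sum.swap)
      also have "\<dots> = (\<Sum>i\<in>J. \<Sum>j\<in>J. ev \<psi> (\<beta> i j) * P $ (i, j))"
        by (simp add: ev_def sum_distrib_right mult.assoc)
      also have "\<dots> = 0" using \<psi>(2) by simp
      finally show ?thesis .
    qed
    moreover have "(\<Sum>m\<in>UNIV. \<psi> $ m * bt m P) = \<psi> $ i0 * bt i0 P + (\<Sum>m\<in>UNIV - {i0}. \<psi> $ m * bt m P)"
      by (rule sum.remove) auto
    ultimately have "bt i0 P = 0" using i0 by simp
    with \<open>\<And>m. m \<noteq> i0 \<Longrightarrow> bt m P = 0\<close> have bt0: "bt m P = 0" for m by (cases "m = i0") auto
    have "(\<Sum>i\<in>J. \<Sum>j\<in>J. (u i * w j) *s \<beta> i j) $ m = 0" for m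
    proof -
      let ?s = "\<Sum>i\<in>J. \<Sum>j\<in>J. u i * w j * \<beta> i j $ m"
      have "?s = (\<Sum>j\<in>J. \<Sum>i\<in>J. u i * w j * \<beta> i j $ m)" by (rule sum.swap)
      also have "\<dots> = (\<Sum>i\<in>J. \<Sum>j\<in>J. - (u j * w i * \<beta> i j $ m))"
      proof (intro sum.cong refl)
        fix i j assume "i \<in> J" "j \<in> J"
        then have "\<beta> j i $ m = - \<beta> i j $ m" using anti[of j i] by simp
        then show "u j * w i * \<beta> j i $ m = - (u j * w i * \<beta> i j $ m)" by simp
      qed
      finally have "?s + ?s = (\<Sum>i\<in>J. \<Sum>j\<in>J. u i * w j * \<beta> i j $ m) + (\<Sum>i\<in>J. \<Sum>j\<in>J. - (u j * w i * \<beta> i j $ m))"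
        by simp
      also have "\<dots> = (\<Sum>i\<in>J. \<Sum>j\<in>J. (u i * w j - u j * w i) * \<beta> i j $ m)"
        by (simp add: sum.distrib[symmetric] left_diff_distrib)
      also have "\<dots> = P $ (a, b) * bt m P"
        unfolding dec bt_def by (simp add: sum_distrib_left mult_ac)
      finally show ?thesis using bt0 by simp
    qed
    then have "(\<Sum>i\<in>J. \<Sum>j\<in>J. (u i * w j) *s \<beta> i j) = 0" by (simp add: vec_eq_iff)
    moreover have "u a * w b - u b * w a \<noteq> 0" unfolding dec using ab by simp
    ultimately show False using no[OF abJ] by blast
  qed
  note nz = this
  obtain D where D: "\<And>d f. d \<ge> D \<Longrightarrow> hform d f \<Longrightarrow> hid F d f"
    by (rule projective_nullstellensatz[of F, OF hF nz]) (assumption, blast, rule that)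
  define C where "C = (\<Sum>e<D. card (monomials e :: (complex ^ ('n \<times> 'n) \<Rightarrow> complex) set))"
  \<comment> \<open>Chosen so that C (2 k K) ^ (2 k - 1) equals (K - 1) K ^ (2 k - 1), which is less
    than K ^ (2 k).\<close>
  define K where "K = C * (2 * k) ^ (2 * k - 1) + 1"
  have "finite J" using J card.infinite by fastforce
  obtain i1 where i1: "i1 \<in> J" using J by fastforce
  obtain i2 where i2: "i2 \<in> J - {i1}" using J i1 \<open>finite J\<close> by (metis card_Diff_singleton card.empty add_diff_cancel_right' add_2_eq_Suc' diff_Suc_1 ex_in_conv nat.distinct(1) Suc_eq_plus1)
  define J' where "J' = J - {i1, i2}"
  have J'c: "card J' = k" "finite J'" using J i1 i2 \<open>finite J\<close> by (auto simp: J'_def card_Diff_subset)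
  obtain c where c: "bij_betw c J' {..<k}"
    using ex_bij_betw_finite_nat[OF J'c(2)] J'c(1) by (auto simp: atLeast0LessThan)
  \<comment> \<open>A curve in the chart P(i1, i2) = 1 whose 2 k free coordinates are the powers of
    T with exponents K ^ t for t < 2 k. Monomials in them realize T ^ n through the digits of n in
    base K.\<close>
  define u w where "u T i = (if i = i1 then 1 else if i \<in> J' then T ^ (K ^ c i) else 0)"
    and "w T i = (if i = i2 then 1 else if i \<in> J' then T ^ (K ^ (k + c i)) else 0)" for T :: complex and i
  define P where "P T = (\<chi> ij. u T (fst ij) * w T (snd ij) - u T (snd ij) * w T (fst ij))" for T
  have PT: "P T $ (i, j) = u T i * w T j - u T j * w T i" for T i j by (simp add: P_def)
  have uw0: "u T i = 0" "w T i = 0" if "i \<notin> J" for T i using that i1 i2 by (auto simp: u_def w_def J'_def)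
  have Pvanish: "f (P T) = 0" if "f \<in> F" "f \<notin> bt ` M" for f T
  proof -
    consider i j a b where "f = pl i j a b" | i j where "f = sk i j" | i j where "f = co i j" "i \<notin> J \<or> j \<notin> J"
      using \<open>f \<in> F\<close> \<open>f \<notin> bt ` M\<close> unfolding F_def by blast
    then show ?thesis
    proof cases
      case 1
      then show ?thesis by (simp add: pl_def PT algebra_simps)
    next
      case 2
      then show ?thesis by (simp add: sk_def PT)
    next
      case 3
      then show ?thesis using uw0 by (auto simp: co_def PT)
    qed
  qed
  \<comment> \<open>Products of powers of the 2 k linear forms and one monomial of degree below D.
    By \<open>upper\<close> they span the restrictions to the curve of all forms of degree
    d.\<close>
  define Gen where "Gen d = {(\<lambda>T. (\<Prod>m\<in>M. bt m (P T) ^ \<mu> m) * g (P T)) | \<mu> e g.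
      e < D \<and> g \<in> monomials e \<and> \<mu> \<in> Pi\<^sub>E M (\<lambda>_. {..d}) \<and> sum \<mu> M + e = d}" for d :: nat
  have GenI: "(\<lambda>T. (\<Prod>m\<in>M. bt m (P T) ^ \<mu> m) * g (P T)) \<in> Gen d"
    if "e < D" "g \<in> monomials e" "sum \<mu> M + e = d" for \<mu> e g d
  proof -
    have "\<mu> m \<le> d" if m: "m \<in> M" for m
      using member_le_sum[of m M \<mu>] m \<open>sum \<mu> M + e = d\<close> by (simp add: M_def)
    then have "restrict \<mu> M \<in> Pi\<^sub>E M (\<lambda>_. {..d})" by auto
    moreover have "(\<Prod>m\<in>M. bt m (P T) ^ \<mu> m) = (\<Prod>m\<in>M. bt m (P T) ^ restrict \<mu> M m)" for T
      by (intro prod.cong) auto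
    moreover have "sum (restrict \<mu> M) M = sum \<mu> M" by (intro sum.cong) auto
    ultimately show ?thesis unfolding Gen_def using that
      by (intro CollectI exI[of _ "restrict \<mu> M"] exI[of _ e] exI[of _ g]) auto
  qed
  have bt_Gen: "(\<lambda>T. bt m (P T) * f T) \<in> fv.span (Gen (Suc d))" if m: "m \<in> M" and f: "f \<in> fv.span (Gen d)" for m f d
    using f
  proof (induction rule: fv.span_induct_alt)
    case base
    show ?case using fv.span_zero by (simp add: zero_fun_def)
  next
    case (step a h f)
    obtain \<mu> e g where h: "h = (\<lambda>T. (\<Prod>m\<in>M. bt m (P T) ^ \<mu> m) * g (P T))" "e < D" "g \<in> monomials e" "sum \<mu> M + e = d"
      using step.hyps unfolding Gen_def by blast
    let ?\<nu> = "\<mu>(m := Suc (\<mu> m))"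
    have fM: "finite M" by simp
    have "(\<lambda>T. (\<Prod>m\<in>M. bt m (P T) ^ ?\<nu> m) * g (P T)) \<in> Gen (Suc d)"
    proof (rule GenI[OF h(2,3)])
      show "sum ?\<nu> M + e = Suc d" using m h(4) by (simp add: sum.remove[OF fM m])
    qed
    moreover have "bt m (P T) * h T = (\<Prod>m\<in>M. bt m (P T) ^ ?\<nu> m) * g (P T)" for T
      unfolding h(1) using m by (simp add: prod.remove[OF fM m] mult_ac)
    ultimately have "(\<lambda>T. bt m (P T) * h T) \<in> Gen (Suc d)" by simp
    then have "(\<lambda>T. a * (bt m (P T) * h T)) + (\<lambda>T. bt m (P T) * f T) \<in> fv.span (Gen (Suc d))"
      by (intro fv.span_add[OF fv.span_scale step.IH] fv.span_base)
    moreover have "(\<lambda>T. a * (bt m (P T) * h T)) + (\<lambda>T. bt m (P T) * f T)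
        = (\<lambda>T. bt m (P T) * ((\<lambda>x. a * h x) + f) T)"
      by (auto simp: fun_eq_iff algebra_simps)
    ultimately show ?case by simp
  qed
  have upper: "(\<lambda>T. f (P T)) \<in> fv.span (Gen d)" if "hform d f" for d f using that
  proof (induction d arbitrary: f rule: less_induct)
    case (less d)
    show ?case
    proof (cases "d < D")
      case True
      from hform_span_monomials[OF less.prems] show ?thesis
      proof (induction rule: fv.span_induct_alt)
        case base
        show ?case using fv.span_zero by (simp add: zero_fun_def)
      next
        case (step a g h)
        have "(\<lambda>T. (\<Prod>m\<in>M. bt m (P T) ^ 0) * g (P T)) \<in> Gen d"
          by (rule GenI[OF True step.hyps]) simp
        then have "(\<lambda>T. g (P T)) \<in> Gen d" by simp
        then have "(\<lambda>T. a * g (P T)) + (\<lambda>T. h (P T)) \<in> fv.span (Gen d)"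
          by (intro fv.span_add[OF fv.span_scale step.IH] fv.span_base)
        then show ?case by (simp add: plus_fun_def)
      qed
    next
      case False
      then have "hid F d f" using D less.prems by simp
      then show ?thesis using less.IH
      proof (induction rule: hid.induct)
        case (hid_0 d)
        show ?case using fv.span_zero by (simp add: zero_fun_def)
      next
        case (hid_step e a f e' g)
        have g: "(\<lambda>T. g (P T)) \<in> fv.span (Gen (e + e'))" by (rule hid_step.IH) (rule hid_step.prems)
        have "(\<lambda>T. a (P T) * f (P T)) \<in> fv.span (Gen (e + e'))"
        proof (cases "\<forall>T. f (P T) = 0")
          case True
          then have "(\<lambda>T. a (P T) * f (P T)) = 0" by (simp add: fun_eq_iff)
          then show ?thesis using fv.span_zero by metis
        next
          case False
          then obtain T m where m: "f (P T) \<noteq> 0" "m \<in> M" "f = bt m" using Pvanish hid_step.hyps(2) by blast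
          have e': "e' = 1" using hform_degree_unique[OF hid_step.hyps(3) hbt[of m, folded m(3)] m(1)] .
          have "(\<lambda>T. a (P T)) \<in> fv.span (Gen e)" by (rule hid_step.prems) (use e' hid_step.hyps(1) in auto)
          from bt_Gen[OF m(2) this] show ?thesis by (simp add: m(3) e' mult.commute)
        qed
        then have "(\<lambda>T. a (P T) * f (P T)) + (\<lambda>T. g (P T)) \<in> fv.span (Gen (e + e'))"
          by (rule fv.span_add) (rule g)
        then show ?case by (simp add: plus_fun_def)
      qed
    qed
  qed
  obtain m0 where m0: "m0 \<in> M" using cM k by fastforce
  have GenU: "Gen d \<subseteq> (\<Union>e<D. \<Union>g\<in>monomials e.
      (\<lambda>\<mu> T. (\<Prod>m\<in>M. bt m (P T) ^ \<mu> m) * g (P T)) ` {\<mu> \<in> Pi\<^sub>E M (\<lambda>_. {..d}). sum \<mu> M = d - e})" for d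
  proof
    fix h assume "h \<in> Gen d"
    then obtain \<mu> e g where h: "h = (\<lambda>T. (\<Prod>m\<in>M. bt m (P T) ^ \<mu> m) * g (P T))" "e < D" "g \<in> monomials e"
      "\<mu> \<in> Pi\<^sub>E M (\<lambda>_. {..d})" "sum \<mu> M + e = d" unfolding Gen_def by (elim CollectE exE conjE)
    show "h \<in> (\<Union>e<D. \<Union>g\<in>monomials e.
      (\<lambda>\<mu> T. (\<Prod>m\<in>M. bt m (P T) ^ \<mu> m) * g (P T)) ` {\<mu> \<in> Pi\<^sub>E M (\<lambda>_. {..d}). sum \<mu> M = d - e})"
    proof (rule UN_I[of e], simp add: h(2), rule UN_I[OF h(3)], rule image_eqI[where x = \<mu>], rule h(1), rule CollectI, rule conjI)
      show "sum \<mu> M = d - e" using h(5) by simp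
    qed (rule h(4))
  qed
  have fex: "finite {\<mu> \<in> Pi\<^sub>E M (\<lambda>_. {..d}). sum \<mu> M = s}" for d s :: nat
    by (rule finite_subset[of _ "Pi\<^sub>E M (\<lambda>_. {..d})"]) (auto intro: finite_PiE)
  have finGen: "finite (Gen d)" for d
    by (rule finite_subset[OF GenU]) (intro finite_UN_I finite_imageI fex finite_monomials finite_lessThan)
  have cardGen: "card (Gen d) \<le> C * (d + 1) ^ (2 * k - 1)" for d
  proof -
    have "card (Gen d) \<le> card (\<Union>e<D. \<Union>g\<in>monomials e.
        (\<lambda>\<mu> T. (\<Prod>m\<in>M. bt m (P T) ^ \<mu> m) * g (P T)) ` {\<mu> \<in> Pi\<^sub>E M (\<lambda>_. {..d}). sum \<mu> M = d - e})"
      by (rule card_mono[OF _ GenU]) (intro finite_UN_I finite_imageI fex finite_monomials finite_lessThan)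
    also have "\<dots> \<le> (\<Sum>e<D. \<Sum>g\<in>(monomials e :: (complex ^ ('n \<times> 'n) \<Rightarrow> complex) set). (d + 1) ^ (2 * k - 1))"
    proof (intro order_trans[OF card_UN_le] sum_mono finite_lessThan finite_monomials)
      fix e and g :: "complex ^ ('n \<times> 'n) \<Rightarrow> complex"
      have "card ((\<lambda>\<mu> T. (\<Prod>m\<in>M. bt m (P T) ^ \<mu> m) * g (P T)) ` {\<mu> \<in> Pi\<^sub>E M (\<lambda>_. {..d}). sum \<mu> M = d - e})
          \<le> card {\<mu> \<in> Pi\<^sub>E M (\<lambda>_. {..d}). sum \<mu> M = d - e}" by (rule card_image_le[OF fex])
      also have "\<dots> \<le> (d + 1) ^ (card M - 1)" by (rule card_exponents) (use m0 in auto)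
      finally show "card ((\<lambda>\<mu> T. (\<Prod>m\<in>M. bt m (P T) ^ \<mu> m) * g (P T)) ` {\<mu> \<in> Pi\<^sub>E M (\<lambda>_. {..d}). sum \<mu> M = d - e})
          \<le> (d + 1) ^ (2 * k - 1)" by (simp add: cM)
    qed
    also have "\<dots> = C * (d + 1) ^ (2 * k - 1)" by (simp add: C_def sum_distrib_right)
    finally show ?thesis .
  qed
  \<comment> \<open>The largest digit sum of a number below K ^ (2 k), so a single degree
    accommodates all powers T ^ n at once.\<close>
  define d where "d = 2 * k * (K - 1)"
  have K0: "K > 0" by (simp add: K_def)
  have power_in: "(\<lambda>T. T ^ n) \<in> fv.span (Gen d)" if n: "n < K ^ (2 * k)" for n
  proof -
    define dg where "dg t = n div K ^ t mod K" for t
    have dgK: "dg t \<le> K - 1" for t using K0 by (simp add: dg_def less_Suc_eq_le[symmetric])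
    define s where "s = (\<Sum>j\<in>J'. dg (k + c j) + dg (c j))"
    have "s \<le> (\<Sum>j\<in>J'. (K - 1) + (K - 1))" unfolding s_def by (intro sum_mono add_mono dgK)
    also have "\<dots> = d" by (simp add: J'c d_def)
    finally have sd: "s \<le> d" .
    \<comment> \<open>The coordinate (i1, i2), which is 1 on the curve, pads the degree up to
      d.\<close>
    define f where "f Q = Q $ (i1, i2) ^ (d - s) * (\<Prod>j\<in>J'. Q $ (i1, j) ^ dg (k + c j) * Q $ (j, i2) ^ dg (c j))"
      for Q :: "complex ^ ('n \<times> 'n)"
    have "hform ((d - s) + s) f"
      unfolding f_def[abs_def] s_def by (intro hform_mult hform_prod hform_nth_power)
    then have hf: "hform d f" using sd by simp
    have "f (P T) = T ^ n" for T
    proof -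
      have P1: "P T $ (i1, i2) = 1" using i2 by (simp add: PT u_def w_def J'_def)
      have P2: "P T $ (i1, j) = T ^ (K ^ (k + c j))" if "j \<in> J'" for j
        using that i2 by (auto simp: PT u_def w_def J'_def)
      have P3: "P T $ (j, i2) = T ^ (K ^ c j)" if "j \<in> J'" for j
        using that i2 by (auto simp: PT u_def w_def J'_def)
      have "f (P T) = (\<Prod>j\<in>J'. T ^ (K ^ (k + c j) * dg (k + c j) + K ^ c j * dg (c j)))"
        unfolding f_def P1 by (simp add: P2 P3 power_add power_mult)
      also have "\<dots> = T ^ (\<Sum>j\<in>J'. K ^ (k + c j) * dg (k + c j) + K ^ c j * dg (c j))"
        by (simp add: power_sum)
      also have "(\<Sum>j\<in>J'. K ^ (k + c j) * dg (k + c j) + K ^ c j * dg (c j))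
          = (\<Sum>t<k. K ^ (k + t) * dg (k + t) + K ^ t * dg t)"
        by (rule sum.reindex_bij_betw[OF c])
      also have "\<dots> = (\<Sum>t<2 * k. dg t * K ^ t)"
      proof -
        have "(\<Sum>t<k + l. dg t * K ^ t) = (\<Sum>t<k. dg t * K ^ t) + (\<Sum>t<l. dg (k + t) * K ^ (k + t))" for l
          by (induction l) simp_all
        from this[of k]
        show ?thesis by (simp add: mult_2 mult_2_right sum.distrib mult.commute add.commute)
      qed
      also have "\<dots> = n" unfolding dg_def by (rule digits[OF K0 n, symmetric])
      finally show ?thesis .
    qed
    then show ?thesis using upper[OF hf] by simp
  qed
  have "K ^ (2 * k) \<le> card (Gen d)"
  proof (rule ccontr)
    assume "\<not> K ^ (2 * k) \<le> card (Gen d)"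
    then obtain n a where n: "n \<in> {..<K ^ (2 * k)}" "a n \<noteq> 0" "\<And>T::complex. (\<Sum>n<K ^ (2 * k). a n * T ^ n) = 0"
      by (rule_tac dependent_family[OF finGen, of "{..<K ^ (2 * k)}" d "\<lambda>n T. T ^ n"]) (auto intro: power_in)
    define p where "p = (\<Sum>n<K ^ (2 * k). monom (a n) n)"
    have "poly p T = 0" for T using n(3)[of T] by (simp add: p_def poly_sum poly_monom)
    then have "p = 0" by (simp add: poly_all_0_iff_0[symmetric])
    moreover have "coeff p n = a n" using n(1) by (simp add: p_def coeff_sum)
    ultimately show False using n(2) by simp
  qed
  also have "\<dots> \<le> C * (d + 1) ^ (2 * k - 1)" by (rule cardGen)
  also have "\<dots> \<le> C * (2 * k * K) ^ (2 * k - 1)"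
  proof -
    have "d + 1 \<le> 2 * k * K" using k(1) K0 by (cases K) (auto simp: d_def)
    then show ?thesis by (intro mult_left_mono power_mono) auto
  qed
  also have "\<dots> = (K - 1) * K ^ (2 * k - 1)" by (subst power_mult_distrib) (simp add: K_def)
  also have "\<dots> < K * K ^ (2 * k - 1)" using K0 by simp
  also have "\<dots> = K ^ (2 * k)" using k(1) by (simp flip: power_Suc)
  finally show False by simp
qed

section \<open>Pfaffians of a Grassmannian syzygy\<close>

text \<open>The Pluecker relation of u0, a, b, c at the bivector \<open>proj \<alpha> x\<close>,
  since u0 paired with a gives a itself.\<close>

definition pfaffian ::
  "(complex ^ 'n \<Rightarrow> complex ^ 'n \<Rightarrow> complex ^ 'n) \<Rightarrow> complex ^ 'n \<Rightarrow> complex ^ 'n \<Rightarrow> complex ^ 'n \<Rightarrow> complex ^ 'n \<Rightarrow> complex"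
  where
  "pfaffian \<alpha> a b c x = ev a x * ev (\<alpha> b c) x - ev b x * ev (\<alpha> a c) x + ev c x * ev (\<alpha> a b) x"

lemma dual_functional:
  fixes B :: "(complex ^ 'n) set"
  assumes "vec.independent B"
  obtains d where "\<And>b. b \<in> B \<Longrightarrow> ev d b = f b"
proof -
  obtain g where g: "Vector_Spaces.linear (*s) (*s) g" "\<forall>b\<in>B. g b = ((\<chi> i. f b) :: complex ^ 'n)"
    using vec.linear_independent_extend[OF assms, of "\<lambda>b. (\<chi> i. f b) :: complex ^ 'n"] by blast
  interpret g: Vector_Spaces.linear "(*s)" "(*s)" g by (rule g(1))
  define d where "d = (\<chi> i. g (axis i 1) $ undefined)"
  have "ev d b = f b" if b: "b \<in> B" for b
  proof -
    have "g b = g (\<Sum>i\<in>UNIV. b $ i *s axis i 1)" by (simp add: basis_expansion)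
    also have "\<dots> = (\<Sum>i\<in>UNIV. b $ i *s g (axis i 1))" by (simp add: g.sum g.scale)
    finally have "g b $ undefined = ev d b" by (simp add: ev_def d_def mult.commute)
    then show ?thesis using bspec[OF g(2) b] by simp
  qed
  then show ?thesis by (rule that)
qed

lemma permutes_insertE:
  assumes "\<rho> permutes insert a S"
  obtains b q where "\<rho> = Transposition.transpose a b \<circ> q" "b \<in> insert a S" "q permutes S"
proof -
  have "\<rho> \<in> {q. q permutes insert a S}" using assms by simp
  then show ?thesis unfolding permutes_insert by (auto intro: that)
qed

locale alternating_map =
  fixes L :: "(complex ^ 'n) set" and \<alpha> :: "complex ^ 'n \<Rightarrow> complex ^ 'n \<Rightarrow> complex ^ 'n"
  assumes L: "vec.subspace L" and alt: "alternating_bilinear_on L \<alpha>"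
begin

lemma L_simps: "0 \<in> L" "a \<in> L \<Longrightarrow> b \<in> L \<Longrightarrow> a + b \<in> L" "a \<in> L \<Longrightarrow> b \<in> L \<Longrightarrow> a - b \<in> L" "a \<in> L \<Longrightarrow> c *s a \<in> L"
  using L by (auto simp: vec.subspace_0 vec.subspace_add vec.subspace_diff vec.subspace_scale)

lemma add_right: "a \<in> L \<Longrightarrow> b \<in> L \<Longrightarrow> c \<in> L \<Longrightarrow> \<alpha> a (b + c) = \<alpha> a b + \<alpha> a c"
  and add_left: "a \<in> L \<Longrightarrow> b \<in> L \<Longrightarrow> c \<in> L \<Longrightarrow> \<alpha> (b + c) a = \<alpha> b a + \<alpha> c a"
  and scale_right: "a \<in> L \<Longrightarrow> b \<in> L \<Longrightarrow> \<alpha> a (t *s b) = t *s \<alpha> a b"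
  and scale_left: "a \<in> L \<Longrightarrow> b \<in> L \<Longrightarrow> \<alpha> (t *s b) a = t *s \<alpha> b a"
  and self: "a \<in> L \<Longrightarrow> \<alpha> a a = 0"
  using alt by (auto simp: alternating_bilinear_on_def lin_on_def)

lemma anti: "a \<in> L \<Longrightarrow> b \<in> L \<Longrightarrow> \<alpha> a b = - \<alpha> b a"
proof -
  assume ab: "a \<in> L" "b \<in> L"
  have "\<alpha> (a + b) (a + b) = (\<alpha> a a + \<alpha> b a) + (\<alpha> a b + \<alpha> b b)"
    using ab by (simp add: add_right add_left L_simps algebra_simps)
  then show ?thesis using ab by (simp add: self L_simps add_eq_0_iff)
qed

lemma diff_left: "a \<in> L \<Longrightarrow> b \<in> L \<Longrightarrow> c \<in> L \<Longrightarrow> \<alpha> (b - c) a = \<alpha> b a - \<alpha> c a"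
proof -
  assume "a \<in> L" "b \<in> L" "c \<in> L"
  then have "\<alpha> ((b - c) + c) a = \<alpha> (b - c) a + \<alpha> c a" by (intro add_left L_simps)
  then show ?thesis by simp
qed

lemma zero_right: "a \<in> L \<Longrightarrow> \<alpha> a 0 = 0" and zero_left: "a \<in> L \<Longrightarrow> \<alpha> 0 a = 0"
  using scale_right[of a 0 0] scale_left[of a 0 0] by (simp_all add: L_simps)

lemma sum_left: "finite I \<Longrightarrow> a \<in> L \<Longrightarrow> (\<And>i. i \<in> I \<Longrightarrow> m i \<in> L) \<Longrightarrow>
    (\<Sum>i\<in>I. u i *s m i) \<in> L \<and> \<alpha> (\<Sum>i\<in>I. u i *s m i) a = (\<Sum>i\<in>I. u i *s \<alpha> (m i) a)"
  by (induction I rule: finite_induct) (auto simp: L_simps zero_left add_left scale_left)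

lemma sum_right: "finite I \<Longrightarrow> a \<in> L \<Longrightarrow> (\<And>i. i \<in> I \<Longrightarrow> m i \<in> L) \<Longrightarrow>
    \<alpha> a (\<Sum>i\<in>I. u i *s m i) = (\<Sum>i\<in>I. u i *s \<alpha> a (m i))"
  by (induction I rule: finite_induct) (auto simp: L_simps sum_left zero_right add_right scale_right)

lemma proj_simps:
  "m \<in> L \<Longrightarrow> proj \<alpha> x u0 (in_U m) = ev m x"
  "proj \<alpha> x (in_U l) (in_U m) = ev (\<alpha> l m) x"
  by (simp_all add: proj_def pi_star_def u0_def in_U_def zero_left)

lemma pfaffian_lin:
  assumes "a \<in> L" "b \<in> L" "c \<in> L" "d \<in> L"
  shows "pfaffian \<alpha> (t *s a + d) b c x = t * pfaffian \<alpha> a b c x + pfaffian \<alpha> d b c x"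
    "pfaffian \<alpha> b (t *s a + d) c x = t * pfaffian \<alpha> b a c x + pfaffian \<alpha> b d c x"
    "pfaffian \<alpha> b c (t *s a + d) x = t * pfaffian \<alpha> b c a x + pfaffian \<alpha> b c d x"
  using assms
  by (simp_all add: pfaffian_def add_left add_right scale_left scale_right L_simps ev_add_left ev_scale_left algebra_simps)

lemma pfaffian_zero_args:
  assumes "a \<in> L" "b \<in> L"
  shows "pfaffian \<alpha> 0 a b x = 0" "pfaffian \<alpha> a 0 b x = 0" "pfaffian \<alpha> a b 0 x = 0"
  using assms by (simp_all add: pfaffian_def zero_left zero_right)

lemma pfaffian_swap:
  assumes "a \<in> L" "b \<in> L" "c \<in> L"
  shows "pfaffian \<alpha> b a c x = - pfaffian \<alpha> a b c x" "pfaffian \<alpha> a c b x = - pfaffian \<alpha> a b c x"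
proof -
  have e: "ev (- v) x = - ev v x" for v :: "complex ^ 'n" using ev_diff_left[of 0 v x] by simp
  show "pfaffian \<alpha> b a c x = - pfaffian \<alpha> a b c x"
    unfolding pfaffian_def anti[OF assms(2,1)] e by (simp add: algebra_simps)
  show "pfaffian \<alpha> a c b x = - pfaffian \<alpha> a b c x"
    unfolding pfaffian_def anti[OF assms(3,2)] e by (simp add: algebra_simps)
qed

lemma pfaffian_span:
  assumes B: "vec.span B = L" and 0: "\<And>a b c. a \<in> B \<Longrightarrow> b \<in> B \<Longrightarrow> c \<in> B \<Longrightarrow> pfaffian \<alpha> a b c x = 0"
    and abc: "a \<in> L" "b \<in> L" "c \<in> L"
  shows "pfaffian \<alpha> a b c x = 0"
proof -
  have BL: "a \<in> L" if "a \<in> B" for a using that B vec.span_base by blast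
  have 1: "a \<in> L \<and> pfaffian \<alpha> a b c x = 0" if bc: "b \<in> B" "c \<in> B" and a: "a \<in> vec.span B" for a b c using a
  proof (induction rule: vec.span_induct_alt)
    case base
    then show ?case using bc BL by (simp add: L_simps pfaffian_zero_args)
  next
    case (step t d e)
    then show ?case using bc BL by (simp add: L_simps pfaffian_lin(1) 0)
  qed
  have 2: "b \<in> L \<and> pfaffian \<alpha> a b c x = 0" if ac: "a \<in> L" "c \<in> B" and b: "b \<in> vec.span B" for a b c using b
  proof (induction rule: vec.span_induct_alt)
    case base
    then show ?case using ac BL by (simp add: L_simps pfaffian_zero_args)
  next
    case (step t d e)
    then show ?case using ac BL 1[of d c a] B by (simp add: L_simps pfaffian_lin(2))
  qed
  have "c \<in> L \<and> pfaffian \<alpha> a b c x = 0" if ab: "a \<in> L" "b \<in> L" and c: "c \<in> vec.span B" for a b c using c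
  proof (induction rule: vec.span_induct_alt)
    case base
    then show ?case using ab by (simp add: L_simps pfaffian_zero_args)
  next
    case (step t d e)
    then show ?case using ab BL 2[of a d b] B by (simp add: L_simps pfaffian_lin(3))
  qed
  then show ?thesis using abc B by blast
qed

text \<open>Averaging over the cyclic permutation of the last three indices.\<close>

lemma symmetrized_sum:
  fixes p :: nat
  assumes e: "e ` {..<p + 3} \<subseteq> L"
    and w: "\<forall>\<sigma> \<sigma>'. (\<forall>a<p. \<sigma> a = \<sigma>' a) \<longrightarrow> w \<sigma> = w \<sigma>'"
  shows "3 * (\<Sum>\<sigma> | \<sigma> permutes {..<p+3}. of_int (sign \<sigma>) * w \<sigma> *
        (ev (e (\<sigma> p)) x * ev (\<alpha> (e (\<sigma> (p+1))) (e (\<sigma> (p+2)))) x))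
    = (\<Sum>\<sigma> | \<sigma> permutes {..<p+3}. of_int (sign \<sigma>) * w \<sigma> *
        pfaffian \<alpha> (e (\<sigma> p)) (e (\<sigma> (p+1))) (e (\<sigma> (p+2))) x)"
proof -
  define f where "f \<sigma> = of_int (sign \<sigma>) * w \<sigma> * (ev (e (\<sigma> p)) x * ev (\<alpha> (e (\<sigma> (p+1))) (e (\<sigma> (p+2)))) x)" for \<sigma>
  \<comment> \<open>A 3-cycle on the last three positions: it is even and does not affect the weight
    w.\<close>
  define c where "c = Transposition.transpose p (p+1) \<circ> Transposition.transpose (p+1) (p+2)"
  have cp: "c permutes {..<p+3}" unfolding c_def by (intro permutes_compose permutes_swap_id) auto
  have c: "c p = p + 1" "c (p + 1) = p + 2" "c (p + 2) = p" "\<And>a. a < p \<Longrightarrow> c a = a"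
    by (auto simp: c_def Transposition.transpose_def)
  have sc: "sign c = 1" unfolding c_def
    by (subst sign_compose) (auto simp: permutation_swap_id sign_swap_id)
  have 1: "(\<Sum>\<sigma> | \<sigma> permutes {..<p+3}. f \<sigma>) = (\<Sum>\<sigma> | \<sigma> permutes {..<p+3}. f (\<sigma> \<circ> c))"
    by (rule sum_permutations_compose_right[OF cp])
  have 2: "(\<Sum>\<sigma> | \<sigma> permutes {..<p+3}. f \<sigma>) = (\<Sum>\<sigma> | \<sigma> permutes {..<p+3}. f (\<sigma> \<circ> c \<circ> c))"
    using 1 sum_permutations_compose_right[OF cp, of "\<lambda>\<sigma>. f (\<sigma> \<circ> c)"] by simp
  have "3 * (\<Sum>\<sigma> | \<sigma> permutes {..<p+3}. f \<sigma>)
      = (\<Sum>\<sigma> | \<sigma> permutes {..<p+3}. f \<sigma> + f (\<sigma> \<circ> c) + f (\<sigma> \<circ> c \<circ> c))"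
    unfolding sum.distrib 1[symmetric] 2[symmetric] by simp
  also have "\<dots> = (\<Sum>\<sigma> | \<sigma> permutes {..<p+3}. of_int (sign \<sigma>) * w \<sigma> *
        pfaffian \<alpha> (e (\<sigma> p)) (e (\<sigma> (p+1))) (e (\<sigma> (p+2))) x)"
  proof (intro sum.cong refl)
    fix \<sigma> assume "\<sigma> \<in> {\<sigma>. \<sigma> permutes {..<p+3}}"
    then have \<sigma>: "\<sigma> permutes {..<p+3}" by simp
    have perm: "permutation \<sigma>" "permutation c" "permutation (\<sigma> \<circ> c)"
      using \<sigma> cp permutes_compose[OF cp \<sigma>] by (auto simp: permutation_permutes)
    have s: "sign (\<sigma> \<circ> c) = sign \<sigma>" "sign (\<sigma> \<circ> c \<circ> c) = sign \<sigma>"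
      using perm by (simp_all add: sign_compose sc)
    have w': "w (\<sigma> \<circ> c) = w \<sigma>" "w (\<sigma> \<circ> c \<circ> c) = w \<sigma>" by (intro w[rule_format]; simp add: c(4))+
    have eL: "e (\<sigma> i) \<in> L" if "i < p + 3" for i using e permutes_in_image[OF \<sigma>, of i] that by auto
    have en: "ev (- v) x = - ev v x" for v :: "complex ^ 'n" using ev_diff_left[of 0 v x] by simp
    have "\<alpha> (e (\<sigma> (p+2))) (e (\<sigma> p)) = - \<alpha> (e (\<sigma> p)) (e (\<sigma> (p+2)))" by (intro anti eL) auto
    then show "f \<sigma> + f (\<sigma> \<circ> c) + f (\<sigma> \<circ> c \<circ> c) = of_int (sign \<sigma>) * w \<sigma> *
        pfaffian \<alpha> (e (\<sigma> p)) (e (\<sigma> (p+1))) (e (\<sigma> (p+2))) x"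
      unfolding f_def s w' pfaffian_def comp_apply c en by (simp only: en) (simp add: algebra_simps c)
  qed
  finally show ?thesis unfolding f_def .
qed

text \<open>Both permutations agree on the first p positions, so they differ by a permutation of the
  last three, under which the Pfaffian changes by the same sign.\<close>

lemma pfaffian_permutation:
  fixes p :: nat
  assumes e: "e ` {..<p + 3} \<subseteq> L" and \<tau>: "\<tau> permutes {..<p+3}" and \<sigma>: "\<sigma> permutes {..<p+3}"
    and eq: "\<And>a. a < p \<Longrightarrow> \<sigma> a = \<tau> a"
  shows "of_int (sign \<sigma>) * pfaffian \<alpha> (e (\<sigma> p)) (e (\<sigma> (p+1))) (e (\<sigma> (p+2))) x
    = of_int (sign \<tau>) * pfaffian \<alpha> (e (\<tau> p)) (e (\<tau> (p+1))) (e (\<tau> (p+2))) x"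
proof -
  define \<rho> where "\<rho> = inv \<tau> \<circ> \<sigma>"
  have \<sigma>\<rho>: "\<sigma> = \<tau> \<circ> \<rho>" unfolding \<rho>_def using permutes_inv_o(1)[OF \<tau>] by (simp add: o_assoc)
  have "\<rho> permutes {..<p+3}" unfolding \<rho>_def by (intro permutes_compose[OF \<sigma>] permutes_inv \<tau>)
  moreover have "\<rho> a = a" if "a < p" for a
    using eq[OF that] permutes_inverses(2)[OF \<tau>, of a] by (simp add: \<rho>_def)
  ultimately have \<rho>: "\<rho> permutes {p, p+1, p+2}"
    by (elim permutes_superset) auto
  then obtain b q where q: "\<rho> = Transposition.transpose p b \<circ> q" "b \<in> {p, p+1, p+2}" "q permutes {p+1, p+2}"
    by (rule permutes_insertE)
  from q(3) obtain b' q' where b': "q = Transposition.transpose (p+1) b' \<circ> q'" "b' \<in> {p+1, p+2}" "q' permutes {p+2}"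
    by (rule permutes_insertE)
  have "q' = id" using b'(3) by simp
  then have b': "q = Transposition.transpose (p+1) b'" "b' \<in> {p+1, p+2}" using b'(1,2) by simp_all
  have "permutation \<tau>" using \<tau> by (auto simp: permutation_permutes)
  then have sign: "sign \<sigma> = sign \<tau> * ((if p = b then 1 else - 1) * (if p + 1 = b' then 1 else - 1))"
    unfolding \<sigma>\<rho> q(1) b'(1) by (simp add: sign_compose permutation_compose permutation_swap_id sign_swap_id)
  have eL: "e (\<tau> i) \<in> L" if "i < p + 3" for i using e permutes_in_image[OF \<tau>, of i] that by auto
  define A B C where "A = e (\<tau> p)" and "B = e (\<tau> (p+1))" and "C = e (\<tau> (p+2))"
  then have ABC: "e (\<tau> p) = A" "e (\<tau> (Suc p)) = B" "e (\<tau> (Suc (Suc p))) = C" by simp_all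
  have L3: "A \<in> L" "B \<in> L" "C \<in> L" unfolding A_def B_def C_def by (intro eL; simp)+
  have pf: "pfaffian \<alpha> B A C x = - pfaffian \<alpha> A B C x" "pfaffian \<alpha> A C B x = - pfaffian \<alpha> A B C x"
    "pfaffian \<alpha> B C A x = pfaffian \<alpha> A B C x" "pfaffian \<alpha> C A B x = pfaffian \<alpha> A B C x"
    "pfaffian \<alpha> C B A x = - pfaffian \<alpha> A B C x"
    using L3 pfaffian_swap by (metis minus_minus)+
  have \<sigma>v: "\<sigma> i = \<tau> (Transposition.transpose p b (Transposition.transpose (p+1) b' i))" for i by (simp add: \<sigma>\<rho> q(1) b'(1))
  from q(2) b'(2) show ?thesis
    unfolding sign \<sigma>v A_def[symmetric] B_def[symmetric] C_def[symmetric]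
    by (elim insertE emptyE) (simp_all add: Transposition.transpose_def pf ABC)
qed

lemma generic_syzygy_eq:
  fixes p :: nat
  assumes e: "e ` {..<p + 3} \<subseteq> L"
  shows "generic_syzygy p e js (proj \<alpha> x) = 1/2 * (\<Sum>\<sigma> | \<sigma> permutes {..<p+3}.
    of_int (sign \<sigma>) * (\<Prod>a<p. e (\<sigma> a) $ (js ! a)) * (ev (e (\<sigma> p)) x * ev (\<alpha> (e (\<sigma> (p+1))) (e (\<sigma> (p+2)))) x))"
proof -
  have "e (\<sigma> p) \<in> L" if "\<sigma> permutes {..<p+3}" for \<sigma>
    using e permutes_in_image[OF that, of p] by auto
  then show ?thesis unfolding generic_syzygy_def
    by (intro arg_cong[where f = "\<lambda>t. 1/2 * t"] sum.cong refl) (simp add: proj_simps)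
qed

lemma generic_syzygy_zero:
  fixes p :: nat
  assumes e: "e ` {..<p + 3} \<subseteq> L" and 0: "\<And>a b c. a \<in> L \<Longrightarrow> b \<in> L \<Longrightarrow> c \<in> L \<Longrightarrow> pfaffian \<alpha> a b c x = 0"
  shows "generic_syzygy p e js (proj \<alpha> x) = 0"
proof -
  have "3 * (\<Sum>\<sigma> | \<sigma> permutes {..<p+3}.
    of_int (sign \<sigma>) * (\<Prod>a<p. e (\<sigma> a) $ (js ! a)) * (ev (e (\<sigma> p)) x * ev (\<alpha> (e (\<sigma> (p+1))) (e (\<sigma> (p+2)))) x)) = 0"
  proof (subst symmetrized_sum[OF e, where w = "\<lambda>\<sigma>. \<Prod>a<p. e (\<sigma> a) $ (js ! a)"])
    show "(\<Sum>\<sigma> | \<sigma> permutes {..<p+3}. of_int (sign \<sigma>) * (\<Prod>a<p. e (\<sigma> a) $ (js ! a)) *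
        pfaffian \<alpha> (e (\<sigma> p)) (e (\<sigma> (p+1))) (e (\<sigma> (p+2))) x) = 0"
    proof (intro sum.neutral ballI)
      fix \<sigma> assume "\<sigma> \<in> {\<sigma>. \<sigma> permutes {..<p+3}}"
      then have "e (\<sigma> i) \<in> L" if "i < p + 3" for i using e permutes_in_image[of \<sigma> "{..<p+3}" i] that by auto
      then show "of_int (sign \<sigma>) * (\<Prod>a<p. e (\<sigma> a) $ (js ! a)) *
        pfaffian \<alpha> (e (\<sigma> p)) (e (\<sigma> (p+1))) (e (\<sigma> (p+2))) x = 0" by (simp add: 0)
    qed
  qed (auto intro!: prod.cong)
  then show ?thesis unfolding generic_syzygy_eq[OF e] by simp
qed

text \<open>Contracting the syzygy with a dual basis isolates each Pfaffian.\<close>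

lemma pfaffian_from_syzygy:
  fixes p :: nat and e :: "nat \<Rightarrow> complex ^ 'n"
  assumes inj: "inj_on e {..<p+3}" and ind: "vec.independent (e ` {..<p+3})" and e: "e ` {..<p + 3} \<subseteq> L"
    and s: "\<And>js. length js = p \<Longrightarrow> generic_syzygy p e js (proj \<alpha> x) = 0" and \<tau>: "\<tau> permutes {..<p+3}"
  shows "pfaffian \<alpha> (e (\<tau> p)) (e (\<tau> (p+1))) (e (\<tau> (p+2))) x = 0"
proof -
  have "\<exists>d. \<forall>j<p+3. ev d (e j) = (if i = j then 1 else 0)" if i: "i < p + 3" for i
  proof -
    obtain d where d: "\<And>b. b \<in> e ` {..<p+3} \<Longrightarrow> ev d b = (if b = e i then 1 else 0)"
      by (rule dual_functional[OF ind]) (rule that)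
    have "ev d (e j) = (if i = j then 1 else 0)" if "j < p + 3" for j
      using d[of "e j"] that i inj by (auto simp: inj_on_def)
    then show ?thesis by blast
  qed
  then obtain d where d: "\<And>i j. i < p + 3 \<Longrightarrow> j < p + 3 \<Longrightarrow> ev (d i) (e j) = (if i = j then 1 else 0)" by metis
  define Q where "Q \<sigma> = ev (e (\<sigma> p)) x * ev (\<alpha> (e (\<sigma> (p+1))) (e (\<sigma> (p+2)))) x" for \<sigma>
  define w where "w \<sigma> = (\<Prod>a<p. ev (d (\<tau> a)) (e (\<sigma> a)))" for \<sigma>
  let ?S = "{\<sigma>. \<sigma> permutes {..<p+3}}"
  let ?G = "Pi\<^sub>E {..<p} (\<lambda>_. UNIV :: 'n set)"
  have s0: "(\<Sum>\<sigma>\<in>?S. of_int (sign \<sigma>) * (\<Prod>a<p. e (\<sigma> a) $ g a) * Q \<sigma>) = 0" for g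
  proof -
    have "(\<Prod>a<p. e (\<sigma> a) $ (map g [0..<p] ! a)) = (\<Prod>a<p. e (\<sigma> a) $ g a)" for \<sigma>
      by (intro prod.cong) auto
    then show ?thesis using s[of "map g [0..<p]"] unfolding generic_syzygy_eq[OF e] Q_def by simp
  qed
  \<comment> \<open>Expanding the product of pairings over all words g writes the contraction as a
    combination of coefficients of the syzygy, which vanish at x.\<close>
  have "(\<Sum>\<sigma>\<in>?S. of_int (sign \<sigma>) * w \<sigma> * Q \<sigma>)
      = (\<Sum>\<sigma>\<in>?S. \<Sum>g\<in>?G. (\<Prod>a<p. d (\<tau> a) $ g a) * (of_int (sign \<sigma>) * (\<Prod>a<p. e (\<sigma> a) $ g a) * Q \<sigma>))"
  proof (intro sum.cong refl)
    fix \<sigma>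
    have "w \<sigma> = (\<Sum>g\<in>?G. \<Prod>a<p. d (\<tau> a) $ g a * e (\<sigma> a) $ g a)"
      unfolding w_def ev_def by (rule prod_sum_PiE) auto
    then show "of_int (sign \<sigma>) * w \<sigma> * Q \<sigma>
        = (\<Sum>g\<in>?G. (\<Prod>a<p. d (\<tau> a) $ g a) * (of_int (sign \<sigma>) * (\<Prod>a<p. e (\<sigma> a) $ g a) * Q \<sigma>))"
      by (simp add: prod.distrib sum_distrib_left sum_distrib_right mult_ac)
  qed
  also have "\<dots> = (\<Sum>g\<in>?G. \<Sum>\<sigma>\<in>?S. (\<Prod>a<p. d (\<tau> a) $ g a) * (of_int (sign \<sigma>) * (\<Prod>a<p. e (\<sigma> a) $ g a) * Q \<sigma>))"
    by (rule sum.swap)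
  also have "\<dots> = 0" unfolding sum_distrib_left[symmetric] s0 by simp
  finally have "(\<Sum>\<sigma>\<in>?S. of_int (sign \<sigma>) * w \<sigma> * Q \<sigma>) = 0" .
  moreover have wcong: "\<forall>\<sigma> \<sigma>'. (\<forall>a<p. \<sigma> a = \<sigma>' a) \<longrightarrow> w \<sigma> = w \<sigma>'"
    unfolding w_def by (auto intro!: prod.cong)
  ultimately have "(\<Sum>\<sigma>\<in>?S. of_int (sign \<sigma>) * w \<sigma> * pfaffian \<alpha> (e (\<sigma> p)) (e (\<sigma> (p+1))) (e (\<sigma> (p+2))) x) = 0"
    using symmetrized_sum[OF e wcong, of x] unfolding Q_def by simp
  \<comment> \<open>By duality of the bases w selects the permutations that agree with \<tau> on the
    first p positions. Their contributions are all equal, so the sum is a positive multiple of one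
    signed Pfaffian.\<close>
  moreover have "of_int (sign \<sigma>) * w \<sigma> * pfaffian \<alpha> (e (\<sigma> p)) (e (\<sigma> (p+1))) (e (\<sigma> (p+2))) x
      = (if \<forall>a<p. \<sigma> a = \<tau> a then of_int (sign \<tau>) * pfaffian \<alpha> (e (\<tau> p)) (e (\<tau> (p+1))) (e (\<tau> (p+2))) x else 0)"
    if \<sigma>: "\<sigma> \<in> ?S" for \<sigma>
  proof -
    have r: "\<sigma> a < p + 3" "\<tau> a < p + 3" if "a < p" for a
      using \<sigma> permutes_in_image[of \<sigma> "{..<p+3}" a] permutes_in_image[OF \<tau>, of a] that by auto
    have w: "w \<sigma> = (\<Prod>a<p. if \<tau> a = \<sigma> a then 1 else 0)" unfolding w_def by (intro prod.cong) (auto simp: d r)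
    show ?thesis
    proof (cases "\<forall>a<p. \<sigma> a = \<tau> a")
      case True
      then have "w \<sigma> = 1" unfolding w by simp
      then show ?thesis using True pfaffian_permutation[OF e \<tau>, of \<sigma> x] \<sigma> by simp
    next
      case False
      then obtain a where "a < p" "\<sigma> a \<noteq> \<tau> a" by blast
      then have "w \<sigma> = 0" unfolding w by (intro prod_zero) (auto intro!: bexI[of _ a])
      then show ?thesis unfolding if_not_P[OF False] by simp
    qed
  qed
  ultimately have "(\<Sum>\<sigma>\<in>?S. if \<forall>a<p. \<sigma> a = \<tau> a then of_int (sign \<tau>) * pfaffian \<alpha> (e (\<tau> p)) (e (\<tau> (p+1))) (e (\<tau> (p+2))) x else 0) = 0"
    by simp
  moreover have finS: "finite ?S" by (intro finite_permutations) simp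
  ultimately have "of_nat (card {\<sigma>\<in>?S. \<forall>a<p. \<sigma> a = \<tau> a}) * (of_int (sign \<tau>) * pfaffian \<alpha> (e (\<tau> p)) (e (\<tau> (p+1))) (e (\<tau> (p+2))) x) = 0"
    by (simp add: sum.If_cases[OF finS] Int_def)
  moreover have "card {\<sigma>\<in>?S. \<forall>a<p. \<sigma> a = \<tau> a} \<noteq> 0" using finS \<tau> by auto
  ultimately show ?thesis by (simp add: sign_def split: if_splits)
qed

lemma permutation_with_values:
  assumes "a < p + 3" "b < p + 3" "c < p + 3" "a \<noteq> b" "a \<noteq> c" "b \<noteq> c"
  obtains \<tau> where "\<tau> permutes {..<p+3::nat}" "\<tau> p = a" "\<tau> (p+1) = b" "\<tau> (p+2) = c"
proof -
  have "card ({..<p+3} - {a, b, c}) = p" using assms by (simp add: card_Diff_subset)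
  then obtain h where h: "bij_betw h {..<p} ({..<p+3} - {a, b, c})"
    using ex_bij_betw_nat_finite[of "{..<p+3} - {a, b, c}"] by (auto simp: atLeast0LessThan)
  define \<tau> where "\<tau> i = (if i < p then h i else if i = p then a else if i = p + 1 then b else if i = p + 2 then c else i)" for i
  have hr: "h i < p + 3" "h i \<noteq> a" "h i \<noteq> b" "h i \<noteq> c" if "i < p" for i
    using bij_betwE[OF h] that by auto
  have hi: "h i = h j \<longleftrightarrow> i = j" if "i < p" "j < p" for i j
    using h that by (auto simp: bij_betw_def inj_on_def)
  have inj: "inj_on \<tau> {..<p+3}"
  proof (rule inj_onI)
    fix i j assume ij: "i \<in> {..<p+3}" "j \<in> {..<p+3}" and eq: "\<tau> i = \<tau> j"
    have v: "\<tau> p = a" "\<tau> (p+1) = b" "\<tau> (p+2) = c" "\<And>i. i < p \<Longrightarrow> \<tau> i = h i" by (simp_all add: \<tau>_def)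
    have cs: "i < p \<or> i = p \<or> i = p + 1 \<or> i = p + 2" "j < p \<or> j = p \<or> j = p + 1 \<or> j = p + 2" using ij by auto
    show "i = j"
    proof (cases "i < p")
      case True
      then show ?thesis using cs(2) eq hr(2-4)[OF True] hi[OF True] by (elim disjE) (simp_all only: v)
    next
      case i: False
      show ?thesis
      proof (cases "j < p")
        case True
        then show ?thesis using cs(1) i eq hr(2-4)[OF True] by (elim disjE) (simp_all only: v not_True_eq_False)
      next
        case False
        then show ?thesis using cs i eq assms(4-6) by (elim disjE) (simp_all only: v not_True_eq_False not_False_eq_True)
      qed
    qed
  qed
  moreover have "\<tau> ` {..<p+3} \<subseteq> {..<p+3}" using hr assms by (auto simp: \<tau>_def)
  ultimately have "bij_betw \<tau> {..<p+3} {..<p+3}"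
    by (simp add: bij_betw_def endo_inj_surj)
  then have "\<tau> permutes {..<p+3}" by (rule bij_imp_permutes) (simp add: \<tau>_def)
  then show ?thesis by (rule that) (simp_all add: \<tau>_def)
qed

lemma all_pfaffians_from_syzygy:
  fixes p :: nat and e :: "nat \<Rightarrow> complex ^ 'n"
  assumes inj: "inj_on e {..<p+3}" and ind: "vec.independent (e ` {..<p+3})" and span: "vec.span (e ` {..<p+3}) = L"
    and s: "\<And>js. length js = p \<Longrightarrow> generic_syzygy p e js (proj \<alpha> x) = 0"
    and abc: "a \<in> L" "b \<in> L" "c \<in> L"
  shows "pfaffian \<alpha> a b c x = 0"
proof (rule pfaffian_span[OF span _ abc])
  have e: "e ` {..<p + 3} \<subseteq> L" using vec.span_superset[of "e ` {..<p+3}"] unfolding span .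
  fix a b c assume "a \<in> e ` {..<p+3}" "b \<in> e ` {..<p+3}" "c \<in> e ` {..<p+3}"
  then obtain i j k where ijk: "i < p + 3" "a = e i" "j < p + 3" "b = e j" "k < p + 3" "c = e k" by blast
  have ee: "e i \<in> L" "e j \<in> L" "e k \<in> L" using e ijk by auto
  show "pfaffian \<alpha> a b c x = 0"
  proof (cases "i \<noteq> j \<and> i \<noteq> k \<and> j \<noteq> k")
    case True
    then obtain \<tau> where \<tau>: "\<tau> permutes {..<p+3}" "\<tau> p = i" "\<tau> (p+1) = j" "\<tau> (p+2) = k"
      using permutation_with_values[of i p j k] ijk by metis
    have "pfaffian \<alpha> (e (\<tau> p)) (e (\<tau> (p+1))) (e (\<tau> (p+2))) x = 0"
      by (rule pfaffian_from_syzygy[OF inj ind e _ \<tau>(1)]) (rule s)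
    then show ?thesis unfolding \<tau> ijk .
  next
    case False
    have neg: "t = 0" if "t = - t" for t :: complex using that by simp
    have z: "pfaffian \<alpha> u u v x = 0" "pfaffian \<alpha> v u u x = 0" if "u \<in> L" "v \<in> L" for u v
      by (rule neg, rule pfaffian_swap, (rule that)+)+
    moreover have "pfaffian \<alpha> u v u x = 0" if "u \<in> L" "v \<in> L" for u v
      using pfaffian_swap(2)[OF that(1,1,2)] z(1)[OF that] by simp
    moreover note ee
    moreover
    have "i = j \<or> i = k \<or> j = k" using False by blast
    ultimately show ?thesis unfolding ijk(2,4,6) by (elim disjE) simp_all
  qed
qed

end

section \<open>The induced projection\<close>

context alternating_map
begin

text \<open>Once all Pluecker relations hold and some value \<omega> u1 w1 is nonzero, the rows of
  \<omega> at u1 and w1 are, up to scaling, the coordinates of the quotient map.\<close>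

lemma proj_in_Gr2:
  fixes S :: "(complex ^ 'n) set"
  assumes S: "pvariety S" and nd: "nondegenerate S" and l: "l \<in> L" "l \<noteq> 0"
    and pf: "\<And>x a b c. x \<in> S \<Longrightarrow> a \<in> L \<Longrightarrow> b \<in> L \<Longrightarrow> c \<in> L \<Longrightarrow> pfaffian \<alpha> a b c x = 0"
    and x: "x \<in> S" and nb: "\<not> base_point L \<alpha> x"
  shows "proj \<alpha> x \<in> Gr2 L"
proof -
  have Pl: "ev (\<alpha> b c) x * ev (\<alpha> d e) x - ev (\<alpha> b d) x * ev (\<alpha> c e) x + ev (\<alpha> b e) x * ev (\<alpha> c d) x = 0"
    if L4: "b \<in> L" "c \<in> L" "d \<in> L" "e \<in> L" for b c d e
  proof -
    define g where "g y = ev (\<alpha> b c) y * ev (\<alpha> d e) y - ev (\<alpha> b d) y * ev (\<alpha> c e) y + ev (\<alpha> b e) y * ev (\<alpha> c d) y" for y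
    have hg: "hform (1 + 1) g" unfolding g_def[abs_def] by (intro hform.add hform_diff hform_mult hform_ev)
    have z: "ev l y ^ 2 * g y = 0" if y: "y \<in> S" for y
    proof -
      have p: "ev l y * ev (\<alpha> i j) y = ev i y * ev (\<alpha> l j) y - ev j y * ev (\<alpha> l i) y" if "i \<in> L" "j \<in> L" for i j
        using pf[OF y l(1) that] unfolding pfaffian_def by (simp add: algebra_simps)
      have "ev l y ^ 2 * g y = (ev l y * ev (\<alpha> b c) y) * (ev l y * ev (\<alpha> d e) y)
          - (ev l y * ev (\<alpha> b d) y) * (ev l y * ev (\<alpha> c e) y) + (ev l y * ev (\<alpha> b e) y) * (ev l y * ev (\<alpha> c d) y)"
        by (simp add: g_def power2_eq_square algebra_simps)
      also have "\<dots> = 0"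
        unfolding p[OF L4(1,2)] p[OF L4(3,4)] p[OF L4(1,3)] p[OF L4(2,4)] p[OF L4(1,4)] p[OF L4(2,3)]
        by (simp add: algebra_simps)
      finally show ?thesis .
    qed
    obtain y where y: "y \<in> S" "ev l y \<noteq> 0" using nd l(2) unfolding nondegenerate_def by blast
    have "ev l y ^ 2 \<noteq> 0" using y(2) by simp
    from pvariety_domain[OF S hform_ev_power hg z y(1) this x] show ?thesis by (simp add: g_def)
  qed
  define \<omega> where "\<omega> = proj \<alpha> x"
  have \<omega>: "\<omega> u w = fst u * ev (snd w) x - fst w * ev (snd u) x + ev (\<alpha> (snd u) (snd w)) x" for u w
    by (simp add: \<omega>_def proj_def pi_star_def ev_add_left ev_diff_left ev_scale_left)
  have U: "u \<in> U_of L \<longleftrightarrow> snd u \<in> L" for u :: "'n U" by (auto simp: U_of_def mem_Times_iff)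
  have P\<omega>: "\<omega> u v * \<omega> w z - \<omega> u w * \<omega> v z + \<omega> u z * \<omega> v w = 0"
    if "u \<in> U_of L" "v \<in> U_of L" "w \<in> U_of L" "z \<in> U_of L" for u v w z
  proof -
    have L4: "snd u \<in> L" "snd v \<in> L" "snd w \<in> L" "snd z \<in> L" using that by (simp_all add: U)
    \<comment> \<open>By bilinearity the relation on U splits into the one on L and four Pfaffians
      weighted by the u0-components.\<close>
    have "\<omega> u v * \<omega> w z - \<omega> u w * \<omega> v z + \<omega> u z * \<omega> v w
      = (ev (\<alpha> (snd u) (snd v)) x * ev (\<alpha> (snd w) (snd z)) x - ev (\<alpha> (snd u) (snd w)) x * ev (\<alpha> (snd v) (snd z)) x
          + ev (\<alpha> (snd u) (snd z)) x * ev (\<alpha> (snd v) (snd w)) x)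
        + fst u * pfaffian \<alpha> (snd v) (snd w) (snd z) x - fst v * pfaffian \<alpha> (snd u) (snd w) (snd z) x
        + fst w * pfaffian \<alpha> (snd u) (snd v) (snd z) x - fst z * pfaffian \<alpha> (snd u) (snd v) (snd w) x"
      unfolding \<omega> pfaffian_def by (simp add: algebra_simps)
    then show ?thesis by (simp add: Pl[OF L4] pf[OF x] L4)
  qed
  obtain u1 w1 where uw: "u1 \<in> U_of L" "w1 \<in> U_of L" "\<omega> u1 w1 \<noteq> 0"
    using nb unfolding base_point_def \<omega>_def by blast
  \<comment> \<open>Only one row is divided by \<omega> u1 w1, because the 2 by 2 minors of both
    rows have to reproduce \<omega> itself.\<close>
  define q :: "'n U \<Rightarrow> complex ^ 2" where "q u = vector [\<omega> u1 u / \<omega> u1 w1, \<omega> w1 u]" for u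
  have q: "q u $ 1 = \<omega> u1 u / \<omega> u1 w1" "q u $ 2 = \<omega> w1 u" for u by (simp_all add: q_def)
  have \<omega>add: "\<omega> u (v + w) = \<omega> u v + \<omega> u w" if "u \<in> U_of L" "v \<in> U_of L" "w \<in> U_of L" for u v w
    using that by (simp add: \<omega> U add_right ev_add_left algebra_simps)
  have \<omega>scale: "\<omega> u (U_scale c v) = c * \<omega> u v" if "u \<in> U_of L" "v \<in> U_of L" for u v c
    using that by (simp add: \<omega> U U_scale_def scale_right ev_scale_left algebra_simps)
  have Uadd: "u + v \<in> U_of L" "U_scale c u \<in> U_of L" if "u \<in> U_of L" "v \<in> U_of L" for u v c
    using that by (simp_all add: U U_scale_def L_simps)
  have \<omega>self: "\<omega> u u = 0" if "u \<in> U_of L" for u using that by (simp add: \<omega> U self)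
  have \<omega>anti: "\<omega> w1 u1 = - \<omega> u1 w1"
    using uw(1,2) ev_diff_left[of 0 "\<alpha> (snd u1) (snd w1)" x]
    by (simp add: \<omega> U anti[of "snd w1" "snd u1"])
  show ?thesis unfolding Gr2_def \<omega>_def[symmetric]
  proof (intro CollectI exI[of _ q] conjI ballI)
    show "lin_on U_scale (*s) (U_of L) q"
      unfolding lin_on_def
      by (intro conjI ballI allI) (simp_all add: vec_eq_iff forall_2 q \<omega>add \<omega>scale uw add_divide_distrib)
    show "q ` U_of L = UNIV"
    proof (intro equalityI subsetI)
      fix z :: "complex ^ 2"
      define u where "u = U_scale (z $ 1) w1 + U_scale (- (z $ 2 / \<omega> u1 w1)) u1"
      have m: "U_scale (z $ 1) w1 \<in> U_of L" "U_scale (- (z $ 2 / \<omega> u1 w1)) u1 \<in> U_of L" using uw by (intro Uadd; simp)+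
      have "q u = z" using uw(3)
        by (simp add: vec_eq_iff forall_2 q u_def \<omega>add[OF uw(1) m] \<omega>add[OF uw(2) m] \<omega>scale uw(1,2) \<omega>self \<omega>anti)
      moreover have "u \<in> U_of L" unfolding u_def by (intro Uadd(1) m)
      ultimately show "z \<in> q ` U_of L" by blast
    qed simp
    fix u w assume m: "u \<in> U_of L" "w \<in> U_of L"
    have "\<omega> u1 w1 * \<omega> u w = \<omega> u1 u * \<omega> w1 w - \<omega> u1 w * \<omega> w1 u"
      using P\<omega>[OF uw(1,2) m] by (simp add: algebra_simps)
    then show "\<omega> u w = q u $ 1 * q w $ 2 - q u $ 2 * q w $ 1"
      using uw(3) by (simp add: q field_simps)
  qed
qed

text \<open>As the values of \<open>pi_star\<close> span V, an equation between projections, scalar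
  included, lifts to the points. A functional on V is evaluation at a vector, which gives
  surjectivity.\<close>

lemma proj_iso:
  assumes "pi_star_image L \<alpha> = UNIV"
  shows "proj_is_iso L \<alpha>"
proof -
  have sp: "x = c *s y" if h: "\<forall>u\<in>U_of L. \<forall>w\<in>U_of L. proj \<alpha> x u w = c * proj \<alpha> y u w" for x y c
  proof -
    have "ev l x = c * ev l y" for l
    proof -
      have "l \<in> vec.span {pi_star \<alpha> u w | u w. u \<in> U_of L \<and> w \<in> U_of L}"
        using assms unfolding pi_star_image_def by simp
      then show ?thesis
      proof (induction rule: vec.span_induct_alt)
        case base
        show ?case by simp
      next
        case (step t b m)
        then obtain u w where "b = pi_star \<alpha> u w" "u \<in> U_of L" "w \<in> U_of L" by blast
        then have "ev b x = c * ev b y" using h by (simp add: proj_def)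
        then show ?case using step(2) by (simp add: ev_add_left ev_scale_left algebra_simps)
      qed
    qed
    from this[of "axis _ 1"] show ?thesis by (simp add: vec_eq_iff)
  qed
  show ?thesis unfolding proj_is_iso_def
  proof (intro conjI allI impI ballI notI)
    fix x :: "complex ^ 'n" assume x: "x \<noteq> 0" "base_point L \<alpha> x"
    then have "x = 0 *s x" by (intro sp) (simp add: base_point_def)
    then show False using x(1) by simp
  next
    fix x y c
    assume "x \<noteq> 0 \<and> y \<noteq> 0 \<and> (\<forall>u\<in>U_of L. \<forall>w\<in>U_of L. proj \<alpha> x u w = c * proj \<alpha> y u w)"
    then show "\<exists>c'. x = c' *s y" using sp by blast
  next
    fix \<omega> assume "\<omega> \<in> cone_Pn L \<alpha>"
    then obtain \<phi> where \<phi>: "lin_on (*s) (*) UNIV \<phi>" "\<And>u w. u \<in> U_of L \<Longrightarrow> w \<in> U_of L \<Longrightarrow> \<omega> u w = \<phi> (pi_star \<alpha> u w)"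
      unfolding cone_Pn_def assms by blast
    have lin: "\<phi> (a + b) = \<phi> a + \<phi> b" "\<phi> (t *s a) = t * \<phi> a" for a b t using \<phi>(1) by (simp_all add: lin_on_def)
    have \<phi>0: "\<phi> 0 = 0" using lin(2)[of 0 0] by simp
    have sum: "\<phi> (\<Sum>i\<in>I. v i *s b i) = (\<Sum>i\<in>I. v i * \<phi> (b i))" if "finite I" for I :: "'n set" and v b
      using that by (induction rule: finite_induct) (simp_all add: lin \<phi>0)
    have "\<phi> v = ev v (\<chi> i. \<phi> (axis i 1))" for v
    proof -
      have "\<phi> v = \<phi> (\<Sum>i\<in>UNIV. v $ i *s axis i 1)" by (simp add: basis_expansion)
      then show ?thesis by (simp add: sum ev_def)
    qed
    then show "\<exists>x. \<forall>u\<in>U_of L. \<forall>w\<in>U_of L. \<omega> u w = proj \<alpha> x u w" unfolding proj_def using \<phi>(2) by metis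
  qed
qed

text \<open>A plane in \<open>U\<close> killed by the projection contains no \<open>u\<^sub>0\<close>, as \<open>u\<^sub>0 \<and> l\<close> is mapped to \<open>l\<close>.\<close>

lemma kernel_pair:
  assumes k: "k \<ge> 1" "CARD('n) = 2 * k + 1"
    and e: "inj_on e {..<k+1}" "vec.independent (e ` {..<k+1})" "e ` {..<k+1} \<subseteq> L"
    and ne: "pi_star_image L \<alpha> \<noteq> UNIV"
  obtains l l' c where "l \<in> L" "l' \<in> L" "l \<noteq> 0" "\<And>t. l' \<noteq> t *s l" "\<alpha> l l' = c *s l"
proof -
  obtain z where z: "z \<notin> pi_star_image L \<alpha>" using ne by blast
  have "vec.subspace (pi_star_image L \<alpha>)" unfolding pi_star_image_def by (rule vec.subspace_span)
  from annihilator_span[OF this, of z] z obtain \<psi> where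
    \<psi>: "\<And>c. c \<in> pi_star_image L \<alpha> \<Longrightarrow> ev c \<psi> = 0" "ev z \<psi> \<noteq> 0" by blast
  have \<psi>0: "\<psi> \<noteq> 0" using \<psi>(2) by auto
  \<comment> \<open>\<open>decomposable_in_kernel\<close> indexes a basis of U by coordinates, so k
    + 2 of the 2 k + 1 elements of 'n are used as labels.\<close>
  obtain J :: "'n set" where J: "card J = k + 2" "finite J"
    by (rule obtain_subset_with_card_n[of "k + 2" "UNIV :: 'n set"]) (use k in auto)
  obtain h where h: "bij_betw h J {..<k+2}"
    using finite_same_card_bij[OF J(2), of "{..<k+2}"] J(1) by auto
  define b :: "'n \<Rightarrow> 'n U" where "b j = (if h j = 0 then u0 else in_U (e (h j - 1)))" for j
  have hr: "h j < k + 2" if "j \<in> J" for j using bij_betwE[OF h] that by auto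
  have hi: "h i = h j \<longleftrightarrow> i = j" if "i \<in> J" "j \<in> J" for i j using h that by (auto simp: bij_betw_def inj_on_def)
  have sb: "snd (b j) \<in> L" if "j \<in> J" for j
  proof (cases "h j = 0")
    case False
    then have "h j - 1 < k + 1" using hr[OF that] by simp
    then show ?thesis using e(3) False by (auto simp: b_def in_U_def)
  qed (simp add: b_def u0_def L_simps)
  define \<beta> where "\<beta> i j = pi_star \<alpha> (b i) (b j)" for i j
  have \<beta>anti: "\<beta> i j = - \<beta> j i" if "i \<in> J" "j \<in> J" for i j
    using anti[OF sb[OF that(1)] sb[OF that(2)]] by (simp add: \<beta>_def pi_star_def)
  have \<beta>\<psi>: "ev \<psi> (\<beta> i j) = 0" if "i \<in> J" "j \<in> J" for i j
  proof -
    have "\<beta> i j \<in> pi_star_image L \<alpha>" unfolding pi_star_image_def \<beta>_def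
    proof (rule vec.span_base)
      have "b i \<in> U_of L" "b j \<in> U_of L" using sb[OF that(1)] sb[OF that(2)] by (simp_all add: U_of_def mem_Times_iff)
      then show "pi_star \<alpha> (b i) (b j) \<in> {pi_star \<alpha> u w | u w. u \<in> U_of L \<and> w \<in> U_of L}" by blast
    qed
    from \<psi>(1)[OF this] show ?thesis by (simp add: ev_commute)
  qed
  obtain u w i j where uw: "i \<in> J" "j \<in> J" "u i * w j - u j * w i \<noteq> 0"
    "(\<Sum>i\<in>J. \<Sum>j\<in>J. (u i * w j) *s \<beta> i j) = 0"
    by (rule decomposable_in_kernel[of k J \<beta> \<psi>, OF k J(1) \<beta>anti \<psi>0 \<beta>\<psi>]) (assumption | rule that)+
  \<comment> \<open>The killed bivector is the wedge of x0 u0 + X and y0 u0 + Y with X and Y in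
    L.\<close>
  define x0 y0 X Y where "x0 = (\<Sum>i\<in>J. u i * fst (b i))" and "y0 = (\<Sum>i\<in>J. w i * fst (b i))"
    and "X = (\<Sum>i\<in>J. u i *s snd (b i))" and "Y = (\<Sum>i\<in>J. w i *s snd (b i))"
  have XL: "X \<in> L" and YL: "Y \<in> L" unfolding X_def Y_def
    by (rule conjunct1[OF sum_left[OF J(2) L_simps(1)]], erule sb)+
  have s1: "(\<Sum>i\<in>J. \<Sum>j\<in>J. (v i * v' j) *s (fst (b i) *s snd (b j)))
      = (\<Sum>i\<in>J. v i * fst (b i)) *s (\<Sum>j\<in>J. v' j *s snd (b j))" for v v'
    by (subst vec.scale_sum_left) (simp add: vec.scale_sum_right mult_ac)
  have s1': "(\<Sum>i\<in>J. \<Sum>j\<in>J. (u i * w j) *s (fst (b i) *s snd (b j))) = x0 *s Y"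
    unfolding x0_def Y_def by (rule s1)
  have s2: "(\<Sum>i\<in>J. \<Sum>j\<in>J. (u i * w j) *s (fst (b j) *s snd (b i))) = y0 *s X"
    unfolding y0_def X_def s1[symmetric] by (subst sum.swap) (simp add: mult.commute)
  have s3: "(\<Sum>i\<in>J. \<Sum>j\<in>J. (u i * w j) *s \<alpha> (snd (b i)) (snd (b j))) = \<alpha> X Y"
  proof -
    have "\<alpha> X Y = (\<Sum>i\<in>J. u i *s \<alpha> (snd (b i)) Y)" unfolding X_def
      by (rule conjunct2[OF sum_left[OF J(2) YL]]) (erule sb)
    also have "\<dots> = (\<Sum>i\<in>J. u i *s (\<Sum>j\<in>J. w j *s \<alpha> (snd (b i)) (snd (b j))))"
      unfolding Y_def by (intro sum.cong refl arg_cong[where f = "\<lambda>v. _ *s v"] sum_right J(2) sb)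
    finally show ?thesis by (simp add: vec.scale_sum_right)
  qed
  have "x0 *s Y - y0 *s X + \<alpha> X Y = (\<Sum>i\<in>J. \<Sum>j\<in>J. (u i * w j) *s \<beta> i j)"
    unfolding \<beta>_def pi_star_def
    by (simp only: sum.distrib sum_subtractf vec.scale_right_distrib vec.scale_right_diff_distrib s1' s2 s3)
  then have \<alpha>XY: "\<alpha> X Y = y0 *s X - x0 *s Y" unfolding uw(4) by (simp add: algebra_simps)
  \<comment> \<open>The labelled vectors b j are linearly independent in U; this makes the two
    vectors spanning the killed plane independent.\<close>
  have coeff: "v m = 0" if v: "(\<Sum>j\<in>J. v j * fst (b j)) = 0" "(\<Sum>j\<in>J. v j *s snd (b j)) = 0" and m: "m \<in> J" for v m
  proof (cases "h m = 0")
    case True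
    have "fst (b j) = (if j = m then 1 else 0)" if "j \<in> J" for j
      using hi[OF that m] True by (auto simp: b_def u0_def in_U_def)
    then have "(\<Sum>j\<in>J. v j * fst (b j)) = (\<Sum>j\<in>J. if j = m then v j else 0)" by (intro sum.cong) auto
    then show ?thesis using v(1) m J(2) by simp
  next
    case False
    obtain d where d: "\<And>t. t \<in> e ` {..<k+1} \<Longrightarrow> ev d t = (if t = e (h m - 1) then 1 else 0)"
      by (rule dual_functional[OF e(2)]) (rule that)
    have "ev d (snd (b j)) = (if j = m then 1 else 0)" if j: "j \<in> J" for j
    proof (cases "h j = 0")
      case True
      then show ?thesis using False by (auto simp: b_def u0_def)
    next
      case hj: False
      have r: "h j - 1 \<in> {..<k+1}" "h m - 1 \<in> {..<k+1}" using hr[OF j] hr[OF m] hj False by auto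
      have "e (h j - 1) = e (h m - 1) \<longleftrightarrow> j = m"
        using inj_on_eq_iff[OF e(1) r] hi[OF j m] hj False by auto
      then show ?thesis using hj d[of "e (h j - 1)"] r(1) by (simp add: b_def in_U_def)
    qed
    then have "ev d (\<Sum>j\<in>J. v j *s snd (b j)) = (\<Sum>j\<in>J. if j = m then v j else 0)"
      unfolding ev_sum ev_scale by (intro sum.cong) auto
    then show ?thesis using v(2) m J(2) by simp
  qed
  have ind: "r = 0" "r' = 0" if eq: "r * x0 + r' * y0 = 0" "r *s X + r' *s Y = 0" for r r'
  proof -
    have "r * u m + r' * w m = 0" if "m \<in> J" for m
    proof (rule coeff[OF _ _ that])
      show "(\<Sum>j\<in>J. (r * u j + r' * w j) * fst (b j)) = 0"
        using eq(1) by (simp add: x0_def y0_def sum_distrib_left sum.distrib algebra_simps)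
      show "(\<Sum>j\<in>J. (r * u j + r' * w j) *s snd (b j)) = 0"
        using eq(2) by (simp add: X_def Y_def vec.scale_sum_right vec.scale_left_distrib sum.distrib)
    qed
    then have 1: "r * u i + r' * w i = 0" "r * u j + r' * w j = 0" using uw(1,2) by auto
    have "r * (u i * w j - u j * w i) = (r * u i + r' * w i) * w j - (r * u j + r' * w j) * w i"
      "r' * (u i * w j - u j * w i) = (r * u j + r' * w j) * u i - (r * u i + r' * w i) * u j"
      by (simp_all add: algebra_simps)
    then show "r = 0" "r' = 0" using uw(3) unfolding 1 by auto
  qed
  show ?thesis
  proof (cases "x0 = 0")
    case False
    \<comment> \<open>The combination of the two vectors without u0-component, which equals \<alpha>
      X Y. Hence \<alpha> l X = - x0 \<alpha> Y X = x0 l.\<close>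
    define l where "l = y0 *s X - x0 *s Y"
    have lL: "l \<in> L" unfolding l_def by (intro L_simps XL YL)
    have "l \<noteq> 0"
    proof
      assume l0: "l = 0"
      have "- x0 = 0" by (rule ind(2)[of y0]) (use l0 in \<open>simp_all add: l_def\<close>)
      then show False using False by simp
    qed
    moreover have \<alpha>l: "\<alpha> l X = x0 *s l"
    proof -
      have "\<alpha> l X = y0 *s \<alpha> X X - x0 *s \<alpha> Y X"
        by (simp add: l_def diff_left scale_left L_simps XL YL)
      also have "\<dots> = x0 *s l" unfolding self[OF XL] anti[OF YL XL] \<alpha>XY l_def by simp
      finally show ?thesis .
    qed
    moreover have "X \<noteq> t *s l" for t
    proof
      assume "X = t *s l"
      then have "\<alpha> l X = 0" using lL by (simp add: scale_right self)
      then show False using \<alpha>l False \<open>l \<noteq> 0\<close> by simp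
    qed
    ultimately show ?thesis using lL XL by (intro that[of l X x0])
  next
    case True
    have \<alpha>XY': "\<alpha> X Y = y0 *s X" using \<alpha>XY True by simp
    have X0: "X \<noteq> 0" using ind(1)[of 1 0] True by auto
    moreover have "Y \<noteq> t *s X" for t
    proof
      assume Y: "Y = t *s X"
      then have "\<alpha> X Y = 0" using XL by (simp add: scale_right self)
      then have y00: "y0 = 0" using \<alpha>XY' X0 by simp
      have "(- 1 :: complex) = 0" by (rule ind(2)[of t]) (simp_all add: True Y y00)
      then show False by simp
    qed
    ultimately show ?thesis using XL YL \<alpha>XY' by (intro that[of X Y y0])
  qed
qed

lemma pfaffians_vanish:
  fixes S :: "(complex ^ 'n) set"
  assumes S: "smooth_variety S 2" and nd: "nondegenerate S" and Pic: "Pic_generated_by_hyperplane_class S"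
    and pf: "\<And>x a b c. x \<in> S \<Longrightarrow> a \<in> L \<Longrightarrow> b \<in> L \<Longrightarrow> c \<in> L \<Longrightarrow> pfaffian \<alpha> a b c x = 0"
    and l: "l \<in> L" "l' \<in> L" "l \<noteq> 0" "\<And>t. l' \<noteq> t *s l" and \<alpha>l: "\<alpha> l l' = c *s l"
    and abd: "a \<in> L" "b \<in> L" "d \<in> L"
  shows "pfaffian \<alpha> a b d x = 0"
proof -
  have V: "pvariety S" using S by (simp add: smooth_variety_def)
  obtain y where y: "y \<in> S" "ev l y \<noteq> 0" using nd l(3) unfolding nondegenerate_def by blast
  have "\<exists>t. \<alpha> l m = t *s l" if m: "m \<in> L" for m
  proof -
    have eq: "ev l x * ev (\<alpha> l' m + c *s m) x = ev l' x * ev (\<alpha> l m) x" if "x \<in> S" for x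
      using pf[OF that l(1,2) m] by (simp add: pfaffian_def \<alpha>l ev_add_left ev_scale_left algebra_simps)
    show ?thesis by (rule proportional_factors[OF S nd Pic l(3,4) eq]) (assumption, rule exI, assumption)
  qed
  then obtain \<tau> where \<tau>: "\<And>m. m \<in> L \<Longrightarrow> \<alpha> l m = \<tau> m *s l" by metis
  have *: "\<alpha> m n = \<tau> n *s m - \<tau> m *s n" if mn: "m \<in> L" "n \<in> L" for m n
  proof -
    \<comment> \<open>Every term of Pf(l, m, n) is divisible by l once \<alpha> l is a multiple of
      l, and g is the quotient.\<close>
    define g where "g = \<alpha> m n - (\<tau> n *s m - \<tau> m *s n)"
    have z: "ev l x * ev g x = 0" if "x \<in> S" for x
      using pf[OF that l(1) mn]
      by (simp add: pfaffian_def \<tau> mn g_def ev_add_left ev_diff_left ev_scale_left algebra_simps)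
    have "ev g x = 0" if "x \<in> S" for x
      by (rule pvariety_domain[OF V hform_ev hform_ev z y that])
    then have "g = 0" using nd unfolding nondegenerate_def by blast
    then show ?thesis by (simp add: g_def)
  qed
  show ?thesis using abd by (simp add: pfaffian_def * ev_diff_left ev_scale_left algebra_simps)
qed

end

theorem proposition10p4:
  fixes k :: nat
    and S C :: "(complex ^ 'n) set"
    and s :: "'n list \<Rightarrow> complex ^ 'n \<Rightarrow> complex"
    and \<alpha> :: "complex ^ 'n \<Rightarrow> complex ^ 'n \<Rightarrow> complex ^ 'n"
  assumes "k \<ge> 3" and "CARD('n) = 2 * k + 1"
    and "K3_surface S" and "nondegenerate S"
    and "Pic_generated_by_hyperplane_class S"
    and "smooth_hyperplane_section S C" and "smooth_curve_of_genus C (2 * k)"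
    and "s \<in> syzygies S (k - 2)" and "syz_rank S (k - 2) s = k + 1"
    and "induces_projection S (k - 2) s \<alpha>"
  shows "(\<forall>x\<in>S. \<not> base_point (syz_L S (k - 2) s) \<alpha> x \<longrightarrow> proj \<alpha> x \<in> Gr2 (syz_L S (k - 2) s)) \<and>
         pi_star_image (syz_L S (k - 2) s) \<alpha> = UNIV \<and>
         proj_is_iso (syz_L S (k - 2) s) \<alpha>"
proof -
  define p where "p = k - 2"
  define L where "L = syz_L S p s"
  have p3: "p + 3 = k + 1" using assms(1) by (simp add: p_def)
  from assms(10) obtain e where alt: "alternating_bilinear_on L \<alpha>"
    and e: "inj_on e {..<p+3}" "vec.independent (e ` {..<p+3})" "vec.span (e ` {..<p+3}) = L"
    and gen: "\<And>js x. length js = p \<Longrightarrow> s js x = generic_syzygy p e js (proj \<alpha> x)"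
    unfolding induces_projection_def p_def[symmetric] L_def[symmetric] by blast
  interpret alternating_map L \<alpha>
    by unfold_locales (use e(3) vec.subspace_span alt in auto)
  have S: "smooth_variety S 2" using assms(3) by (simp add: K3_surface_def)
  then have V: "pvariety S" by (simp add: smooth_variety_def)
  have eL: "e ` {..<p+3} \<subseteq> L" using vec.span_superset[of "e ` {..<p+3}"] unfolding e(3) .
  have "e 0 \<in> e ` {..<p+3}" by simp
  then have e0: "e 0 \<in> L" "e 0 \<noteq> 0"
    using eL vec.dependent_zero[of "e ` {..<p+3}"] e(2) by (blast, metis)
  have syz: "s \<in> syzygies S p" using assms(8) by (simp add: p_def)
  have pf: "pfaffian \<alpha> a b c x = 0" if x: "x \<in> S" and abc: "a \<in> L" "b \<in> L" "c \<in> L" for x a b c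
  proof (rule all_pfaffians_from_syzygy[OF e _ abc])
    fix js :: "'n list" assume js: "length js = p"
    from syzygiesD(1)[OF syz js] have "s js x = 0" using x unfolding ideal_deg_def by blast
    then show "generic_syzygy p e js (proj \<alpha> x) = 0" unfolding gen[OF js] .
  qed
  have img: "pi_star_image L \<alpha> = UNIV"
  proof (rule ccontr)
    assume ne: "pi_star_image L \<alpha> \<noteq> UNIV"
    have k1: "k \<ge> 1" using assms(1) by simp
    obtain l l' c where l: "l \<in> L" "l' \<in> L" "l \<noteq> 0" "\<And>t. l' \<noteq> t *s l" "\<alpha> l l' = c *s l"
      by (rule kernel_pair[OF k1 assms(2) e(1,2)[unfolded p3] eL[unfolded p3] ne]) (rule that)
    have pf0: "pfaffian \<alpha> a b d x = 0" if "a \<in> L" "b \<in> L" "d \<in> L" for a b d x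
      by (rule pfaffians_vanish[OF S assms(4,5) pf l that])
    have s0: "s js x = 0" for js x
    proof (cases "length js = p")
      case True
      show ?thesis unfolding gen[OF True] by (rule generic_syzygy_zero[OF eL pf0])
    next
      case False
      show ?thesis unfolding syzygiesD(2)[OF syz False] ..
    qed
    \<comment> \<open>If s were zero, every element of L would be the value of a linear map at the
      zero syzygy. But L contains the nonzero basis vector e 0.\<close>
    have 0: "(\<lambda>js x. 0) \<in> syzygies S (p - 1)"
      by (rule syzygiesI) (simp_all add: ideal_deg_def hform_0)
    obtain \<phi> where \<phi>: "e 0 = (\<chi> i. \<phi> (\<lambda>js. s (i # js)))"
      "lin_on (\<lambda>c t js x. c * t js x) (*) (syzygies S (p - 1)) \<phi>"
      using e0(1) unfolding L_def syz_L_def by blast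
    have "\<phi> (\<lambda>js x. 0) = 0"
      using \<phi>(2)[unfolded lin_on_def, THEN conjunct2, rule_format, OF 0, of 0] by simp
    moreover have "(\<lambda>js. s (i # js)) = (\<lambda>js x. 0)" for i by (simp add: fun_eq_iff s0)
    ultimately have "e 0 = 0" unfolding \<phi>(1) by (simp add: vec_eq_iff)
    then show False using e0(2) by simp
  qed
  show ?thesis unfolding p_def[symmetric] L_def[symmetric]
    by (intro conjI ballI impI img proj_iso proj_in_Gr2[OF V assms(4) e0 pf])
qed

end
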